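(* Let $(\Omega,\mathcal{F},P)$ be a probability space with a filtration $(\mathcal{F}_t)_{0\le t\le T}$ satisfying the usual conditions, and let $W$ be a one-dimensional standard Brownian motion adapted to $(\mathcal{F}_t)$. Let $L,b,T$ be positive constants with $L\ge b$. Let $f:[0,T]\times C([-L,0],\mathbf{R})\to\mathbf{R}$ be continuous and $g:\mathbf{R}\to\mathbf{R}$ be continuous, and assume: (i) there is a constant $L'>0$ with $|f(t,\eta)|\le L'(1+\|\eta\|)$ for all $(t,\eta)\in[0,T]\times C([-L,0],\mathbf{R})$; (ii) for each integer $n>0$ there is a constant $L_n>0$ with $|f(t,\eta^1)-f(t,\eta^2)|\le L_n\|\eta^1-\eta^2\|$ for all $t\in[0,T]$ and all $\eta^1,\eta^2\in C([-L,0],\mathbf{R})$ with $\|\eta^i\|\le n$, $i=1,2$; (iii) $f(t,\eta)>0$ for all $t\in[0,T]$ and all $\eta\in C([-L,0],\mathbf{R}^+)$. Consider the stochastic functional differential equation $$dS(t)=f(t,S_t)\,dt+g(S(t-b))S(t)\,dW(t),\quad t\in[0,T],\qquad S(t)=\varphi(t),\quad t\in[-L,0].$$ Then for every $\mathcal{F}_0$-measurable initial process $\varphi:\Omega\to C([-L,0],\mathbf{R})$ this equation has a pathwise unique solution $S$. Furthermore, if $\varphi(t)\ge 0$ for all $t\in[-L,0]$ a.s., then $S(t)\ge 0$ for all $t\ge 0$ (in $[0,T]$) a.s. If in addition $\varphi(0)>0$ a.s., then $S(t)>0$ for all $t\ge0$ (in $[0,T]$) a.s.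
   Context: $C([-L,0],\mathbf{R})$ is the Banach space of continuous functions $\eta:[-L,0]\to\mathbf{R}$ with the supremum norm $\|\eta\|=\sup_{s\in[-L,0]}|\eta(s)|$; $C([-L,0],\mathbf{R}^+)$ denotes those taking values in $\mathbf{R}^+$ (the nonnegative reals). The initial process $\varphi$ is measurable from $\mathcal{F}_0$ to the Borel $\sigma$-algebra of $C([-L,0],\mathbf{R})$. For a process $S$ on $[-L,T]$, the segment $S_t\in C([-L,0],\mathbf{R})$ is $S_t(s)=S(t+s)$, $s\in[-L,0]$. A solution is a continuous $(\mathcal{F}_t)$-adapted process on $[-L,T]$ equal to $\varphi$ on $[-L,0]$ and satisfying the equation in integral (Itô) form on $[0,T]$. *)

theory Defs
  imports "HOL-Probability.Probability"
begin

definition cspace :: "real \<Rightarrow> (real \<Rightarrow> real) set" where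
  "cspace L = {\<eta>. continuous_on {-L..0} \<eta> \<and> (\<forall>s. s \<notin> {-L..0} \<longrightarrow> \<eta> s = 0)}"

definition supn :: "real \<Rightarrow> (real \<Rightarrow> real) \<Rightarrow> real" where
  "supn L \<eta> = (SUP s\<in>{-L..0}. \<bar>\<eta> s\<bar>)"

definition seg :: "real \<Rightarrow> (real \<Rightarrow> real) \<Rightarrow> real \<Rightarrow> (real \<Rightarrow> real)" where
  "seg L x t = (\<lambda>s. if s \<in> {-L..0} then x (t + s) else 0)"

definition sup_open :: "real \<Rightarrow> (real \<Rightarrow> real) set \<Rightarrow> bool" where
  "sup_open L U \<longleftrightarrow> U \<subseteq> cspace L \<and>
     (\<forall>\<eta>\<in>U. \<exists>e>0. \<forall>\<eta>'\<in>cspace L. supn L (\<lambda>s. \<eta>' s - \<eta> s) < e \<longrightarrow> \<eta>' \<in> U)"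

definition cborel :: "real \<Rightarrow> (real \<Rightarrow> real) set set" where
  "cborel L = sigma_sets (cspace L) {U. sup_open L U}"

definition cont_drift :: "real \<Rightarrow> real \<Rightarrow> (real \<Rightarrow> (real \<Rightarrow> real) \<Rightarrow> real) \<Rightarrow> bool" where
  "cont_drift T L f \<longleftrightarrow> (\<forall>t\<in>{0..T}. \<forall>\<eta>\<in>cspace L. \<forall>e>0. \<exists>d>0. \<forall>t'\<in>{0..T}. \<forall>\<eta>'\<in>cspace L.
      \<bar>t' - t\<bar> < d \<and> supn L (\<lambda>s. \<eta>' s - \<eta> s) < d \<longrightarrow> \<bar>f t' \<eta>' - f t \<eta>\<bar> < e)"

definition meas_wrt :: "'a measure \<Rightarrow> 'a set set \<Rightarrow> ('a \<Rightarrow> real) \<Rightarrow> bool" where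
  "meas_wrt M G X \<longleftrightarrow> (\<forall>B\<in>sets borel. {\<omega>\<in>space M. X \<omega> \<in> B} \<in> G)"

definition usual_filtration :: "'a measure \<Rightarrow> real \<Rightarrow> (real \<Rightarrow> 'a set set) \<Rightarrow> bool" where
  "usual_filtration M T F \<longleftrightarrow>
     (\<forall>t\<in>{0..T}. sigma_algebra (space M) (F t) \<and> F t \<subseteq> sets M) \<and>
     (\<forall>s t. 0 \<le> s \<and> s \<le> t \<and> t \<le> T \<longrightarrow> F s \<subseteq> F t) \<and>
     (\<forall>N\<in>null_sets M. \<forall>A. A \<subseteq> N \<longrightarrow> A \<in> F 0) \<and>
     (\<forall>t\<in>{0..<T}. F t = (\<Inter>s\<in>{t<..T}. F s))"

definition std_BM :: "'a measure \<Rightarrow> real \<Rightarrow> (real \<Rightarrow> 'a set set) \<Rightarrow> (real \<Rightarrow> 'a \<Rightarrow> real) \<Rightarrow> bool" where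
  "std_BM M T F W \<longleftrightarrow>
     (\<forall>t\<in>{0..T}. meas_wrt M (F t) (W t)) \<and>
     (AE \<omega> in M. W 0 \<omega> = 0 \<and> continuous_on {0..T} (\<lambda>t. W t \<omega>)) \<and>
     (\<forall>s t. 0 \<le> s \<and> s < t \<and> t \<le> T \<longrightarrow>
        distributed M lborel (\<lambda>\<omega>. W t \<omega> - W s \<omega>) (\<lambda>x. ennreal (normal_density 0 (sqrt (t - s)) x)) \<and>
        (\<forall>A\<in>F s. \<forall>B\<in>sets borel.
           measure M (A \<inter> {\<omega>\<in>space M. W t \<omega> - W s \<omega> \<in> B}) =
           measure M A * measure M {\<omega>\<in>space M. W t \<omega> - W s \<omega> \<in> B}))"

definition conv_in_prob :: "'a measure \<Rightarrow> (nat \<Rightarrow> 'a \<Rightarrow> real) \<Rightarrow> ('a \<Rightarrow> real) \<Rightarrow> bool" where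
  "conv_in_prob M R X \<longleftrightarrow>
     (\<forall>e>0. (\<lambda>n. measure M {\<omega>\<in>space M. \<bar>R n \<omega> - X \<omega>\<bar> > e}) \<longlonglongrightarrow> 0)"

text \<open>I t is the Ito integral of the continuous adapted integrand H over [0,t] against W,
  characterised as the limit in probability of left-endpoint Riemann sums.\<close>
definition is_ito_integral :: "'a measure \<Rightarrow> real \<Rightarrow> (real \<Rightarrow> 'a \<Rightarrow> real) \<Rightarrow> (real \<Rightarrow> 'a \<Rightarrow> real)
    \<Rightarrow> (real \<Rightarrow> 'a \<Rightarrow> real) \<Rightarrow> bool" where
  "is_ito_integral M T W H I \<longleftrightarrow>
     (\<forall>t\<in>{0..T}. I t \<in> borel_measurable M \<and>
        conv_in_prob M
          (\<lambda>n \<omega>. \<Sum>k<n. H (real k * t / real n) \<omega> *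
                     (W (real (Suc k) * t / real n) \<omega> - W (real k * t / real n) \<omega>))
          (I t))"

definition sfde_solution :: "'a measure \<Rightarrow> real \<Rightarrow> (real \<Rightarrow> 'a set set) \<Rightarrow> (real \<Rightarrow> 'a \<Rightarrow> real)
    \<Rightarrow> real \<Rightarrow> real \<Rightarrow> (real \<Rightarrow> (real \<Rightarrow> real) \<Rightarrow> real) \<Rightarrow> (real \<Rightarrow> real)
    \<Rightarrow> ('a \<Rightarrow> real \<Rightarrow> real) \<Rightarrow> (real \<Rightarrow> 'a \<Rightarrow> real) \<Rightarrow> bool" where
  "sfde_solution M T F W L b f g \<phi> S \<longleftrightarrow>
     (\<forall>\<omega>\<in>space M. continuous_on {-L..T} (\<lambda>t. S t \<omega>)) \<and>
     (\<forall>t\<in>{0..T}. meas_wrt M (F t) (S t)) \<and>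
     (\<forall>\<omega>\<in>space M. \<forall>t\<in>{-L..0}. S t \<omega> = \<phi> \<omega> t) \<and>
     (\<exists>I. is_ito_integral M T W (\<lambda>s \<omega>. g (S (s - b) \<omega>) * S s \<omega>) I \<and>
        (AE \<omega> in M. \<forall>t\<in>{0..T}.
           S t \<omega> = \<phi> \<omega> 0 + integral {0..t} (\<lambda>s. f s (seg L (\<lambda>u. S u \<omega>) s)) + I t \<omega>))"

end

theory Submission
  imports Defs
begin

text \<open>
  The delay makes the diffusion coefficient linear in the unknown: on each time interval of length
  \<open>b\<close> the factor \<open>h(t) = g(S(t-b))\<close> is already known. With the Doleans exponential
  \<open>E = exp(\<integral>h dW - (1/2)\<integral>h^2 ds)\<close>, Ito's formula shows that \<open>S\<close> solves the equation iff
  \<open>Y = S/E\<close> solves the random ordinary equation \<open>Y' = f(t, (EY)_t)/E(t)\<close>. Pathwise, the linear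
  growth and local Lipschitz conditions give existence (Picard iteration, which preserves adaptedness)
  and uniqueness of \<open>Y\<close>, and \<open>Y\<close> is increasing as long as \<open>S\<close> is nonnegative.

  Since the stochastic integral is a limit of Riemann sums, localisation needs no stopping times:
  truncating the integrand does not change the sums on the event where it is bounded. Ito's formula is
  only needed for \<open>u exp v\<close> and is obtained from a second order expansion along uniform grids.
\<close>

section \<open>The filtration and Brownian increments\<close>

text \<open>The integral of the statement is weak: for each t separately, a limit in probability of
  sums over a grid of [0, t], with no continuity in t. A second object, \<open>ito\<close>, is
  therefore built: a continuous adapted process, the almost sure limit of sums over grids of the
  whole of [0, T]. The two are linked by the cell errors J(t_(k+1)) - J(t_k) - H(t_k) dW, whose
  squares and weighted sums vanish in probability. The same facts, with the quadratic variation,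
  feed Ito's formula.

  The formula is used twice. With u = Y and v = log E it turns a solution of the random differential
  equation into a solution S = EY. With u = S and v = -log E it shows that every solution arises
  this way: the integrand of the resulting stochastic integral is identically 0. Uniqueness and
  positivity thus become statements about single paths.

  Randomness enters the expansion only through finitely many sums that vanish in probability, so it
  is carried out path by path along subsequences. Lipschitz constants are only local, but linear
  growth keeps all Picard iterates of a path in one ball.\<close>

locale brownian_motion = prob_space M for M :: "'a measure" +
  fixes T :: real and F :: "real \<Rightarrow> 'a set set" and W :: "real \<Rightarrow> 'a \<Rightarrow> real"
  assumes T_pos: "T > 0"
    and usual: "usual_filtration M T F"
    and bmW: "std_BM M T F W"
begin

text \<open>The set system becomes a measure space so that the usual measurability rules apply to
  adaptedness; \<open>meas_wrt_iff\<close> is the bridge. Only the space and the sets matter here,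
  not the measure.\<close>

definition Ft :: "real \<Rightarrow> 'a measure" where
  "Ft t = sigma (space M) (F t)"

lemma sigma_algebra_F: "t \<in> {0..T} \<Longrightarrow> sigma_algebra (space M) (F t)"
  and F_subset_sets: "t \<in> {0..T} \<Longrightarrow> F t \<subseteq> sets M"
  and F_mono: "0 \<le> s \<Longrightarrow> s \<le> t \<Longrightarrow> t \<le> T \<Longrightarrow> F s \<subseteq> F t"
  and null_subset_F0: "N \<in> null_sets M \<Longrightarrow> A \<subseteq> N \<Longrightarrow> A \<in> F 0"
  using usual unfolding usual_filtration_def by auto

lemma space_Ft [simp]: "space (Ft t) = space M"
  by (simp add: Ft_def space_measure_of_conv)

lemma sets_Ft: "t \<in> {0..T} \<Longrightarrow> sets (Ft t) = F t"
proof -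
  assume t: "t \<in> {0..T}"
  interpret sigma_algebra "space M" "F t" by (rule sigma_algebra_F[OF t])
  show ?thesis
    unfolding Ft_def by (simp add: sigma_sets_eq space_closed)
qed

lemma meas_wrt_iff: "t \<in> {0..T} \<Longrightarrow> meas_wrt M (F t) X \<longleftrightarrow> X \<in> borel_measurable (Ft t)"
  unfolding meas_wrt_def measurable_def
  by (auto simp: sets_Ft vimage_def Int_def conj_commute)

lemma Ft_mono:
  assumes "X \<in> measurable (Ft s) N" "0 \<le> s" "s \<le> t" "t \<le> T"
  shows "X \<in> measurable (Ft t) N"
  using assms F_mono[of s t] unfolding measurable_def by (auto simp: sets_Ft)

lemma Ft_measurable_M:
  assumes "X \<in> measurable (Ft s) N" "0 \<le> s" "s \<le> T"
  shows "X \<in> measurable M N"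
  using assms F_subset_sets[of s] unfolding measurable_def by (auto simp: sets_Ft)

lemma W_Ft: "0 \<le> s \<Longrightarrow> s \<le> t \<Longrightarrow> t \<le> T \<Longrightarrow> W s \<in> borel_measurable (Ft t)"
  using bmW unfolding std_BM_def by (auto simp: meas_wrt_iff intro: Ft_mono)

lemma W_measurable: "0 \<le> s \<Longrightarrow> s \<le> T \<Longrightarrow> W s \<in> borel_measurable M"
  using W_Ft[of s s] Ft_measurable_M by auto

lemma AE_W_cont: "AE \<omega> in M. continuous_on {0..T} (\<lambda>t. W t \<omega>)"
  using bmW unfolding std_BM_def by auto

text \<open>Subsets of null sets lie in \<open>F 0\<close>, hence so do sets of full probability.
  This lets an almost sure limit be reset to 0 off its convergence event while staying adapted at
  every time.\<close>

lemma AE_in_F0: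
  assumes "AE \<omega> in M. P \<omega>"
  shows "{\<omega>\<in>space M. P \<omega>} \<in> F 0"
proof -
  obtain N where N: "N \<in> null_sets M" "{\<omega>\<in>space M. \<not> P \<omega>} \<subseteq> N"
    using assms by (auto elim!: AE_E)
  interpret sigma_algebra "space M" "F 0" using T_pos by (intro sigma_algebra_F) auto
  have "{\<omega>\<in>space M. \<not> P \<omega>} \<in> F 0" using N by (rule null_subset_F0)
  then have "space M - {\<omega>\<in>space M. \<not> P \<omega>} \<in> F 0" by auto
  also have "space M - {\<omega>\<in>space M. \<not> P \<omega>} = {\<omega>\<in>space M. P \<omega>}" by auto
  finally show ?thesis .
qed

lemma increment_distributed:
  assumes "0 \<le> s" "s < t" "t \<le> T"
  shows "distributed M lborel (\<lambda>\<omega>. W t \<omega> - W s \<omega>) (normal_density 0 (sqrt (t - s)))"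
  using bmW assms unfolding std_BM_def by auto

lemma increment_moments:
  assumes "0 \<le> s" "s \<le> t" "t \<le> T"
  shows "integrable M (\<lambda>\<omega>. (W t \<omega> - W s \<omega>) ^ k)"
    and "expectation (\<lambda>\<omega>. W t \<omega> - W s \<omega>) = 0"
    and "expectation (\<lambda>\<omega>. (W t \<omega> - W s \<omega>)\<^sup>2) = t - s"
    and "expectation (\<lambda>\<omega>. (W t \<omega> - W s \<omega>) ^ 4) = 3 * (t - s)\<^sup>2"
proof -
  have "integrable M (\<lambda>\<omega>. (W t \<omega> - W s \<omega>) ^ k) \<and> expectation (\<lambda>\<omega>. W t \<omega> - W s \<omega>) = 0 \<and>
    expectation (\<lambda>\<omega>. (W t \<omega> - W s \<omega>)\<^sup>2) = t - s \<and> expectation (\<lambda>\<omega>. (W t \<omega> - W s \<omega>) ^ 4) = 3 * (t - s)\<^sup>2"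
  \<comment> \<open>\<open>std_BM\<close> describes increments only for s < t, but grids may have
    repeated points, for instance when the end time is 0.\<close>
  proof (cases "s = t")
    case True then show ?thesis by simp
  next
    case False
    then have st: "s < t" using assms by auto
    note D = increment_distributed[OF assms(1) st assms(3)]
    let ?\<sigma> = "sqrt (t - s)"
    have \<sigma>: "0 < ?\<sigma>" using st by simp
    have 1: "integrable M (\<lambda>\<omega>. (W t \<omega> - W s \<omega>) ^ k)"
      using distributed_integrable[OF D, of "\<lambda>x. x ^ k"] integrable_normal_moment[OF \<sigma>, of 0 k] by simp
    have int: "expectation (\<lambda>\<omega>. (W t \<omega> - W s \<omega>) ^ j) = (\<integral>x. normal_density 0 ?\<sigma> x * x ^ j \<partial>lborel)" for j
      using distributed_integral[OF D, of "\<lambda>x. x ^ j"] by simp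
    have 2: "expectation (\<lambda>\<omega>. W t \<omega> - W s \<omega>) = 0"
      using int[of 1] integral_normal_moment_nz_1[OF \<sigma>, of 0] by simp
    have 3: "expectation (\<lambda>\<omega>. (W t \<omega> - W s \<omega>)\<^sup>2) = t - s"
      using int[of 2] integral_normal_moment_even[OF \<sigma>, of 0 1] st by (simp add: fact_numeral)
    have "(\<integral>x. normal_density 0 ?\<sigma> x * x ^ 4 \<partial>lborel) = fact 4 / ((2 / (t - s))\<^sup>2 * fact 2)"
      using integral_normal_moment_even[OF \<sigma>, of 0 2] st by simp
    also have "\<dots> = 3 * (t - s)\<^sup>2"
      using st by (simp add: fact_numeral field_simps power2_eq_square)
    finally have 4: "expectation (\<lambda>\<omega>. (W t \<omega> - W s \<omega>) ^ 4) = 3 * (t - s)\<^sup>2" using int[of 4] by simp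
    show ?thesis using 1 2 3 4 by auto
  qed
  then show "integrable M (\<lambda>\<omega>. (W t \<omega> - W s \<omega>) ^ k)"
    and "expectation (\<lambda>\<omega>. W t \<omega> - W s \<omega>) = 0"
    and "expectation (\<lambda>\<omega>. (W t \<omega> - W s \<omega>)\<^sup>2) = t - s"
    and "expectation (\<lambda>\<omega>. (W t \<omega> - W s \<omega>) ^ 4) = 3 * (t - s)\<^sup>2" by auto
qed

text \<open>\<open>std_BM\<close> gives independence as a product formula for events. Preimages of
  Borel sets under X belong to \<open>F s\<close>, and the preimages under X and under the increment
  are intersection-stable, so the formula extends to the generated sigma-algebras and then to
  functions of the increment.\<close>

lemma indep_increment:
  assumes "0 \<le> s" "s < t" "t \<le> T" and X: "X \<in> borel_measurable (Ft s)"
    and p: "p \<in> borel_measurable borel"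
  shows "indep_var borel (X :: 'a \<Rightarrow> real) borel (\<lambda>\<omega>. (p (W t \<omega> - W s \<omega>) :: real))"
proof -
  let ?D = "\<lambda>\<omega>. W t \<omega> - W s \<omega>"
  have [measurable]: "X \<in> borel_measurable M" using Ft_measurable_M[OF X] assms by auto
  have [measurable]: "?D \<in> borel_measurable M" using W_measurable assms by auto
  have "indep_var borel X borel ?D"
    unfolding indep_var_eq
  proof (intro conjI)
    let ?A = "{X -` A \<inter> space M |A. A \<in> sets borel}"
    let ?B = "{?D -` A \<inter> space M |A. A \<in> sets borel}"
    have "indep_set ?A ?B"
      unfolding indep_sets2_eq
    proof (intro conjI ballI)
      show "?A \<subseteq> events" "?B \<subseteq> events" by (auto intro: measurable_sets)
    next
      fix a b assume "a \<in> ?A" "b \<in> ?B"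
      then obtain A B where AB: "A \<in> sets borel" "a = X -` A \<inter> space M" "B \<in> sets borel" "b = ?D -` B \<inter> space M"
        by auto
      have "a \<in> F s" using measurable_sets[OF X AB(1)] AB(2) sets_Ft[of s] assms by auto
      moreover have "b = {\<omega>\<in>space M. W t \<omega> - W s \<omega> \<in> B}" using AB by auto
      ultimately show "prob (a \<inter> b) = prob a * prob b"
        using bmW AB assms unfolding std_BM_def by auto
    qed
    then show "indep_set (sigma_sets (space M) ?A) (sigma_sets (space M) ?B)"
    proof (rule indep_set_sigma_sets)
      show "Int_stable ?A"
        unfolding Int_stable_def
      proof safe
        fix A B :: "real set" assume "A \<in> sets borel" "B \<in> sets borel"
        then show "\<exists>C. X -` A \<inter> space M \<inter> (X -` B \<inter> space M) = X -` C \<inter> space M \<and> C \<in> sets borel"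
          by (intro exI[of _ "A \<inter> B"]) auto
      qed
      show "Int_stable ?B"
        unfolding Int_stable_def
      proof safe
        fix A B :: "real set" assume "A \<in> sets borel" "B \<in> sets borel"
        then show "\<exists>C. ?D -` A \<inter> space M \<inter> (?D -` B \<inter> space M) = ?D -` C \<inter> space M \<and> C \<in> sets borel"
          by (intro exI[of _ "A \<inter> B"]) auto
      qed
    qed
  qed auto
  from indep_var_compose[OF this, of id borel p borel] p show ?thesis by (simp add: comp_def)
qed

text \<open>Independence factors the expectation. The powers in use are 1 for orthogonality of
  increments, 2 for the isometry and 4 for the quadratic variation.\<close>

lemma increment_product:
  assumes "0 \<le> s" "s \<le> t" "t \<le> T" and X: "X \<in> borel_measurable (Ft s)" and int: "integrable M (X :: 'a \<Rightarrow> real)"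
  shows "integrable M (\<lambda>\<omega>. X \<omega> * (W t \<omega> - W s \<omega>) ^ k)"
    and "expectation (\<lambda>\<omega>. X \<omega> * (W t \<omega> - W s \<omega>) ^ k) = expectation X * expectation (\<lambda>\<omega>. (W t \<omega> - W s \<omega>) ^ k)"
proof -
  have "integrable M (\<lambda>\<omega>. X \<omega> * (W t \<omega> - W s \<omega>) ^ k) \<and>
   expectation (\<lambda>\<omega>. X \<omega> * (W t \<omega> - W s \<omega>) ^ k) = expectation X * expectation (\<lambda>\<omega>. (W t \<omega> - W s \<omega>) ^ k)"
  proof (cases "s = t")
    case True
    have [simp]: "prob (space M) = 1" by (rule prob_space)
    show ?thesis using int True by (cases k) auto
  next
    case False
    then have st: "s < t" using assms by auto
    have ind: "indep_var borel X borel (\<lambda>\<omega>. (W t \<omega> - W s \<omega>) ^ k)"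
      using indep_increment[OF assms(1) st assms(3) X, of "\<lambda>x. x ^ k"] by simp
    show ?thesis
      using indep_var_lebesgue_integral[OF ind int increment_moments(1)[OF assms(1-3)]]
        indep_var_integrable[OF ind int increment_moments(1)[OF assms(1-3)]] by auto
  qed
  then show "integrable M (\<lambda>\<omega>. X \<omega> * (W t \<omega> - W s \<omega>) ^ k)"
    and "expectation (\<lambda>\<omega>. X \<omega> * (W t \<omega> - W s \<omega>) ^ k) = expectation X * expectation (\<lambda>\<omega>. (W t \<omega> - W s \<omega>) ^ k)"
    by auto
qed

lemma increment_product1:
  assumes "0 \<le> s" "s \<le> t" "t \<le> T" "X \<in> borel_measurable (Ft s)" "integrable M (X :: 'a \<Rightarrow> real)"
  shows "integrable M (\<lambda>\<omega>. X \<omega> * (W t \<omega> - W s \<omega>))"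
    and "expectation (\<lambda>\<omega>. X \<omega> * (W t \<omega> - W s \<omega>)) = 0"
  using increment_product[OF assms, of 1] increment_moments(2)[OF assms(1-3)] by auto

lemma increment_product2:
  assumes "0 \<le> s" "s \<le> t" "t \<le> T" "X \<in> borel_measurable (Ft s)" "integrable M (X :: 'a \<Rightarrow> real)"
  shows "integrable M (\<lambda>\<omega>. X \<omega> * (W t \<omega> - W s \<omega>)\<^sup>2)"
    and "expectation (\<lambda>\<omega>. X \<omega> * (W t \<omega> - W s \<omega>)\<^sup>2) = (t - s) * expectation X"
  using increment_product[OF assms, of 2] increment_moments(3)[OF assms(1-3)] by auto

end

section \<open>Elementary integrals\<close>

text \<open>The cell k is determined by u alone, so the quantifier over the weights g comes after
  it: in the applications g depends on the random outcome while k must not. Consecutive points may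
  coincide; their cell is empty.\<close>

lemma partition_sum_cases:
  fixes \<tau> :: "nat \<Rightarrow> real"
  assumes "\<And>k. k < N \<Longrightarrow> \<tau> k \<le> \<tau> (Suc k)"
  shows "(u \<in> {\<tau> 0<..\<tau> N} \<and> (\<exists>k<N. u \<in> {\<tau> k<..\<tau> (Suc k)} \<and> (\<forall>g. (\<Sum>j<N. indicator {\<tau> j<..\<tau> (Suc j)} u * g j) = (g k :: real)))) \<or>
    (u \<notin> {\<tau> 0<..\<tau> N} \<and> (\<forall>g. (\<Sum>j<N. indicator {\<tau> j<..\<tau> (Suc j)} u * g j) = (0 :: real)))"
  using assms
proof (induction N)
  case 0 then show ?case by auto
next
  case (Suc N)
  have le: "\<tau> 0 \<le> \<tau> N"
    using Suc.prems by (induction N) (auto intro: order_trans)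
  have step: "\<tau> N \<le> \<tau> (Suc N)" using Suc.prems by simp
  from Suc.IH Suc.prems consider
    (a) k where "u \<in> {\<tau> 0<..\<tau> N}" "k < N" "u \<in> {\<tau> k<..\<tau> (Suc k)}"
      "\<forall>g. (\<Sum>j<N. indicator {\<tau> j<..\<tau> (Suc j)} u * g j) = (g k :: real)"
    | (b) "u \<notin> {\<tau> 0<..\<tau> N}" "\<forall>g. (\<Sum>j<N. indicator {\<tau> j<..\<tau> (Suc j)} u * g j) = (0 :: real)"
    by fastforce
  then show ?case
  proof cases
    case a
    have "u \<notin> {\<tau> N<..\<tau> (Suc N)}" using a by auto
    then show ?thesis using a step by (intro disjI1 conjI exI[of _ k]) auto
  next
    case b
    then show ?thesis using le step by (cases "u \<in> {\<tau> N<..\<tau> (Suc N)}") (auto intro!: exI[of _ N])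
  qed
qed

text \<open>The increment that leads to the first value beyond l still has weight 1, and all later
  ones have weight 0. So V follows z as long as the threshold is respected and afterwards stays at
  the first value that violates it.\<close>

lemma stopped_sum:
  fixes z :: "nat \<Rightarrow> real" and l :: real
  assumes "z 0 = 0"
  defines "V \<equiv> \<lambda>N. \<Sum>k<N. (if \<forall>j\<le>k. \<bar>z j\<bar> \<le> l then 1 else 0) * (z (Suc k) - z k)"
  shows "(if \<forall>j\<le>N. \<bar>z j\<bar> \<le> l then V N = z N else \<bar>V N\<bar> > l \<or> l < 0)"
proof (induction N)
  case 0 then show ?case using assms by auto
next
  case (Suc N)
  show ?case
  proof (cases "\<forall>j\<le>N. \<bar>z j\<bar> \<le> l")
    case True
    then have "V (Suc N) = z (Suc N)" using Suc unfolding V_def by simp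
    then show ?thesis using True by (auto simp: le_Suc_eq)
  next
    case False
    then have "V (Suc N) = V N" unfolding V_def by auto
    moreover have "\<not> (\<forall>j\<le>Suc N. \<bar>z j\<bar> \<le> l)" using False by (auto simp: le_Suc_eq)
    moreover have "\<bar>V N\<bar> > l \<or> l < 0" using Suc False by (simp only: if_False)
    ultimately show ?thesis by (simp only: if_False)
  qed
qed

section \<open>Square integrability and tail bounds\<close>

context prob_space
begin

lemma bounded_mult_integrable:
  assumes "X \<in> borel_measurable M" "\<And>\<omega>. \<omega> \<in> space M \<Longrightarrow> \<bar>X \<omega>\<bar> \<le> K" "integrable M (Y :: 'a \<Rightarrow> real)"
  shows "integrable M (\<lambda>\<omega>. X \<omega> * Y \<omega>)"
proof (rule Bochner_Integration.integrable_bound[of _ "\<lambda>\<omega>. K * \<bar>Y \<omega>\<bar>"])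
  show "integrable M (\<lambda>\<omega>. K * \<bar>Y \<omega>\<bar>)" using assms by auto
  show "(\<lambda>\<omega>. X \<omega> * Y \<omega>) \<in> borel_measurable M" using assms by measurable
  show "AE \<omega> in M. norm (X \<omega> * Y \<omega>) \<le> norm (K * \<bar>Y \<omega>\<bar>)"
  proof (rule AE_I2)
    fix \<omega> assume "\<omega> \<in> space M"
    then have "\<bar>X \<omega>\<bar> * \<bar>Y \<omega>\<bar> \<le> K * \<bar>Y \<omega>\<bar>" using assms(2) by (intro mult_right_mono) auto
    also have "\<dots> \<le> \<bar>K * \<bar>Y \<omega>\<bar>\<bar>" by (rule abs_ge_self)
    finally show "norm (X \<omega> * Y \<omega>) \<le> norm (K * \<bar>Y \<omega>\<bar>)" by (simp add: abs_mult)
  qed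
qed

lemma bounded_integrable:
  assumes "X \<in> borel_measurable M" "\<And>\<omega>. \<omega> \<in> space M \<Longrightarrow> \<bar>X \<omega>\<bar> \<le> (K::real)"
  shows "integrable M X"
  using bounded_mult_integrable[OF assms, of "\<lambda>_. 1"] by simp

lemma square_integrable_mult:
  fixes X Y :: "'a \<Rightarrow> real"
  assumes [measurable]: "X \<in> borel_measurable M" "Y \<in> borel_measurable M"
    and "integrable M (\<lambda>\<omega>. (X \<omega>)\<^sup>2)" "integrable M (\<lambda>\<omega>. (Y \<omega>)\<^sup>2)"
  shows "integrable M (\<lambda>\<omega>. X \<omega> * Y \<omega>)"
proof (rule Bochner_Integration.integrable_bound[of _ "\<lambda>\<omega>. (X \<omega>)\<^sup>2 + (Y \<omega>)\<^sup>2"])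
  show "AE \<omega> in M. norm (X \<omega> * Y \<omega>) \<le> norm ((X \<omega>)\<^sup>2 + (Y \<omega>)\<^sup>2)"
  proof (rule AE_I2)
    fix \<omega>
    have "0 \<le> (\<bar>X \<omega>\<bar> - \<bar>Y \<omega>\<bar>)\<^sup>2" "0 \<le> \<bar>X \<omega>\<bar> * \<bar>Y \<omega>\<bar>" by auto
    then have "\<bar>X \<omega>\<bar> * \<bar>Y \<omega>\<bar> \<le> (X \<omega>)\<^sup>2 + (Y \<omega>)\<^sup>2" unfolding power2_diff power2_abs by linarith
    then show "norm (X \<omega> * Y \<omega>) \<le> norm ((X \<omega>)\<^sup>2 + (Y \<omega>)\<^sup>2)" by (simp add: abs_mult)
  qed
qed (use assms in auto)

lemma square_integrable_add:
  fixes X Y :: "'a \<Rightarrow> real"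
  assumes "X \<in> borel_measurable M" "Y \<in> borel_measurable M"
    and "integrable M (\<lambda>\<omega>. (X \<omega>)\<^sup>2)" "integrable M (\<lambda>\<omega>. (Y \<omega>)\<^sup>2)"
  shows "integrable M (\<lambda>\<omega>. (X \<omega> + Y \<omega>)\<^sup>2)"
  unfolding power2_sum mult.assoc using assms square_integrable_mult by auto

text \<open>Chebyshev's inequality: Markov's inequality applied to the square.\<close>

lemma prob_abs_gt_le:
  fixes V :: "'a \<Rightarrow> real"
  assumes [measurable]: "V \<in> borel_measurable M" and "integrable M (\<lambda>\<omega>. (V \<omega>)\<^sup>2)" "0 < l"
  shows "prob {\<omega>\<in>space M. \<bar>V \<omega>\<bar> > l} \<le> expectation (\<lambda>\<omega>. (V \<omega>)\<^sup>2) / l\<^sup>2"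
proof -
  have "prob {\<omega>\<in>space M. \<bar>V \<omega>\<bar> > l} \<le> prob {\<omega>\<in>space M. (V \<omega>)\<^sup>2 \<ge> l\<^sup>2}"
    using \<open>0 < l\<close> by (intro finite_measure_mono) (auto simp: abs_le_square_iff[symmetric])
  also have "\<dots> \<le> expectation (\<lambda>\<omega>. (V \<omega>)\<^sup>2) / l\<^sup>2"
    using assms by (intro integral_Markov_inequality_measure[where A="{}"]) auto
  finally show ?thesis .
qed

end

section \<open>Elementary integrals: isometry, restriction and maximal inequality\<close>

context brownian_motion
begin

text \<open>The second argument is the integral process of the first one. Intervals may overlap, so sums over
  different grids can be compared without passing to a common refinement.\<close>

inductive elementary :: "(real \<Rightarrow> 'a \<Rightarrow> real) \<Rightarrow> (real \<Rightarrow> 'a \<Rightarrow> real) \<Rightarrow> bool" where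
  elementary_base: "0 \<le> p \<Longrightarrow> p \<le> q \<Longrightarrow> q \<le> T \<Longrightarrow> c \<in> borel_measurable (Ft p) \<Longrightarrow> (\<And>\<omega>. \<omega> \<in> space M \<Longrightarrow> \<bar>c \<omega>\<bar> \<le> K) \<Longrightarrow>
    elementary (\<lambda>s \<omega>. indicator {p<..q} s * c \<omega>) (\<lambda>t \<omega>. c \<omega> * (W (min q t) \<omega> - W (min p t) \<omega>))"
| elementary_add: "elementary X Z \<Longrightarrow> elementary X' Z' \<Longrightarrow> elementary (\<lambda>s \<omega>. X s \<omega> + X' s \<omega>) (\<lambda>t \<omega>. Z t \<omega> + Z' t \<omega>)"

lemma elementary_zero: "elementary (\<lambda>_ _. 0) (\<lambda>_ _. 0)"
  using elementary_base[of 0 0 "\<lambda>_. 0" 0] T_pos by simp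

lemma elementary_uminus: "elementary X Z \<Longrightarrow> elementary (\<lambda>s \<omega>. - X s \<omega>) (\<lambda>t \<omega>. - Z t \<omega>)"
proof (induction rule: elementary.induct)
  case (elementary_base p q c K)
  then show ?case using elementary.elementary_base[of p q "\<lambda>\<omega>. - c \<omega>" K] by simp
next
  case (elementary_add X Z X' Z')
  show ?case using elementary.elementary_add[OF elementary_add.IH] by (simp add: algebra_simps)
qed

lemma elementary_diff: "elementary X Z \<Longrightarrow> elementary X' Z' \<Longrightarrow> elementary (\<lambda>s \<omega>. X s \<omega> - X' s \<omega>) (\<lambda>t \<omega>. Z t \<omega> - Z' t \<omega>)"
  using elementary_add[OF _ elementary_uminus, of X Z X' Z'] by simp

lemma elementary_sum:
  "finite A \<Longrightarrow> (\<And>i. i \<in> A \<Longrightarrow> elementary (X i) (Z i)) \<Longrightarrow> elementary (\<lambda>s \<omega>. \<Sum>i\<in>A. X i s \<omega>) (\<lambda>t \<omega>. \<Sum>i\<in>A. Z i t \<omega>)"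
  by (induction A rule: finite_induct) (auto intro: elementary_zero elementary_add)

lemma elementary_integrand:
  assumes "elementary X Z"
  shows elementary_measurable: "X s \<in> borel_measurable M"
    and elementary_bounded: "\<exists>K. \<forall>s. \<forall>\<omega>\<in>space M. \<bar>X s \<omega>\<bar> \<le> K"
    and elementary_outside: "s \<notin> {0<..T} \<Longrightarrow> X s \<omega> = 0"
  using assms
proof (induction rule: elementary.induct)
  case (elementary_base p q c K)
  { case 1 show ?case using Ft_measurable_M[OF elementary_base(4)] elementary_base by auto }
  { case 2 show ?case using elementary_base(5) by (intro exI[of _ "\<bar>K\<bar>"]) (fastforce simp: indicator_def) }
  { case 3 then show ?case using elementary_base by (auto simp: indicator_def) }
next
  case (elementary_add X Z X' Z')
  { case 1 show ?case using elementary_add.IH by auto }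
  { case 2
    obtain K K' where "\<forall>s. \<forall>\<omega>\<in>space M. \<bar>X s \<omega>\<bar> \<le> K" "\<forall>s. \<forall>\<omega>\<in>space M. \<bar>X' s \<omega>\<bar> \<le> K'"
      using elementary_add.IH by auto
    then show ?case by (intro exI[of _ "K + K'"] allI ballI order_trans[OF abs_triangle_ineq] add_mono) auto }
  { case 3 then show ?case using elementary_add.IH by auto }
qed

lemma elementary_adapted:
  assumes "elementary X Z" "0 \<le> t" "t \<le> T"
  shows "Z t \<in> borel_measurable (Ft t)"
  using assms
proof (induction rule: elementary.induct)
  case (elementary_base p q c K)
  show ?case
  proof (cases "p \<le> t")
    case True
    then have "c \<in> borel_measurable (Ft t)" using Ft_mono elementary_base by blast
    moreover have "W (min q t) \<in> borel_measurable (Ft t)" "W (min p t) \<in> borel_measurable (Ft t)"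
      using elementary_base by (auto intro!: W_Ft)
    ultimately show ?thesis by measurable
  next
    case False
    \<comment> \<open>Before time p the weight c is not yet known, but then the increment that it
      multiplies is 0.\<close>
    then have "min q t = t" "min p t = t" using elementary_base by auto
    then show ?thesis by simp
  qed
qed auto

lemma elementary_square_integrable:
  assumes "elementary X Z" "0 \<le> t" "t \<le> T"
  shows "Z t \<in> borel_measurable M" "integrable M (\<lambda>\<omega>. (Z t \<omega>)\<^sup>2)"
proof -
  have m: "Z t \<in> borel_measurable M" if "elementary X Z" for X Z
    using elementary_adapted[OF that assms(2,3)] Ft_measurable_M assms by auto
  show "Z t \<in> borel_measurable M" using m assms by auto
  show "integrable M (\<lambda>\<omega>. (Z t \<omega>)\<^sup>2)" using assms
  proof (induction rule: elementary.induct)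
    case (elementary_base p q c K)
    have "integrable M (\<lambda>\<omega>. (W (min q t) \<omega> - W (min p t) \<omega>)\<^sup>2)"
      by (rule increment_moments) (use elementary_base in auto)
    moreover have "c \<in> borel_measurable M" using Ft_measurable_M[OF elementary_base(4)] elementary_base by auto
    moreover have "\<bar>(c \<omega>)\<^sup>2\<bar> \<le> K\<^sup>2" if "\<omega> \<in> space M" for \<omega> using elementary_base(5)[OF that]
      by (metis abs_ge_zero abs_power2 power2_abs power_mono)
    ultimately show ?case unfolding power_mult_distrib
      by (intro bounded_mult_integrable) auto
  next
    case (elementary_add X Z X' Z')
    then show ?case using square_integrable_add m by auto
  qed
qed

lemma elementary_mult_integrable:
  assumes "elementary X Z" "elementary X' Z'" "0 \<le> t" "t \<le> T"
  shows "integrable M (\<lambda>\<omega>. Z t \<omega> * Z' t \<omega>)"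
  using elementary_square_integrable[OF assms(1,3,4)] elementary_square_integrable[OF assms(2,3,4)]
  by (intro square_integrable_mult)

lemma elementary_integrand_mult_integrable:
  assumes "elementary X Z" "elementary X' Z'"
  shows "integrable M (\<lambda>\<omega>. X s \<omega> * X' s \<omega>)"
proof -
  obtain K K' where "\<forall>s. \<forall>\<omega>\<in>space M. \<bar>X s \<omega>\<bar> \<le> K" "\<forall>s. \<forall>\<omega>\<in>space M. \<bar>X' s \<omega>\<bar> \<le> K'"
    using elementary_bounded assms by metis
  then show ?thesis using elementary_measurable assms
    by (intro bounded_mult_integrable[of _ K] bounded_integrable[of _ K']) auto
qed

text \<open>If the intervals are disjoint, the later increment has mean 0 and is independent of all
  the rest. If they overlap, both increments are cut at p' and at m, the end of the overlap; all
  products of increments over different pieces have mean 0, and the squared increment over the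
  overlap contributes its length.\<close>

lemma increments_covariance:
  assumes p: "0 \<le> p" "p \<le> q" "q \<le> T" "0 \<le> p'" "p' \<le> q'" "q' \<le> T" "p \<le> p'"
    and c: "c \<in> borel_measurable (Ft p)" "\<And>\<omega>. \<omega> \<in> space M \<Longrightarrow> \<bar>c \<omega>\<bar> \<le> K"
    and c': "c' \<in> borel_measurable (Ft p')" "\<And>\<omega>. \<omega> \<in> space M \<Longrightarrow> \<bar>c' \<omega>\<bar> \<le> K'"
  shows "expectation (\<lambda>\<omega>. c \<omega> * (W q \<omega> - W p \<omega>) * (c' \<omega> * (W q' \<omega> - W p' \<omega>))) =
    expectation (\<lambda>\<omega>. c \<omega> * c' \<omega>) * max 0 (min q q' - p')"
proof -
  have m[measurable]: "c \<in> borel_measurable M" "c' \<in> borel_measurable M"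
    using Ft_measurable_M[OF c(1)] Ft_measurable_M[OF c'(1)] p by auto
  have mF[measurable]: "c \<in> borel_measurable (Ft p')"
    using Ft_mono[OF c(1)] p by auto
  note c'(1)[measurable]
  have W1: "integrable M (\<lambda>\<omega>. W r \<omega> - W s \<omega>)" if "0 \<le> s" "s \<le> r" "r \<le> T" for r s
    using increment_moments(1)[OF that, of 1] by simp
  have cc: "\<bar>c \<omega> * c' \<omega>\<bar> \<le> \<bar>K\<bar> * \<bar>K'\<bar>" if "\<omega> \<in> space M" for \<omega>
    unfolding abs_mult using c(2)[OF that] c'(2)[OF that] by (intro mult_mono) auto
  show ?thesis
  proof (cases "q \<le> p'")
    case True
    let ?X = "\<lambda>\<omega>. c \<omega> * c' \<omega> * (W q \<omega> - W p \<omega>)"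
    have [measurable]: "W q \<in> borel_measurable (Ft p')" "W p \<in> borel_measurable (Ft p')"
      using W_Ft True p by auto
    have iX: "integrable M ?X" by (intro bounded_mult_integrable[OF _ cc] W1) (use p in auto)
    have mX: "?X \<in> borel_measurable (Ft p')" by measurable
    have "expectation (\<lambda>\<omega>. ?X \<omega> * (W q' \<omega> - W p' \<omega>)) = 0"
      by (rule increment_product1(2)[OF p(4-6) mX iX])
    moreover have "(\<lambda>\<omega>. c \<omega> * (W q \<omega> - W p \<omega>) * (c' \<omega> * (W q' \<omega> - W p' \<omega>))) = (\<lambda>\<omega>. ?X \<omega> * (W q' \<omega> - W p' \<omega>))"
      by (simp add: fun_eq_iff)
    ultimately show ?thesis using True by simp
  next
    case False
    define m where "m = min q q'"
    have m: "p' \<le> m" "m \<le> q" "m \<le> q'" "m = q \<or> m = q'" using False p unfolding m_def by auto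
    let ?A = "\<lambda>\<omega>. c \<omega> * c' \<omega> * (W p' \<omega> - W p \<omega>)"
    let ?B = "\<lambda>\<omega>. c \<omega> * c' \<omega> * (W m \<omega> - W p' \<omega>)"
    have [measurable]: "W p' \<in> borel_measurable (Ft p')" "W p \<in> borel_measurable (Ft p')"
      "W p' \<in> borel_measurable (Ft m)" "W m \<in> borel_measurable (Ft m)"
      using W_Ft p m by auto
    have [measurable]: "c \<in> borel_measurable (Ft m)" "c' \<in> borel_measurable (Ft m)"
      using Ft_mono[OF mF, of m] Ft_mono[OF c'(1), of m] p m by auto
    have icc: "integrable M (\<lambda>\<omega>. c \<omega> * c' \<omega>)" by (rule bounded_integrable[OF _ cc]) auto
    have iA: "integrable M ?A" and iB: "integrable M ?B"
      by (intro bounded_mult_integrable[OF _ cc] W1; use p m in auto)+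
    have mA: "?A \<in> borel_measurable (Ft p')" by measurable
    have mB: "?B \<in> borel_measurable (Ft m)" by measurable
    have p3: "0 \<le> m" "m \<le> T" using p m by auto
    note 1 = increment_product1[OF p(4,5,6) mA iA]
    note 2 = increment_product1[OF p3(1) m(2) p(3) mB iB]
    note 3 = increment_product1[OF p3(1) m(3) p(6) mB iB]
    note 4 = increment_product2[OF p(4) m(1) p3(2) _ icc]
    \<comment> \<open>There is no product of W q - W m with W q' - W m, because m is one of q and q'
      and one of these factors is 0.\<close>
    have "(\<lambda>\<omega>. c \<omega> * (W q \<omega> - W p \<omega>) * (c' \<omega> * (W q' \<omega> - W p' \<omega>))) =
      (\<lambda>\<omega>. ?A \<omega> * (W q' \<omega> - W p' \<omega>) + c \<omega> * c' \<omega> * (W m \<omega> - W p' \<omega>)\<^sup>2 + ?B \<omega> * (W q \<omega> - W m \<omega>) + ?B \<omega> * (W q' \<omega> - W m \<omega>))"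
      using m(4) by (auto simp: fun_eq_iff algebra_simps power2_eq_square)
    then have "expectation (\<lambda>\<omega>. c \<omega> * (W q \<omega> - W p \<omega>) * (c' \<omega> * (W q' \<omega> - W p' \<omega>))) =
      (m - p') * expectation (\<lambda>\<omega>. c \<omega> * c' \<omega>)"
      using 1 2 3 4 by simp
    moreover have "max 0 (min q q' - p') = m - p'" using m unfolding m_def by simp
    ultimately show ?thesis by simp
  qed
qed

text \<open>Both sides equal the expectation of c * c' times the length of the overlap of the two
  intervals. By symmetry the interval that starts first may be taken as the first one.\<close>

lemma elementary_isometry_base:
  assumes p: "0 \<le> p" "p \<le> q" "q \<le> T" "0 \<le> p'" "p' \<le> q'" "q' \<le> T"
    and c: "c \<in> borel_measurable (Ft p)" "\<And>\<omega>. \<omega> \<in> space M \<Longrightarrow> \<bar>c \<omega>\<bar> \<le> K"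
    and c': "c' \<in> borel_measurable (Ft p')" "\<And>\<omega>. \<omega> \<in> space M \<Longrightarrow> \<bar>c' \<omega>\<bar> \<le> K'"
  shows "has_bochner_integral lborel (\<lambda>s. expectation (\<lambda>\<omega>. (indicator {p<..q} s * c \<omega>) * (indicator {p'<..q'} s * c' \<omega>)))
    (expectation (\<lambda>\<omega>. c \<omega> * (W q \<omega> - W p \<omega>) * (c' \<omega> * (W q' \<omega> - W p' \<omega>))))"
proof -
  have 1: "expectation (\<lambda>\<omega>. c \<omega> * (W q \<omega> - W p \<omega>) * (c' \<omega> * (W q' \<omega> - W p' \<omega>))) =
    expectation (\<lambda>\<omega>. c \<omega> * c' \<omega>) * max 0 (min q q' - max p p')"
  proof (cases "p \<le> p'")
    case True then show ?thesis using increments_covariance[OF p _ c c'] by simp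
  next
    case False
    then have "expectation (\<lambda>\<omega>. c' \<omega> * (W q' \<omega> - W p' \<omega>) * (c \<omega> * (W q \<omega> - W p \<omega>))) =
    expectation (\<lambda>\<omega>. c' \<omega> * c \<omega>) * max 0 (min q' q - p)"
      using increments_covariance[OF p(4-6) p(1-3) _ c' c] by simp
    then show ?thesis using False by (simp add: ac_simps)
  qed
  let ?I = "{max p p'<..min q q'}"
  have 2: "(\<lambda>s. expectation (\<lambda>\<omega>. (indicator {p<..q} s * c \<omega>) * (indicator {p'<..q'} s * c' \<omega>))) =
    (\<lambda>s. expectation (\<lambda>\<omega>. c \<omega> * c' \<omega>) * indicator ?I s)"
    by (auto simp: fun_eq_iff indicator_def)
  have "has_bochner_integral lborel (indicator ?I :: real \<Rightarrow> real) (max 0 (min q q' - max p p'))"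
    using has_bochner_integral_real_indicator[of ?I lborel]
    by (cases "max p p' \<le> min q q'") (auto simp: emeasure_lborel_Ioc max_def split: if_splits)
  then show ?thesis unfolding 1 2 by (rule has_bochner_integral_mult_right)
qed

text \<open>The bilinear form is the one that induction can prove: squaring a sum produces cross
  terms between the summands. The first integrand is decomposed with the second arbitrary, and for a
  single interval the second is decomposed in turn. \<open>has_bochner_integral\<close> carries the
  integrability in s that additivity needs.\<close>

theorem elementary_isometry:
  assumes "elementary X Z" "elementary X' Z'"
  shows "has_bochner_integral lborel (\<lambda>s. expectation (\<lambda>\<omega>. X s \<omega> * X' s \<omega>)) (expectation (\<lambda>\<omega>. Z T \<omega> * Z' T \<omega>))"
  using assms
proof (induction arbitrary: X' Z' rule: elementary.induct)
  case 1: (elementary_base p q c K)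
  let ?X = "\<lambda>s \<omega>. indicator {p<..q} s * c \<omega>" and ?Z = "\<lambda>t \<omega>. c \<omega> * (W (min q t) \<omega> - W (min p t) \<omega>)"
  have e: "elementary ?X ?Z" using 1 by (intro elementary_base) auto
  from 1(6) show ?case
  proof (induction rule: elementary.induct)
    case 2: (elementary_base p' q' c' K')
    show ?case
      using elementary_isometry_base[OF 1(1-3) 2(1-3) 1(4,5) 2(4,5)] 1(1-3) 2(1-3)
      by (simp add: min_absorb1)
  next
    case (elementary_add X1 Z1 X2 Z2)
    have "0 \<le> T" using T_pos by simp
    then show ?case
      using has_bochner_integral_add[OF elementary_add.IH] elementary_mult_integrable[OF e elementary_add.hyps(1)]
        elementary_mult_integrable[OF e elementary_add.hyps(2)] elementary_integrand_mult_integrable[OF e elementary_add.hyps(1)]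
        elementary_integrand_mult_integrable[OF e elementary_add.hyps(2)]
      by (simp add: distrib_left)
  qed
next
  case (elementary_add X1 Z1 X2 Z2)
  have "0 \<le> T" using T_pos by simp
  then show ?case
    using has_bochner_integral_add[OF elementary_add.IH(1)[OF elementary_add.prems] elementary_add.IH(2)[OF elementary_add.prems]]
      elementary_mult_integrable[OF elementary_add.hyps(1) elementary_add.prems]
      elementary_mult_integrable[OF elementary_add.hyps(2) elementary_add.prems] elementary_integrand_mult_integrable[OF elementary_add.hyps(1) elementary_add.prems]
      elementary_integrand_mult_integrable[OF elementary_add.hyps(2) elementary_add.prems]
    by (simp add: distrib_right)
qed

text \<open>The indicator keeps track of the length of the interval that carries the integrand.
  Summed over the cells of a grid, the bounds add up to e times the total length.\<close>

lemma elementary_square_le: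
  assumes "elementary X Z" "\<alpha> \<le> \<beta>" "\<And>s. s \<in> {0<..T} \<Longrightarrow> expectation (\<lambda>\<omega>. (X s \<omega>)\<^sup>2) \<le> e * indicator {\<alpha><..\<beta>} s" "0 \<le> e"
  shows "expectation (\<lambda>\<omega>. (Z T \<omega>)\<^sup>2) \<le> e * (\<beta> - \<alpha>)"
proof -
  have "has_bochner_integral lborel (\<lambda>s. e * indicator {\<alpha><..\<beta>} s) (e * (\<beta> - \<alpha>))"
    using has_bochner_integral_real_indicator[of "{\<alpha><..\<beta>}" lborel] assms(2)
    by (intro has_bochner_integral_mult_right) (simp add: emeasure_lborel_Ioc)
  moreover have "expectation (\<lambda>\<omega>. X s \<omega> * X s \<omega>) \<le> e * indicator {\<alpha><..\<beta>} s" for s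
    using assms(3)[of s] elementary_outside[OF assms(1), of s] \<open>0 \<le> e\<close>
    by (cases "s \<in> {0<..T}") (auto simp: power2_eq_square)
  ultimately show ?thesis
    using elementary_isometry[OF assms(1,1)] unfolding power2_eq_square
    by (metis (no_types, lifting) has_bochner_integral_iff integral_mono)
qed

text \<open>Intersecting the interval of each base integrand with (s, t] gives another interval,
  whose left end is not before s, so a weight known at time s is known there. This one operation
  yields stopped integrals, integrals up to a time t, and integrals over a single grid cell.\<close>

lemma elementary_restrict:
  assumes "elementary X Z" "0 \<le> s" "s \<le> t" "t \<le> T" and G: "G \<in> borel_measurable (Ft s)" "\<And>\<omega>. \<omega> \<in> space M \<Longrightarrow> \<bar>G \<omega>\<bar> \<le> K"
  shows "elementary (\<lambda>u \<omega>. indicator {s<..t} u * G \<omega> * X u \<omega>) (\<lambda>r \<omega>. G \<omega> * (Z (min t r) \<omega> - Z (min s r) \<omega>))"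
  using assms
proof (induction rule: elementary.induct)
  case (elementary_base p q c K')
  show ?case
  proof (cases "max p s \<le> min q t")
    case True
    have "elementary (\<lambda>u \<omega>. indicator {max p s<..min q t} u * (G \<omega> * c \<omega>))
        (\<lambda>r \<omega>. (G \<omega> * c \<omega>) * (W (min (min q t) r) \<omega> - W (min (max p s) r) \<omega>))"
    proof (rule elementary.elementary_base)
      have "G \<in> borel_measurable (Ft (max p s))" "c \<in> borel_measurable (Ft (max p s))"
        using Ft_mono[of G s borel "max p s"] Ft_mono[of c p borel "max p s"] elementary_base by auto
      then show "(\<lambda>\<omega>. G \<omega> * c \<omega>) \<in> borel_measurable (Ft (max p s))" by simp
      show "\<bar>G \<omega> * c \<omega>\<bar> \<le> \<bar>K\<bar> * \<bar>K'\<bar>" if "\<omega> \<in> space M" for \<omega>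
        unfolding abs_mult using order_trans[OF elementary_base(5)[OF that] abs_ge_self] order_trans[OF elementary_base(10)[OF that] abs_ge_self]
        by (intro mult_mono) auto
    qed (use elementary_base True in auto)
    moreover have "(\<lambda>u \<omega>. indicator {max p s<..min q t} u * (G \<omega> * c \<omega>)) =
      (\<lambda>u \<omega>. indicator {s<..t} u * G \<omega> * (indicator {p<..q} u * c \<omega>))"
      by (auto simp: fun_eq_iff indicator_def)
    moreover have "(\<lambda>r \<omega>. (G \<omega> * c \<omega>) * (W (min (min q t) r) \<omega> - W (min (max p s) r) \<omega>)) =
      (\<lambda>r \<omega>. G \<omega> * (c \<omega> * (W (min q (min t r)) \<omega> - W (min p (min t r)) \<omega>) -
        c \<omega> * (W (min q (min s r)) \<omega> - W (min p (min s r)) \<omega>)))"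
    proof (intro ext)
      fix r \<omega>
      have "min q (min t r) = min (min q t) r" by (simp add: min.assoc)
      moreover have "min p (min t r) = min p r" "min q (min s r) = min s r" using True by linarith+
      \<comment> \<open>The two stopped times of p and s reappear as the minimum and the maximum, in
        one order or the other, so the four values of W rearrange.\<close>
      moreover have "(min p (min s r) = min p r \<and> min (max p s) r = min s r) \<or> (min p (min s r) = min s r \<and> min (max p s) r = min p r)"
        by linarith
      ultimately show "(G \<omega> * c \<omega>) * (W (min (min q t) r) \<omega> - W (min (max p s) r) \<omega>) =
       G \<omega> * (c \<omega> * (W (min q (min t r)) \<omega> - W (min p (min t r)) \<omega>) -
        c \<omega> * (W (min q (min s r)) \<omega> - W (min p (min s r)) \<omega>))" by (auto simp: algebra_simps)
    qed
    ultimately show ?thesis by simp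
  next
    case False
    then have "q < s \<or> t < p" using elementary_base by (auto simp: max_def min_def split: if_splits)
    then have "(\<lambda>r \<omega>. G \<omega> * (c \<omega> * (W (min q (min t r)) \<omega> - W (min p (min t r)) \<omega>) -
        c \<omega> * (W (min q (min s r)) \<omega> - W (min p (min s r)) \<omega>))) = (\<lambda>r \<omega>. 0)"
    proof
      assume "q < s"
      then have "min q (min t r) = min q r" "min p (min t r) = min p r" "min q (min s r) = min q r" "min p (min s r) = min p r" for r
        using elementary_base by (auto simp: min_def)
      then show ?thesis by simp
    next
      assume "t < p"
      then have "min q (min t r) = min t r" "min p (min t r) = min t r" "min q (min s r) = min s r" "min p (min s r) = min s r" for r
        using elementary_base by (auto simp: min_def)
      then show ?thesis by simp
    qed
    moreover have "(\<lambda>u \<omega>. indicator {s<..t} u * G \<omega> * (indicator {p<..q} u * c \<omega>)) = (\<lambda>u \<omega>. 0)"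
      using \<open>q < s \<or> t < p\<close> by (auto simp: fun_eq_iff indicator_def)
    ultimately show ?thesis using elementary_zero by simp
  qed
next
  case (elementary_add X Z X' Z')
  show ?case using elementary.elementary_add[OF elementary_add.IH(1)[OF elementary_add.prems] elementary_add.IH(2)[OF elementary_add.prems]]
    by (simp add: algebra_simps)
qed

lemma elementary_at_0: "elementary X Z \<Longrightarrow> Z 0 \<omega> = 0"
  by (induction rule: elementary.induct) (auto simp: min_absorb2)

text \<open>Doob's inequality: freezing the integral once it exceeds the threshold again gives an elementary
  integral, with a smaller integrand, so the isometry applies.\<close>

lemma elementary_maximal:
  assumes el: "elementary X Z" and \<tau>: "\<tau> 0 = 0" "\<And>k. k < N \<Longrightarrow> \<tau> k \<le> \<tau> (Suc k)" "\<tau> N \<le> T" and l: "0 < l"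
    and e: "\<And>s. s \<in> {0<..T} \<Longrightarrow> expectation (\<lambda>\<omega>. (X s \<omega>)\<^sup>2) \<le> e" "0 \<le> e"
  shows "prob {\<omega>\<in>space M. \<exists>k\<le>N. \<bar>Z (\<tau> k) \<omega>\<bar> > l} \<le> e * T / l\<^sup>2"
proof -
  have mono: "\<tau> j \<le> \<tau> k" if "j \<le> k" "k \<le> N" for j k
    using that
  proof (induction k rule: dec_induct)
    case (step n) then show ?case using \<tau>(2)[of n] by simp
  qed simp
  have rng: "0 \<le> \<tau> k" "\<tau> k \<le> T" if "k \<le> N" for k
    using mono[of 0 k] mono[of k N] that \<tau>(1,3) by auto
  \<comment> \<open>G is 1 until the first grid value beyond l and 0 afterwards. G k looks only at
    grid values up to index k, so it is known at time \<open>\<tau> k\<close>, as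
    \<open>elementary_restrict\<close> requires.\<close>
  define G where "G = (\<lambda>k \<omega>. if \<forall>j\<le>k. \<bar>Z (\<tau> j) \<omega>\<bar> \<le> l then 1 else (0::real))"
  define Xs where "Xs = (\<lambda>u \<omega>. \<Sum>k<N. indicator {\<tau> k<..\<tau> (Suc k)} u * G k \<omega> * X u \<omega>)"
  define Zs where "Zs = (\<lambda>r \<omega>. \<Sum>k<N. G k \<omega> * (Z (min (\<tau> (Suc k)) r) \<omega> - Z (min (\<tau> k) r) \<omega>))"
  have els: "elementary Xs Zs" unfolding Xs_def Zs_def
  proof (rule elementary_sum[OF finite_lessThan])
    fix k assume "k \<in> {..<N}"
    then have k: "k < N" by simp
    have Zj: "Z (\<tau> j) \<in> borel_measurable (Ft (\<tau> k))" if "j \<le> k" for j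
    proof (rule Ft_mono)
      show "Z (\<tau> j) \<in> borel_measurable (Ft (\<tau> j))" by (rule elementary_adapted[OF el rng]) (use k that in auto)
    qed (use rng[of j] rng[of k] mono[of j k] k that in auto)
    \<comment> \<open>The condition on all j up to k is written as a finite product, so
      measurability reduces to that of each factor.\<close>
    have m: "(\<lambda>\<omega>. \<Prod>j\<le>k. if \<bar>Z (\<tau> j) \<omega>\<bar> \<le> l then 1 else (0::real)) \<in> borel_measurable (Ft (\<tau> k))"
    proof (rule borel_measurable_prod)
      fix j assume "j \<in> {..k}"
      then have [measurable]: "Z (\<tau> j) \<in> borel_measurable (Ft (\<tau> k))" using Zj by simp
      show "(\<lambda>\<omega>. if \<bar>Z (\<tau> j) \<omega>\<bar> \<le> l then 1 else (0::real)) \<in> borel_measurable (Ft (\<tau> k))" by measurable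
    qed
    have "G k = (\<lambda>\<omega>. \<Prod>j\<le>k. if \<bar>Z (\<tau> j) \<omega>\<bar> \<le> l then 1 else (0::real))"
    proof
      fix \<omega>
      show "G k \<omega> = (\<Prod>j\<le>k. if \<bar>Z (\<tau> j) \<omega>\<bar> \<le> l then 1 else (0::real))"
        unfolding G_def by (cases "\<forall>j\<le>k. \<bar>Z (\<tau> j) \<omega>\<bar> \<le> l") auto
    qed
    with m have "G k \<in> borel_measurable (Ft (\<tau> k))" by simp
    moreover have "\<bar>G k \<omega>\<bar> \<le> 1" for \<omega> by (simp add: G_def)
    ultimately show "elementary (\<lambda>u \<omega>. indicator {\<tau> k<..\<tau> (Suc k)} u * G k \<omega> * X u \<omega>)
      (\<lambda>r \<omega>. G k \<omega> * (Z (min (\<tau> (Suc k)) r) \<omega> - Z (min (\<tau> k) r) \<omega>))"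
      using rng[of k] rng[of "Suc k"] \<tau>(2)[of k] k
      by (rule_tac elementary_restrict[OF el, of "\<tau> k" "\<tau> (Suc k)" "G k" 1]) simp_all
  qed
  have T0: "0 \<le> T" using T_pos by simp
  note m[measurable] = elementary_square_integrable(1)[OF els T0 order_refl]
  \<comment> \<open>At any time at most one cell is active, so the integrand is multiplied by a
    single weight, which is 0 or 1.\<close>
  have Xs_le: "(Xs u \<omega>)\<^sup>2 \<le> (X u \<omega>)\<^sup>2" for u \<omega>
  proof -
    let ?S = "\<Sum>k<N. indicator {\<tau> k<..\<tau> (Suc k)} u * G k \<omega>"
    have G1: "\<bar>G k \<omega>\<bar> \<le> 1" for k by (simp add: G_def)
    have "(\<exists>k. ?S = G k \<omega>) \<or> ?S = 0"
      using partition_sum_cases[of N \<tau>, OF \<tau>(2), of u] by (auto dest: spec[of _ "\<lambda>k. G k \<omega>"])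
    then have "\<bar>?S\<bar> \<le> 1"
    proof
      assume "\<exists>k. ?S = G k \<omega>"
      then obtain k where k: "?S = G k \<omega>" ..
      show ?thesis unfolding k by (rule G1)
    next
      assume S: "?S = 0"
      show ?thesis unfolding S by simp
    qed
    then have "\<bar>Xs u \<omega>\<bar> \<le> 1 * \<bar>X u \<omega>\<bar>"
      unfolding Xs_def sum_distrib_right[symmetric] abs_mult by (intro mult_right_mono) auto
    then show ?thesis by (simp add: abs_le_square_iff)
  qed
  have "expectation (\<lambda>\<omega>. (Zs T \<omega>)\<^sup>2) \<le> e * (T - 0)"
  proof (rule elementary_square_le[OF els T0])
    fix s assume s: "s \<in> {0<..T}"
    have "expectation (\<lambda>\<omega>. (Xs s \<omega>)\<^sup>2) \<le> expectation (\<lambda>\<omega>. (X s \<omega>)\<^sup>2)"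
      using elementary_integrand_mult_integrable[OF els els] elementary_integrand_mult_integrable[OF el el] Xs_le
      by (intro integral_mono) (auto simp: power2_eq_square)
    then show "expectation (\<lambda>\<omega>. (Xs s \<omega>)\<^sup>2) \<le> e * indicator {0<..T} s" using e(1)[OF s] s by simp
  qed (use e in auto)
  moreover have "prob {\<omega>\<in>space M. \<bar>Zs T \<omega>\<bar> > l} \<le> expectation (\<lambda>\<omega>. (Zs T \<omega>)\<^sup>2) / l\<^sup>2"
    using elementary_square_integrable[OF els T0 order_refl] l by (intro prob_abs_gt_le) auto
  moreover have "prob {\<omega>\<in>space M. \<exists>k\<le>N. \<bar>Z (\<tau> k) \<omega>\<bar> > l} \<le> prob {\<omega>\<in>space M. \<bar>Zs T \<omega>\<bar> > l}"
  proof (rule finite_measure_mono)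
    show "{\<omega>\<in>space M. \<exists>k\<le>N. \<bar>Z (\<tau> k) \<omega>\<bar> > l} \<subseteq> {\<omega>\<in>space M. \<bar>Zs T \<omega>\<bar> > l}"
    proof safe
      fix \<omega> k assume k: "k \<le> N" "l < \<bar>Z (\<tau> k) \<omega>\<bar>"
      have "Zs T \<omega> = (\<Sum>k<N. (if \<forall>j\<le>k. \<bar>Z (\<tau> j) \<omega>\<bar> \<le> l then 1 else 0) * (Z (\<tau> (Suc k)) \<omega> - Z (\<tau> k) \<omega>))"
        unfolding Zs_def G_def using rng by (intro sum.cong) (auto simp: min_absorb1)
      moreover have n: "(\<forall>j\<le>N. \<bar>Z (\<tau> j) \<omega>\<bar> \<le> l) = False" using k by force
      have "Z (\<tau> 0) \<omega> = 0" using \<tau>(1) elementary_at_0[OF el] by simp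
      from stopped_sum[where z="\<lambda>k. Z (\<tau> k) \<omega>", OF this, of N l, unfolded n if_False] l
      have "l < \<bar>\<Sum>k<N. (if \<forall>j\<le>k. \<bar>Z (\<tau> j) \<omega>\<bar> \<le> l then 1 else 0) * (Z (\<tau> (Suc k)) \<omega> - Z (\<tau> k) \<omega>)\<bar>"
        by linarith
      ultimately show "l < \<bar>Zs T \<omega>\<bar>" by simp
    qed
  qed measurable
  ultimately show ?thesis
    using divide_right_mono[of "expectation (\<lambda>\<omega>. (Zs T \<omega>)\<^sup>2)" "e * T" "l\<^sup>2"] by simp
qed

end

section \<open>Existence of the Ito integral\<close>

context brownian_motion
begin

text \<open>Continuity is required of every path, not of almost every one. Exceptional null sets are
  removed when a process is constructed, which the completeness of \<open>F 0\<close> permits, and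
  pathwise arguments are then free of them.\<close>

definition cont_adapted :: "(real \<Rightarrow> 'a \<Rightarrow> real) \<Rightarrow> bool" where
  "cont_adapted H \<longleftrightarrow> (\<forall>t\<in>{0..T}. H t \<in> borel_measurable (Ft t)) \<and> (\<forall>\<omega>\<in>space M. continuous_on {0..T} (\<lambda>t. H t \<omega>))"

lemma cont_adapted_Ft: "cont_adapted H \<Longrightarrow> 0 \<le> s \<Longrightarrow> s \<le> t \<Longrightarrow> t \<le> T \<Longrightarrow> H s \<in> borel_measurable (Ft t)"
  unfolding cont_adapted_def by (rule Ft_mono) simp_all

lemma cont_adapted_measurable: "cont_adapted H \<Longrightarrow> 0 \<le> t \<Longrightarrow> t \<le> T \<Longrightarrow> H t \<in> borel_measurable M"
  by (rule Ft_measurable_M[OF cont_adapted_Ft[OF _ _ order_refl]])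

lemma cont_adapted_cont: "cont_adapted H \<Longrightarrow> \<omega> \<in> space M \<Longrightarrow> continuous_on {0..T} (\<lambda>t. H t \<omega>)"
  unfolding cont_adapted_def by auto

lemma cadI:
  "(\<And>t. 0 \<le> t \<Longrightarrow> t \<le> T \<Longrightarrow> H t \<in> borel_measurable (Ft t)) \<Longrightarrow>
    (\<And>\<omega>. \<omega> \<in> space M \<Longrightarrow> continuous_on {0..T} (\<lambda>t. H t \<omega>)) \<Longrightarrow> cont_adapted H"
  unfolding cont_adapted_def by auto

lemma cont_adapted_compose:
  assumes "cont_adapted H" "continuous_on UNIV (g :: real \<Rightarrow> real)"
  shows "cont_adapted (\<lambda>t \<omega>. g (H t \<omega>))"
proof (rule cadI)
  fix t assume t: "0 \<le> t" "t \<le> T"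
  have "g \<in> borel_measurable borel" using assms(2) by (rule borel_measurable_continuous_onI)
  then show "(\<lambda>\<omega>. g (H t \<omega>)) \<in> borel_measurable (Ft t)"
    using cont_adapted_Ft[OF assms(1) t(1) order_refl t(2)] by (rule measurable_compose_rev)
next
  fix \<omega> assume "\<omega> \<in> space M"
  from cont_adapted_cont[OF assms(1) this] show "continuous_on {0..T} (\<lambda>t. g (H t \<omega>))"
    by (rule continuous_on_compose2[OF assms(2)]) auto
qed

lemma cont_adapted_add: "cont_adapted H \<Longrightarrow> cont_adapted H' \<Longrightarrow> cont_adapted (\<lambda>t \<omega>. H t \<omega> + H' t \<omega>)"
  and cont_adapted_diff: "cont_adapted H \<Longrightarrow> cont_adapted H' \<Longrightarrow> cont_adapted (\<lambda>t \<omega>. H t \<omega> - H' t \<omega>)"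
  and cont_adapted_mult: "cont_adapted H \<Longrightarrow> cont_adapted H' \<Longrightarrow> cont_adapted (\<lambda>t \<omega>. H t \<omega> * H' t \<omega>)"
  unfolding cont_adapted_def by (auto intro!: continuous_intros borel_measurable_add borel_measurable_diff borel_measurable_times)

lemma cont_adapted_const: "cont_adapted (\<lambda>t \<omega>. c)"
  unfolding cont_adapted_def by auto

lemma cont_adapted_uminus: "cont_adapted H \<Longrightarrow> cont_adapted (\<lambda>t \<omega>. - H t \<omega>)"
  unfolding cont_adapted_def by (auto intro!: continuous_intros)

text \<open>Suprema over time are taken over this countable set: their events are measurable, its
  finite levels increase so that discrete maximal inequalities pass to the limit, and continuity
  recovers all of [0, T].\<close>

definition dyadics :: "real set" where
  "dyadics = (\<Union>m::nat. (\<lambda>j::nat. T * real j / 2 ^ m) ` {..2 ^ m})"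

lemma countable_dyadics: "countable dyadics"
  unfolding dyadics_def by auto

lemma dyadics_subset: "t \<in> dyadics \<Longrightarrow> 0 \<le> t \<and> t \<le> T"
proof -
  assume "t \<in> dyadics"
  then obtain m j :: nat where j: "j \<le> 2 ^ m" "t = T * real j / 2 ^ m" unfolding dyadics_def by auto
  have "real j \<le> 2 ^ m" using j(1) by (metis of_nat_le_iff of_nat_numeral of_nat_power)
  then show ?thesis using T_pos unfolding j(2) by (auto simp: field_simps)
qed

lemma dyadics_dense:
  assumes "0 \<le> t" "t \<le> T"
  shows "\<exists>q. (\<forall>m. q m \<in> dyadics) \<and> q \<longlonglongrightarrow> t"
proof -
  define q where "q = (\<lambda>m. T * real (nat \<lfloor>t / T * 2 ^ m\<rfloor>) / 2 ^ m)"
  have tT: "0 \<le> t / T" "t / T \<le> 1" using assms T_pos by auto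
  have 1: "q m \<in> dyadics" for m
  proof -
    have "t / T * 2 ^ m \<le> 2 ^ m" using mult_right_mono[OF tT(2), of "2 ^ m"] by simp
    then have "\<lfloor>t / T * 2 ^ m\<rfloor> \<le> 2 ^ m" by (metis floor_mono floor_of_int of_int_numeral of_int_power)
    then have "nat \<lfloor>t / T * 2 ^ m\<rfloor> \<le> 2 ^ m" by (simp add: nat_le_iff)
    then show ?thesis unfolding q_def dyadics_def by blast
  qed
  have 2: "\<bar>q m - t\<bar> \<le> T * (1 / 2) ^ m" for m
  proof -
    have n: "real (nat \<lfloor>t / T * 2 ^ m\<rfloor>) = of_int \<lfloor>t / T * 2 ^ m\<rfloor>"
      by (rule of_nat_nat) (use assms T_pos in simp)
    have "of_int \<lfloor>t / T * 2 ^ m\<rfloor> \<le> t / T * 2 ^ m" "t / T * 2 ^ m \<le> of_int \<lfloor>t / T * 2 ^ m\<rfloor> + 1" by linarith+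
    then have 1: "\<bar>real (nat \<lfloor>t / T * 2 ^ m\<rfloor>) - t / T * 2 ^ m\<bar> \<le> 1" unfolding n by linarith
    define a where "a = real (nat \<lfloor>t / T * 2 ^ m\<rfloor>) - t / T * 2 ^ m"
    have "real (nat \<lfloor>t / T * 2 ^ m\<rfloor>) = a + t / T * 2 ^ m" unfolding a_def by linarith
    then have "q m = T * (a + t / T * 2 ^ m) / 2 ^ m" unfolding q_def by (rule arg_cong)
    also have "\<dots> = a * (T / 2 ^ m) + t" using T_pos by (simp add: field_simps)
    finally have "\<bar>q m - t\<bar> = \<bar>a\<bar> * (T / 2 ^ m)" using T_pos by (simp add: abs_mult)
    also have "\<dots> \<le> 1 * (T / 2 ^ m)" using 1[folded a_def] T_pos by (intro mult_right_mono) auto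
    finally have "\<bar>q m - t\<bar> \<le> 1 * (T / 2 ^ m)" .
    then show ?thesis by (simp add: power_one_over)
  qed
  have "(\<lambda>m. T * (1 / 2) ^ m) \<longlonglongrightarrow> T * 0"
    by (intro tendsto_mult tendsto_const LIMSEQ_realpow_zero) auto
  then have "(\<lambda>m. T * (1 / 2) ^ m) \<longlonglongrightarrow> 0" by simp
  then have "(\<lambda>m. q m - t) \<longlonglongrightarrow> 0"
    by (rule Lim_null_comparison[rotated]) (use 2 in auto)
  then have "q \<longlonglongrightarrow> t" using LIM_zero_cancel by blast
  with 1 show ?thesis by blast
qed

lemma dyadics_bound:
  fixes h :: "real \<Rightarrow> real"
  assumes "continuous_on {0..T} h" "\<And>t. t \<in> dyadics \<Longrightarrow> h t \<le> l" "0 \<le> t" "t \<le> T"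
  shows "h t \<le> l"
proof -
  obtain q where q: "\<forall>m. q m \<in> dyadics" "q \<longlonglongrightarrow> t" using dyadics_dense assms by blast
  have "(\<lambda>m. h (q m)) \<longlonglongrightarrow> h t"
    using assms q dyadics_subset by (intro continuous_on_tendsto_compose[OF assms(1) q(2)]) (auto intro: always_eventually)
  then show ?thesis using assms(2) q by (intro LIMSEQ_le_const2) auto
qed

text \<open>The null sets of countably many times combine into one, and continuity in t does the
  rest. The premise P serves localised statements, where the two processes agree only on some
  event.\<close>

lemma AE_all_from_dyadics:
  assumes "AE \<omega> in M. continuous_on {0..T} (\<lambda>t. A t \<omega>)" "AE \<omega> in M. continuous_on {0..T} (\<lambda>t. B t \<omega>)"
    and "\<And>t. 0 \<le> t \<Longrightarrow> t \<le> T \<Longrightarrow> AE \<omega> in M. P \<omega> \<longrightarrow> A t \<omega> = (B t \<omega> :: real)"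
  shows "AE \<omega> in M. P \<omega> \<longrightarrow> (\<forall>t\<in>{0..T}. A t \<omega> = B t \<omega>)"
proof -
  have "AE \<omega> in M. \<forall>t\<in>dyadics. P \<omega> \<longrightarrow> A t \<omega> = B t \<omega>"
    using assms(3) dyadics_subset by (subst AE_ball_countable[OF countable_dyadics]) auto
  then show ?thesis using assms(1,2)
  proof eventually_elim
    case (elim \<omega>)
    show ?case
    proof (intro impI ballI)
      fix t assume P: "P \<omega>" and t: "t \<in> {0..T}"
      have "\<bar>A t \<omega> - B t \<omega>\<bar> \<le> 0"
        by (rule dyadics_bound[where h="\<lambda>t. \<bar>A t \<omega> - B t \<omega>\<bar>"]) (use elim P t in \<open>auto intro!: continuous_intros\<close>)
      then show "A t \<omega> = B t \<omega>" by simp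
    qed
  qed
qed

section \<open>Riemann sums over one grid of [0, T]\<close>

definition unif_pt :: "nat \<Rightarrow> nat \<Rightarrow> real" where "unif_pt n k = real k * T / real n"

text \<open>The sums of \<open>is_ito_integral\<close> move their grid with t. Here the grid is
  fixed and the increments are stopped at t instead, so that for bounded H the sums form one
  elementary integral and are continuous in t wherever W is.\<close>

definition ito_sum :: "(real \<Rightarrow> 'a \<Rightarrow> real) \<Rightarrow> nat \<Rightarrow> real \<Rightarrow> 'a \<Rightarrow> real" where
  "ito_sum H n t \<omega> = (\<Sum>k<n. H (unif_pt n k) \<omega> * (W (min (unif_pt n (Suc k)) t) \<omega> - W (min (unif_pt n k) t) \<omega>))"

definition ito_sum_integrand :: "(real \<Rightarrow> 'a \<Rightarrow> real) \<Rightarrow> nat \<Rightarrow> real \<Rightarrow> 'a \<Rightarrow> real" where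
  "ito_sum_integrand H n s \<omega> = (\<Sum>k<n. indicator {unif_pt n k<..unif_pt n (Suc k)} s * H (unif_pt n k) \<omega>)"

lemma unif_pt_bounds: "k \<le> n \<Longrightarrow> 0 \<le> unif_pt n k \<and> unif_pt n k \<le> T"
  using T_pos unfolding unif_pt_def by (cases "n = 0") (auto simp: divide_le_eq mult.commute)

lemma unif_pt_Suc: "unif_pt n k \<le> unif_pt n (Suc k)" "unif_pt n (Suc k) - unif_pt n k = T / real n"
  using T_pos unfolding unif_pt_def by (auto simp: divide_right_mono diff_divide_distrib[symmetric] distrib_right)

lemma elementary_ito_sum:
  assumes "cont_adapted H" "\<And>t \<omega>. 0 \<le> t \<Longrightarrow> t \<le> T \<Longrightarrow> \<omega> \<in> space M \<Longrightarrow> \<bar>H t \<omega>\<bar> \<le> K"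
  shows "elementary (ito_sum_integrand H n) (ito_sum H n)"
proof -
  have "elementary (\<lambda>s \<omega>. \<Sum>k<n. indicator {unif_pt n k<..unif_pt n (Suc k)} s * H (unif_pt n k) \<omega>)
    (\<lambda>t \<omega>. \<Sum>k<n. H (unif_pt n k) \<omega> * (W (min (unif_pt n (Suc k)) t) \<omega> - W (min (unif_pt n k) t) \<omega>))"
  proof (rule elementary_sum[OF finite_lessThan])
    fix k assume "k \<in> {..<n}"
    then have k: "k \<le> n" "Suc k \<le> n" by auto
    show "elementary (\<lambda>s \<omega>. indicator {unif_pt n k<..unif_pt n (Suc k)} s * H (unif_pt n k) \<omega>)
      (\<lambda>t \<omega>. H (unif_pt n k) \<omega> * (W (min (unif_pt n (Suc k)) t) \<omega> - W (min (unif_pt n k) t) \<omega>))"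
      by (rule elementary_base[where K=K]) (use k unif_pt_bounds[of k n] unif_pt_bounds[of "Suc k" n] unif_pt_Suc[of n k] cont_adapted_Ft[OF assms(1)] assms(2) in auto)
  qed
  moreover have "(\<lambda>s \<omega>. \<Sum>k<n. indicator {unif_pt n k<..unif_pt n (Suc k)} s * H (unif_pt n k) \<omega>) = ito_sum_integrand H n"
    by (simp add: fun_eq_iff ito_sum_integrand_def)
  moreover have "(\<lambda>t \<omega>. \<Sum>k<n. H (unif_pt n k) \<omega> * (W (min (unif_pt n (Suc k)) t) \<omega> - W (min (unif_pt n k) t) \<omega>)) = ito_sum H n"
    by (simp add: fun_eq_iff ito_sum_def)
  ultimately show ?thesis by simp
qed

text \<open>The time u is the left end of the cell that contains s. It is the same for all outcomes,
  so second moments of the step integrand reduce to those of H at deterministic times.\<close>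

lemma ito_sum_integrand_eq:
  assumes "0 < n" "s \<in> {0<..T}"
  obtains u where "0 \<le> u" "u \<le> T" "u \<le> s" "s - u \<le> T / real n" "\<And>\<omega>. ito_sum_integrand H n s \<omega> = H u \<omega>"
proof -
  have p0: "unif_pt n 0 = 0" "unif_pt n n = T" using assms unfolding unif_pt_def by auto
  from partition_sum_cases[of n "unif_pt n" s] unif_pt_Suc assms p0 obtain k where
    k: "k < n" "s \<in> {unif_pt n k<..unif_pt n (Suc k)}" "\<And>g. (\<Sum>j<n. indicator {unif_pt n j<..unif_pt n (Suc j)} s * g j) = (g k :: real)"
    by auto
  show ?thesis
  proof (rule that[of "unif_pt n k"])
    show "ito_sum_integrand H n s \<omega> = H (unif_pt n k) \<omega>" for \<omega> unfolding ito_sum_integrand_def by (rule k(3))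
  qed (use k unif_pt_bounds[of k n] unif_pt_Suc[of n k] in auto)
qed

lemma ito_sum_adapted:
  assumes "cont_adapted H" "0 \<le> t" "t \<le> T"
  shows "ito_sum H n t \<in> borel_measurable (Ft t)"
proof -
  have "(\<lambda>\<omega>. \<Sum>k<n. H (unif_pt n k) \<omega> * (W (min (unif_pt n (Suc k)) t) \<omega> - W (min (unif_pt n k) t) \<omega>)) \<in> borel_measurable (Ft t)"
  proof (rule borel_measurable_sum)
    fix k assume "k \<in> {..<n}"
    then have b: "0 \<le> unif_pt n k" "unif_pt n k \<le> T" "0 \<le> unif_pt n (Suc k)" "unif_pt n (Suc k) \<le> T"
      using unif_pt_bounds[of k n] unif_pt_bounds[of "Suc k" n] by auto
    show "(\<lambda>\<omega>. H (unif_pt n k) \<omega> * (W (min (unif_pt n (Suc k)) t) \<omega> - W (min (unif_pt n k) t) \<omega>)) \<in> borel_measurable (Ft t)"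
    proof (cases "unif_pt n k \<le> t")
      case True
      then have [measurable]: "H (unif_pt n k) \<in> borel_measurable (Ft t)" using cont_adapted_Ft[OF assms(1)] b assms by auto
      have [measurable]: "W (min (unif_pt n (Suc k)) t) \<in> borel_measurable (Ft t)" "W (min (unif_pt n k) t) \<in> borel_measurable (Ft t)"
        using b assms by (auto intro!: W_Ft)
      show ?thesis by measurable
    next
      case False
      then have "min (unif_pt n (Suc k)) t = t" "min (unif_pt n k) t = t" using unif_pt_Suc[of n k] by auto
      then show ?thesis by simp
    qed
  qed
  moreover have "ito_sum H n t = (\<lambda>\<omega>. \<Sum>k<n. H (unif_pt n k) \<omega> * (W (min (unif_pt n (Suc k)) t) \<omega> - W (min (unif_pt n k) t) \<omega>))"
    by (simp add: fun_eq_iff ito_sum_def)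
  ultimately show ?thesis by simp
qed

lemma ito_sum_measurable:
  "cont_adapted H \<Longrightarrow> 0 \<le> t \<Longrightarrow> t \<le> T \<Longrightarrow> ito_sum H n t \<in> borel_measurable M"
  using ito_sum_adapted Ft_measurable_M by blast

lemma ito_sum_cont:
  assumes "continuous_on {0..T} (\<lambda>t. W t \<omega>)"
  shows "continuous_on {0..T} (\<lambda>t. ito_sum H n t \<omega>)"
proof -
  have "continuous_on {0..T} (\<lambda>t. W (min (unif_pt n k) t) \<omega>)" if "k \<le> n" for k
    by (rule continuous_on_compose2[OF assms]) (use unif_pt_bounds[OF that] in \<open>auto intro!: continuous_intros\<close>)
  then show ?thesis unfolding ito_sum_def by (intro continuous_intros) auto
qed

lemma ito_sum_cong:
  assumes "\<And>t. 0 \<le> t \<Longrightarrow> t \<le> T \<Longrightarrow> H t \<omega> = H' t \<omega>"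
  shows "ito_sum H n t \<omega> = ito_sum H' n t \<omega>"
  unfolding ito_sum_def using assms unif_pt_bounds by (intro sum.cong) auto

text \<open>Paths are uniformly continuous, but with a modulus that depends on the outcome. For
  bounded H, dominated convergence makes the mean square of H u - H v a continuous function of (u,
  v) on a compact square, hence a uniformly continuous one.\<close>

lemma mean_square_modulus:
  assumes H: "cont_adapted H" "\<And>t \<omega>. 0 \<le> t \<Longrightarrow> t \<le> T \<Longrightarrow> \<omega> \<in> space M \<Longrightarrow> \<bar>H t \<omega>\<bar> \<le> K" and "0 < e"
  shows "\<exists>d>0. \<forall>u\<in>{0..T}. \<forall>v\<in>{0..T}. \<bar>u - v\<bar> < d \<longrightarrow> expectation (\<lambda>\<omega>. (H u \<omega> - H v \<omega>)\<^sup>2) \<le> e"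
proof -
  let ?g = "\<lambda>p. expectation (\<lambda>\<omega>. (H (fst p) \<omega> - H (snd p) \<omega>)\<^sup>2)"
  let ?S = "{0..T} \<times> {0..T}"
  have "continuous_on ?S ?g"
    unfolding continuous_on_sequentially
  proof (intro allI ballI impI, elim conjE)
    fix x p assume p: "p \<in> ?S" and x: "\<forall>n. x n \<in> ?S" "x \<longlonglongrightarrow> p"
    have fs: "fst (x n) \<in> {0..T}" "snd (x n) \<in> {0..T}" "fst p \<in> {0..T}" "snd p \<in> {0..T}" for n
      using x(1) p by (auto simp: mem_Times_iff)
    have [measurable]: "H (fst (x n)) \<in> borel_measurable M" "H (snd (x n)) \<in> borel_measurable M"
      "H (fst p) \<in> borel_measurable M" "H (snd p) \<in> borel_measurable M" for n
      using cont_adapted_measurable[OF H(1)] fs by auto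
    have "(\<lambda>n. expectation (\<lambda>\<omega>. (H (fst (x n)) \<omega> - H (snd (x n)) \<omega>)\<^sup>2)) \<longlonglongrightarrow> expectation (\<lambda>\<omega>. (H (fst p) \<omega> - H (snd p) \<omega>)\<^sup>2)"
    proof (rule integral_dominated_convergence[where w="\<lambda>_. (2 * K)\<^sup>2"])
      show "AE \<omega> in M. (\<lambda>n. (H (fst (x n)) \<omega> - H (snd (x n)) \<omega>)\<^sup>2) \<longlonglongrightarrow> (H (fst p) \<omega> - H (snd p) \<omega>)\<^sup>2"
      proof (rule AE_I2)
        fix \<omega> assume \<omega>: "\<omega> \<in> space M"
        have "(\<lambda>n. H (fst (x n)) \<omega>) \<longlonglongrightarrow> H (fst p) \<omega>" "(\<lambda>n. H (snd (x n)) \<omega>) \<longlonglongrightarrow> H (snd p) \<omega>"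
          using fs by (auto intro!: continuous_on_tendsto_compose[OF cont_adapted_cont[OF H(1) \<omega>]] tendsto_fst tendsto_snd x(2) always_eventually)
        then show "(\<lambda>n. (H (fst (x n)) \<omega> - H (snd (x n)) \<omega>)\<^sup>2) \<longlonglongrightarrow> (H (fst p) \<omega> - H (snd p) \<omega>)\<^sup>2"
          by (intro tendsto_intros)
      qed
      show "AE \<omega> in M. norm ((H (fst (x n)) \<omega> - H (snd (x n)) \<omega>)\<^sup>2) \<le> (2 * K)\<^sup>2" for n
      proof (rule AE_I2)
        fix \<omega> assume \<omega>: "\<omega> \<in> space M"
        have "\<bar>H (fst (x n)) \<omega> - H (snd (x n)) \<omega>\<bar> \<le> 2 * K"
          using H(2)[OF _ _ \<omega>, of "fst (x n)"] H(2)[OF _ _ \<omega>, of "snd (x n)"] fs(1)[of n] fs(2)[of n] by auto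
        then show "norm ((H (fst (x n)) \<omega> - H (snd (x n)) \<omega>)\<^sup>2) \<le> (2 * K)\<^sup>2"
          using power_mono[of "\<bar>H (fst (x n)) \<omega> - H (snd (x n)) \<omega>\<bar>" "2 * K" 2] by simp
      qed
    qed measurable
    then show "(?g \<circ> x) \<longlonglongrightarrow> ?g p" by (simp add: comp_def)
  qed
  then have "uniformly_continuous_on ?S ?g"
    by (rule compact_uniformly_continuous) (intro compact_Times compact_Icc)
  then have "\<exists>d>0. \<forall>p\<in>?S. \<forall>q\<in>?S. dist q p < d \<longrightarrow> dist (?g q) (?g p) < e"
    unfolding uniformly_continuous_on_def using \<open>0 < e\<close> by blast
  then obtain d where d: "d > 0" "\<And>p q. p \<in> ?S \<Longrightarrow> q \<in> ?S \<Longrightarrow> dist q p < d \<Longrightarrow> dist (?g q) (?g p) < e"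
    by blast
  show ?thesis
  proof (intro exI[of _ d] conjI ballI impI)
    fix u v assume uv: "u \<in> {0..T}" "v \<in> {0..T}" "\<bar>u - v\<bar> < d"
    \<comment> \<open>The comparison point lies on the diagonal, where the function is 0.\<close>
    have "dist (?g (u, v)) (?g (v, v)) < e"
      by (rule d(2)) (use uv in \<open>auto simp: dist_Pair_Pair dist_real_def\<close>)
    then show "expectation (\<lambda>\<omega>. (H u \<omega> - H v \<omega>)\<^sup>2) \<le> e" by (simp add: dist_real_def)
  qed (rule d(1))
qed

text \<open>Both step integrands sample H at times at most T / N before s, so the two sample times
  differ by less than the d of \<open>mean_square_modulus\<close>.\<close>

lemma ito_sum_integrand_close:
  assumes H: "cont_adapted H" "\<And>t \<omega>. 0 \<le> t \<Longrightarrow> t \<le> T \<Longrightarrow> \<omega> \<in> space M \<Longrightarrow> \<bar>H t \<omega>\<bar> \<le> K" and "0 < e"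
  shows "\<exists>N>0. \<forall>n\<ge>N. \<forall>n'\<ge>N. \<forall>s\<in>{0<..T}. expectation (\<lambda>\<omega>. (ito_sum_integrand H n s \<omega> - ito_sum_integrand H n' s \<omega>)\<^sup>2) \<le> e"
proof -
  obtain d where d: "d > 0" "\<forall>u\<in>{0..T}. \<forall>v\<in>{0..T}. \<bar>u - v\<bar> < d \<longrightarrow> expectation (\<lambda>\<omega>. (H u \<omega> - H v \<omega>)\<^sup>2) \<le> e"
    using mean_square_modulus[OF H \<open>0 < e\<close>] by auto
  obtain N :: nat where N: "N > 0" "T / real N < d"
    using reals_Archimedean2[of "T / d"] d(1) T_pos
    by (metis divide_pos_pos gr0I less_asym of_nat_0 pos_divide_less_eq mult.commute of_nat_0_less_iff)
  show ?thesis
  proof (intro exI[of _ N] conjI allI impI ballI)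
    fix n n' s assume n: "N \<le> n" "N \<le> n'" and s: "s \<in> {0<..T}"
    have le: "T / real m < d" if "N \<le> m" for m
      using N that T_pos by (intro le_less_trans[OF _ N(2)] divide_left_mono) auto
    obtain u where u: "0 \<le> u" "u \<le> T" "u \<le> s" "s - u \<le> T / real n" "\<And>\<omega>. ito_sum_integrand H n s \<omega> = H u \<omega>"
      using ito_sum_integrand_eq[of n s H] n N s by auto
    obtain v where v: "0 \<le> v" "v \<le> T" "v \<le> s" "s - v \<le> T / real n'" "\<And>\<omega>. ito_sum_integrand H n' s \<omega> = H v \<omega>"
      using ito_sum_integrand_eq[of n' s H] n N s by auto
    have "\<bar>u - v\<bar> < d" using u v le[OF n(1)] le[OF n(2)] by linarith
    then show "expectation (\<lambda>\<omega>. (ito_sum_integrand H n s \<omega> - ito_sum_integrand H n' s \<omega>)\<^sup>2) \<le> e"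
      using d(2) u v by auto
  qed (use N in auto)
qed

lemma exceed_measurable:
  assumes "\<And>t. 0 \<le> t \<Longrightarrow> t \<le> T \<Longrightarrow> V t \<in> borel_measurable M"
  shows "{\<omega>\<in>space M. \<exists>t\<in>dyadics. \<bar>V t \<omega>\<bar> > (l::real)} \<in> sets M"
proof -
  have "{\<omega>\<in>space M. \<exists>t\<in>dyadics. \<bar>V t \<omega>\<bar> > l} = (\<Union>t\<in>dyadics. {\<omega>\<in>space M. \<bar>V t \<omega>\<bar> > l})" by auto
  also have "\<dots> \<in> sets M"
  proof (rule sets.countable_UN''[OF countable_dyadics])
    fix t assume "t \<in> dyadics"
    then have [measurable]: "V t \<in> borel_measurable M" using assms dyadics_subset by auto
    show "{\<omega>\<in>space M. \<bar>V t \<omega>\<bar> > l} \<in> sets M" by measurable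
  qed
  finally show ?thesis .
qed

text \<open>The bound of \<open>elementary_maximal\<close> does not depend on the number of grid
  points, so it survives the increasing union over the dyadic levels.\<close>

lemma elementary_maximal_dyadics:
  assumes el: "elementary X Z" and l: "0 < l"
    and e: "\<And>s. s \<in> {0<..T} \<Longrightarrow> expectation (\<lambda>\<omega>. (X s \<omega>)\<^sup>2) \<le> e" "0 \<le> e"
  shows "prob {\<omega>\<in>space M. \<exists>t\<in>dyadics. \<bar>Z t \<omega>\<bar> > l} \<le> e * T / l\<^sup>2"
proof -
  define A where "A = (\<lambda>m::nat. {\<omega>\<in>space M. \<exists>k\<le>2 ^ m. \<bar>Z (T * real k / 2 ^ m) \<omega>\<bar> > l})"
  have mZ: "Z t \<in> borel_measurable M" if "0 \<le> t" "t \<le> T" for t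
    using elementary_square_integrable(1)[OF el that] .
  have in_dyadics: "T * real k / 2 ^ m \<in> dyadics" if "k \<le> 2 ^ m" for k m :: nat
    using that unfolding dyadics_def by blast
  have "A m \<in> sets M" for m
  proof -
    have "A m = (\<Union>k\<in>{..2 ^ m}. {\<omega>\<in>space M. \<bar>Z (T * real k / 2 ^ m) \<omega>\<bar> > l})" unfolding A_def by auto
    also have "\<dots> \<in> sets M"
    proof (rule sets.finite_UN)
      fix k :: nat assume "k \<in> {..2 ^ m}"
      then have [measurable]: "Z (T * real k / 2 ^ m) \<in> borel_measurable M"
        using mZ dyadics_subset[OF in_dyadics] by auto
      show "{\<omega>\<in>space M. \<bar>Z (T * real k / 2 ^ m) \<omega>\<bar> > l} \<in> sets M" by measurable
    qed simp
    finally show ?thesis .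
  qed
  then have "range A \<subseteq> sets M" by auto
  moreover have "incseq A"
  proof (rule incseq_SucI, rule subsetI)
    fix m \<omega> assume "\<omega> \<in> A m"
    then obtain k where k: "\<omega> \<in> space M" "k \<le> 2 ^ m" "\<bar>Z (T * real k / 2 ^ m) \<omega>\<bar> > l" unfolding A_def by auto
    have "T * real (2 * k) / 2 ^ Suc m = T * real k / 2 ^ m" by simp
    then show "\<omega> \<in> A (Suc m)" unfolding A_def using k by (auto intro!: exI[of _ "2 * k"])
  qed
  ultimately have lim: "(\<lambda>m. prob (A m)) \<longlonglongrightarrow> prob (\<Union>m. A m)" by (rule finite_Lim_measure_incseq)
  have "prob (A m) \<le> e * T / l\<^sup>2" for m
  proof -
    have "prob {\<omega>\<in>space M. \<exists>k\<le>2 ^ m. \<bar>Z (T * real k / 2 ^ m) \<omega>\<bar> > l} \<le> e * T / l\<^sup>2"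
      by (rule elementary_maximal[OF el, where \<tau>="\<lambda>k. T * real k / 2 ^ m"])
        (use l e T_pos in \<open>auto simp: divide_right_mono\<close>)
    then show ?thesis unfolding A_def .
  qed
  then have "prob (\<Union>m. A m) \<le> e * T / l\<^sup>2" by (intro LIMSEQ_le_const2[OF lim]) auto
  moreover have "(\<Union>m. A m) = {\<omega>\<in>space M. \<exists>t\<in>dyadics. \<bar>Z t \<omega>\<bar> > l}"
    unfolding A_def dyadics_def by auto
  ultimately show ?thesis by simp
qed

lemma ito_sum_Cauchy_bounded:
  assumes H: "cont_adapted H" "\<And>t \<omega>. 0 \<le> t \<Longrightarrow> t \<le> T \<Longrightarrow> \<omega> \<in> space M \<Longrightarrow> \<bar>H t \<omega>\<bar> \<le> K" and "0 < e" "0 < l"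
  shows "\<exists>N. \<forall>n\<ge>N. \<forall>n'\<ge>N. prob {\<omega>\<in>space M. \<exists>t\<in>dyadics. \<bar>ito_sum H n t \<omega> - ito_sum H n' t \<omega>\<bar> > l} \<le> e"
proof -
  \<comment> \<open>With this mean-square error the maximal inequality returns exactly e.\<close>
  have e': "0 < e * l\<^sup>2 / T" using assms T_pos by auto
  obtain N where N: "\<forall>n\<ge>N. \<forall>n'\<ge>N. \<forall>s\<in>{0<..T}. expectation (\<lambda>\<omega>. (ito_sum_integrand H n s \<omega> - ito_sum_integrand H n' s \<omega>)\<^sup>2) \<le> e * l\<^sup>2 / T"
    using ito_sum_integrand_close[OF H e'] by auto
  show ?thesis
  proof (intro exI[of _ N] allI impI)
    fix n n' assume n: "N \<le> n" "N \<le> n'"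
    have "prob {\<omega>\<in>space M. \<exists>t\<in>dyadics. \<bar>ito_sum H n t \<omega> - ito_sum H n' t \<omega>\<bar> > l} \<le> (e * l\<^sup>2 / T) * T / l\<^sup>2"
      by (rule elementary_maximal_dyadics[OF elementary_diff[OF elementary_ito_sum[OF H] elementary_ito_sum[OF H]]]) (use assms e' N n in auto)
    then show "prob {\<omega>\<in>space M. \<exists>t\<in>dyadics. \<bar>ito_sum H n t \<omega> - ito_sum H n' t \<omega>\<bar> > l} \<le> e"
      using T_pos \<open>0 < l\<close> by simp
  qed
qed

text \<open>Every path is continuous on a compact interval and thus bounded, so the events of
  exceeding K decrease to the empty set.\<close>

lemma cont_adapted_tail:
  assumes H: "cont_adapted H" "0 < e"
  shows "\<exists>K>0. prob {\<omega>\<in>space M. \<exists>t\<in>dyadics. \<bar>H t \<omega>\<bar> > K} < e"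
proof -
  define A where "A = (\<lambda>K::nat. {\<omega>\<in>space M. \<exists>t\<in>dyadics. \<bar>H t \<omega>\<bar> > real K})"
  have "range A \<subseteq> sets M" unfolding A_def by (intro image_subsetI exceed_measurable cont_adapted_measurable[OF H(1)])
  moreover have "decseq A" unfolding A_def by (intro decseq_SucI) force
  ultimately have "(\<lambda>K. prob (A K)) \<longlonglongrightarrow> prob (\<Inter>K. A K)" by (rule finite_Lim_measure_decseq)
  moreover have "(\<Inter>K. A K) = {}"
  proof (intro equals0I)
    fix \<omega> assume \<omega>: "\<omega> \<in> (\<Inter>K. A K)"
    then have sp: "\<omega> \<in> space M" unfolding A_def by auto
    have "bounded ((\<lambda>t. H t \<omega>) ` {0..T})"
      by (intro compact_imp_bounded compact_continuous_image cont_adapted_cont[OF H(1) sp] compact_Icc)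
    then obtain B where B: "\<forall>x\<in>(\<lambda>t. H t \<omega>) ` {0..T}. norm x \<le> B" unfolding bounded_iff by blast
    obtain K :: nat where K: "B < real K" using reals_Archimedean2 by blast
    from \<omega> have "\<omega> \<in> A K" by auto
    then obtain t where "t \<in> dyadics" "\<bar>H t \<omega>\<bar> > real K" unfolding A_def by auto
    moreover from this have "\<bar>H t \<omega>\<bar> \<le> B" using B dyadics_subset[of t] by auto
    ultimately show False using K by linarith
  qed
  ultimately have "(\<lambda>K. prob (A K)) \<longlonglongrightarrow> 0" by simp
  then have "eventually (\<lambda>K. prob (A K) < e) sequentially" using H(2) by (rule order_tendstoD)
  then obtain K0 where "\<forall>K\<ge>K0. prob (A K) < e" unfolding eventually_sequentially by auto
  then have "prob (A (Suc K0)) < e" by auto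
  then show ?thesis unfolding A_def by (intro exI[of _ "real (Suc K0)"]) auto
qed

section \<open>Removing boundedness by truncation, and the integral process\<close>

definition truncate_at :: "real \<Rightarrow> real \<Rightarrow> real" where "truncate_at K x = max (- K) (min K x)"

lemma truncate_at_cont: "continuous_on UNIV (truncate_at K)"
  unfolding truncate_at_def by (intro continuous_intros)

lemma truncate_at_abs: "0 \<le> K \<Longrightarrow> \<bar>truncate_at K x\<bar> \<le> K"
  unfolding truncate_at_def by auto

lemma truncate_at_id: "\<bar>x\<bar> \<le> K \<Longrightarrow> truncate_at K x = x"
  unfolding truncate_at_def by auto

lemma cont_adapted_truncate_at: "cont_adapted H \<Longrightarrow> cont_adapted (\<lambda>t \<omega>. truncate_at K (H t \<omega>))"
  by (rule cont_adapted_compose[OF _ truncate_at_cont])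

lemma not_exceed:
  assumes "cont_adapted H" "\<omega> \<in> space M" "\<not> (\<exists>t\<in>dyadics. \<bar>H t \<omega>\<bar> > K)" "0 \<le> t" "t \<le> T"
  shows "\<bar>H t \<omega>\<bar> \<le> K"
  by (rule dyadics_bound[where h="\<lambda>t. \<bar>H t \<omega>\<bar>"]) (use assms in \<open>auto intro!: continuous_intros cont_adapted_cont simp: not_less\<close>)

text \<open>Off the event that |H| exceeds K, the sums for H and for its truncation coincide. One
  half of e pays for that event, the other half for the bounded case.\<close>

lemma ito_sum_Cauchy:
  assumes H: "cont_adapted H" and "0 < e" "0 < l"
  shows "\<exists>N. \<forall>n\<ge>N. \<forall>n'\<ge>N. prob {\<omega>\<in>space M. \<exists>t\<in>dyadics. \<bar>ito_sum H n t \<omega> - ito_sum H n' t \<omega>\<bar> > l} \<le> e"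
proof -
  obtain K where K: "K > 0" "prob {\<omega>\<in>space M. \<exists>t\<in>dyadics. \<bar>H t \<omega>\<bar> > K} < e / 2" using cont_adapted_tail[OF H, of "e / 2"] assms by auto
  define H' where "H' = (\<lambda>t \<omega>. truncate_at K (H t \<omega>))"
  have H': "cont_adapted H'" unfolding H'_def by (rule cont_adapted_truncate_at[OF H])
  have H'K: "\<bar>H' t \<omega>\<bar> \<le> K" for t \<omega> unfolding H'_def using K by (intro truncate_at_abs) auto
  obtain N where N: "\<forall>n\<ge>N. \<forall>n'\<ge>N. prob {\<omega>\<in>space M. \<exists>t\<in>dyadics. \<bar>ito_sum H' n t \<omega> - ito_sum H' n' t \<omega>\<bar> > l} \<le> e / 2"
    using ito_sum_Cauchy_bounded[OF H' H'K, of "e / 2" l] assms by auto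
  show ?thesis
  proof (intro exI[of _ N] allI impI)
    fix n n' assume n: "N \<le> n" "N \<le> n'"
    let ?A = "{\<omega>\<in>space M. \<exists>t\<in>dyadics. \<bar>ito_sum H n t \<omega> - ito_sum H n' t \<omega>\<bar> > l}"
    let ?B = "{\<omega>\<in>space M. \<exists>t\<in>dyadics. \<bar>H t \<omega>\<bar> > K}"
    let ?C = "{\<omega>\<in>space M. \<exists>t\<in>dyadics. \<bar>ito_sum H' n t \<omega> - ito_sum H' n' t \<omega>\<bar> > l}"
    have mB: "?B \<in> sets M" by (rule exceed_measurable[OF cont_adapted_measurable[OF H]])
    have mC: "?C \<in> sets M" by (rule exceed_measurable) (auto intro!: borel_measurable_diff ito_sum_measurable H')
    have "?A \<subseteq> ?B \<union> ?C"
    proof (rule subsetI, rule ccontr)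
      fix \<omega> assume \<omega>: "\<omega> \<in> ?A" "\<omega> \<notin> ?B \<union> ?C"
      then have "\<bar>H t \<omega>\<bar> \<le> K" if "0 \<le> t" "t \<le> T" for t using not_exceed[OF H _ _ that] by auto
      then have "H t \<omega> = H' t \<omega>" if "0 \<le> t" "t \<le> T" for t unfolding H'_def using that by (simp add: truncate_at_id)
      then have "ito_sum H m t \<omega> = ito_sum H' m t \<omega>" for m t by (rule ito_sum_cong)
      then show False using \<omega> by auto
    qed
    then have "prob ?A \<le> prob (?B \<union> ?C)" using mB mC by (intro finite_measure_mono) auto
    also have "\<dots> \<le> prob ?B + prob ?C" using mB mC by (rule measure_Un_le)
    also have "\<dots> \<le> e / 2 + e / 2" using K(2) N n by (intro add_mono) auto
    finally show "prob ?A \<le> e" by simp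
  qed
qed

text \<open>A continuous version of the stochastic integral, valid for all times at once. An almost
  sure limit is available only along some subsequence, which is left existential;
  \<open>ito_sum_L2\<close> and \<open>ito_is_ito_integral\<close> recover statements about full
  sequences.\<close>

definition ito :: "(real \<Rightarrow> 'a \<Rightarrow> real) \<Rightarrow> (real \<Rightarrow> 'a \<Rightarrow> real) \<Rightarrow> bool" where
  "ito H J \<longleftrightarrow> cont_adapted J \<and> (\<forall>\<omega>\<in>space M. J 0 \<omega> = 0) \<and>
    (\<exists>r. strict_mono r \<and> (AE \<omega> in M. \<forall>t\<in>{0..T}. (\<lambda>i. ito_sum H (r i) t \<omega>) \<longlonglongrightarrow> J t \<omega>))"

lemma ito_sum_0: "ito_sum H n 0 \<omega> = 0"
  unfolding ito_sum_def using unif_pt_bounds by (intro sum.neutral) (auto simp: min_absorb2)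

text \<open>A subsequence is chosen whose consecutive members differ by more than 2^-i with
  probability at most 2^-i. By Borel-Cantelli, almost every path eventually obeys these bounds, and
  the Weierstrass test turns this into uniform convergence, so the limit is continuous.\<close>

theorem ito_exists:
  assumes H: "cont_adapted H"
  shows "\<exists>J. ito H J"
proof -
  have "\<forall>i::nat. \<exists>N. \<forall>n\<ge>N. \<forall>n'\<ge>N. prob {\<omega>\<in>space M. \<exists>t\<in>dyadics. \<bar>ito_sum H n t \<omega> - ito_sum H n' t \<omega>\<bar> > (1 / 2) ^ i} \<le> (1 / 2) ^ i"
    by (intro allI ito_sum_Cauchy[OF H]) auto
  from choice[OF this] obtain N where N': "\<forall>i. \<forall>n\<ge>N i. \<forall>n'\<ge>N i.
    prob {\<omega>\<in>space M. \<exists>t\<in>dyadics. \<bar>ito_sum H n t \<omega> - ito_sum H n' t \<omega>\<bar> > (1 / 2) ^ i} \<le> (1 / 2) ^ i" ..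
  have N: "prob {\<omega>\<in>space M. \<exists>t\<in>dyadics. \<bar>ito_sum H n t \<omega> - ito_sum H n' t \<omega>\<bar> > (1 / 2) ^ i} \<le> (1 / 2) ^ i"
    if "n \<ge> N i" "n' \<ge> N i" for i n n'
    using N' that by blast
  define r where "r = rec_nat (N 0) (\<lambda>i ri. max (N (Suc i)) (Suc ri))"
  have r: "r 0 = N 0" "r (Suc i) = max (N (Suc i)) (Suc (r i))" for i unfolding r_def by auto
  have mono: "strict_mono r" by (rule strict_monoI_Suc) (simp add: r)
  have rN: "N i \<le> r i" for i by (cases i) (auto simp: r)
  define A where "A = (\<lambda>i. {\<omega>\<in>space M. \<exists>t\<in>dyadics. \<bar>ito_sum H (r (Suc i)) t \<omega> - ito_sum H (r i) t \<omega>\<bar> > (1 / 2) ^ i})"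
  have mA: "A i \<in> sets M" for i unfolding A_def
    by (rule exceed_measurable) (auto intro!: borel_measurable_diff ito_sum_measurable H)
  have pA: "prob (A i) \<le> (1 / 2) ^ i" for i
  proof -
    have "N i \<le> r (Suc i)" using rN[of i] by (simp add: r)
    then show ?thesis unfolding A_def by (rule N[OF _ rN])
  qed
  have "summable (\<lambda>i. prob (A i))"
    by (rule summable_comparison_test'[of "\<lambda>i. (1 / 2) ^ i" 0]) (auto simp: pA)
  then have ev: "AE \<omega> in M. eventually (\<lambda>i. \<omega> \<in> space M - A i) sequentially"
    by (intro borel_cantelli_AE1 mA) (auto simp: less_top[symmetric])
  define good where "good = (\<lambda>\<omega>. continuous_on {0..T} (\<lambda>t. W t \<omega>) \<and>
    (\<exists>j. uniform_limit {0..T} (\<lambda>i t. ito_sum H (r i) t \<omega>) j sequentially))"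
  have "AE \<omega> in M. good \<omega>"
    using AE_W_cont ev
  proof eventually_elim
    case (elim \<omega>)
    define f where "f = (\<lambda>i t. ito_sum H (r (Suc i)) t \<omega> - ito_sum H (r i) t \<omega>)"
    have "\<forall>\<^sub>F i in sequentially. \<forall>t\<in>{0..T}. norm (f i t) \<le> (1 / 2) ^ i"
      using elim(2)
    proof eventually_elim
      case (elim i)
      show ?case
      proof
        fix t assume t: "t \<in> {0..T}"
        show "norm (f i t) \<le> (1 / 2) ^ i" unfolding real_norm_def
        proof (rule dyadics_bound[where h="\<lambda>t. \<bar>f i t\<bar>"])
          show "continuous_on {0..T} (\<lambda>t. \<bar>f i t\<bar>)" unfolding f_def
            using ito_sum_cont[OF \<open>continuous_on {0..T} (\<lambda>t. W t \<omega>)\<close>] by (intro continuous_intros)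
          show "\<bar>f i t\<bar> \<le> (1 / 2) ^ i" if "t \<in> dyadics" for t
            using elim that unfolding A_def f_def by force
        qed (use t in auto)
      qed
    qed
    moreover have "summable (\<lambda>i. (1 / 2 :: real) ^ i)" by (simp add: summable_geometric)
    ultimately have "uniform_limit {0..T} (\<lambda>n t. \<Sum>i<n. f i t) (\<lambda>t. suminf (\<lambda>i. f i t)) sequentially"
      by (rule Weierstrass_m_test_ev)
    then have "uniform_limit {0..T} (\<lambda>n t. ito_sum H (r 0) t \<omega> + (\<Sum>i<n. f i t)) (\<lambda>t. ito_sum H (r 0) t \<omega> + suminf (\<lambda>i. f i t)) sequentially"
      by (intro uniform_limit_intros)
    moreover have "ito_sum H (r 0) t \<omega> + (\<Sum>i<n. f i t) = ito_sum H (r n) t \<omega>" for n t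
      unfolding f_def by (subst sum_lessThan_telescope) simp
    ultimately show ?case unfolding good_def using elim(1) by auto
  qed
  note AEgood = this
  \<comment> \<open>Resetting the limit to 0 off \<open>good\<close> makes every path continuous.
    The event \<open>good\<close> has probability 1 and therefore belongs to \<open>F 0\<close> by
    \<open>AE_in_F0\<close>, so J stays adapted.\<close>
  define J where "J = (\<lambda>t \<omega>. if good \<omega> then lim (\<lambda>i. ito_sum H (r i) t \<omega>) else 0)"
  have ul: "uniform_limit {0..T} (\<lambda>i t. ito_sum H (r i) t \<omega>) (\<lambda>t. J t \<omega>) sequentially" if g: "good \<omega>" for \<omega>
  proof -
    obtain j where j: "uniform_limit {0..T} (\<lambda>i t. ito_sum H (r i) t \<omega>) j sequentially" using g unfolding good_def by auto
    have "(\<lambda>i. ito_sum H (r i) t \<omega>) \<longlonglongrightarrow> j t" if "t \<in> {0..T}" for t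
      using tendsto_uniform_limitI[OF j that] .
    then have "J t \<omega> = j t" if "t \<in> {0..T}" for t unfolding J_def using g that by (simp add: limI)
    then show ?thesis using j by (subst uniform_limit_cong'[where g="\<lambda>i t. ito_sum H (r i) t \<omega>" and i=j]) auto
  qed
  have conv: "(\<lambda>i. ito_sum H (r i) t \<omega>) \<longlonglongrightarrow> J t \<omega>" if "good \<omega>" "t \<in> {0..T}" for t \<omega>
    using tendsto_uniform_limitI[OF ul[OF that(1)] that(2)] .
  have "cont_adapted J"
  proof (rule cadI)
    fix \<omega> assume "\<omega> \<in> space M"
    show "continuous_on {0..T} (\<lambda>t. J t \<omega>)"
    proof (cases "good \<omega>")
      case True
      show ?thesis
        by (rule uniform_limit_theorem[OF _ ul[OF True]]) (use True ito_sum_cont in \<open>auto simp: good_def\<close>)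
    next
      case False then show ?thesis unfolding J_def by simp
    qed
  next
    fix t assume t: "0 \<le> t" "t \<le> T"
    have "{\<omega>\<in>space M. good \<omega>} \<in> F t" using AE_in_F0[OF AEgood] F_mono[of 0 t] t by auto
    then have good_meas: "{\<omega>\<in>space (Ft t). good \<omega>} \<in> sets (Ft t)" using sets_Ft[of t] t by auto
    show "J t \<in> borel_measurable (Ft t)"
    proof (rule borel_measurable_LIMSEQ_real)
      fix i
      have [measurable]: "ito_sum H (r i) t \<in> borel_measurable (Ft t)" by (rule ito_sum_adapted[OF H t])
      show "(\<lambda>\<omega>. if good \<omega> then ito_sum H (r i) t \<omega> else 0) \<in> borel_measurable (Ft t)"
        by (rule measurable_If[OF _ _ good_meas]) auto
    next
      fix \<omega>
      show "(\<lambda>i. if good \<omega> then ito_sum H (r i) t \<omega> else 0) \<longlonglongrightarrow> J t \<omega>"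
        using conv[of \<omega> t] t by (cases "good \<omega>") (auto simp: J_def)
    qed
  qed
  moreover have "AE \<omega> in M. \<forall>t\<in>{0..T}. (\<lambda>i. ito_sum H (r i) t \<omega>) \<longlonglongrightarrow> J t \<omega>"
    using AEgood by eventually_elim (auto intro: conv)
  moreover have "J 0 \<omega> = 0" for \<omega> unfolding J_def by (simp add: ito_sum_0)
  ultimately show ?thesis unfolding ito_def using mono by blast
qed

end

section \<open>Convergence in probability of Riemann sums\<close>

context prob_space
begin

abbreviation conv_to_0 :: "(nat \<Rightarrow> 'a \<Rightarrow> real) \<Rightarrow> bool" where
  "conv_to_0 Y \<equiv> conv_in_prob M Y (\<lambda>_. 0)"

lemma conv_to_0_tendsto: "conv_to_0 Y \<longleftrightarrow> (\<forall>l>0. (\<lambda>n. prob {\<omega>\<in>space M. \<bar>Y n \<omega>\<bar> > l}) \<longlonglongrightarrow> 0)"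
  unfolding conv_in_prob_def by simp

lemma conv0I:
  assumes "\<And>l e. 0 < l \<Longrightarrow> 0 < e \<Longrightarrow> \<exists>N. \<forall>n\<ge>N. prob {\<omega>\<in>space M. \<bar>Y n \<omega>\<bar> > l} \<le> e"
  shows "conv_to_0 Y"
  unfolding conv_to_0_tendsto
proof (intro allI impI LIMSEQ_I)
  fix l e :: real assume "0 < l" "0 < e"
  then obtain N where N: "\<forall>n\<ge>N. prob {\<omega>\<in>space M. \<bar>Y n \<omega>\<bar> > l} \<le> e / 2" using assms[of l "e / 2"] by auto
  show "\<exists>N. \<forall>n\<ge>N. norm (prob {\<omega>\<in>space M. \<bar>Y n \<omega>\<bar> > l} - 0) < e"
    using N \<open>0 < e\<close> by (intro exI[of _ N]) fastforce
qed

lemma conv0D: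
  assumes "conv_to_0 Y" "0 < l" "0 < e"
  shows "\<exists>N. \<forall>n\<ge>N. prob {\<omega>\<in>space M. \<bar>Y n \<omega>\<bar> > l} < e"
  using order_tendstoD(2)[OF assms(1)[unfolded conv_to_0_tendsto, rule_format, OF assms(2)] assms(3)]
  unfolding eventually_sequentially .

lemma conv_to_0_subseq:
  assumes "conv_to_0 Y" "strict_mono r"
  shows "conv_to_0 (\<lambda>n. Y (r n))"
  unfolding conv_to_0_tendsto
proof (intro allI impI)
  fix l :: real assume "0 < l"
  with assms(1) have "(\<lambda>n. prob {\<omega>\<in>space M. \<bar>Y n \<omega>\<bar> > l}) \<longlonglongrightarrow> 0" unfolding conv_to_0_tendsto by simp
  from LIMSEQ_subseq_LIMSEQ[OF this assms(2)]
  show "(\<lambda>n. prob {\<omega>\<in>space M. \<bar>Y (r n) \<omega>\<bar> > l}) \<longlonglongrightarrow> 0" unfolding comp_def .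
qed

lemma conv_to_0_L1:
  assumes "\<And>e. 0 < e \<Longrightarrow> \<exists>N. \<forall>n\<ge>N. integrable M (Y n) \<and> expectation (\<lambda>\<omega>. \<bar>Y n \<omega>\<bar>) \<le> e"
  shows "conv_to_0 Y"
proof (rule conv0I)
  fix l e :: real assume le: "0 < l" "0 < e"
  then obtain N where N: "\<forall>n\<ge>N. integrable M (Y n) \<and> expectation (\<lambda>\<omega>. \<bar>Y n \<omega>\<bar>) \<le> l * e"
    using assms[of "l * e"] by auto
  show "\<exists>N. \<forall>n\<ge>N. prob {\<omega>\<in>space M. \<bar>Y n \<omega>\<bar> > l} \<le> e"
  proof (intro exI[of _ N] allI impI)
    fix n assume "N \<le> n"
    then have int: "integrable M (Y n)" and E: "expectation (\<lambda>\<omega>. \<bar>Y n \<omega>\<bar>) \<le> l * e" using N by auto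
    have [measurable]: "Y n \<in> borel_measurable M" using int by simp
    have "prob {\<omega>\<in>space M. \<bar>Y n \<omega>\<bar> > l} \<le> prob {\<omega>\<in>space M. \<bar>Y n \<omega>\<bar> \<ge> l}"
      by (intro finite_measure_mono) auto
    also have "\<dots> \<le> expectation (\<lambda>\<omega>. \<bar>Y n \<omega>\<bar>) / l"
      using int le by (intro integral_Markov_inequality_measure[where A="{}"]) auto
    also have "\<dots> \<le> e" using E le by (simp add: field_simps)
    finally show "prob {\<omega>\<in>space M. \<bar>Y n \<omega>\<bar> > l} \<le> e" .
  qed
qed

lemma conv_to_0_of_square:
  assumes "conv_to_0 (\<lambda>n \<omega>. (Y n \<omega>)\<^sup>2)"
  shows "conv_to_0 Y"
  unfolding conv_to_0_tendsto
proof (intro allI impI)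
  fix l :: real assume l: "0 < l"
  have "(\<bar>Y n \<omega>\<bar> > l) = (\<bar>(Y n \<omega>)\<^sup>2\<bar> > l\<^sup>2)" for n \<omega>
    using abs_le_square_iff[of "Y n \<omega>" l] l by auto
  then have "{\<omega>\<in>space M. \<bar>Y n \<omega>\<bar> > l} = {\<omega>\<in>space M. \<bar>(Y n \<omega>)\<^sup>2\<bar> > l\<^sup>2}" for n
    by simp
  moreover have "(\<lambda>n. prob {\<omega>\<in>space M. \<bar>(Y n \<omega>)\<^sup>2\<bar> > l\<^sup>2}) \<longlonglongrightarrow> 0"
    using assms l unfolding conv_to_0_tendsto by simp
  ultimately show "(\<lambda>n. prob {\<omega>\<in>space M. \<bar>Y n \<omega>\<bar> > l}) \<longlonglongrightarrow> 0" by simp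
qed

text \<open>Moment bounds come from the isometry, which holds for elementary integrals. Fatou's
  lemma carries them over to almost sure limits of such integrals; bounds from some index on are
  enough.\<close>

lemma fatou_expectation:
  fixes U :: "nat \<Rightarrow> 'a \<Rightarrow> real"
  assumes "\<And>j. integrable M (U j)" "\<And>j \<omega>. 0 \<le> U j \<omega>" "\<And>j. j \<ge> m \<Longrightarrow> expectation (U j) \<le> c"
    and "AE \<omega> in M. (\<lambda>j. U j \<omega>) \<longlonglongrightarrow> V \<omega>" "V \<in> borel_measurable M" "\<And>\<omega>. 0 \<le> V \<omega>"
  shows "integrable M V" "expectation V \<le> c"
proof -
  have "0 \<le> expectation (U m)" by (rule integral_nonneg_AE) (use assms(2) in auto)
  then have c0: "0 \<le> c" using assms(3)[of m] by simp
  have "(\<integral>\<^sup>+\<omega>. ennreal (V \<omega>) \<partial>M) = (\<integral>\<^sup>+\<omega>. liminf (\<lambda>j. ennreal (U j \<omega>)) \<partial>M)"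
  proof (rule nn_integral_cong_AE)
    show "AE \<omega> in M. ennreal (V \<omega>) = liminf (\<lambda>j. ennreal (U j \<omega>))"
      using assms(4)
    proof eventually_elim
      case (elim \<omega>)
      have "(\<lambda>j. ennreal (U j \<omega>)) \<longlonglongrightarrow> ennreal (V \<omega>)" using elim by (rule tendsto_ennrealI)
      then show ?case by (simp add: lim_imp_Liminf)
    qed
  qed
  also have "\<dots> \<le> liminf (\<lambda>j. \<integral>\<^sup>+\<omega>. ennreal (U j \<omega>) \<partial>M)"
    using assms(1) by (intro nn_integral_liminf) auto
  also have "\<dots> \<le> ennreal c"
  proof (rule Liminf_le)
    show "\<forall>\<^sub>F j in sequentially. (\<integral>\<^sup>+\<omega>. ennreal (U j \<omega>) \<partial>M) \<le> ennreal c"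
      unfolding eventually_sequentially
      using assms(1-3) by (intro exI[of _ m]) (auto simp: nn_integral_eq_integral intro!: ennreal_leI)
  qed simp
  finally have le: "(\<integral>\<^sup>+\<omega>. ennreal (V \<omega>) \<partial>M) \<le> ennreal c" .
  then show i: "integrable M V"
    using assms(5,6) by (intro integrableI_nonneg) (auto simp: le_less_trans[OF _ ennreal_less_top])
  have "ennreal (expectation V) \<le> ennreal c" using le nn_integral_eq_integral[OF i] assms(6) by auto
  then show "expectation V \<le> c" using c0 by (simp add: ennreal_le_iff)
qed

text \<open>This takes the place of stopping times. The exceptional event B is the same for all n,
  so its probability is paid once and the rest is convergence of the modified sequence Y'.\<close>

lemma conv_to_0_localise:
  assumes mY: "\<And>n. Y n \<in> borel_measurable M"
    and loc: "\<And>e. 0 < e \<Longrightarrow> \<exists>Y' B. (\<forall>n. Y' n \<in> borel_measurable M) \<and> conv_to_0 Y' \<and> B \<in> sets M \<and> prob B \<le> e \<and>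
      (AE \<omega> in M. \<omega> \<notin> B \<longrightarrow> (\<forall>n. Y n \<omega> = Y' n \<omega>))"
  shows "conv_to_0 Y"
proof (rule conv0I)
  fix l e :: real assume le: "0 < l" "0 < e"
  obtain Y' B where Y': "\<And>n. Y' n \<in> borel_measurable M" "conv_to_0 Y'" "B \<in> sets M" "prob B \<le> e / 2"
    "AE \<omega> in M. \<omega> \<notin> B \<longrightarrow> (\<forall>n. Y n \<omega> = Y' n \<omega>)" using loc[of "e / 2"] le by auto
  obtain N where N: "\<forall>n\<ge>N. prob {\<omega>\<in>space M. \<bar>Y' n \<omega>\<bar> > l} < e / 2" using conv0D[OF Y'(2), of l "e / 2"] le by auto
  show "\<exists>N. \<forall>n\<ge>N. prob {\<omega>\<in>space M. \<bar>Y n \<omega>\<bar> > l} \<le> e"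
  proof (intro exI[of _ N] allI impI)
    fix n assume n: "N \<le> n"
    note [measurable] = mY Y'(1) Y'(3)
    have "prob {\<omega>\<in>space M. \<bar>Y n \<omega>\<bar> > l} \<le> prob (B \<union> {\<omega>\<in>space M. \<bar>Y' n \<omega>\<bar> > l})"
    proof (rule finite_measure_mono_AE)
      show "AE \<omega> in M. \<omega> \<in> {\<omega>\<in>space M. \<bar>Y n \<omega>\<bar> > l} \<longrightarrow> \<omega> \<in> B \<union> {\<omega>\<in>space M. \<bar>Y' n \<omega>\<bar> > l}"
        using Y'(5) by eventually_elim auto
    qed measurable
    also have "\<dots> \<le> prob B + prob {\<omega>\<in>space M. \<bar>Y' n \<omega>\<bar> > l}" by (rule measure_Un_le) measurable
    also have "\<dots> \<le> e / 2 + e / 2" using Y'(4) N n by (intro add_mono) auto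
    finally show "prob {\<omega>\<in>space M. \<bar>Y n \<omega>\<bar> > l} \<le> e" by simp
  qed
qed

lemma conv_to_0_AE:
  assumes mY: "\<And>n. Y n \<in> borel_measurable M" and lim: "AE \<omega> in M. (\<lambda>n. Y n \<omega>) \<longlonglongrightarrow> 0"
  shows "conv_to_0 Y"
  unfolding conv_to_0_tendsto
proof (intro allI impI)
  fix l :: real assume l: "0 < l"
  note [measurable] = mY
  let ?A = "\<lambda>n. {\<omega>\<in>space M. \<bar>Y n \<omega>\<bar> > l}"
  have "(\<lambda>n. expectation (indicat_real (?A n))) \<longlonglongrightarrow> expectation (\<lambda>_. 0)"
  proof (rule integral_dominated_convergence[where w="\<lambda>_. 1"])
    show "AE \<omega> in M. (\<lambda>n. indicat_real (?A n) \<omega>) \<longlonglongrightarrow> 0"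
      using lim
    proof eventually_elim
      case (elim \<omega>)
      have "(\<lambda>n. \<bar>Y n \<omega>\<bar>) \<longlonglongrightarrow> 0" using elim by (rule tendsto_rabs_zero)
      then have "eventually (\<lambda>n. \<bar>Y n \<omega>\<bar> < l) sequentially" using l by (rule order_tendstoD)
      then have "eventually (\<lambda>n. indicat_real (?A n) \<omega> = 0) sequentially"
        by eventually_elim (auto simp: indicator_def)
      then show ?case by (rule tendsto_eventually)
    qed
  qed (auto simp: indicator_def)
  then show "(\<lambda>n. prob (?A n)) \<longlonglongrightarrow> 0" by simp
qed

text \<open>Finiteness of I gives a common index for all sequences at each accuracy 2^-n;
  Borel-Cantelli then applies to each of them along the same subsequence.\<close>

lemma conv_to_0_AE_subseq:
  assumes I: "finite I" and X: "\<And>i n. i \<in> I \<Longrightarrow> X i n \<in> borel_measurable M" "\<And>i. i \<in> I \<Longrightarrow> conv_to_0 (X i)"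
  shows "\<exists>s. strict_mono s \<and> (AE \<omega> in M. \<forall>i\<in>I. (\<lambda>n. X i (s n) \<omega>) \<longlonglongrightarrow> 0)"
proof -
  have "\<forall>n::nat. \<exists>N. \<forall>m\<ge>N. \<forall>i\<in>I. prob {\<omega>\<in>space M. \<bar>X i m \<omega>\<bar> > (1 / 2) ^ n} < (1 / 2) ^ n"
  proof
    fix n :: nat
    have "\<forall>i\<in>I. \<forall>\<^sub>F m in sequentially. prob {\<omega>\<in>space M. \<bar>X i m \<omega>\<bar> > (1 / 2) ^ n} < (1 / 2) ^ n"
      using conv0D[OF X(2), of _ "(1 / 2) ^ n" "(1 / 2) ^ n"] unfolding eventually_sequentially by auto
    then have "\<forall>\<^sub>F m in sequentially. \<forall>i\<in>I. prob {\<omega>\<in>space M. \<bar>X i m \<omega>\<bar> > (1 / 2) ^ n} < (1 / 2) ^ n"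
      by (rule eventually_ball_finite[OF I])
    then show "\<exists>N. \<forall>m\<ge>N. \<forall>i\<in>I. prob {\<omega>\<in>space M. \<bar>X i m \<omega>\<bar> > (1 / 2) ^ n} < (1 / 2) ^ n"
      unfolding eventually_sequentially .
  qed
  from choice[OF this] obtain N where N: "\<forall>n. \<forall>m\<ge>N n. \<forall>i\<in>I. prob {\<omega>\<in>space M. \<bar>X i m \<omega>\<bar> > (1 / 2) ^ n} < (1 / 2) ^ n" ..
  define s where "s = rec_nat (N 0) (\<lambda>i ri. max (N (Suc i)) (Suc ri))"
  have s: "s 0 = N 0" "s (Suc i) = max (N (Suc i)) (Suc (s i))" for i unfolding s_def by auto
  have mono: "strict_mono s" by (rule strict_monoI_Suc) (simp add: s)
  have sN: "N i \<le> s i" for i by (cases i) (auto simp: s)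
  have "AE \<omega> in M. (\<lambda>n. X i (s n) \<omega>) \<longlonglongrightarrow> 0" if i: "i \<in> I" for i
  proof -
    note [measurable] = X(1)[OF i]
    let ?A = "\<lambda>n. {\<omega>\<in>space M. \<bar>X i (s n) \<omega>\<bar> > (1 / 2) ^ n}"
    have pA: "prob (?A n) \<le> (1 / 2) ^ n" for n using N sN[of n] i by (intro less_imp_le) blast
    have "summable (\<lambda>n. prob (?A n))"
      by (rule summable_comparison_test'[of "\<lambda>i. (1 / 2) ^ i" 0]) (use pA in auto)
    then have "AE \<omega> in M. eventually (\<lambda>n. \<omega> \<in> space M - ?A n) sequentially"
      by (intro borel_cantelli_AE1) (auto simp: less_top[symmetric])
    then show ?thesis
    proof eventually_elim
      case (elim \<omega>)
      then have "eventually (\<lambda>n. norm (X i (s n) \<omega>) \<le> (1 / 2) ^ n) sequentially"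
        by eventually_elim (auto simp: not_less)
      moreover have "(\<lambda>n. (1 / 2 :: real) ^ n) \<longlonglongrightarrow> 0" by (intro LIMSEQ_realpow_zero) auto
      ultimately show ?case by (rule Lim_null_comparison)
    qed
  qed
  then have "AE \<omega> in M. \<forall>i\<in>I. (\<lambda>n. X i (s n) \<omega>) \<longlonglongrightarrow> 0" using I by (intro AE_finite_allI) auto
  with mono show ?thesis by blast
qed

text \<open>Passing to almost surely convergent subsequences turns statements about convergence in probability
  into pathwise ones.\<close>

theorem conv_to_0_combine:
  assumes I: "finite I" and X: "\<And>i n. i \<in> I \<Longrightarrow> X i n \<in> borel_measurable M" "\<And>i. i \<in> I \<Longrightarrow> conv_to_0 (X i)"
    and Y: "\<And>n. Y n \<in> borel_measurable M"
    and path: "AE \<omega> in M. \<forall>r. strict_mono r \<longrightarrow> (\<forall>i\<in>I. (\<lambda>n. X i (r n) \<omega>) \<longlonglongrightarrow> 0) \<longrightarrow> (\<lambda>n. Y (r n) \<omega>) \<longlonglongrightarrow> 0"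
  shows "conv_to_0 Y"
proof (rule ccontr)
  assume "\<not> conv_to_0 Y"
  then obtain l where l: "0 < l" "\<not> (\<lambda>n. prob {\<omega>\<in>space M. \<bar>Y n \<omega>\<bar> > l}) \<longlonglongrightarrow> 0" unfolding conv_to_0_tendsto by auto
  define a where "a = (\<lambda>n. prob {\<omega>\<in>space M. \<bar>Y n \<omega>\<bar> > l})"
  have "\<not> a \<longlonglongrightarrow> 0" using l(2) unfolding a_def .
  then obtain e where e: "0 < e" "\<forall>N. \<exists>n\<ge>N. a n \<ge> e"
    unfolding LIMSEQ_iff by (auto simp: a_def not_less)
  have inf: "infinite {n. a n \<ge> e}" unfolding infinite_nat_iff_unbounded_le using e(2) by auto
  \<comment> \<open>Along q the deviations of Y keep probability at least e. A further subsequence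
    makes all X i vanish almost surely, and the pathwise hypothesis then makes Y vanish along it,
    which is contradictory.\<close>
  define q where "q = enumerate {n. a n \<ge> e}"
  have q: "strict_mono q" "\<And>n. a (q n) \<ge> e"
    unfolding q_def using strict_mono_enumerate[OF inf] enumerate_in_set[OF inf] by auto
  have "conv_to_0 (\<lambda>n. X i (q n))" if "i \<in> I" for i
    by (rule conv_to_0_subseq[OF X(2)[OF that] q(1)])
  then obtain s where s: "strict_mono s" "AE \<omega> in M. \<forall>i\<in>I. (\<lambda>n. X i (q (s n)) \<omega>) \<longlonglongrightarrow> 0"
    using conv_to_0_AE_subseq[OF I, of "\<lambda>i n. X i (q n)"] X(1) by auto
  have qs: "strict_mono (\<lambda>n. q (s n))" using strict_mono_o[OF q(1) s(1)] by (simp add: comp_def)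
  have "AE \<omega> in M. (\<lambda>n. Y (q (s n)) \<omega>) \<longlonglongrightarrow> 0"
    using path s(2)
  proof eventually_elim
    case (elim \<omega>) show ?case by (rule elim(1)[rule_format, OF qs]) (use elim(2) in auto)
  qed
  then have "conv_to_0 (\<lambda>n. Y (q (s n)))" by (intro conv_to_0_AE Y)
  then have "\<exists>N. \<forall>n\<ge>N. a (q (s n)) < e" unfolding a_def by (rule conv0D[OF _ l(1) e(1)])
  then show False using q(2) by (meson linorder_not_less order_refl)
qed

lemma conv_in_prob_of_conv_to_0: "conv_to_0 (\<lambda>n \<omega>. R n \<omega> - X \<omega>) \<Longrightarrow> conv_in_prob M R X"
  and conv_to_0_of_conv_in_prob: "conv_in_prob M R X \<Longrightarrow> conv_to_0 (\<lambda>n \<omega>. R n \<omega> - X \<omega>)"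
  unfolding conv_in_prob_def by simp_all

text \<open>Both error sequences, indexed by a boolean, vanish almost surely along a common
  subsequence, and on P the approximants agree. P may be an arbitrary predicate, since the argument
  is pathwise.\<close>

lemma conv_in_prob_unique:
  assumes "conv_in_prob M R X" "conv_in_prob M R' X'" "AE \<omega> in M. P \<omega> \<longrightarrow> (\<forall>n. R n \<omega> = R' n \<omega>)"
    and m: "\<And>n. R n \<in> borel_measurable M" "\<And>n. R' n \<in> borel_measurable M" "X \<in> borel_measurable M" "X' \<in> borel_measurable M"
  shows "AE \<omega> in M. P \<omega> \<longrightarrow> X \<omega> = X' \<omega>"
proof -
  define V where "V = (\<lambda>b n \<omega>. if b then R n \<omega> - X \<omega> else R' n \<omega> - X' \<omega>)"
  have V: "V b n \<in> borel_measurable M" "conv_to_0 (V b)" for b n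
    unfolding V_def using assms(1,2)[THEN conv_to_0_of_conv_in_prob] m by (cases b; simp)+
  obtain s where s: "strict_mono s" "AE \<omega> in M. \<forall>b\<in>UNIV. (\<lambda>n. V b (s n) \<omega>) \<longlonglongrightarrow> 0"
    using conv_to_0_AE_subseq[of "UNIV :: bool set" V] V by auto
  from s(2) assms(3) show ?thesis
  proof eventually_elim
    case (elim \<omega>)
    show ?case
    proof
      assume P: "P \<omega>"
      have "(\<lambda>n. V False (s n) \<omega> - V True (s n) \<omega>) \<longlonglongrightarrow> 0 - 0" using elim(1) by (intro tendsto_diff) auto
      moreover have "V False (s n) \<omega> - V True (s n) \<omega> = X \<omega> - X' \<omega>" for n using elim(2) P by (auto simp: V_def)
      ultimately have "(\<lambda>n::nat. X \<omega> - X' \<omega>) \<longlonglongrightarrow> 0" by simp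
      then show "X \<omega> = X' \<omega>" using LIMSEQ_unique[OF tendsto_const, of "X \<omega> - X' \<omega>" 0] by simp
    qed
  qed
qed

end

section \<open>Mean-square convergence and locality of the integral\<close>

context brownian_motion
begin

lemma elementary_square_le_t:
  assumes el: "elementary X Z" and t: "0 \<le> t" "t \<le> T"
    and e: "\<And>s. s \<in> {0<..T} \<Longrightarrow> expectation (\<lambda>\<omega>. (X s \<omega>)\<^sup>2) \<le> e" "0 \<le> e"
  shows "expectation (\<lambda>\<omega>. (Z t \<omega>)\<^sup>2) \<le> e * T"
proof -
  have r: "elementary (\<lambda>u \<omega>. indicator {0<..t} u * 1 * X u \<omega>) (\<lambda>r \<omega>. 1 * (Z (min t r) \<omega> - Z (min 0 r) \<omega>))"
    by (rule elementary_restrict[OF el, of 0 t "\<lambda>_. 1" 1]) (use t in auto)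
  have "expectation (\<lambda>\<omega>. (1 * (Z (min t T) \<omega> - Z (min 0 T) \<omega>))\<^sup>2) \<le> e * (T - 0)"
  proof (rule elementary_square_le[OF r])
    fix s assume s: "s \<in> {0<..T}"
    show "expectation (\<lambda>\<omega>. (indicator {0<..t} s * 1 * X s \<omega>)\<^sup>2) \<le> e * indicator {0<..T} s"
      using e(1)[OF s] e(2) s by (cases "s \<in> {0<..t}") auto
  qed (use T_pos e in auto)
  then show ?thesis using t elementary_at_0[OF el] T_pos by (simp add: min_absorb1)
qed

text \<open>The sums are Cauchy in mean square. Letting the second index run along the subsequence
  that defines J, Fatou's lemma replaces the second sum by J. The result concerns the whole sequence
  of sums.\<close>

lemma ito_sum_L2:
  assumes H: "cont_adapted H" "\<And>t \<omega>. 0 \<le> t \<Longrightarrow> t \<le> T \<Longrightarrow> \<omega> \<in> space M \<Longrightarrow> \<bar>H t \<omega>\<bar> \<le> K" and J: "ito H J"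
    and t: "0 \<le> t" "t \<le> T" and e: "0 < e"
  shows "\<exists>N. \<forall>n\<ge>N. integrable M (\<lambda>\<omega>. (ito_sum H n t \<omega> - J t \<omega>)\<^sup>2) \<and> expectation (\<lambda>\<omega>. (ito_sum H n t \<omega> - J t \<omega>)\<^sup>2) \<le> e"
proof -
  have eT: "0 < e / T" using e T_pos by simp
  obtain N where N: "\<forall>n\<ge>N. \<forall>n'\<ge>N. \<forall>s\<in>{0<..T}. expectation (\<lambda>\<omega>. (ito_sum_integrand H n s \<omega> - ito_sum_integrand H n' s \<omega>)\<^sup>2) \<le> e / T"
    using ito_sum_integrand_close[OF H eT] by auto
  obtain r where r: "strict_mono r" "AE \<omega> in M. \<forall>t\<in>{0..T}. (\<lambda>i. ito_sum H (r i) t \<omega>) \<longlonglongrightarrow> J t \<omega>"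
    using J unfolding ito_def by auto
  have [measurable]: "J t \<in> borel_measurable M" using J t unfolding ito_def by (auto intro: cont_adapted_measurable)
  have [measurable]: "ito_sum H n t \<in> borel_measurable M" for n by (rule ito_sum_measurable[OF H(1) t])
  show ?thesis
  proof (intro exI[of _ N] allI impI)
    fix n assume n: "N \<le> n"
    have el: "elementary (\<lambda>s \<omega>. ito_sum_integrand H n s \<omega> - ito_sum_integrand H m s \<omega>) (\<lambda>t \<omega>. ito_sum H n t \<omega> - ito_sum H m t \<omega>)" for m
      by (rule elementary_diff[OF elementary_ito_sum[OF H] elementary_ito_sum[OF H]])
    have int: "integrable M (\<lambda>\<omega>. (ito_sum H n t \<omega> - ito_sum H (r j) t \<omega>)\<^sup>2)" for j
      by (rule elementary_square_integrable(2)[OF el t])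
    have "expectation (\<lambda>\<omega>. (ito_sum H n t \<omega> - ito_sum H (r j) t \<omega>)\<^sup>2) \<le> e" if j: "N \<le> j" for j
    proof -
      have "N \<le> r j" using j strict_mono_imp_increasing[OF r(1), of j] by simp
      then have "expectation (\<lambda>\<omega>. (ito_sum H n t \<omega> - ito_sum H (r j) t \<omega>)\<^sup>2) \<le> e / T * T"
        using N n eT by (intro elementary_square_le_t[OF el t]) auto
      then show ?thesis using T_pos by simp
    qed
    moreover have "AE \<omega> in M. (\<lambda>j. (ito_sum H n t \<omega> - ito_sum H (r j) t \<omega>)\<^sup>2) \<longlonglongrightarrow> (ito_sum H n t \<omega> - J t \<omega>)\<^sup>2"
      using r(2) by eventually_elim (use t in \<open>auto intro!: tendsto_intros\<close>)
    ultimately show "integrable M (\<lambda>\<omega>. (ito_sum H n t \<omega> - J t \<omega>)\<^sup>2) \<and> expectation (\<lambda>\<omega>. (ito_sum H n t \<omega> - J t \<omega>)\<^sup>2) \<le> e"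
      using fatou_expectation[where U="\<lambda>j \<omega>. (ito_sum H n t \<omega> - ito_sum H (r j) t \<omega>)\<^sup>2" and m=N and c=e and V="\<lambda>\<omega>. (ito_sum H n t \<omega> - J t \<omega>)\<^sup>2"] int by auto
  qed
qed

lemma ito_cont_adapted: "ito H J \<Longrightarrow> cont_adapted J"
  unfolding ito_def by auto

text \<open>J and J' may come from different subsequences. Since H' is bounded, its sums converge
  along the whole sequence, in particular along the subsequence of J, where the two families of sums
  agree on the event in question.\<close>

lemma ito_local:
  assumes H: "cont_adapted H" "ito H J" and H': "cont_adapted H'" "\<And>t \<omega>. 0 \<le> t \<Longrightarrow> t \<le> T \<Longrightarrow> \<omega> \<in> space M \<Longrightarrow> \<bar>H' t \<omega>\<bar> \<le> K" "ito H' J'"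
  shows "AE \<omega> in M. (\<forall>s\<in>{0..T}. H s \<omega> = H' s \<omega>) \<longrightarrow> (\<forall>t\<in>{0..T}. J t \<omega> = J' t \<omega>)"
proof (rule AE_all_from_dyadics)
  show "AE \<omega> in M. continuous_on {0..T} (\<lambda>t. J t \<omega>)" "AE \<omega> in M. continuous_on {0..T} (\<lambda>t. J' t \<omega>)"
    using cont_adapted_cont[OF ito_cont_adapted] H(2) H'(3) by auto
next
  fix t assume t: "0 \<le> t" "t \<le> T"
  obtain r where r: "strict_mono r" "AE \<omega> in M. \<forall>t\<in>{0..T}. (\<lambda>i. ito_sum H (r i) t \<omega>) \<longlonglongrightarrow> J t \<omega>"
    using H(2) unfolding ito_def by auto
  have m: "J t \<in> borel_measurable M" "J' t \<in> borel_measurable M"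
    using cont_adapted_measurable[OF ito_cont_adapted] H H' t by auto
  have mA: "ito_sum H n t \<in> borel_measurable M" "ito_sum H' n t \<in> borel_measurable M" for n
    using ito_sum_measurable t H(1) H'(1) by auto
  have "conv_to_0 (\<lambda>n \<omega>. (ito_sum H' n t \<omega> - J' t \<omega>)\<^sup>2)"
    using ito_sum_L2[OF H' t] by (intro conv_to_0_L1) auto
  then have c0: "conv_to_0 (\<lambda>n \<omega>. ito_sum H' n t \<omega> - J' t \<omega>)" by (rule conv_to_0_of_square)
  have c1: "conv_in_prob M (\<lambda>i. ito_sum H' (r i) t) (J' t)"
    by (rule conv_in_prob_of_conv_to_0[OF conv_to_0_subseq[OF c0 r(1)]])
  have c2: "conv_in_prob M (\<lambda>i. ito_sum H (r i) t) (J t)"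
  proof (rule conv_in_prob_of_conv_to_0, rule conv_to_0_AE)
    show "AE \<omega> in M. (\<lambda>i. ito_sum H (r i) t \<omega> - J t \<omega>) \<longlonglongrightarrow> 0"
      using r(2) by eventually_elim (use t in \<open>auto intro!: LIM_zero\<close>)
  qed (use m mA in auto)
  show "AE \<omega> in M. (\<forall>s\<in>{0..T}. H s \<omega> = H' s \<omega>) \<longrightarrow> J t \<omega> = J' t \<omega>"
    by (rule conv_in_prob_unique[OF c2 c1]) (use m mA ito_sum_cong[of H _ H'] in auto)
qed

section \<open>Cell errors on the grids of the statement\<close>

definition grid :: "real \<Rightarrow> nat \<Rightarrow> nat \<Rightarrow> real" where "grid t n k = real k * t / real n"

abbreviation incr :: "real \<Rightarrow> nat \<Rightarrow> nat \<Rightarrow> 'a \<Rightarrow> real" where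
  "incr t n k \<omega> \<equiv> W (grid t n (Suc k)) \<omega> - W (grid t n k) \<omega>"

text \<open>The error of freezing H at the left end of a cell, that is, the integral of H - H(t_k)
  over that cell. The grid depends on t and in general is no part of the grids behind J, so
  comparisons go through integrands rather than through grid points.\<close>

definition ito_remainder :: "(real \<Rightarrow> 'a \<Rightarrow> real) \<Rightarrow> (real \<Rightarrow> 'a \<Rightarrow> real) \<Rightarrow> real \<Rightarrow> nat \<Rightarrow> nat \<Rightarrow> 'a \<Rightarrow> real" where
  "ito_remainder H J t n k \<omega> = J (grid t n (Suc k)) \<omega> - J (grid t n k) \<omega> - H (grid t n k) \<omega> * (incr t n k \<omega>)"

lemma grid_bounds:
  assumes "0 \<le> t" "k \<le> n"
  shows "0 \<le> grid t n k" "grid t n k \<le> t"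
  using assms unfolding grid_def by (auto intro: divide_nonneg_nonneg) (cases "n = 0"; simp add: divide_le_eq mult.commute mult_left_mono)

lemma grid_Suc: "0 \<le> t \<Longrightarrow> grid t n k \<le> grid t n (Suc k)" "grid t n (Suc k) - grid t n k = t / real n"
  unfolding grid_def by (auto simp: divide_right_mono diff_divide_distrib[symmetric] algebra_simps)

lemma grid_ends: "grid t n 0 = 0" "0 < n \<Longrightarrow> grid t n n = t"
  unfolding grid_def by auto

lemma ito_remainder_measurable:
  assumes "cont_adapted H" "cont_adapted J" "0 \<le> t" "t \<le> T" "k < n"
  shows "ito_remainder H J t n k \<in> borel_measurable M"
proof -
  have b: "0 \<le> grid t n k" "grid t n k \<le> T" "0 \<le> grid t n (Suc k)" "grid t n (Suc k) \<le> T"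
    using grid_bounds[of t k n] grid_bounds[of t "Suc k" n] assms by auto
  note [measurable] = cont_adapted_measurable[OF assms(1) b(1,2)] cont_adapted_measurable[OF assms(2) b(1,2)]
    cont_adapted_measurable[OF assms(2) b(3,4)] W_measurable[OF b(1,2)] W_measurable[OF b(3,4)]
  have "ito_remainder H J t n k = (\<lambda>\<omega>. J (grid t n (Suc k)) \<omega> - J (grid t n k) \<omega> - H (grid t n k) \<omega> * (incr t n k \<omega>))"
    by (simp add: fun_eq_iff ito_remainder_def)
  then show ?thesis by simp
qed

lemma elementary_ito_remainder:
  assumes H: "cont_adapted H" "\<And>t \<omega>. 0 \<le> t \<Longrightarrow> t \<le> T \<Longrightarrow> \<omega> \<in> space M \<Longrightarrow> \<bar>H t \<omega>\<bar> \<le> K"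
    and ab: "0 \<le> a" "a \<le> b" "b \<le> T" and G: "G \<in> borel_measurable (Ft a)" "\<And>\<omega>. \<omega> \<in> space M \<Longrightarrow> \<bar>G \<omega>\<bar> \<le> K'"
  shows "elementary (\<lambda>s \<omega>. indicator {a<..b} s * (G \<omega> * (ito_sum_integrand H i s \<omega> - H a \<omega>)))
    (\<lambda>r \<omega>. G \<omega> * (ito_sum H i (min b r) \<omega> - ito_sum H i (min a r) \<omega> - H a \<omega> * (W (min b r) \<omega> - W (min a r) \<omega>)))"
proof -
  have 1: "elementary (\<lambda>s \<omega>. indicator {a<..b} s * G \<omega> * ito_sum_integrand H i s \<omega>) (\<lambda>r \<omega>. G \<omega> * (ito_sum H i (min b r) \<omega> - ito_sum H i (min a r) \<omega>))"
    by (rule elementary_restrict[OF elementary_ito_sum[OF H] ab G]) auto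
  have 2: "elementary (\<lambda>s \<omega>. indicator {a<..b} s * (G \<omega> * H a \<omega>)) (\<lambda>r \<omega>. (G \<omega> * H a \<omega>) * (W (min b r) \<omega> - W (min a r) \<omega>))"
  proof (rule elementary_base[where K="\<bar>K'\<bar> * \<bar>K\<bar>"])
    have "H a \<in> borel_measurable (Ft a)" using cont_adapted_Ft[OF H(1)] ab by auto
    then show "(\<lambda>\<omega>. G \<omega> * H a \<omega>) \<in> borel_measurable (Ft a)" using G(1) by simp
    show "\<bar>G \<omega> * H a \<omega>\<bar> \<le> \<bar>K'\<bar> * \<bar>K\<bar>" if "\<omega> \<in> space M" for \<omega>
      unfolding abs_mult using order_trans[OF G(2)[OF that] abs_ge_self] order_trans[OF H(2)[OF _ _ that, of a] abs_ge_self] ab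
      by (intro mult_mono) auto
  qed (use ab in auto)
  show ?thesis using elementary_diff[OF 1 2] by (simp add: algebra_simps)
qed

text \<open>Once both meshes are below d, the sample time of the step integrand and the left end of
  the cell lie within d below s, hence within d of each other.\<close>

lemma ito_sum_integrand_grid_close:
  assumes H: "cont_adapted H" "\<And>t \<omega>. 0 \<le> t \<Longrightarrow> t \<le> T \<Longrightarrow> \<omega> \<in> space M \<Longrightarrow> \<bar>H t \<omega>\<bar> \<le> K" and "0 < e" and t: "0 \<le> t" "t \<le> T"
  shows "\<exists>N>0. \<forall>n\<ge>N. \<forall>i\<ge>N. \<forall>k<n. \<forall>s\<in>{grid t n k<..grid t n (Suc k)}. expectation (\<lambda>\<omega>. (ito_sum_integrand H i s \<omega> - H (grid t n k) \<omega>)\<^sup>2) \<le> e"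
proof -
  obtain d where d: "d > 0" "\<forall>u\<in>{0..T}. \<forall>v\<in>{0..T}. \<bar>u - v\<bar> < d \<longrightarrow> expectation (\<lambda>\<omega>. (H u \<omega> - H v \<omega>)\<^sup>2) \<le> e"
    using mean_square_modulus[OF H \<open>0 < e\<close>] by auto
  obtain N :: nat where N: "N > 0" "T / real N < d"
    using reals_Archimedean2[of "T / d"] d(1) T_pos
    by (metis divide_pos_pos gr0I less_asym of_nat_0 pos_divide_less_eq mult.commute of_nat_0_less_iff)
  show ?thesis
  proof (intro exI[of _ N] conjI allI impI ballI)
    fix n i k s assume n: "N \<le> n" "N \<le> i" "k < n" and s: "s \<in> {grid t n k<..grid t n (Suc k)}"
    have le: "T / real m < d" if "N \<le> m" for m
      using N that T_pos by (intro le_less_trans[OF _ N(2)] divide_left_mono) auto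
    have b: "0 \<le> grid t n k" "grid t n k \<le> T" "grid t n (Suc k) \<le> T"
      using grid_bounds[of t k n] grid_bounds[of t "Suc k" n] n t by auto
    have sT: "s \<in> {0<..T}" using s b by auto
    obtain u where u: "0 \<le> u" "u \<le> T" "u \<le> s" "s - u \<le> T / real i" "\<And>\<omega>. ito_sum_integrand H i s \<omega> = H u \<omega>"
      using ito_sum_integrand_eq[of i s H] n N sT by auto
    have "s - grid t n k \<le> t / real n" using s grid_Suc(2)[of t n k] by auto
    also have "\<dots> \<le> T / real n" using t by (intro divide_right_mono) auto
    also have "\<dots> < d" by (rule le[OF n(1)])
    finally have "\<bar>u - grid t n k\<bar> < d" using u s le[OF n(2)] by auto
    then show "expectation (\<lambda>\<omega>. (ito_sum_integrand H i s \<omega> - H (grid t n k) \<omega>)\<^sup>2) \<le> e"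
      using d(2) u b by auto
  qed (use N in auto)
qed

lemma ito_remainder_limit:
  assumes "\<forall>t\<in>{0..T}. (\<lambda>i. ito_sum H (r i) t \<omega>) \<longlonglongrightarrow> J t \<omega>" "0 \<le> t" "t \<le> T" "k < n"
  shows "(\<lambda>i. ito_sum H (r i) (grid t n (Suc k)) \<omega> - ito_sum H (r i) (grid t n k) \<omega> - H (grid t n k) \<omega> * (incr t n k \<omega>))
    \<longlonglongrightarrow> ito_remainder H J t n k \<omega>"
  unfolding ito_remainder_def using grid_bounds[of t k n] grid_bounds[of t "Suc k" n] assms
  by (intro tendsto_diff tendsto_const assms(1)[rule_format]) auto

text \<open>By the isometry a cell of length t / n contributes at most e / T * (t / n), and the n
  cells together at most e. This is shown for the approximating sums and passes to J by Fatou's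
  lemma.\<close>

lemma ito_remainder_squares_bounded:
  assumes H: "cont_adapted H" "\<And>t \<omega>. 0 \<le> t \<Longrightarrow> t \<le> T \<Longrightarrow> \<omega> \<in> space M \<Longrightarrow> \<bar>H t \<omega>\<bar> \<le> K" and J: "ito H J" and t: "0 \<le> t" "t \<le> T"
  shows "conv_to_0 (\<lambda>n \<omega>. \<Sum>k<n. (ito_remainder H J t n k \<omega>)\<^sup>2)"
proof (rule conv_to_0_L1)
  fix e :: real assume e: "0 < e"
  have eT: "0 < e / T" using e T_pos by simp
  obtain r where r: "strict_mono r" "AE \<omega> in M. \<forall>t\<in>{0..T}. (\<lambda>i. ito_sum H (r i) t \<omega>) \<longlonglongrightarrow> J t \<omega>"
    using J unfolding ito_def by auto
  obtain N where N: "\<forall>n\<ge>N. \<forall>i\<ge>N. \<forall>k<n. \<forall>s\<in>{grid t n k<..grid t n (Suc k)}. expectation (\<lambda>\<omega>. (ito_sum_integrand H i s \<omega> - H (grid t n k) \<omega>)\<^sup>2) \<le> e / T"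
    using ito_sum_integrand_grid_close[OF H eT t] by auto
  show "\<exists>N. \<forall>n\<ge>N. integrable M (\<lambda>\<omega>. \<Sum>k<n. (ito_remainder H J t n k \<omega>)\<^sup>2) \<and> expectation (\<lambda>\<omega>. \<bar>\<Sum>k<n. (ito_remainder H J t n k \<omega>)\<^sup>2\<bar>) \<le> e"
  proof (intro exI[of _ N] allI impI)
    fix n assume n: "N \<le> n"
    define V where "V = (\<lambda>i k \<omega>. ito_sum H i (grid t n (Suc k)) \<omega> - ito_sum H i (grid t n k) \<omega> - H (grid t n k) \<omega> * (incr t n k \<omega>))"
    have b: "0 \<le> grid t n k" "grid t n k \<le> grid t n (Suc k)" "grid t n (Suc k) \<le> T" if "k < n" for k
      using grid_bounds[of t k n] grid_bounds[of t "Suc k" n] grid_Suc[of t n k] that t by auto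
    have el: "elementary (\<lambda>s \<omega>. indicator {grid t n k<..grid t n (Suc k)} s * (1 * (ito_sum_integrand H i s \<omega> - H (grid t n k) \<omega>)))
      (\<lambda>r \<omega>. 1 * (ito_sum H i (min (grid t n (Suc k)) r) \<omega> - ito_sum H i (min (grid t n k) r) \<omega> - H (grid t n k) \<omega> * (W (min (grid t n (Suc k)) r) \<omega> - W (min (grid t n k) r) \<omega>)))"
      if "k < n" for k i
      by (rule elementary_ito_remainder[OF H b[OF that], where K'=1]) auto
    have VT: "(\<lambda>\<omega>. 1 * (ito_sum H i (min (grid t n (Suc k)) T) \<omega> - ito_sum H i (min (grid t n k) T) \<omega> - H (grid t n k) \<omega> * (W (min (grid t n (Suc k)) T) \<omega> - W (min (grid t n k) T) \<omega>))) = V i k"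
      if "k < n" for i k using b[OF that] unfolding V_def by (simp add: min_absorb1)
    have T0: "0 \<le> T" using T_pos by simp
    have Vint: "integrable M (\<lambda>\<omega>. (V i k \<omega>)\<^sup>2)" if "k < n" for i k
      using elementary_square_integrable(2)[OF el[OF that] T0 order_refl, of i] unfolding VT[OF that, symmetric] .
    have VE: "expectation (\<lambda>\<omega>. (V i k \<omega>)\<^sup>2) \<le> e / T * (t / real n)" if "k < n" "N \<le> i" for i k
    proof -
      have "expectation (\<lambda>\<omega>. (V i k \<omega>)\<^sup>2) \<le> e / T * (grid t n (Suc k) - grid t n k)"
        unfolding VT[OF that(1), symmetric]
      proof (rule elementary_square_le[OF el[OF that(1)] b(2)[OF that(1)]])
        fix s
        show "expectation (\<lambda>\<omega>. (indicator {grid t n k<..grid t n (Suc k)} s * (1 * (ito_sum_integrand H i s \<omega> - H (grid t n k) \<omega>)))\<^sup>2)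
          \<le> e / T * indicator {grid t n k<..grid t n (Suc k)} s"
          using N n that by (cases "s \<in> {grid t n k<..grid t n (Suc k)}") auto
      qed (use eT in auto)
      then show ?thesis unfolding grid_Suc .
    qed
    let ?U = "\<lambda>j \<omega>. \<Sum>k<n. (V (r j) k \<omega>)\<^sup>2"
    have Uint: "integrable M (?U j)" for j using Vint by (intro Bochner_Integration.integrable_sum) auto
    have UE: "expectation (?U j) \<le> e" if "N \<le> j" for j
    proof -
      have "N \<le> r j" using that strict_mono_imp_increasing[OF r(1), of j] by simp
      then have "(\<Sum>k<n. expectation (\<lambda>\<omega>. (V (r j) k \<omega>)\<^sup>2)) \<le> (\<Sum>k<n. e / T * (t / real n))" by (intro sum_mono VE) auto
      also have "\<dots> \<le> e / T * t" using e T_pos t by (cases "n = 0") auto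
      also have "\<dots> \<le> e / T * T" using eT t by (intro mult_left_mono) auto
      also have "\<dots> = e" using T_pos by simp
      finally show ?thesis using Vint by (subst Bochner_Integration.integral_sum) auto
    qed
    have lim: "AE \<omega> in M. (\<lambda>j. ?U j \<omega>) \<longlonglongrightarrow> (\<Sum>k<n. (ito_remainder H J t n k \<omega>)\<^sup>2)"
      using r(2)
    proof eventually_elim
      case (elim \<omega>)
      show ?case unfolding V_def by (intro tendsto_sum tendsto_power ito_remainder_limit[where r=r and H=H and J=J, OF elim t]) auto
    qed
    have m: "(\<lambda>\<omega>. \<Sum>k<n. (ito_remainder H J t n k \<omega>)\<^sup>2) \<in> borel_measurable M"
      using ito_remainder_measurable[OF H(1) ito_cont_adapted[OF J] t] by auto
    have pos: "0 \<le> (\<Sum>k<n. (ito_remainder H J t n k \<omega>)\<^sup>2)" for \<omega> by (intro sum_nonneg) auto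
    note F = fatou_expectation[where U="?U" and m=N and c=e, OF Uint _ UE lim m pos]
    then show "integrable M (\<lambda>\<omega>. \<Sum>k<n. (ito_remainder H J t n k \<omega>)\<^sup>2) \<and> expectation (\<lambda>\<omega>. \<bar>\<Sum>k<n. (ito_remainder H J t n k \<omega>)\<^sup>2\<bar>) \<le> e"
      by (simp add: sum_nonneg)
  qed
qed

text \<open>Bounding each cell separately would be too coarse, as no square helps here. Instead the
  whole weighted sum is recognised as one elementary integral whose integrand is small in mean
  square at every time; the orthogonality of cells is then part of the isometry.\<close>

lemma weighted_ito_remainder_bounded:
  assumes H: "cont_adapted H" "\<And>t \<omega>. 0 \<le> t \<Longrightarrow> t \<le> T \<Longrightarrow> \<omega> \<in> space M \<Longrightarrow> \<bar>H t \<omega>\<bar> \<le> K" and J: "ito H J" and t: "0 \<le> t" "t \<le> T"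
    and G: "cont_adapted G" "\<And>t \<omega>. 0 \<le> t \<Longrightarrow> t \<le> T \<Longrightarrow> \<omega> \<in> space M \<Longrightarrow> \<bar>G t \<omega>\<bar> \<le> K'" and K': "0 < K'"
  shows "conv_to_0 (\<lambda>n \<omega>. \<Sum>k<n. G (grid t n k) \<omega> * ito_remainder H J t n k \<omega>)"
proof (rule conv_to_0_of_square, rule conv_to_0_L1)
  fix e :: real assume e: "0 < e"
  \<comment> \<open>Chosen so that \<open>K'\<^sup>2 * e' * T\<close> equals e.\<close>
  define e' where "e' = e / (T * K'\<^sup>2)"
  have e'0: "0 < e'" using e T_pos K' unfolding e'_def by simp
  obtain r where r: "strict_mono r" "AE \<omega> in M. \<forall>t\<in>{0..T}. (\<lambda>i. ito_sum H (r i) t \<omega>) \<longlonglongrightarrow> J t \<omega>"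
    using J unfolding ito_def by auto
  obtain N where N: "\<forall>n\<ge>N. \<forall>i\<ge>N. \<forall>k<n. \<forall>s\<in>{grid t n k<..grid t n (Suc k)}. expectation (\<lambda>\<omega>. (ito_sum_integrand H i s \<omega> - H (grid t n k) \<omega>)\<^sup>2) \<le> e'"
    using ito_sum_integrand_grid_close[OF H e'0 t] by auto
  show "\<exists>N. \<forall>n\<ge>N. integrable M (\<lambda>\<omega>. (\<Sum>k<n. G (grid t n k) \<omega> * ito_remainder H J t n k \<omega>)\<^sup>2) \<and>
    expectation (\<lambda>\<omega>. \<bar>(\<Sum>k<n. G (grid t n k) \<omega> * ito_remainder H J t n k \<omega>)\<^sup>2\<bar>) \<le> e"
  proof (intro exI[of _ N] allI impI)
    fix n assume n: "N \<le> n"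
    define V where "V = (\<lambda>i k \<omega>. ito_sum H i (grid t n (Suc k)) \<omega> - ito_sum H i (grid t n k) \<omega> - H (grid t n k) \<omega> * (incr t n k \<omega>))"
    have b: "0 \<le> grid t n k" "grid t n k \<le> grid t n (Suc k)" "grid t n (Suc k) \<le> T" if "k < n" for k
      using grid_bounds[of t k n] grid_bounds[of t "Suc k" n] grid_Suc[of t n k] that t by auto
    define X where "X = (\<lambda>i s \<omega>. \<Sum>k<n. indicator {grid t n k<..grid t n (Suc k)} s * (G (grid t n k) \<omega> * (ito_sum_integrand H i s \<omega> - H (grid t n k) \<omega>)))"
    define Z where "Z = (\<lambda>i r \<omega>. \<Sum>k<n. G (grid t n k) \<omega> * (ito_sum H i (min (grid t n (Suc k)) r) \<omega> - ito_sum H i (min (grid t n k) r) \<omega> - H (grid t n k) \<omega> * (W (min (grid t n (Suc k)) r) \<omega> - W (min (grid t n k) r) \<omega>)))"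
    have el: "elementary (X i) (Z i)" for i
      unfolding X_def Z_def
    proof (rule elementary_sum[OF finite_lessThan])
      fix k assume "k \<in> {..<n}"
      then have k: "k < n" by simp
      have G1: "G (grid t n k) \<in> borel_measurable (Ft (grid t n k))" using cont_adapted_Ft[OF G(1) b(1)[OF k] order_refl] b[OF k] by auto
      have G2: "\<bar>G (grid t n k) \<omega>\<bar> \<le> K'" if "\<omega> \<in> space M" for \<omega> using G(2)[OF _ _ that] b[OF k] by auto
      show "elementary (\<lambda>s \<omega>. indicator {grid t n k<..grid t n (Suc k)} s * (G (grid t n k) \<omega> * (ito_sum_integrand H i s \<omega> - H (grid t n k) \<omega>)))
        (\<lambda>r \<omega>. G (grid t n k) \<omega> * (ito_sum H i (min (grid t n (Suc k)) r) \<omega> - ito_sum H i (min (grid t n k) r) \<omega> - H (grid t n k) \<omega> * (W (min (grid t n (Suc k)) r) \<omega> - W (min (grid t n k) r) \<omega>)))"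
        by (rule elementary_ito_remainder[OF H b[OF k] G1 G2])
    qed
    have VT: "Z i T \<omega> = (\<Sum>k<n. G (grid t n k) \<omega> * V i k \<omega>)" for i \<omega>
      unfolding Z_def V_def
    proof (rule sum.cong[OF refl])
      fix k assume "k \<in> {..<n}"
      then have "min (grid t n (Suc k)) T = grid t n (Suc k)" "min (grid t n k) T = grid t n k" using b[of k] by auto
      then show "G (grid t n k) \<omega> * (ito_sum H i (min (grid t n (Suc k)) T) \<omega> - ito_sum H i (min (grid t n k) T) \<omega> - H (grid t n k) \<omega> * (W (min (grid t n (Suc k)) T) \<omega> - W (min (grid t n k) T) \<omega>)) =
        G (grid t n k) \<omega> * (ito_sum H i (grid t n (Suc k)) \<omega> - ito_sum H i (grid t n k) \<omega> - H (grid t n k) \<omega> * (incr t n k \<omega>))"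
        by simp
    qed
    have T0: "0 \<le> T" using T_pos by simp
    have XE: "expectation (\<lambda>\<omega>. (X i s \<omega>)\<^sup>2) \<le> K'\<^sup>2 * e'" if i: "N \<le> i" for i s
    proof -
      from partition_sum_cases[of n "grid t n" s] grid_Suc(1)[OF t(1)]
      consider (a) k where "k < n" "s \<in> {grid t n k<..grid t n (Suc k)}"
          "\<And>g. (\<Sum>j<n. indicator {grid t n j<..grid t n (Suc j)} s * g j) = (g k :: real)"
        | (z) "\<And>g. (\<Sum>j<n. indicator {grid t n j<..grid t n (Suc j)} s * g j) = (0 :: real)" by blast
      then show ?thesis
      proof cases
        case a
        have Xeq: "X i s \<omega> = G (grid t n k) \<omega> * (ito_sum_integrand H i s \<omega> - H (grid t n k) \<omega>)" for \<omega>
          unfolding X_def by (rule a(3))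
        have gk: "0 \<le> grid t n k" "grid t n k \<le> T" using b[OF a(1)] by auto
        have [measurable]: "ito_sum_integrand H i s \<in> borel_measurable M" "H (grid t n k) \<in> borel_measurable M"
          using elementary_measurable[OF elementary_ito_sum[OF H]] cont_adapted_measurable[OF H(1) gk] by auto
        have sT: "0 < i \<Longrightarrow> s \<in> {0<..T}" using a(2) b[OF a(1)] by auto
        have bd: "\<bar>(ito_sum_integrand H i s \<omega> - H (grid t n k) \<omega>)\<^sup>2\<bar> \<le> (2 * \<bar>K\<bar>)\<^sup>2" if \<omega>: "\<omega> \<in> space M" for \<omega>
        proof -
          have "\<bar>ito_sum_integrand H i s \<omega>\<bar> \<le> \<bar>K\<bar>"
          proof (cases "i = 0")
            case False
            then have i0: "0 < i" by simp
            obtain u where "0 \<le> u" "u \<le> T" "ito_sum_integrand H i s \<omega> = H u \<omega>" by (rule ito_sum_integrand_eq[OF i0 sT[OF i0], of H]) blast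
            then show ?thesis using order_trans[OF H(2)[OF _ _ \<omega>, of u] abs_ge_self] by simp
          qed (simp add: ito_sum_integrand_def)
          moreover have "\<bar>H (grid t n k) \<omega>\<bar> \<le> \<bar>K\<bar>" using order_trans[OF H(2)[OF gk \<omega>] abs_ge_self] .
          ultimately have "\<bar>ito_sum_integrand H i s \<omega> - H (grid t n k) \<omega>\<bar> \<le> 2 * \<bar>K\<bar>" by linarith
          then show ?thesis using power_mono[of "\<bar>ito_sum_integrand H i s \<omega> - H (grid t n k) \<omega>\<bar>" "2 * \<bar>K\<bar>" 2] by simp
        qed
        have int: "integrable M (\<lambda>\<omega>. (ito_sum_integrand H i s \<omega> - H (grid t n k) \<omega>)\<^sup>2)"
          by (rule bounded_integrable[OF _ bd]) auto
        have "expectation (\<lambda>\<omega>. (X i s \<omega>)\<^sup>2) \<le> expectation (\<lambda>\<omega>. K'\<^sup>2 * (ito_sum_integrand H i s \<omega> - H (grid t n k) \<omega>)\<^sup>2)"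
        proof (rule integral_mono)
          show "integrable M (\<lambda>\<omega>. (X i s \<omega>)\<^sup>2)"
            using elementary_integrand_mult_integrable[OF el el] by (simp add: power2_eq_square)
          fix \<omega> assume \<omega>: "\<omega> \<in> space M"
          have "(G (grid t n k) \<omega>)\<^sup>2 \<le> K'\<^sup>2" using power_mono[OF G(2)[OF gk \<omega>], of 2] by simp
          then show "(X i s \<omega>)\<^sup>2 \<le> K'\<^sup>2 * (ito_sum_integrand H i s \<omega> - H (grid t n k) \<omega>)\<^sup>2"
            unfolding Xeq power_mult_distrib by (intro mult_right_mono) auto
        qed (use int in auto)
        also have "\<dots> \<le> K'\<^sup>2 * e'"
          using N n i a(1,2) by (simp add: mult_left_mono)
        finally show ?thesis .
      next
        case z
        have "X i s \<omega> = 0" for \<omega> unfolding X_def by (rule z)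
        then show ?thesis using e'0 by simp
      qed
    qed
    let ?U = "\<lambda>j \<omega>. (Z (r j) T \<omega>)\<^sup>2"
    have Uint: "integrable M (?U j)" for j by (rule elementary_square_integrable(2)[OF el T0 order_refl])
    have UE: "expectation (?U j) \<le> e" if "N \<le> j" for j
    proof -
      have "N \<le> r j" using that strict_mono_imp_increasing[OF r(1), of j] by simp
      then have "expectation (?U j) \<le> (K'\<^sup>2 * e') * T"
        using e'0 by (intro elementary_square_le_t[OF el T0 order_refl] XE) auto
      then show ?thesis using T_pos K' by (simp add: e'_def)
    qed
    have lim: "AE \<omega> in M. (\<lambda>j. ?U j \<omega>) \<longlonglongrightarrow> (\<Sum>k<n. G (grid t n k) \<omega> * ito_remainder H J t n k \<omega>)\<^sup>2"
      using r(2)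
    proof eventually_elim
      case (elim \<omega>)
      show ?case unfolding VT V_def by (intro tendsto_sum tendsto_power tendsto_mult tendsto_const ito_remainder_limit[where r=r and H=H and J=J, OF elim t]) auto
    qed
    have m: "(\<lambda>\<omega>. (\<Sum>k<n. G (grid t n k) \<omega> * ito_remainder H J t n k \<omega>)\<^sup>2) \<in> borel_measurable M"
      using ito_remainder_measurable[OF H(1) ito_cont_adapted[OF J] t] cont_adapted_measurable[OF G(1)] b by (intro borel_measurable_power borel_measurable_sum borel_measurable_times) force+
    note F = fatou_expectation[where U="?U" and m=N and c=e, OF Uint _ UE lim m]
    then show "integrable M (\<lambda>\<omega>. (\<Sum>k<n. G (grid t n k) \<omega> * ito_remainder H J t n k \<omega>)\<^sup>2) \<and>
      expectation (\<lambda>\<omega>. \<bar>(\<Sum>k<n. G (grid t n k) \<omega> * ito_remainder H J t n k \<omega>)\<^sup>2\<bar>) \<le> e"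
      by simp
  qed
qed

lemma ito_remainder_truncate_at:
  assumes H: "cont_adapted H" "ito H J" and K: "0 < K" and t: "0 \<le> t" "t \<le> T" and J': "ito (\<lambda>t \<omega>. truncate_at K (H t \<omega>)) J'"
  shows "AE \<omega> in M. \<omega> \<notin> {\<omega>\<in>space M. \<exists>t\<in>dyadics. \<bar>H t \<omega>\<bar> > K} \<longrightarrow>
    (\<forall>n. \<forall>k<n. ito_remainder H J t n k \<omega> = ito_remainder (\<lambda>t \<omega>. truncate_at K (H t \<omega>)) J' t n k \<omega>)"
proof -
  have "AE \<omega> in M. (\<forall>s\<in>{0..T}. H s \<omega> = truncate_at K (H s \<omega>)) \<longrightarrow> (\<forall>t\<in>{0..T}. J t \<omega> = J' t \<omega>)"
    by (rule ito_local[OF H cont_adapted_truncate_at[OF H(1)] truncate_at_abs J']) (use K in auto)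
  then show ?thesis using AE_space
  proof eventually_elim
    case (elim \<omega>)
    show ?case
    proof (intro impI allI)
      fix n k :: nat assume \<omega>: "\<omega> \<notin> {\<omega>\<in>space M. \<exists>t\<in>dyadics. \<bar>H t \<omega>\<bar> > K}" and k: "k < n"
      have 1: "H s \<omega> = truncate_at K (H s \<omega>)" if "0 \<le> s" "s \<le> T" for s
        using not_exceed[OF H(1) elim(2) _ that, of K] \<omega> elim(2) by (auto simp: truncate_at_id)
      have 2: "J s \<omega> = J' s \<omega>" if "0 \<le> s" "s \<le> T" for s
        using elim(1) 1 that by auto
      have b: "0 \<le> grid t n k" "grid t n k \<le> T" "0 \<le> grid t n (Suc k)" "grid t n (Suc k) \<le> T"
        using grid_bounds[of t k n] grid_bounds[of t "Suc k" n] t k by auto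
      show "ito_remainder H J t n k \<omega> = ito_remainder (\<lambda>t \<omega>. truncate_at K (H t \<omega>)) J' t n k \<omega>"
        unfolding ito_remainder_def using 1[OF b(1,2)] 2[OF b(1,2)] 2[OF b(3,4)] by simp
    qed
  qed
qed

text \<open>H is cut at a level that it exceeds with probability less than e. Off that event
  \<open>ito_local\<close> identifies the integral of H with that of its truncation, so all cell
  errors coincide.\<close>

theorem ito_remainder_squares:
  assumes H: "cont_adapted H" "ito H J" and t: "0 \<le> t" "t \<le> T"
  shows "conv_to_0 (\<lambda>n \<omega>. \<Sum>k<n. (ito_remainder H J t n k \<omega>)\<^sup>2)"
proof (rule conv_to_0_localise)
  show "(\<lambda>\<omega>. \<Sum>k<n. (ito_remainder H J t n k \<omega>)\<^sup>2) \<in> borel_measurable M" for n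
    using ito_remainder_measurable[OF H(1) ito_cont_adapted[OF H(2)] t] by auto
  fix e :: real assume "0 < e"
  then obtain K where K: "0 < K" "prob {\<omega>\<in>space M. \<exists>t\<in>dyadics. \<bar>H t \<omega>\<bar> > K} < e" using cont_adapted_tail[OF H(1)] by auto
  define H' where "H' = (\<lambda>t \<omega>. truncate_at K (H t \<omega>))"
  have H': "cont_adapted H'" "\<And>t \<omega>. \<bar>H' t \<omega>\<bar> \<le> K" unfolding H'_def using cont_adapted_truncate_at[OF H(1)] truncate_at_abs K by auto
  obtain J' where J': "ito H' J'" using ito_exists[OF H'(1)] by auto
  let ?B = "{\<omega>\<in>space M. \<exists>t\<in>dyadics. \<bar>H t \<omega>\<bar> > K}"
  show "\<exists>Y' B. (\<forall>n. Y' n \<in> borel_measurable M) \<and> conv_to_0 Y' \<and> B \<in> sets M \<and> prob B \<le> e \<and>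
      (AE \<omega> in M. \<omega> \<notin> B \<longrightarrow> (\<forall>n. (\<Sum>k<n. (ito_remainder H J t n k \<omega>)\<^sup>2) = Y' n \<omega>))"
  proof (intro exI[of _ "\<lambda>n \<omega>. \<Sum>k<n. (ito_remainder H' J' t n k \<omega>)\<^sup>2"] exI[of _ ?B] conjI allI)
    show "(\<lambda>\<omega>. \<Sum>k<n. (ito_remainder H' J' t n k \<omega>)\<^sup>2) \<in> borel_measurable M" for n
      using ito_remainder_measurable[OF H'(1) ito_cont_adapted[OF J'] t] by auto
    show "conv_to_0 (\<lambda>n \<omega>. \<Sum>k<n. (ito_remainder H' J' t n k \<omega>)\<^sup>2)"
      by (rule ito_remainder_squares_bounded[OF H' J' t])
    show "?B \<in> sets M" by (rule exceed_measurable[OF cont_adapted_measurable[OF H(1)]])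
    show "prob ?B \<le> e" using K by simp
    show "AE \<omega> in M. \<omega> \<notin> ?B \<longrightarrow> (\<forall>n. (\<Sum>k<n. (ito_remainder H J t n k \<omega>)\<^sup>2) = (\<Sum>k<n. (ito_remainder H' J' t n k \<omega>)\<^sup>2))"
      using ito_remainder_truncate_at[OF H K(1) t J'[unfolded H'_def]]
    proof eventually_elim
      case (elim \<omega>)
      show ?case
      proof (intro impI allI sum.cong refl)
        fix n k :: nat assume "\<omega> \<notin> ?B" "k \<in> {..<n}"
        then show "(ito_remainder H J t n k \<omega>)\<^sup>2 = (ito_remainder H' J' t n k \<omega>)\<^sup>2" using elim unfolding H'_def by simp
      qed
    qed
  qed
qed

text \<open>With G = 1 this identifies \<open>ito\<close> with \<open>is_ito_integral\<close>; with
  G = exp v and G = exp v * u it disposes of the first order errors in Ito's formula. Integrand and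
  weight are truncated separately, at a cost of e / 2 each.\<close>

theorem weighted_ito_remainder:
  assumes H: "cont_adapted H" "ito H J" and G: "cont_adapted G" and t: "0 \<le> t" "t \<le> T"
  shows "conv_to_0 (\<lambda>n \<omega>. \<Sum>k<n. G (grid t n k) \<omega> * ito_remainder H J t n k \<omega>)"
proof (rule conv_to_0_localise)
  have meas: "(\<lambda>\<omega>. \<Sum>k<n. G (grid t n k) \<omega> * ito_remainder H J t n k \<omega>) \<in> borel_measurable M" if "cont_adapted H" "cont_adapted J" "cont_adapted G" for n G H J
  proof (rule borel_measurable_sum)
    fix k assume "k \<in> {..<n}"
    then have k: "k < n" by simp
    have "0 \<le> grid t n k" "grid t n k \<le> T" using grid_bounds[of t k n] t k by auto
    note [measurable] = cont_adapted_measurable[OF that(3) this] ito_remainder_measurable[OF that(1,2) t k]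
    show "(\<lambda>\<omega>. G (grid t n k) \<omega> * ito_remainder H J t n k \<omega>) \<in> borel_measurable M" by measurable
  qed
  show "(\<lambda>\<omega>. \<Sum>k<n. G (grid t n k) \<omega> * ito_remainder H J t n k \<omega>) \<in> borel_measurable M" for n
    by (rule meas[OF H(1) ito_cont_adapted[OF H(2)] G])
  fix e :: real assume e: "0 < e"
  then obtain K where K: "0 < K" "prob {\<omega>\<in>space M. \<exists>t\<in>dyadics. \<bar>H t \<omega>\<bar> > K} < e / 2" using cont_adapted_tail[OF H(1), of "e / 2"] by auto
  obtain K' where K': "0 < K'" "prob {\<omega>\<in>space M. \<exists>t\<in>dyadics. \<bar>G t \<omega>\<bar> > K'} < e / 2" using cont_adapted_tail[OF G, of "e / 2"] e by auto
  define H' where "H' = (\<lambda>t \<omega>. truncate_at K (H t \<omega>))"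
  define G' where "G' = (\<lambda>t \<omega>. truncate_at K' (G t \<omega>))"
  have H': "cont_adapted H'" "\<And>t \<omega>. \<bar>H' t \<omega>\<bar> \<le> K" unfolding H'_def using cont_adapted_truncate_at[OF H(1)] truncate_at_abs K by auto
  have G': "cont_adapted G'" "\<And>t \<omega>. \<bar>G' t \<omega>\<bar> \<le> K'" unfolding G'_def using cont_adapted_truncate_at[OF G] truncate_at_abs K' by auto
  obtain J' where J': "ito H' J'" using ito_exists[OF H'(1)] by auto
  let ?B = "{\<omega>\<in>space M. \<exists>t\<in>dyadics. \<bar>H t \<omega>\<bar> > K}"
  let ?C = "{\<omega>\<in>space M. \<exists>t\<in>dyadics. \<bar>G t \<omega>\<bar> > K'}"
  show "\<exists>Y' B. (\<forall>n. Y' n \<in> borel_measurable M) \<and> conv_to_0 Y' \<and> B \<in> sets M \<and> prob B \<le> e \<and>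
      (AE \<omega> in M. \<omega> \<notin> B \<longrightarrow> (\<forall>n. (\<Sum>k<n. G (grid t n k) \<omega> * ito_remainder H J t n k \<omega>) = Y' n \<omega>))"
  proof (intro exI[of _ "\<lambda>n \<omega>. \<Sum>k<n. G' (grid t n k) \<omega> * ito_remainder H' J' t n k \<omega>"] exI[of _ "?B \<union> ?C"] conjI allI)
    show "(\<lambda>\<omega>. \<Sum>k<n. G' (grid t n k) \<omega> * ito_remainder H' J' t n k \<omega>) \<in> borel_measurable M" for n
      by (rule meas[OF H'(1) ito_cont_adapted[OF J'] G'(1)])
    show "conv_to_0 (\<lambda>n \<omega>. \<Sum>k<n. G' (grid t n k) \<omega> * ito_remainder H' J' t n k \<omega>)"
      by (rule weighted_ito_remainder_bounded[OF H' J' t G' K'(1)])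
    have B: "?B \<in> sets M" by (rule exceed_measurable[OF cont_adapted_measurable[OF H(1)]])
    have C: "?C \<in> sets M" by (rule exceed_measurable[OF cont_adapted_measurable[OF G]])
    show "?B \<union> ?C \<in> sets M" using B C by (rule sets.Un)
    show "prob (?B \<union> ?C) \<le> e" using measure_Un_le[OF B C] K(2) K'(2) by linarith
    show "AE \<omega> in M. \<omega> \<notin> ?B \<union> ?C \<longrightarrow> (\<forall>n. (\<Sum>k<n. G (grid t n k) \<omega> * ito_remainder H J t n k \<omega>) = (\<Sum>k<n. G' (grid t n k) \<omega> * ito_remainder H' J' t n k \<omega>))"
      using ito_remainder_truncate_at[OF H K(1) t J'[unfolded H'_def]] AE_space
    proof eventually_elim
      case (elim \<omega>)
      show ?case
      proof (intro impI allI sum.cong refl)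
        fix n k :: nat assume \<omega>: "\<omega> \<notin> ?B \<union> ?C" and k: "k \<in> {..<n}"
        then have "ito_remainder H J t n k \<omega> = ito_remainder H' J' t n k \<omega>" using elim(1) unfolding H'_def by simp
        moreover have "0 \<le> grid t n k" "grid t n k \<le> T" using grid_bounds[of t k n] t k by auto
        then have "G (grid t n k) \<omega> = G' (grid t n k) \<omega>"
          using not_exceed[OF G elim(2), of K' "grid t n k"] \<omega> elim(2) unfolding G'_def by (auto simp: truncate_at_id)
        ultimately show "G (grid t n k) \<omega> * ito_remainder H J t n k \<omega> = G' (grid t n k) \<omega> * ito_remainder H' J' t n k \<omega>" by simp
      qed
    qed
  qed
qed

section \<open>Agreement with the integral of the statement, and its uniqueness\<close>

lemma riemann_sum_measurable:
  assumes "cont_adapted H" "0 \<le> t" "t \<le> T"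
  shows "(\<lambda>\<omega>. \<Sum>k<n. H (grid t n k) \<omega> * (incr t n k \<omega>)) \<in> borel_measurable M"
proof (rule borel_measurable_sum)
  fix k assume "k \<in> {..<n}"
  then have b: "0 \<le> grid t n k" "grid t n k \<le> T" "0 \<le> grid t n (Suc k)" "grid t n (Suc k) \<le> T"
    using grid_bounds[of t k n] grid_bounds[of t "Suc k" n] assms by auto
  note [measurable] = cont_adapted_measurable[OF assms(1) b(1,2)] W_measurable[OF b(1,2)] W_measurable[OF b(3,4)]
  show "(\<lambda>\<omega>. H (grid t n k) \<omega> * (incr t n k \<omega>)) \<in> borel_measurable M" by measurable
qed

lemma is_ito_integral_grid:
  "is_ito_integral M T W H I \<longleftrightarrow> (\<forall>t\<in>{0..T}. I t \<in> borel_measurable M \<and>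
     conv_in_prob M (\<lambda>n \<omega>. \<Sum>k<n. H (grid t n k) \<omega> * (incr t n k \<omega>)) (I t))"
  unfolding is_ito_integral_def grid_def by simp

text \<open>The increments of J telescope to J t because J 0 = 0, so the unweighted sum of the cell
  errors is J t minus the Riemann sum.\<close>

theorem ito_is_ito_integral:
  assumes H: "cont_adapted H" "ito H J"
  shows "is_ito_integral M T W H J"
  unfolding is_ito_integral_grid
proof (intro ballI conjI)
  fix t assume "t \<in> {0..T}"
  then have t: "0 \<le> t" "t \<le> T" by auto
  show m: "J t \<in> borel_measurable M" by (rule cont_adapted_measurable[OF ito_cont_adapted[OF H(2)] t])
  have c: "conv_to_0 (\<lambda>n \<omega>. \<Sum>k<n. 1 * ito_remainder H J t n k \<omega>)"
    by (rule weighted_ito_remainder[OF H cont_adapted_const t])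
  have "conv_to_0 (\<lambda>n \<omega>. (\<Sum>k<n. H (grid t n k) \<omega> * (incr t n k \<omega>)) - J t \<omega>)"
  proof (rule conv_to_0_combine[where I="{()}" and X="\<lambda>_ n \<omega>. \<Sum>k<n. 1 * ito_remainder H J t n k \<omega>"])
    show "(\<lambda>\<omega>. \<Sum>k<n. 1 * ito_remainder H J t n k \<omega>) \<in> borel_measurable M" for n
      using ito_remainder_measurable[OF H(1) ito_cont_adapted[OF H(2)] t] by (intro borel_measurable_sum) auto
    show "AE \<omega> in M. \<forall>r. strict_mono r \<longrightarrow> (\<forall>i\<in>{()}. (\<lambda>n. \<Sum>k<r n. 1 * ito_remainder H J t (r n) k \<omega>) \<longlonglongrightarrow> 0) \<longrightarrow>
      (\<lambda>n. (\<Sum>k<r n. H (grid t (r n) k) \<omega> * (W (grid t (r n) (Suc k)) \<omega> - W (grid t (r n) k) \<omega>)) - J t \<omega>) \<longlonglongrightarrow> 0"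
    proof (rule AE_I2, intro allI impI)
      fix \<omega> r assume \<omega>: "\<omega> \<in> space M" and r: "strict_mono (r :: nat \<Rightarrow> nat)"
        and lim: "\<forall>i\<in>{()}. (\<lambda>n. \<Sum>k<r n. 1 * ito_remainder H J t (r n) k \<omega>) \<longlonglongrightarrow> 0"
      have J0: "J 0 \<omega> = 0" using H(2) \<omega> unfolding ito_def by auto
      have eq: "(\<Sum>k<n. H (grid t n k) \<omega> * (incr t n k \<omega>)) - J t \<omega> = - (\<Sum>k<n. 1 * ito_remainder H J t n k \<omega>)"
        if "0 < n" for n
      proof -
        have "(\<Sum>k<n. J (grid t n (Suc k)) \<omega> - J (grid t n k) \<omega>) = J t \<omega>"
          using sum_lessThan_telescope[of "\<lambda>k. J (grid t n k) \<omega>" n] grid_ends(1)[of t n] grid_ends(2)[OF that, of t] J0 by simp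
        then show ?thesis unfolding ito_remainder_def by (simp add: sum_subtractf)
      qed
      \<comment> \<open>Telescoping needs a nonempty grid; with 0 cells the last grid point is 0
        instead of t.\<close>
      have "\<forall>\<^sub>F n in sequentially. 0 < r n"
        using eventually_gt_at_top[of 0] by eventually_elim (use strict_mono_imp_increasing[OF r] in \<open>auto intro: less_le_trans\<close>)
      then have ev: "\<forall>\<^sub>F n in sequentially. - (\<Sum>k<r n. 1 * ito_remainder H J t (r n) k \<omega>) =
        (\<Sum>k<r n. H (grid t (r n) k) \<omega> * (W (grid t (r n) (Suc k)) \<omega> - W (grid t (r n) k) \<omega>)) - J t \<omega>"
        by eventually_elim (simp only: eq)
      have "(\<lambda>n. - (\<Sum>k<r n. 1 * ito_remainder H J t (r n) k \<omega>)) \<longlonglongrightarrow> - 0" using lim by (intro tendsto_minus) auto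
      then show "(\<lambda>n. (\<Sum>k<r n. H (grid t (r n) k) \<omega> * (W (grid t (r n) (Suc k)) \<omega> - W (grid t (r n) k) \<omega>)) - J t \<omega>) \<longlonglongrightarrow> 0"
        using Lim_transform_eventually[OF _ ev] by simp
    qed
  qed (use c m riemann_sum_measurable[OF H(1) t] in auto)
  then show "conv_in_prob M (\<lambda>n \<omega>. \<Sum>k<n. H (grid t n k) \<omega> * (incr t n k \<omega>)) (J t)"
    by (rule conv_in_prob_of_conv_to_0)
qed

text \<open>The sums for time t sample their integrand in [0, t] only, so agreement up to t
  suffices. This is what allows uniqueness to advance by one delay at a time.\<close>

lemma is_ito_integral_unique:
  assumes "is_ito_integral M T W H I" "is_ito_integral M T W H' I'" "cont_adapted H" "cont_adapted H'" "0 \<le> t" "t \<le> T"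
    and eq: "AE \<omega> in M. P \<omega> \<longrightarrow> (\<forall>s\<in>{0..t}. H s \<omega> = H' s \<omega>)"
  shows "AE \<omega> in M. P \<omega> \<longrightarrow> I t \<omega> = I' t \<omega>"
proof (rule conv_in_prob_unique)
  show "conv_in_prob M (\<lambda>n \<omega>. \<Sum>k<n. H (grid t n k) \<omega> * (incr t n k \<omega>)) (I t)"
    "conv_in_prob M (\<lambda>n \<omega>. \<Sum>k<n. H' (grid t n k) \<omega> * (incr t n k \<omega>)) (I' t)"
    "I t \<in> borel_measurable M" "I' t \<in> borel_measurable M"
    using assms(1,2,5,6) unfolding is_ito_integral_grid by auto
  show "AE \<omega> in M. P \<omega> \<longrightarrow> (\<forall>n. (\<Sum>k<n. H (grid t n k) \<omega> * (incr t n k \<omega>)) =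
    (\<Sum>k<n. H' (grid t n k) \<omega> * (incr t n k \<omega>)))"
    using eq
  proof eventually_elim
    case (elim \<omega>)
    show ?case
    proof (intro impI allI sum.cong refl)
      fix n k :: nat assume "P \<omega>" "k \<in> {..<n}"
      then have "H (grid t n k) \<omega> = H' (grid t n k) \<omega>" using elim grid_bounds[of t k n] assms(5) by auto
      then show "H (grid t n k) \<omega> * (incr t n k \<omega>) = H' (grid t n k) \<omega> * (incr t n k \<omega>)"
        by simp
    qed
  qed
qed (use riemann_sum_measurable assms in auto)

end

section \<open>Ito formula\<close>

text \<open>The Cauchy-Schwarz inequality: one factor has bounded quadratic sums, those of the other
  vanish.\<close>

lemma tendsto_sum_abs_mult_0:
  fixes p q :: "nat \<Rightarrow> nat \<Rightarrow> real"
  assumes "eventually (\<lambda>n. (\<Sum>k<r n. (p n k)\<^sup>2) \<le> B) sequentially" "(\<lambda>n. \<Sum>k<r n. (q n k)\<^sup>2) \<longlonglongrightarrow> 0"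
  shows "(\<lambda>n. \<Sum>k<r n. \<bar>p n k\<bar> * \<bar>q n k\<bar>) \<longlonglongrightarrow> 0"
proof -
  define S where "S = (\<lambda>n. \<Sum>k<r n. \<bar>p n k\<bar> * \<bar>q n k\<bar>)"
  have "(\<lambda>n. B * (\<Sum>k<r n. (q n k)\<^sup>2)) \<longlonglongrightarrow> B * 0" by (intro tendsto_mult tendsto_const assms)
  then have lim: "(\<lambda>n. B * (\<Sum>k<r n. (q n k)\<^sup>2)) \<longlonglongrightarrow> 0" by simp
  have "eventually (\<lambda>n. norm ((S n)\<^sup>2) \<le> B * (\<Sum>k<r n. (q n k)\<^sup>2)) sequentially"
    using assms(1)
  proof eventually_elim
    case (elim n)
    have "(S n)\<^sup>2 \<le> (\<Sum>k<r n. (\<bar>p n k\<bar>)\<^sup>2) * (\<Sum>k<r n. (\<bar>q n k\<bar>)\<^sup>2)"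
      unfolding S_def by (rule Cauchy_Schwarz_ineq_sum)
    also have "\<dots> \<le> B * (\<Sum>k<r n. (q n k)\<^sup>2)" using elim by (simp add: mult_right_mono sum_nonneg)
    finally show ?case by simp
  qed
  from Lim_null_comparison[OF this lim] have "(\<lambda>n. (S n)\<^sup>2) \<longlonglongrightarrow> 0" .
  then have "(\<lambda>n. sqrt ((S n)\<^sup>2)) \<longlonglongrightarrow> sqrt 0" by (rule tendsto_real_sqrt)
  then have "(\<lambda>n. \<bar>S n\<bar>) \<longlonglongrightarrow> 0" by simp
  then show ?thesis unfolding S_def by (rule tendsto_rabs_zero_cancel)
qed

text \<open>In the application p and q are the increments caused by the Brownian motion, with
  bounded quadratic sums, and alpha and beta collect drift and cell error, with vanishing ones. Each
  of the three terms created by expanding the product is handled by Cauchy-Schwarz.\<close>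

lemma product_perturbation:
  fixes p q \<alpha> \<beta> G :: "nat \<Rightarrow> nat \<Rightarrow> real"
  assumes G: "\<And>n k. k < r n \<Longrightarrow> \<bar>G n k\<bar> \<le> C"
    and p: "eventually (\<lambda>n. (\<Sum>k<r n. (p n k)\<^sup>2) \<le> B) sequentially" and q: "eventually (\<lambda>n. (\<Sum>k<r n. (q n k)\<^sup>2) \<le> B') sequentially"
    and \<alpha>: "(\<lambda>n. \<Sum>k<r n. (\<alpha> n k)\<^sup>2) \<longlonglongrightarrow> 0" and \<beta>: "(\<lambda>n. \<Sum>k<r n. (\<beta> n k)\<^sup>2) \<longlonglongrightarrow> 0"
  shows "(\<lambda>n. \<Sum>k<r n. G n k * ((p n k + \<alpha> n k) * (q n k + \<beta> n k) - p n k * q n k)) \<longlonglongrightarrow> 0"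
proof -
  have "eventually (\<lambda>n. (\<Sum>k<r n. (\<alpha> n k)\<^sup>2) < 1) sequentially" using \<alpha> by (rule order_tendstoD) simp
  then have \<alpha>1: "eventually (\<lambda>n. (\<Sum>k<r n. (\<alpha> n k)\<^sup>2) \<le> 1) sequentially" by eventually_elim simp
  have "(\<lambda>n. \<bar>C\<bar> * ((\<Sum>k<r n. \<bar>p n k\<bar> * \<bar>\<beta> n k\<bar>) + (\<Sum>k<r n. \<bar>q n k\<bar> * \<bar>\<alpha> n k\<bar>) + (\<Sum>k<r n. \<bar>\<alpha> n k\<bar> * \<bar>\<beta> n k\<bar>))) \<longlonglongrightarrow> \<bar>C\<bar> * (0 + 0 + 0)"
    by (intro tendsto_mult tendsto_add tendsto_const tendsto_sum_abs_mult_0[OF p \<beta>] tendsto_sum_abs_mult_0[OF q \<alpha>] tendsto_sum_abs_mult_0[OF \<alpha>1 \<beta>])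
  then have lim: "(\<lambda>n. \<bar>C\<bar> * ((\<Sum>k<r n. \<bar>p n k\<bar> * \<bar>\<beta> n k\<bar>) + (\<Sum>k<r n. \<bar>q n k\<bar> * \<bar>\<alpha> n k\<bar>) + (\<Sum>k<r n. \<bar>\<alpha> n k\<bar> * \<bar>\<beta> n k\<bar>))) \<longlonglongrightarrow> 0" by simp
  show ?thesis
  proof (rule Lim_null_comparison[OF always_eventually[OF allI] lim])
    fix n
    have "norm (\<Sum>k<r n. G n k * ((p n k + \<alpha> n k) * (q n k + \<beta> n k) - p n k * q n k)) \<le>
      (\<Sum>k<r n. \<bar>C\<bar> * (\<bar>p n k\<bar> * \<bar>\<beta> n k\<bar> + \<bar>q n k\<bar> * \<bar>\<alpha> n k\<bar> + \<bar>\<alpha> n k\<bar> * \<bar>\<beta> n k\<bar>))"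
    proof (rule sum_norm_le)
      fix k assume "k \<in> {..<r n}"
      then have "\<bar>G n k\<bar> \<le> \<bar>C\<bar>" using G[of k n] by simp
      moreover have "\<bar>(p n k + \<alpha> n k) * (q n k + \<beta> n k) - p n k * q n k\<bar> \<le> \<bar>p n k\<bar> * \<bar>\<beta> n k\<bar> + \<bar>q n k\<bar> * \<bar>\<alpha> n k\<bar> + \<bar>\<alpha> n k\<bar> * \<bar>\<beta> n k\<bar>"
      proof -
        have "(p n k + \<alpha> n k) * (q n k + \<beta> n k) - p n k * q n k = p n k * \<beta> n k + q n k * \<alpha> n k + \<alpha> n k * \<beta> n k" by (simp add: algebra_simps)
        then show ?thesis unfolding abs_mult[symmetric] by linarith
      qed
      ultimately show "norm (G n k * ((p n k + \<alpha> n k) * (q n k + \<beta> n k) - p n k * q n k)) \<le>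
        \<bar>C\<bar> * (\<bar>p n k\<bar> * \<bar>\<beta> n k\<bar> + \<bar>q n k\<bar> * \<bar>\<alpha> n k\<bar> + \<bar>\<alpha> n k\<bar> * \<bar>\<beta> n k\<bar>)"
        unfolding real_norm_def abs_mult[of "G n k"] by (intro mult_mono) auto
    qed
    then show "norm (\<Sum>k<r n. G n k * ((p n k + \<alpha> n k) * (q n k + \<beta> n k) - p n k * q n k)) \<le>
      \<bar>C\<bar> * ((\<Sum>k<r n. \<bar>p n k\<bar> * \<bar>\<beta> n k\<bar>) + (\<Sum>k<r n. \<bar>q n k\<bar> * \<bar>\<alpha> n k\<bar>) + (\<Sum>k<r n. \<bar>\<alpha> n k\<bar> * \<bar>\<beta> n k\<bar>))"
      by (simp add: sum_distrib_left[symmetric] sum.distrib)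
  qed
qed

text \<open>Lagrange remainders of orders 2 and 3, with the exponential at the intermediate point at
  most 3. The resulting constants 3/2 and 1/2 are rounded up to 2 and 1.\<close>

lemma exp_taylor_bounds:
  fixes x :: real
  assumes "\<bar>x\<bar> \<le> 1"
  shows "\<bar>exp x - 1 - x\<bar> \<le> 2 * x\<^sup>2" "\<bar>exp x - 1 - x - x\<^sup>2 / 2\<bar> \<le> \<bar>x\<bar> * x\<^sup>2"
proof -
  have e3: "exp t \<le> 3" if "\<bar>t\<bar> \<le> \<bar>x\<bar>" for t :: real
  proof -
    have "exp t \<le> exp 1" using that assms by simp
    also have "\<dots> \<le> 3" by (rule exp_le)
    finally show ?thesis .
  qed
  obtain s where s: "\<bar>s\<bar> \<le> \<bar>x\<bar>" "exp x = (\<Sum>m<2. x ^ m / fact m) + exp s / fact 2 * x ^ 2"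
    using Maclaurin_exp_le by blast
  have "exp x - 1 - x = exp s / 2 * x\<^sup>2" using s(2) by (simp add: numeral_2_eq_2)
  then have "\<bar>exp x - 1 - x\<bar> = \<bar>exp s / 2 * x\<^sup>2\<bar>" by (rule arg_cong)
  also have "\<dots> = exp s / 2 * x\<^sup>2" by (simp add: abs_mult)
  also have "\<dots> \<le> 2 * x\<^sup>2" using e3[OF s(1)] by (intro mult_right_mono) auto
  finally show "\<bar>exp x - 1 - x\<bar> \<le> 2 * x\<^sup>2" .
  obtain s where s: "\<bar>s\<bar> \<le> \<bar>x\<bar>" "exp x = (\<Sum>m<3. x ^ m / fact m) + exp s / fact 3 * x ^ 3"
    using Maclaurin_exp_le by blast
  have "exp x - 1 - x - x\<^sup>2 / 2 = exp s / 6 * x ^ 3" using s(2) by (simp add: numeral_3_eq_3 fact_numeral numeral_2_eq_2)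
  then have "\<bar>exp x - 1 - x - x\<^sup>2 / 2\<bar> = \<bar>exp s / 6 * x ^ 3\<bar>" by (rule arg_cong)
  also have "\<dots> = exp s / 6 * (\<bar>x\<bar> * x\<^sup>2)" by (simp add: abs_mult power3_eq_cube power2_eq_square)
  also have "\<dots> \<le> 1 * (\<bar>x\<bar> * x\<^sup>2)" using e3[OF s(1)] by (intro mult_right_mono) auto
  finally show "\<bar>exp x - 1 - x - x\<^sup>2 / 2\<bar> \<le> \<bar>x\<bar> * x\<^sup>2" by simp
qed

section \<open>Riemann sums, drift increments and quadratic variation\<close>

context brownian_motion
begin

lemma grid_oscillation:
  fixes a :: "real \<Rightarrow> real"
  assumes a: "continuous_on {0..t} a" and t: "0 \<le> t" and r: "filterlim r at_top sequentially" and e: "0 < e"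
  shows "eventually (\<lambda>n. \<forall>k<r n. \<forall>s\<in>{grid t (r n) k..grid t (r n) (Suc k)}. \<bar>a s - a (grid t (r n) k)\<bar> \<le> e) sequentially"
proof -
  have "uniformly_continuous_on {0..t} a" by (rule compact_uniformly_continuous[OF a compact_Icc])
  then obtain d where d: "0 < d" "\<And>x y. x \<in> {0..t} \<Longrightarrow> y \<in> {0..t} \<Longrightarrow> dist y x < d \<Longrightarrow> dist (a y) (a x) < e"
    unfolding uniformly_continuous_on_def using e by blast
  have "(\<lambda>n. t / real (r n)) \<longlonglongrightarrow> 0"
    by (rule tendsto_divide_0[OF tendsto_const filterlim_at_top_imp_at_infinity[OF filterlim_compose[OF filterlim_real_sequentially r]]])
  then have "eventually (\<lambda>n. t / real (r n) < d) sequentially" using d(1) by (rule order_tendstoD)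
  then show ?thesis
  proof eventually_elim
    case (elim n)
    show ?case
    proof (intro allI impI ballI)
      fix k s assume k: "k < r n" and s: "s \<in> {grid t (r n) k..grid t (r n) (Suc k)}"
      have b: "0 \<le> grid t (r n) k" "grid t (r n) k \<le> t" "grid t (r n) (Suc k) \<le> t"
        using grid_bounds[OF t, of k "r n"] grid_bounds[OF t, of "Suc k" "r n"] k by auto
      have "\<bar>s - grid t (r n) k\<bar> < d" using s grid_Suc(2)[of t "r n" k] elim by auto
      then show "\<bar>a s - a (grid t (r n) k)\<bar> \<le> e"
        using d(2)[of "grid t (r n) k" s] s b by (auto simp: dist_real_def intro: less_imp_le)
    qed
  qed
qed

lemma integral_grid_sum:
  fixes a :: "real \<Rightarrow> real"
  assumes a: "continuous_on {0..t} a" and t: "0 \<le> t" and n: "0 < n"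
  shows "integral {0..t} a = (\<Sum>k<n. integral {grid t n k..grid t n (Suc k)} a)"
proof -
  have "integral {0..grid t n m} a = (\<Sum>k<m. integral {grid t n k..grid t n (Suc k)} a)" if "m \<le> n" for m
    using that
  proof (induction m)
    case 0 then show ?case by (simp add: grid_ends)
  next
    case (Suc m)
    have "a integrable_on {0..grid t n (Suc m)}"
      using grid_bounds[OF t Suc.prems] by (intro integrable_continuous_interval continuous_on_subset[OF a]) auto
    then have "integral {0..grid t n m} a + integral {grid t n m..grid t n (Suc m)} a = integral {0..grid t n (Suc m)} a"
      using grid_bounds(1)[OF t, of m n] Suc.prems grid_Suc(1)[OF t, of n m] by (intro Henstock_Kurzweil_Integration.integral_combine) auto
    then show ?case using Suc by simp
  qed
  from this[of n] show ?thesis using grid_ends(2)[OF n] by simp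
qed

text \<open>The drift part of an increment is an exact integral over the cell, while its coefficient
  is taken at the left end. Only the oscillation of G within a cell separates the sum from the
  integral of the product.\<close>

lemma grid_weighted_riemann:
  fixes a G :: "real \<Rightarrow> real"
  assumes a: "continuous_on {0..t} a" and G: "continuous_on {0..t} G" and t: "0 \<le> t" and r: "filterlim r at_top sequentially"
  shows "(\<lambda>n. \<Sum>k<r n. G (grid t (r n) k) * integral {grid t (r n) k..grid t (r n) (Suc k)} a) \<longlonglongrightarrow> integral {0..t} (\<lambda>s. G s * a s)"
proof (rule LIMSEQ_I)
  fix e :: real assume e: "0 < e"
  obtain C where C: "0 < C" "\<And>s. s \<in> {0..t} \<Longrightarrow> \<bar>a s\<bar> \<le> C"
    using compact_imp_bounded[OF compact_continuous_image[OF a compact_Icc]] unfolding bounded_pos by auto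
  \<comment> \<open>The summand 1 avoids a division by 0 when t = 0.\<close>
  define \<epsilon> where "\<epsilon> = e / (2 * C * (t + 1))"
  have \<epsilon>: "0 < \<epsilon>" unfolding \<epsilon>_def using e C t by auto
  have "eventually (\<lambda>n. 0 < r n) sequentially" using r[unfolded filterlim_at_top, rule_format, of 1] by eventually_elim simp
  with grid_oscillation[OF G t r \<epsilon>]
  have "eventually (\<lambda>n. norm ((\<Sum>k<r n. G (grid t (r n) k) * integral {grid t (r n) k..grid t (r n) (Suc k)} a) - integral {0..t} (\<lambda>s. G s * a s)) < e) sequentially"
  proof eventually_elim
    case (elim n)
    let ?g = "grid t (r n)"
    have b: "0 \<le> ?g k" "?g k \<le> t" "?g (Suc k) \<le> t" "?g k \<le> ?g (Suc k)" if "k < r n" for k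
      using grid_bounds[OF t, of k "r n"] grid_bounds[OF t, of "Suc k" "r n"] grid_Suc(1)[OF t] that by auto
    have ca: "continuous_on {?g k..?g (Suc k)} a" and cG: "continuous_on {?g k..?g (Suc k)} G" if "k < r n" for k
      using b[OF that] by (auto intro!: continuous_on_subset[OF a] continuous_on_subset[OF G])
    have "(\<Sum>k<r n. G (?g k) * integral {?g k..?g (Suc k)} a) - integral {0..t} (\<lambda>s. G s * a s) =
      (\<Sum>k<r n. G (?g k) * integral {?g k..?g (Suc k)} a - integral {?g k..?g (Suc k)} (\<lambda>s. G s * a s))"
      unfolding sum_subtractf by (subst integral_grid_sum[OF _ t elim(2)]) (auto intro!: continuous_intros a G)
    also have "norm \<dots> \<le> (\<Sum>k<r n. \<epsilon> * C * (t / real (r n)))"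
    proof (rule sum_norm_le)
      fix k assume "k \<in> {..<r n}"
      then have k: "k < r n" by simp
      have "G (?g k) * integral {?g k..?g (Suc k)} a - integral {?g k..?g (Suc k)} (\<lambda>s. G s * a s) =
        integral {?g k..?g (Suc k)} (\<lambda>s. (G (?g k) - G s) * a s)"
        unfolding left_diff_distrib
        using ca[OF k] cG[OF k]
        by (subst Henstock_Kurzweil_Integration.integral_diff) (auto intro!: integrable_continuous_interval continuous_intros)
      also have "norm \<dots> \<le> (\<epsilon> * C) * (?g (Suc k) - ?g k)"
      proof (rule integral_bound)
        show "continuous_on {?g k..?g (Suc k)} (\<lambda>s. (G (?g k) - G s) * a s)" using ca[OF k] cG[OF k] by (intro continuous_intros)
        fix s assume s: "s \<in> {?g k..?g (Suc k)}"
        have "\<bar>G (?g k) - G s\<bar> \<le> \<epsilon>" using elim(1) k s by (auto simp: abs_minus_commute)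
        moreover have "\<bar>a s\<bar> \<le> C" using C(2) s b[OF k] by auto
        ultimately show "norm ((G (?g k) - G s) * a s) \<le> \<epsilon> * C" unfolding real_norm_def abs_mult using \<epsilon> by (intro mult_mono) auto
      qed (use b[OF k] in auto)
      finally show "norm (G (?g k) * integral {?g k..?g (Suc k)} a - integral {?g k..?g (Suc k)} (\<lambda>s. G s * a s)) \<le> \<epsilon> * C * (t / real (r n))"
        unfolding grid_Suc .
    qed
    also have "\<dots> = \<epsilon> * C * t" using elim(2) by simp
    also have "\<dots> \<le> e / 2"
    proof -
      have "\<epsilon> * C * t = (e / 2) * (t / (t + 1))" unfolding \<epsilon>_def using C(1) by simp
      also have "\<dots> \<le> (e / 2) * 1" using e t by (intro mult_left_mono) auto
      finally show ?thesis by simp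
    qed
    also have "\<dots> < e" using e by simp
    finally show ?case .
  qed
  then show "\<exists>no. \<forall>n\<ge>no. norm ((\<Sum>k<r n. G (grid t (r n) k) * integral {grid t (r n) k..grid t (r n) (Suc k)} a) - integral {0..t} (\<lambda>s. G s * a s)) < e"
    unfolding eventually_sequentially .
qed

lemma grid_riemann:
  fixes G :: "real \<Rightarrow> real"
  assumes G: "continuous_on {0..t} G" and t: "0 \<le> t" and r: "filterlim r at_top sequentially"
  shows "(\<lambda>n. \<Sum>k<r n. G (grid t (r n) k) * (t / real (r n))) \<longlonglongrightarrow> integral {0..t} G"
  using grid_weighted_riemann[OF continuous_on_const[of "{0..t}" 1] G t r] grid_Suc(1)[OF t] by (simp add: grid_Suc(2))

text \<open>Drift increments are of order 1 / n, so the n squares add up to order 1 / n.\<close>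

lemma grid_drift_squares:
  fixes a :: "real \<Rightarrow> real"
  assumes a: "continuous_on {0..t} a" and t: "0 \<le> t" and r: "filterlim r at_top sequentially"
  shows "(\<lambda>n. \<Sum>k<r n. (integral {grid t (r n) k..grid t (r n) (Suc k)} a)\<^sup>2) \<longlonglongrightarrow> 0"
proof -
  obtain C where C: "0 < C" "\<And>s. s \<in> {0..t} \<Longrightarrow> \<bar>a s\<bar> \<le> C"
    using compact_imp_bounded[OF compact_continuous_image[OF a compact_Icc]] unfolding bounded_pos by auto
  have "(\<lambda>n. (C * t)\<^sup>2 / real (r n)) \<longlonglongrightarrow> 0"
    by (rule tendsto_divide_0[OF tendsto_const filterlim_at_top_imp_at_infinity[OF filterlim_compose[OF filterlim_real_sequentially r]]])
  then show ?thesis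
  proof (rule Lim_null_comparison[OF always_eventually[OF allI], rotated])
    fix n
    have "norm (\<Sum>k<r n. (integral {grid t (r n) k..grid t (r n) (Suc k)} a)\<^sup>2) \<le> (\<Sum>k<r n. (C * (t / real (r n)))\<^sup>2)"
    proof (rule sum_norm_le)
      fix k assume "k \<in> {..<r n}"
      then have b: "0 \<le> grid t (r n) k" "grid t (r n) (Suc k) \<le> t" "grid t (r n) k \<le> grid t (r n) (Suc k)"
        using grid_bounds[OF t, of k "r n"] grid_bounds[OF t, of "Suc k" "r n"] grid_Suc(1)[OF t] by auto
      have "norm (integral {grid t (r n) k..grid t (r n) (Suc k)} a) \<le> C * (grid t (r n) (Suc k) - grid t (r n) k)"
        by (rule integral_bound) (use b C in \<open>auto intro!: continuous_on_subset[OF a]\<close>)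
      then have "\<bar>integral {grid t (r n) k..grid t (r n) (Suc k)} a\<bar> \<le> C * (t / real (r n))" unfolding grid_Suc by simp
      from power_mono[OF this, of 2]
      show "norm ((integral {grid t (r n) k..grid t (r n) (Suc k)} a)\<^sup>2) \<le> (C * (t / real (r n)))\<^sup>2" by simp
    qed
    also have "\<dots> = (C * t)\<^sup>2 / real (r n)"
      by (cases "r n = 0") (simp_all add: power_mult_distrib power_divide power2_eq_square)
    finally show "norm (\<Sum>k<r n. (integral {grid t (r n) k..grid t (r n) (Suc k)} a)\<^sup>2) \<le> (C * t)\<^sup>2 / real (r n)" .
  qed
qed

text \<open>The quadratic variation with weights. The compensated squares have mean 0 given the
  past, so second moments add up over the cells; each contributes at most
  \<open>2 * K\<^sup>2 * (t / n)\<^sup>2\<close>, in total of order 1 / n.\<close>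

lemma sq_increments_bounded:
  assumes c: "cont_adapted c" "\<And>t \<omega>. 0 \<le> t \<Longrightarrow> t \<le> T \<Longrightarrow> \<omega> \<in> space M \<Longrightarrow> \<bar>c t \<omega>\<bar> \<le> K" and t: "0 \<le> t" "t \<le> T"
  shows "conv_to_0 (\<lambda>n \<omega>. \<Sum>k<n. c (grid t n k) \<omega> * ((incr t n k \<omega>)\<^sup>2 - t / real n))"
proof (rule conv_to_0_of_square, rule conv_to_0_L1)
  fix e :: real assume e: "0 < e"
  \<comment> \<open>Sums over the first m of the n cells are known at time
    \<open>grid t n m\<close>. The next squared increment is independent of them, and the second
    moment can be followed cell by cell.\<close>
  define S where "S = (\<lambda>n m \<omega>. \<Sum>k<m. c (grid t n k) \<omega> * ((incr t n k \<omega>)\<^sup>2 - t / real n))"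
  have claim: "S n m \<in> borel_measurable (Ft (grid t n m)) \<and> integrable M (\<lambda>\<omega>. (S n m \<omega>)\<^sup>2) \<and>
    expectation (\<lambda>\<omega>. (S n m \<omega>)\<^sup>2) \<le> real m * (2 * K\<^sup>2 * (t / real n)\<^sup>2)" if "m \<le> n" for n m
    using that
  proof (induction m)
    case 0 show ?case unfolding S_def by simp
  next
    case (Suc m)
    then have IH: "S n m \<in> borel_measurable (Ft (grid t n m))" "integrable M (\<lambda>\<omega>. (S n m \<omega>)\<^sup>2)"
      "expectation (\<lambda>\<omega>. (S n m \<omega>)\<^sup>2) \<le> real m * (2 * K\<^sup>2 * (t / real n)\<^sup>2)" by auto
    define s' s d where "s' = grid t n (Suc m)" and "s = grid t n m" and "d = t / real n"
    have b: "0 \<le> s" "s \<le> s'" "s' \<le> T" "s \<le> T" "0 \<le> s'"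
      using grid_bounds[OF t(1), of m n] grid_bounds[OF t(1), of "Suc m" n] grid_Suc(1)[OF t(1), of n m] Suc.prems t
      unfolding s'_def s_def by auto
    have d: "d = s' - s" unfolding d_def s'_def s_def by (simp add: grid_Suc)
    have SS: "S n (Suc m) \<omega> = S n m \<omega> + c s \<omega> * ((W s' \<omega> - W s \<omega>)\<^sup>2 - d)" for \<omega>
      unfolding S_def s'_def s_def d_def by simp
    have cs: "c s \<in> borel_measurable (Ft s)" using cont_adapted_Ft[OF c(1)] b by auto
    have csM: "c s \<in> borel_measurable M" using cont_adapted_measurable[OF c(1)] b by auto
    have cK: "\<bar>c s \<omega>\<bar> \<le> K" if "\<omega> \<in> space M" for \<omega> using c(2)[OF b(1,4) that] .
    have SmF: "S n m \<in> borel_measurable (Ft s)" using IH(1) unfolding s_def .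
    have SmM: "S n m \<in> borel_measurable M" using Ft_measurable_M[OF SmF] b by auto
    have meas: "S n (Suc m) \<in> borel_measurable (Ft s')"
    proof -
      note [measurable] = Ft_mono[OF SmF b(1,2,3)] Ft_mono[OF cs b(1,2,3)] W_Ft[OF b(1,2,3)] W_Ft[OF b(5) order_refl b(3)]
      have "(\<lambda>\<omega>. S n m \<omega> + c s \<omega> * ((W s' \<omega> - W s \<omega>)\<^sup>2 - d)) \<in> borel_measurable (Ft s')" by measurable
      moreover have "S n (Suc m) = (\<lambda>\<omega>. S n m \<omega> + c s \<omega> * ((W s' \<omega> - W s \<omega>)\<^sup>2 - d))" using SS by blast
      ultimately show ?thesis by simp
    qed
    have Sint: "integrable M (S n m)"
      using square_integrable_mult[OF SmM borel_measurable_const IH(2), of 1] by simp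
    let ?X = "\<lambda>\<omega>. c s \<omega> * S n m \<omega>" and ?Y = "\<lambda>\<omega>. (c s \<omega>)\<^sup>2"
    have Xi: "integrable M ?X" by (rule bounded_mult_integrable[OF csM cK Sint])
    have Xm: "?X \<in> borel_measurable (Ft s)" using cs SmF by simp
    have c2: "(c s \<omega>)\<^sup>2 \<le> K\<^sup>2" if "\<omega> \<in> space M" for \<omega> using power_mono[OF cK[OF that], of 2] by simp
    have Yi: "integrable M ?Y" by (rule bounded_integrable[of _ "K\<^sup>2"]) (use csM c2 in auto)
    have Ym: "?Y \<in> borel_measurable (Ft s)" using cs by simp
    note X2 = increment_product2[OF b(1,2,3) Xm Xi]
    note Y2 = increment_product2[OF b(1,2,3) Ym Yi]
    note Y4 = increment_product[OF b(1,2,3) Ym Yi, of 4]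
    have sq: "(S n (Suc m) \<omega>)\<^sup>2 = (S n m \<omega>)\<^sup>2 + 2 * (?X \<omega> * (W s' \<omega> - W s \<omega>)\<^sup>2) - 2 * d * ?X \<omega> +
      (?Y \<omega> * (W s' \<omega> - W s \<omega>) ^ 4 - 2 * d * (?Y \<omega> * (W s' \<omega> - W s \<omega>)\<^sup>2) + d\<^sup>2 * ?Y \<omega>)" for \<omega>
      unfolding SS by (simp add: power2_eq_square power4_eq_xxxx algebra_simps)
    have "integrable M (\<lambda>\<omega>. (S n (Suc m) \<omega>)\<^sup>2)" unfolding sq
      using IH(2) X2(1) Xi Y4(1) Y2(1) Yi by auto
    \<comment> \<open>The cross term has mean 0 because the squared increment has mean d. The rest
      is the expectation of the squared weight times 3 d^2 - 2 d^2 + d^2, where 2 d^2 is the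
      variance of a squared centred normal variable of variance d.\<close>
    moreover have "expectation (\<lambda>\<omega>. (S n (Suc m) \<omega>)\<^sup>2) = expectation (\<lambda>\<omega>. (S n m \<omega>)\<^sup>2) + 2 * d\<^sup>2 * expectation ?Y"
    proof -
      define A B X C D Y where "A = (\<lambda>\<omega>. (S n m \<omega>)\<^sup>2)" and "B = (\<lambda>\<omega>. ?X \<omega> * (W s' \<omega> - W s \<omega>)\<^sup>2)" and "X = ?X"
        and "C = (\<lambda>\<omega>. ?Y \<omega> * (W s' \<omega> - W s \<omega>) ^ 4)" and "D = (\<lambda>\<omega>. ?Y \<omega> * (W s' \<omega> - W s \<omega>)\<^sup>2)" and "Y = ?Y"
      note defs = A_def B_def X_def C_def D_def Y_def
      have i: "integrable M A" "integrable M B" "integrable M X" "integrable M C" "integrable M D" "integrable M Y"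
        unfolding defs using IH(2) X2(1) Xi Y4(1) Y2(1) Yi by blast+
      have v: "expectation B = d * expectation X" "expectation C = expectation Y * (3 * d\<^sup>2)" "expectation D = d * expectation Y"
        unfolding defs using X2(2) Y4(2) Y2(2) increment_moments(4)[OF b(1,2,3)] by (simp_all add: d)
      have "expectation (\<lambda>\<omega>. (S n (Suc m) \<omega>)\<^sup>2) = expectation (\<lambda>\<omega>. A \<omega> + 2 * B \<omega> - 2 * d * X \<omega> + (C \<omega> - 2 * d * D \<omega> + d\<^sup>2 * Y \<omega>))"
        unfolding sq defs ..
      also have "\<dots> = expectation A + 2 * expectation B - 2 * d * expectation X + (expectation C - 2 * d * expectation D + d\<^sup>2 * expectation Y)"
        using i by simp
      also have "\<dots> = expectation A + 2 * d\<^sup>2 * expectation Y" unfolding v by (simp add: power2_eq_square algebra_simps)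
      finally show ?thesis unfolding A_def Y_def .
    qed
    moreover have "expectation ?Y \<le> K\<^sup>2"
    proof -
      have "expectation ?Y \<le> expectation (\<lambda>_. K\<^sup>2)" by (rule integral_mono) (use Yi c2 in auto)
      then show ?thesis by (simp add: prob_space)
    qed
    then have "2 * d\<^sup>2 * expectation ?Y \<le> 2 * d\<^sup>2 * K\<^sup>2" by (intro mult_left_mono) auto
    ultimately show ?case using IH(3) meas unfolding s'_def d_def
      by (simp add: algebra_simps)
  qed
  \<comment> \<open>For m = n the bound is \<open>2 * K\<^sup>2 * t\<^sup>2 / n\<close>; the summand
    1 keeps n positive even if this vanishes.\<close>
  define N where "N = nat \<lceil>2 * K\<^sup>2 * t\<^sup>2 / e\<rceil> + 1"
  show "\<exists>N. \<forall>n\<ge>N. integrable M (\<lambda>\<omega>. (\<Sum>k<n. c (grid t n k) \<omega> * ((incr t n k \<omega>)\<^sup>2 - t / real n))\<^sup>2) \<and>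
    expectation (\<lambda>\<omega>. \<bar>(\<Sum>k<n. c (grid t n k) \<omega> * ((incr t n k \<omega>)\<^sup>2 - t / real n))\<^sup>2\<bar>) \<le> e"
  proof (intro exI[of _ N] allI impI)
    fix n assume n: "N \<le> n"
    then have n0: "0 < real n" unfolding N_def by simp
    have "2 * K\<^sup>2 * t\<^sup>2 / e \<le> real n" using n unfolding N_def by linarith
    then have "2 * K\<^sup>2 * t\<^sup>2 \<le> real n * e" using e by (simp add: divide_le_eq)
    moreover have "real n * (2 * K\<^sup>2 * (t / real n)\<^sup>2) = 2 * K\<^sup>2 * t\<^sup>2 / real n"
      using n0 by (simp add: power2_eq_square)
    ultimately have "real n * (2 * K\<^sup>2 * (t / real n)\<^sup>2) \<le> e" using n0 by (simp add: divide_le_eq mult.commute)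
    then show "integrable M (\<lambda>\<omega>. (\<Sum>k<n. c (grid t n k) \<omega> * ((incr t n k \<omega>)\<^sup>2 - t / real n))\<^sup>2) \<and>
    expectation (\<lambda>\<omega>. \<bar>(\<Sum>k<n. c (grid t n k) \<omega> * ((incr t n k \<omega>)\<^sup>2 - t / real n))\<^sup>2\<bar>) \<le> e"
      using claim[OF order_refl, of n] unfolding S_def by simp
  qed
qed

lemma sq_increments_measurable:
  assumes "cont_adapted c" "0 \<le> t" "t \<le> T"
  shows "(\<lambda>\<omega>. \<Sum>k<n. c (grid t n k) \<omega> * ((incr t n k \<omega>)\<^sup>2 - t / real n)) \<in> borel_measurable M"
proof (rule borel_measurable_sum)
  fix k assume "k \<in> {..<n}"
  then have b: "0 \<le> grid t n k" "grid t n k \<le> T" "0 \<le> grid t n (Suc k)" "grid t n (Suc k) \<le> T"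
    using grid_bounds[of t k n] grid_bounds[of t "Suc k" n] assms by auto
  note [measurable] = cont_adapted_measurable[OF assms(1) b(1,2)] W_measurable[OF b(1,2)] W_measurable[OF b(3,4)]
  show "(\<lambda>\<omega>. c (grid t n k) \<omega> * ((incr t n k \<omega>)\<^sup>2 - t / real n)) \<in> borel_measurable M" by measurable
qed

lemma sq_increments:
  assumes c: "cont_adapted c" and t: "0 \<le> t" "t \<le> T"
  shows "conv_to_0 (\<lambda>n \<omega>. \<Sum>k<n. c (grid t n k) \<omega> * ((incr t n k \<omega>)\<^sup>2 - t / real n))"
proof (rule conv_to_0_localise)
  show "(\<lambda>\<omega>. \<Sum>k<n. c (grid t n k) \<omega> * ((incr t n k \<omega>)\<^sup>2 - t / real n)) \<in> borel_measurable M" for n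
    by (rule sq_increments_measurable[OF c t])
  fix e :: real assume "0 < e"
  then obtain K where K: "0 < K" "prob {\<omega>\<in>space M. \<exists>t\<in>dyadics. \<bar>c t \<omega>\<bar> > K} < e" using cont_adapted_tail[OF c] by auto
  define c' where "c' = (\<lambda>t \<omega>. truncate_at K (c t \<omega>))"
  have c': "cont_adapted c'" "\<And>t \<omega>. \<bar>c' t \<omega>\<bar> \<le> K" unfolding c'_def using cont_adapted_truncate_at[OF c] truncate_at_abs K by auto
  let ?B = "{\<omega>\<in>space M. \<exists>t\<in>dyadics. \<bar>c t \<omega>\<bar> > K}"
  let ?Y = "\<lambda>c n \<omega>. \<Sum>k<n. c (grid t n k) \<omega> * ((incr t n k \<omega>)\<^sup>2 - t / real n)"
  show "\<exists>Y' B. (\<forall>n. Y' n \<in> borel_measurable M) \<and> conv_to_0 Y' \<and> B \<in> sets M \<and> prob B \<le> e \<and>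
      (AE \<omega> in M. \<omega> \<notin> B \<longrightarrow> (\<forall>n. ?Y c n \<omega> = Y' n \<omega>))"
  proof (intro exI[of _ "?Y c'"] exI[of _ ?B] conjI allI)
    show "?Y c' n \<in> borel_measurable M" for n by (rule sq_increments_measurable[OF c'(1) t])
    show "conv_to_0 (?Y c')" by (rule sq_increments_bounded[OF c' t])
    show "?B \<in> sets M" by (rule exceed_measurable[OF cont_adapted_measurable[OF c]])
    show "prob ?B \<le> e" using K by simp
    show "AE \<omega> in M. \<omega> \<notin> ?B \<longrightarrow> (\<forall>n. ?Y c n \<omega> = ?Y c' n \<omega>)"
    proof (rule AE_I2, intro impI allI sum.cong refl)
      fix \<omega> and n k :: nat assume \<omega>: "\<omega> \<in> space M" "\<omega> \<notin> ?B" and k: "k \<in> {..<n}"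
      have "0 \<le> grid t n k" "grid t n k \<le> T" using grid_bounds[of t k n] t k by auto
      then have "c (grid t n k) \<omega> = c' (grid t n k) \<omega>"
        using not_exceed[OF c \<omega>(1), of K "grid t n k"] \<omega> unfolding c'_def by (auto simp: truncate_at_id)
      then show "c (grid t n k) \<omega> * ((incr t n k \<omega>)\<^sup>2 - t / real n) =
        c' (grid t n k) \<omega> * ((incr t n k \<omega>)\<^sup>2 - t / real n)" by simp
    qed
  qed
qed

end

text \<open>Treats an explicitly listed set of functions element by element through unification,
  leaving the large sums that form its elements in their syntactic shape.\<close>

lemma ballI_insert: "P a \<Longrightarrow> \<forall>x\<in>A. P x \<Longrightarrow> \<forall>x\<in>insert a A. P x" "\<forall>x\<in>{}. P x"
  by simp_all

lemma tendsto_eventually_le_ex: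
  fixes f :: "nat \<Rightarrow> real"
  assumes "f \<longlonglongrightarrow> l"
  shows "\<exists>B>0. eventually (\<lambda>n. f n \<le> B) sequentially"
proof -
  have "eventually (\<lambda>n. f n < \<bar>l\<bar> + 1) sequentially" using assms by (rule order_tendstoD) simp
  then have "eventually (\<lambda>n. f n \<le> \<bar>l\<bar> + 1) sequentially" by eventually_elim simp
  then show ?thesis by (intro exI[of _ "\<bar>l\<bar> + 1"]) auto
qed

lemma continuous_on_Icc_bounded:
  fixes a :: "real \<Rightarrow> real"
  assumes "continuous_on {0..t} a"
  shows "\<exists>C>0. \<forall>s\<in>{0..t}. \<bar>a s\<bar> \<le> C"
  using compact_imp_bounded[OF compact_continuous_image[OF assms compact_Icc]] unfolding bounded_pos by auto

section \<open>Ito's formula for a process times an exponential\<close>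

context brownian_motion
begin

text \<open>The deterministic core of Ito's formula, for one path w and one sequence of grids. On
  each cell the increment of u exp v is expanded at the left end to second order; it is linear in u,
  so the quadratic terms are du dv and u dv^2 / 2. X1 and X2 remove the first order cell errors, X3
  and X4 make them negligible in the quadratic terms, X5 and X6 turn products of increments into
  time integrals, and X7 and X8 bound the quadratic sums.\<close>

theorem ito_exp_path:
  fixes u v au av hu hv w ju jv :: "real \<Rightarrow> real"
  assumes t: "0 \<le> t" and r: "filterlim r at_top sequentially"
    and cu: "continuous_on {0..t} u" and cv: "continuous_on {0..t} v" and cau: "continuous_on {0..t} au" and cav: "continuous_on {0..t} av"
    and chu: "continuous_on {0..t} hu" and chv: "continuous_on {0..t} hv"
    and equ: "\<And>s. s \<in> {0..t} \<Longrightarrow> u s = u 0 + integral {0..s} au + ju s"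
    and eqv: "\<And>s. s \<in> {0..t} \<Longrightarrow> v s = v 0 + integral {0..s} av + jv s"
  defines "g \<equiv> \<lambda>n k. grid t (r n) k"
  defines "dW \<equiv> \<lambda>n k. w (g n (Suc k)) - w (g n k)"
  defines "\<rho>u \<equiv> \<lambda>n k. ju (g n (Suc k)) - ju (g n k) - hu (g n k) * dW n k"
  defines "\<rho>v \<equiv> \<lambda>n k. jv (g n (Suc k)) - jv (g n k) - hv (g n k) * dW n k"
  assumes X1: "(\<lambda>n. \<Sum>k<r n. exp (v (g n k)) * \<rho>u n k) \<longlonglongrightarrow> 0"
    and X2: "(\<lambda>n. \<Sum>k<r n. exp (v (g n k)) * u (g n k) * \<rho>v n k) \<longlonglongrightarrow> 0"
    and X3: "(\<lambda>n. \<Sum>k<r n. (\<rho>u n k)\<^sup>2) \<longlonglongrightarrow> 0"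
    and X4: "(\<lambda>n. \<Sum>k<r n. (\<rho>v n k)\<^sup>2) \<longlonglongrightarrow> 0"
    and X5: "(\<lambda>n. \<Sum>k<r n. exp (v (g n k)) * hu (g n k) * hv (g n k) * ((dW n k)\<^sup>2 - t / real (r n))) \<longlonglongrightarrow> 0"
    and X6: "(\<lambda>n. \<Sum>k<r n. exp (v (g n k)) * u (g n k) * (hv (g n k))\<^sup>2 * ((dW n k)\<^sup>2 - t / real (r n))) \<longlonglongrightarrow> 0"
    and X7: "(\<lambda>n. \<Sum>k<r n. (hu (g n k))\<^sup>2 * ((dW n k)\<^sup>2 - t / real (r n))) \<longlonglongrightarrow> 0"
    and X8: "(\<lambda>n. \<Sum>k<r n. (hv (g n k))\<^sup>2 * ((dW n k)\<^sup>2 - t / real (r n))) \<longlonglongrightarrow> 0"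
  shows "(\<lambda>n. (\<Sum>k<r n. exp (v (g n k)) * (hu (g n k) + u (g n k) * hv (g n k)) * dW n k) -
    (u t * exp (v t) - u 0 * exp (v 0) - integral {0..t} (\<lambda>s. exp (v s) * (au s + u s * av s + hu s * hv s + u s * (hv s)\<^sup>2 / 2)))) \<longlonglongrightarrow> 0"
proof -
  have gb: "0 \<le> g n k" "g n k \<le> t" "g n (Suc k) \<in> {0..t}" "g n k \<in> {0..t}" "g n k \<le> g n (Suc k)" if "k < r n" for n k
    using grid_bounds[OF t, of k "r n"] grid_bounds[OF t, of "Suc k" "r n"] grid_Suc(1)[OF t] that unfolding g_def by auto
  define E where "E = (\<lambda>n k. exp (v (g n k)))"
  define U where "U = (\<lambda>n k. u (g n k))"
  define du where "du = (\<lambda>n k. u (g n (Suc k)) - u (g n k))"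
  define dv where "dv = (\<lambda>n k. v (g n (Suc k)) - v (g n k))"
  define Au where "Au = (\<lambda>n k. integral {g n k..g n (Suc k)} au)"
  define Av where "Av = (\<lambda>n k. integral {g n k..g n (Suc k)} av)"
  define D where "D = (\<lambda>n. t / real (r n))"
  have comb: "integral {0..g n (Suc k)} a - integral {0..g n k} a = integral {g n k..g n (Suc k)} a"
    if "k < r n" "continuous_on {0..t} a" for n k and a :: "real \<Rightarrow> real"
  proof -
    have "a integrable_on {0..g n (Suc k)}"
      using gb[OF that(1)] by (intro integrable_continuous_interval continuous_on_subset[OF that(2)]) auto
    then show ?thesis using Henstock_Kurzweil_Integration.integral_combine[of 0 "g n k" "g n (Suc k)" a] gb[OF that(1)] by simp
  qed
  have du: "du n k = hu (g n k) * dW n k + (Au n k + \<rho>u n k)" if "k < r n" for n k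
    using equ[OF gb(3)[OF that]] equ[OF gb(4)[OF that]] comb[OF that cau] unfolding du_def \<rho>u_def Au_def by simp
  have dv: "dv n k = hv (g n k) * dW n k + (Av n k + \<rho>v n k)" if "k < r n" for n k
    using eqv[OF gb(3)[OF that]] eqv[OF gb(4)[OF that]] comb[OF that cav] unfolding dv_def \<rho>v_def Av_def by simp
  have sqsum: "(\<lambda>n. \<Sum>k<r n. (a n k + b n k)\<^sup>2) \<longlonglongrightarrow> 0"
    if "(\<lambda>n. \<Sum>k<r n. (a n k)\<^sup>2) \<longlonglongrightarrow> 0" "(\<lambda>n. \<Sum>k<r n. (b n k)\<^sup>2) \<longlonglongrightarrow> 0" for a b :: "nat \<Rightarrow> nat \<Rightarrow> real"
  proof (rule Lim_null_comparison[OF always_eventually[OF allI]])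
    show "(\<lambda>n. 2 * (\<Sum>k<r n. (a n k)\<^sup>2) + 2 * (\<Sum>k<r n. (b n k)\<^sup>2)) \<longlonglongrightarrow> 0"
      using tendsto_add[OF tendsto_mult_left[OF that(1), of 2] tendsto_mult_left[OF that(2), of 2]] by simp
    fix n
    have "norm (\<Sum>k<r n. (a n k + b n k)\<^sup>2) \<le> (\<Sum>k<r n. 2 * (a n k)\<^sup>2 + 2 * (b n k)\<^sup>2)"
    proof (rule sum_norm_le)
      fix k
      have "0 \<le> (a n k - b n k)\<^sup>2" by simp
      then have "(a n k + b n k)\<^sup>2 \<le> 2 * (a n k)\<^sup>2 + 2 * (b n k)\<^sup>2" unfolding power2_sum power2_diff by linarith
      then show "norm ((a n k + b n k)\<^sup>2) \<le> 2 * (a n k)\<^sup>2 + 2 * (b n k)\<^sup>2" by simp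
    qed
    then show "norm (\<Sum>k<r n. (a n k + b n k)\<^sup>2) \<le> 2 * (\<Sum>k<r n. (a n k)\<^sup>2) + 2 * (\<Sum>k<r n. (b n k)\<^sup>2)"
      by (simp add: sum.distrib sum_distrib_left)
  qed
  have \<alpha>: "(\<lambda>n. \<Sum>k<r n. (Au n k + \<rho>u n k)\<^sup>2) \<longlonglongrightarrow> 0"
    using grid_drift_squares[OF cau t r] by (intro sqsum[OF _ X3]) (simp only: Au_def g_def)
  have \<beta>: "(\<lambda>n. \<Sum>k<r n. (Av n k + \<rho>v n k)\<^sup>2) \<longlonglongrightarrow> 0"
    using grid_drift_squares[OF cav t r] by (intro sqsum[OF _ X4]) (simp only: Av_def g_def)
  have conv: "(\<lambda>n. \<Sum>k<r n. G (g n k) * (dW n k)\<^sup>2) \<longlonglongrightarrow> integral {0..t} G"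
    if "continuous_on {0..t} G" "(\<lambda>n. \<Sum>k<r n. G (g n k) * ((dW n k)\<^sup>2 - t / real (r n))) \<longlonglongrightarrow> 0" for G
  proof -
    have "(\<Sum>k<r n. G (g n k) * (dW n k)\<^sup>2) =
      (\<Sum>k<r n. G (g n k) * ((dW n k)\<^sup>2 - t / real (r n))) + (\<Sum>k<r n. G (grid t (r n) k) * (t / real (r n)))" for n
      unfolding sum.distrib[symmetric] g_def by (rule sum.cong) (simp_all only: right_diff_distrib diff_add_cancel)
    then show ?thesis using tendsto_add[OF that(2) grid_riemann[OF that(1) t r]] by simp
  qed
  \<comment> \<open>These limits supply the bounds on quadratic sums that Cauchy-Schwarz needs in
    \<open>product_perturbation\<close>.\<close>
  have pu: "(\<lambda>n. \<Sum>k<r n. (hu (g n k) * dW n k)\<^sup>2) \<longlonglongrightarrow> integral {0..t} (\<lambda>s. (hu s)\<^sup>2)"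
    unfolding power_mult_distrib by (rule conv) (use X7 chu in \<open>auto intro!: continuous_intros\<close>)
  have pv: "(\<lambda>n. \<Sum>k<r n. (hv (g n k) * dW n k)\<^sup>2) \<longlonglongrightarrow> integral {0..t} (\<lambda>s. (hv s)\<^sup>2)"
    unfolding power_mult_distrib by (rule conv) (use X8 chv in \<open>auto intro!: continuous_intros\<close>)
  obtain Bu where Bu: "eventually (\<lambda>n. (\<Sum>k<r n. (hu (g n k) * dW n k)\<^sup>2) \<le> Bu) sequentially" using tendsto_eventually_le_ex[OF pu] by auto
  obtain Bv where Bv: "eventually (\<lambda>n. (\<Sum>k<r n. (hv (g n k) * dW n k)\<^sup>2) \<le> Bv) sequentially" using tendsto_eventually_le_ex[OF pv] by auto
  have cE: "continuous_on {0..t} (\<lambda>s. exp (v s))" using cv by (intro continuous_intros)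
  obtain C where C: "0 < C" "\<And>s. s \<in> {0..t} \<Longrightarrow> \<bar>exp (v s)\<bar> \<le> C" using continuous_on_Icc_bounded[OF cE] by auto
  obtain C' where C': "0 < C'" "\<And>s. s \<in> {0..t} \<Longrightarrow> \<bar>u s\<bar> \<le> C'" using continuous_on_Icc_bounded[OF cu] by auto
  have EC: "\<bar>E n k\<bar> \<le> C" and UC: "\<bar>U n k\<bar> \<le> C'" if "k < r n" for n k
    using C(2)[OF gb(4)[OF that]] C'(2)[OF gb(4)[OF that]] unfolding E_def U_def by auto
  have EUC: "\<bar>E n k * U n k\<bar> \<le> C * C'" if "k < r n" for n k
    unfolding abs_mult using EC[OF that] UC[OF that] C(1) by (intro mult_mono) auto
  have Q1: "(\<lambda>n. \<Sum>k<r n. E n k * (du n k * dv n k)) \<longlonglongrightarrow> integral {0..t} (\<lambda>s. exp (v s) * hu s * hv s)"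
  proof -
    have 1: "(\<lambda>n. \<Sum>k<r n. E n k * ((hu (g n k) * dW n k + (Au n k + \<rho>u n k)) * (hv (g n k) * dW n k + (Av n k + \<rho>v n k)) - hu (g n k) * dW n k * (hv (g n k) * dW n k))) \<longlonglongrightarrow> 0"
      by (rule product_perturbation[OF EC Bu Bv \<alpha> \<beta>])
    have 2: "(\<lambda>n. \<Sum>k<r n. exp (v (g n k)) * hu (g n k) * hv (g n k) * (dW n k)\<^sup>2) \<longlonglongrightarrow> integral {0..t} (\<lambda>s. exp (v s) * hu s * hv s)"
      by (rule conv[of "\<lambda>s. exp (v s) * hu s * hv s"]) (use X5 chv chu cE in \<open>auto intro!: continuous_intros\<close>)
    have "(\<Sum>k<r n. E n k * (du n k * dv n k)) =
      (\<Sum>k<r n. E n k * ((hu (g n k) * dW n k + (Au n k + \<rho>u n k)) * (hv (g n k) * dW n k + (Av n k + \<rho>v n k)) - hu (g n k) * dW n k * (hv (g n k) * dW n k))) +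
      (\<Sum>k<r n. exp (v (g n k)) * hu (g n k) * hv (g n k) * (dW n k)\<^sup>2)" for n
      unfolding sum.distrib[symmetric]
    proof (rule sum.cong[OF refl])
      fix k assume "k \<in> {..<r n}"
      then have k: "k < r n" by simp
      show "E n k * (du n k * dv n k) = E n k * ((hu (g n k) * dW n k + (Au n k + \<rho>u n k)) * (hv (g n k) * dW n k + (Av n k + \<rho>v n k)) - hu (g n k) * dW n k * (hv (g n k) * dW n k)) +
        exp (v (g n k)) * hu (g n k) * hv (g n k) * (dW n k)\<^sup>2"
        unfolding du[OF k, symmetric] dv[OF k, symmetric] E_def by (simp add: power2_eq_square algebra_simps)
    qed
    then show ?thesis using tendsto_add[OF 1 2] by simp
  qed
  have Q2: "(\<lambda>n. \<Sum>k<r n. E n k * U n k * (dv n k * dv n k)) \<longlonglongrightarrow> integral {0..t} (\<lambda>s. exp (v s) * u s * (hv s)\<^sup>2)"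
  proof -
    have 1: "(\<lambda>n. \<Sum>k<r n. E n k * U n k * ((hv (g n k) * dW n k + (Av n k + \<rho>v n k)) * (hv (g n k) * dW n k + (Av n k + \<rho>v n k)) - hv (g n k) * dW n k * (hv (g n k) * dW n k))) \<longlonglongrightarrow> 0"
      by (rule product_perturbation[OF EUC Bv Bv \<beta> \<beta>])
    have 2: "(\<lambda>n. \<Sum>k<r n. exp (v (g n k)) * u (g n k) * (hv (g n k))\<^sup>2 * (dW n k)\<^sup>2) \<longlonglongrightarrow> integral {0..t} (\<lambda>s. exp (v s) * u s * (hv s)\<^sup>2)"
      by (rule conv[of "\<lambda>s. exp (v s) * u s * (hv s)\<^sup>2"]) (use X6 chv cu cE in \<open>auto intro!: continuous_intros\<close>)
    have "(\<Sum>k<r n. E n k * U n k * (dv n k * dv n k)) =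
      (\<Sum>k<r n. E n k * U n k * ((hv (g n k) * dW n k + (Av n k + \<rho>v n k)) * (hv (g n k) * dW n k + (Av n k + \<rho>v n k)) - hv (g n k) * dW n k * (hv (g n k) * dW n k))) +
      (\<Sum>k<r n. exp (v (g n k)) * u (g n k) * (hv (g n k))\<^sup>2 * (dW n k)\<^sup>2)" for n
      unfolding sum.distrib[symmetric]
    proof (rule sum.cong[OF refl])
      fix k assume "k \<in> {..<r n}"
      then have k: "k < r n" by simp
      show "E n k * U n k * (dv n k * dv n k) = E n k * U n k * ((hv (g n k) * dW n k + (Av n k + \<rho>v n k)) * (hv (g n k) * dW n k + (Av n k + \<rho>v n k)) - hv (g n k) * dW n k * (hv (g n k) * dW n k)) +
        exp (v (g n k)) * u (g n k) * (hv (g n k))\<^sup>2 * (dW n k)\<^sup>2"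
        unfolding dv[OF k, symmetric] E_def U_def by (simp add: power2_eq_square algebra_simps)
    qed
    then show ?thesis using tendsto_add[OF 1 2] by simp
  qed
  obtain B where B: "B > 0" "eventually (\<lambda>n. (\<Sum>k<r n. (dv n k)\<^sup>2) \<le> B) sequentially"
  proof -
    have 1: "(\<lambda>n. \<Sum>k<r n. 1 * ((hv (g n k) * dW n k + (Av n k + \<rho>v n k)) * (hv (g n k) * dW n k + (Av n k + \<rho>v n k)) - hv (g n k) * dW n k * (hv (g n k) * dW n k))) \<longlonglongrightarrow> 0"
      by (rule product_perturbation[OF _ Bv Bv \<beta> \<beta>, of _ 1]) auto
    have "(\<Sum>k<r n. (dv n k)\<^sup>2) =
      (\<Sum>k<r n. 1 * ((hv (g n k) * dW n k + (Av n k + \<rho>v n k)) * (hv (g n k) * dW n k + (Av n k + \<rho>v n k)) - hv (g n k) * dW n k * (hv (g n k) * dW n k))) +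
      (\<Sum>k<r n. (hv (g n k) * dW n k)\<^sup>2)" for n
      unfolding sum.distrib[symmetric]
    proof (rule sum.cong[OF refl])
      fix k assume "k \<in> {..<r n}"
      then have k: "k < r n" by simp
      show "(dv n k)\<^sup>2 = 1 * ((hv (g n k) * dW n k + (Av n k + \<rho>v n k)) * (hv (g n k) * dW n k + (Av n k + \<rho>v n k)) - hv (g n k) * dW n k * (hv (g n k) * dW n k)) + (hv (g n k) * dW n k)\<^sup>2"
        unfolding dv[OF k, symmetric] by (simp add: power2_eq_square)
    qed
    then have "(\<lambda>n. \<Sum>k<r n. (dv n k)\<^sup>2) \<longlonglongrightarrow> 0 + integral {0..t} (\<lambda>s. (hv s)\<^sup>2)" using tendsto_add[OF 1 pv] by simp
    from tendsto_eventually_le_ex[OF this] that show ?thesis by auto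
  qed
  \<comment> \<open>The increment of u exp v over a cell, divided by exp v at its left end, minus
    the second order expansion. Everything left is of third order.\<close>
  define err where "err = (\<lambda>n k. (U n k + du n k) * exp (dv n k) - U n k - du n k - U n k * dv n k - du n k * dv n k - U n k * (dv n k * dv n k) / 2)"
  have errlim: "(\<lambda>n. \<Sum>k<r n. E n k * err n k) \<longlonglongrightarrow> 0"
  proof (rule LIMSEQ_I)
    fix e :: real assume e: "0 < e"
    \<comment> \<open>C bounds exp v, C' bounds u in front of the third order Taylor remainder, and
      2 is the constant of the second order remainder, which du multiplies. Below, the minimum with
      1 makes the Taylor bounds applicable, and the other value of epsilon makes the total at most e
      / 2.\<close>
    define C2 where "C2 = C * (C' + 2)"
    have C2: "0 < C2" unfolding C2_def using C C' by simp
    define \<epsilon> where "\<epsilon> = min 1 (e / (2 * C2 * B))"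
    have \<epsilon>: "0 < \<epsilon>" "\<epsilon> \<le> 1" "\<epsilon> \<le> e / (2 * C2 * B)" unfolding \<epsilon>_def using e C2 B by auto
    have "eventually (\<lambda>n. norm ((\<Sum>k<r n. E n k * err n k) - 0) < e) sequentially"
      using grid_oscillation[OF cu t r \<epsilon>(1)] grid_oscillation[OF cv t r \<epsilon>(1)] B(2)
    proof eventually_elim
      case (elim n)
      have "norm (\<Sum>k<r n. E n k * err n k) \<le> (\<Sum>k<r n. C2 * \<epsilon> * (dv n k)\<^sup>2)"
      proof (rule sum_norm_le)
        fix k assume "k \<in> {..<r n}"
        then have k: "k < r n" by simp
        have "g n (Suc k) \<in> {grid t (r n) k..grid t (r n) (Suc k)}" using gb[OF k] unfolding g_def by simp
        then have d1: "\<bar>du n k\<bar> \<le> \<epsilon>" and d2: "\<bar>dv n k\<bar> \<le> \<epsilon>" using elim(1,2) k unfolding du_def dv_def g_def by auto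
        then have "\<bar>dv n k\<bar> \<le> 1" using \<epsilon>(2) by linarith
        note tb = exp_taylor_bounds[OF this]
        have "err n k = U n k * (exp (dv n k) - 1 - dv n k - (dv n k)\<^sup>2 / 2) + du n k * (exp (dv n k) - 1 - dv n k)"
          unfolding err_def by (simp add: algebra_simps power2_eq_square)
        then have "\<bar>err n k\<bar> \<le> \<bar>U n k\<bar> * \<bar>exp (dv n k) - 1 - dv n k - (dv n k)\<^sup>2 / 2\<bar> + \<bar>du n k\<bar> * \<bar>exp (dv n k) - 1 - dv n k\<bar>"
          unfolding abs_mult[symmetric] by linarith
        also have "\<dots> \<le> C' * (\<bar>dv n k\<bar> * (dv n k)\<^sup>2) + \<epsilon> * (2 * (dv n k)\<^sup>2)"
          using UC[OF k] tb d1 C' \<epsilon> by (intro add_mono mult_mono) auto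
        also have "\<dots> \<le> C' * (\<epsilon> * (dv n k)\<^sup>2) + \<epsilon> * (2 * (dv n k)\<^sup>2)"
          using d2 C' by (intro add_mono mult_left_mono mult_right_mono order_refl) auto
        also have "\<dots> = (C' + 2) * (\<epsilon> * (dv n k)\<^sup>2)" by (simp add: algebra_simps)
        finally have "\<bar>E n k\<bar> * \<bar>err n k\<bar> \<le> C * ((C' + 2) * (\<epsilon> * (dv n k)\<^sup>2))" using EC[OF k] C by (intro mult_mono) auto
        then show "norm (E n k * err n k) \<le> C2 * \<epsilon> * (dv n k)\<^sup>2" unfolding C2_def by (simp add: abs_mult mult.assoc)
      qed
      also have "\<dots> = C2 * \<epsilon> * (\<Sum>k<r n. (dv n k)\<^sup>2)" by (simp add: sum_distrib_left)
      also have "\<dots> \<le> C2 * (e / (2 * C2 * B)) * B" using elim(3) \<epsilon> C2 B(1) e by (intro mult_mono) (auto simp: sum_nonneg)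
      also have "\<dots> = e / 2" using C2 B by simp
      also have "\<dots> < e" using e by simp
      finally show ?case by simp
    qed
    then show "\<exists>no. \<forall>n\<ge>no. norm ((\<Sum>k<r n. E n k * err n k) - 0) < e" unfolding eventually_sequentially .
  qed
  have R1: "(\<lambda>n. \<Sum>k<r n. E n k * Au n k) \<longlonglongrightarrow> integral {0..t} (\<lambda>s. exp (v s) * au s)"
    using grid_weighted_riemann[OF cau cE t r] unfolding E_def Au_def g_def .
  have R2: "(\<lambda>n. \<Sum>k<r n. E n k * U n k * Av n k) \<longlonglongrightarrow> integral {0..t} (\<lambda>s. exp (v s) * u s * av s)"
    using grid_weighted_riemann[OF cav continuous_on_mult[OF cE cu] t r] unfolding E_def U_def Av_def g_def .
  have X1': "(\<lambda>n. \<Sum>k<r n. E n k * \<rho>u n k) \<longlonglongrightarrow> 0" using X1 unfolding E_def .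
  have X2': "(\<lambda>n. \<Sum>k<r n. E n k * U n k * \<rho>v n k) \<longlonglongrightarrow> 0" using X2 unfolding E_def U_def .
  define I where "I = integral {0..t} (\<lambda>s. exp (v s) * (au s + u s * av s + hu s * hv s + u s * (hv s)\<^sup>2 / 2))"
  have Ieq: "I = integral {0..t} (\<lambda>s. exp (v s) * au s) + integral {0..t} (\<lambda>s. exp (v s) * u s * av s) +
    integral {0..t} (\<lambda>s. exp (v s) * hu s * hv s) + integral {0..t} (\<lambda>s. exp (v s) * u s * (hv s)\<^sup>2) / 2"
  proof -
    have i: "(\<lambda>s. exp (v s) * au s) integrable_on {0..t}" "(\<lambda>s. exp (v s) * u s * av s) integrable_on {0..t}"
      "(\<lambda>s. exp (v s) * hu s * hv s) integrable_on {0..t}" "(\<lambda>s. exp (v s) * u s * (hv s)\<^sup>2) integrable_on {0..t}"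
      by (intro integrable_continuous_interval continuous_intros cE cau cav cu chu chv)+
    have "((\<lambda>s. exp (v s) * au s + exp (v s) * u s * av s + exp (v s) * hu s * hv s + (exp (v s) * u s * (hv s)\<^sup>2) / 2) has_integral
      integral {0..t} (\<lambda>s. exp (v s) * au s) + integral {0..t} (\<lambda>s. exp (v s) * u s * av s) +
      integral {0..t} (\<lambda>s. exp (v s) * hu s * hv s) + integral {0..t} (\<lambda>s. exp (v s) * u s * (hv s)\<^sup>2) / 2) {0..t}"
      by (intro has_integral_add has_integral_divide integrable_integral i)
    moreover have "(\<lambda>s. exp (v s) * au s + exp (v s) * u s * av s + exp (v s) * hu s * hv s + (exp (v s) * u s * (hv s)\<^sup>2) / 2) =
      (\<lambda>s. exp (v s) * (au s + u s * av s + hu s * hv s + u s * (hv s)\<^sup>2 / 2))" by (simp add: fun_eq_iff algebra_simps)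
    ultimately show ?thesis unfolding I_def by (intro integral_unique) (simp only:)
  qed
  let ?L = "\<lambda>n. I - ((\<Sum>k<r n. E n k * \<rho>u n k) + (\<Sum>k<r n. E n k * U n k * \<rho>v n k) + (\<Sum>k<r n. E n k * Au n k) + (\<Sum>k<r n. E n k * U n k * Av n k) +
    (\<Sum>k<r n. E n k * (du n k * dv n k)) + (\<Sum>k<r n. E n k * U n k * (dv n k * dv n k)) / 2 + (\<Sum>k<r n. E n k * err n k))"
  have "?L \<longlonglongrightarrow> I - (0 + 0 + integral {0..t} (\<lambda>s. exp (v s) * au s) + integral {0..t} (\<lambda>s. exp (v s) * u s * av s) +
    integral {0..t} (\<lambda>s. exp (v s) * hu s * hv s) + integral {0..t} (\<lambda>s. exp (v s) * u s * (hv s)\<^sup>2) / 2 + 0)"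
    by (intro tendsto_diff tendsto_add tendsto_const X1' X2' R1 R2 Q1 errlim tendsto_divide[OF Q2]) auto
  then have L0: "?L \<longlonglongrightarrow> 0" unfolding Ieq by simp
  have "eventually (\<lambda>n. 0 < r n) sequentially" using r[unfolded filterlim_at_top, rule_format, of 1] by eventually_elim simp
  then have "eventually (\<lambda>n. ?L n = (\<Sum>k<r n. exp (v (g n k)) * (hu (g n k) + u (g n k) * hv (g n k)) * dW n k) -
    (u t * exp (v t) - u 0 * exp (v 0) - I)) sequentially"
  proof eventually_elim
    case (elim n)
    have tele: "u t * exp (v t) - u 0 * exp (v 0) = (\<Sum>k<r n. u (g n (Suc k)) * exp (v (g n (Suc k))) - u (g n k) * exp (v (g n k)))"
      using sum_lessThan_telescope[of "\<lambda>k. u (g n k) * exp (v (g n k))" "r n"] grid_ends(1)[of t "r n"] grid_ends(2)[OF elim, of t]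
      unfolding g_def by simp
    have "(\<Sum>k<r n. exp (v (g n k)) * (hu (g n k) + u (g n k) * hv (g n k)) * dW n k - (u (g n (Suc k)) * exp (v (g n (Suc k))) - u (g n k) * exp (v (g n k)))) =
      (\<Sum>k<r n. - (E n k * \<rho>u n k + E n k * U n k * \<rho>v n k + E n k * Au n k + E n k * U n k * Av n k + E n k * (du n k * dv n k) + (E n k * U n k * (dv n k * dv n k)) / 2 + E n k * err n k))"
    proof (rule sum.cong[OF refl])
      fix k assume "k \<in> {..<r n}"
      then have k: "k < r n" by simp
      have 1: "u (g n (Suc k)) = U n k + du n k" unfolding U_def du_def by simp
      have 2: "exp (v (g n (Suc k))) = E n k * exp (dv n k)" unfolding E_def dv_def by (simp add: exp_add[symmetric])
      have 3: "\<rho>u n k = du n k - hu (g n k) * dW n k - Au n k" "\<rho>v n k = dv n k - hv (g n k) * dW n k - Av n k"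
        using du[OF k] dv[OF k] by auto
      have 4: "exp (v (g n k)) = E n k" "u (g n k) = U n k" unfolding E_def U_def by simp_all
      show "exp (v (g n k)) * (hu (g n k) + u (g n k) * hv (g n k)) * dW n k - (u (g n (Suc k)) * exp (v (g n (Suc k))) - u (g n k) * exp (v (g n k))) =
        - (E n k * \<rho>u n k + E n k * U n k * \<rho>v n k + E n k * Au n k + E n k * U n k * Av n k + E n k * (du n k * dv n k) + (E n k * U n k * (dv n k * dv n k)) / 2 + E n k * err n k)"
        unfolding 1 2 3 4 err_def by (simp add: algebra_simps)
    qed
    then show ?case unfolding tele sum_subtractf sum_negf sum.distrib sum_divide_distrib[symmetric] by linarith
  qed
  from Lim_transform_eventually[OF L0 this] show ?thesis unfolding I_def .
qed

text \<open>The integral up to t is a limit of Riemann sums at times not after t, each of them known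
  at time t.\<close>

lemma cont_adapted_integral:
  assumes a: "cont_adapted a"
  shows "cont_adapted (\<lambda>t \<omega>. integral {0..t} (\<lambda>s. a s \<omega>))"
proof (rule cadI)
  fix \<omega> assume "\<omega> \<in> space M"
  then show "continuous_on {0..T} (\<lambda>t. integral {0..t} (\<lambda>s. a s \<omega>))"
    using cont_adapted_cont[OF a] by (intro indefinite_integral_continuous_1 integrable_continuous_interval)
next
  fix t assume t: "0 \<le> t" "t \<le> T"
  show "(\<lambda>\<omega>. integral {0..t} (\<lambda>s. a s \<omega>)) \<in> borel_measurable (Ft t)"
  proof (rule borel_measurable_LIMSEQ_real)
    fix \<omega> assume "\<omega> \<in> space (Ft t)"
    then have "continuous_on {0..T} (\<lambda>s. a s \<omega>)" using cont_adapted_cont[OF a] by simp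
    then have "continuous_on {0..t} (\<lambda>s. a s \<omega>)" by (rule continuous_on_subset) (use t in auto)
    from grid_riemann[OF this t(1) filterlim_ident]
    show "(\<lambda>n. \<Sum>k<n. a (grid t n k) \<omega> * (t / real n)) \<longlonglongrightarrow> integral {0..t} (\<lambda>s. a s \<omega>)" .
  next
    fix n
    show "(\<lambda>\<omega>. \<Sum>k<n. a (grid t n k) \<omega> * (t / real n)) \<in> borel_measurable (Ft t)"
    proof (rule borel_measurable_sum)
      fix k assume "k \<in> {..<n}"
      then have "0 \<le> grid t n k" "grid t n k \<le> t" using grid_bounds[OF t(1), of k n] by auto
      from cont_adapted_Ft[OF a this t(2)] show "(\<lambda>\<omega>. a (grid t n k) \<omega> * (t / real n)) \<in> borel_measurable (Ft t)" by simp
    qed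
  qed
qed

lemma cont_adapted_exp: "cont_adapted v \<Longrightarrow> cont_adapted (\<lambda>t \<omega>. exp (v t \<omega>))"
  by (rule cont_adapted_compose[OF _ continuous_on_exp[OF continuous_on_id]])

lemma cont_adapted_power2: "cont_adapted v \<Longrightarrow> cont_adapted (\<lambda>t \<omega>. (v t \<omega>)\<^sup>2)"
  unfolding power2_eq_square by (rule cont_adapted_mult)

text \<open>All eight sums vanish in probability, so \<open>conv_to_0_combine\<close> reduces the
  claim to \<open>ito_exp_path\<close> along subsequences. The conclusion is about the Riemann sums
  themselves, which is the form in which the definition of a solution speaks of the
  integral.\<close>

theorem ito_exp_product:
  assumes cont_adapted: "cont_adapted u" "cont_adapted v" "cont_adapted au" "cont_adapted av" "cont_adapted Hu" "cont_adapted Hv" and ito: "ito Hu Ju" "ito Hv Jv"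
    and equ: "AE \<omega> in M. \<forall>t\<in>{0..T}. u t \<omega> = u 0 \<omega> + integral {0..t} (\<lambda>s. au s \<omega>) + Ju t \<omega>"
    and eqv: "AE \<omega> in M. \<forall>t\<in>{0..T}. v t \<omega> = v 0 \<omega> + integral {0..t} (\<lambda>s. av s \<omega>) + Jv t \<omega>"
  shows "is_ito_integral M T W (\<lambda>s \<omega>. exp (v s \<omega>) * (Hu s \<omega> + u s \<omega> * Hv s \<omega>))
    (\<lambda>t \<omega>. u t \<omega> * exp (v t \<omega>) - u 0 \<omega> * exp (v 0 \<omega>) -
      integral {0..t} (\<lambda>s. exp (v s \<omega>) * (au s \<omega> + u s \<omega> * av s \<omega> + Hu s \<omega> * Hv s \<omega> + u s \<omega> * (Hv s \<omega>)\<^sup>2 / 2)))"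
  unfolding is_ito_integral_grid
proof (intro ballI conjI)
  fix t assume "t \<in> {0..T}"
  then have t: "0 \<le> t" "t \<le> T" by auto
  let ?I = "\<lambda>\<omega>. u t \<omega> * exp (v t \<omega>) - u 0 \<omega> * exp (v 0 \<omega>) -
      integral {0..t} (\<lambda>s. exp (v s \<omega>) * (au s \<omega> + u s \<omega> * av s \<omega> + Hu s \<omega> * Hv s \<omega> + u s \<omega> * (Hv s \<omega>)\<^sup>2 / 2))"
  have cE: "cont_adapted (\<lambda>s \<omega>. exp (v s \<omega>))" by (rule cont_adapted_exp[OF cont_adapted(2)])
  have half: "cont_adapted (\<lambda>s \<omega>. u s \<omega> * (Hv s \<omega>)\<^sup>2 / 2)"
    using cont_adapted_mult[OF cont_adapted_mult[OF cont_adapted(1) cont_adapted_power2[OF cont_adapted(6)]] cont_adapted_const[of "1 / 2"]] by simp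
  have cI: "cont_adapted (\<lambda>s \<omega>. exp (v s \<omega>) * (au s \<omega> + u s \<omega> * av s \<omega> + Hu s \<omega> * Hv s \<omega> + u s \<omega> * (Hv s \<omega>)\<^sup>2 / 2))"
    by (intro cont_adapted_mult[OF cE] cont_adapted_add half cont_adapted cont_adapted_mult)
  have mu: "(\<lambda>\<omega>. u s \<omega> * exp (v s \<omega>)) \<in> borel_measurable M" if "0 \<le> s" "s \<le> T" for s
    using cont_adapted_measurable[OF cont_adapted_mult[OF cont_adapted(1) cE] that] .
  show mI: "?I \<in> borel_measurable M"
    using mu[OF t] mu[of 0] T_pos cont_adapted_measurable[OF cont_adapted_integral[OF cI] t] by simp
  have cH: "cont_adapted (\<lambda>s \<omega>. exp (v s \<omega>) * (Hu s \<omega> + u s \<omega> * Hv s \<omega>))"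
    by (intro cont_adapted_mult[OF cE] cont_adapted_add cont_adapted cont_adapted_mult)
  have cEu: "cont_adapted (\<lambda>s \<omega>. exp (v s \<omega>) * u s \<omega>)" by (rule cont_adapted_mult[OF cE cont_adapted(1)])
  let ?D = "\<lambda>n k \<omega>. W (grid t n (Suc k)) \<omega> - W (grid t n k) \<omega>"
  let ?X1 = "\<lambda>n \<omega>. \<Sum>k<n. exp (v (grid t n k) \<omega>) * ito_remainder Hu Ju t n k \<omega>"
  let ?X2 = "\<lambda>n \<omega>. \<Sum>k<n. exp (v (grid t n k) \<omega>) * u (grid t n k) \<omega> * ito_remainder Hv Jv t n k \<omega>"
  let ?X3 = "\<lambda>n \<omega>. \<Sum>k<n. (ito_remainder Hu Ju t n k \<omega>)\<^sup>2"
  let ?X4 = "\<lambda>n \<omega>. \<Sum>k<n. (ito_remainder Hv Jv t n k \<omega>)\<^sup>2"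
  let ?X5 = "\<lambda>n \<omega>. \<Sum>k<n. exp (v (grid t n k) \<omega>) * Hu (grid t n k) \<omega> * Hv (grid t n k) \<omega> * ((?D n k \<omega>)\<^sup>2 - t / real n)"
  let ?X6 = "\<lambda>n \<omega>. \<Sum>k<n. exp (v (grid t n k) \<omega>) * u (grid t n k) \<omega> * (Hv (grid t n k) \<omega>)\<^sup>2 * ((?D n k \<omega>)\<^sup>2 - t / real n)"
  let ?X7 = "\<lambda>n \<omega>. \<Sum>k<n. (Hu (grid t n k) \<omega>)\<^sup>2 * ((?D n k \<omega>)\<^sup>2 - t / real n)"
  let ?X8 = "\<lambda>n \<omega>. \<Sum>k<n. (Hv (grid t n k) \<omega>)\<^sup>2 * ((?D n k \<omega>)\<^sup>2 - t / real n)"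
  have wm: "(\<lambda>\<omega>. \<Sum>k<n. G (grid t n k) \<omega> * ito_remainder H J t n k \<omega>) \<in> borel_measurable M" if "cont_adapted H" "ito H J" "cont_adapted G" for n G H J
  proof (rule borel_measurable_sum)
    fix k assume "k \<in> {..<n}"
    then have k: "k < n" by simp
    have "0 \<le> grid t n k" "grid t n k \<le> T" using grid_bounds[of t k n] t k by auto
    note [measurable] = cont_adapted_measurable[OF that(3) this] ito_remainder_measurable[OF that(1) ito_cont_adapted[OF that(2)] t k]
    show "(\<lambda>\<omega>. G (grid t n k) \<omega> * ito_remainder H J t n k \<omega>) \<in> borel_measurable M" by measurable
  qed
  have sm: "(\<lambda>\<omega>. \<Sum>k<n. (ito_remainder H J t n k \<omega>)\<^sup>2) \<in> borel_measurable M" if "cont_adapted H" "ito H J" for n H J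
    using ito_remainder_measurable[OF that(1) ito_cont_adapted[OF that(2)] t] by (intro borel_measurable_sum borel_measurable_power) auto
  have c: "conv_to_0 ?X1" "conv_to_0 ?X2" "conv_to_0 ?X3" "conv_to_0 ?X4" "conv_to_0 ?X5" "conv_to_0 ?X6" "conv_to_0 ?X7" "conv_to_0 ?X8"
    by (fact weighted_ito_remainder[OF cont_adapted(5) ito(1) cE t] weighted_ito_remainder[OF cont_adapted(6) ito(2) cEu t] ito_remainder_squares[OF cont_adapted(5) ito(1) t] ito_remainder_squares[OF cont_adapted(6) ito(2) t]
        sq_increments[OF cont_adapted_mult[OF cont_adapted_mult[OF cE cont_adapted(5)] cont_adapted(6)] t] sq_increments[OF cont_adapted_mult[OF cEu cont_adapted_power2[OF cont_adapted(6)]] t]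
        sq_increments[OF cont_adapted_power2[OF cont_adapted(5)] t] sq_increments[OF cont_adapted_power2[OF cont_adapted(6)] t])+
  have m: "?X1 n \<in> borel_measurable M" "?X2 n \<in> borel_measurable M" "?X3 n \<in> borel_measurable M" "?X4 n \<in> borel_measurable M"
    "?X5 n \<in> borel_measurable M" "?X6 n \<in> borel_measurable M" "?X7 n \<in> borel_measurable M" "?X8 n \<in> borel_measurable M" for n
    by (fact wm[OF cont_adapted(5) ito(1) cE] wm[OF cont_adapted(6) ito(2) cEu] sm[OF cont_adapted(5) ito(1)] sm[OF cont_adapted(6) ito(2)]
        sq_increments_measurable[OF cont_adapted_mult[OF cont_adapted_mult[OF cE cont_adapted(5)] cont_adapted(6)] t] sq_increments_measurable[OF cont_adapted_mult[OF cEu cont_adapted_power2[OF cont_adapted(6)]] t]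
        sq_increments_measurable[OF cont_adapted_power2[OF cont_adapted(5)] t] sq_increments_measurable[OF cont_adapted_power2[OF cont_adapted(6)] t])+
  have "conv_to_0 (\<lambda>n \<omega>. (\<Sum>k<n. exp (v (grid t n k) \<omega>) * (Hu (grid t n k) \<omega> + u (grid t n k) \<omega> * Hv (grid t n k) \<omega>) * ?D n k \<omega>) - ?I \<omega>)"
  \<comment> \<open>The index set consists of the eight sequences themselves, indexed by the
    identity.\<close>
  proof (rule conv_to_0_combine[where I="{?X1, ?X2, ?X3, ?X4, ?X5, ?X6, ?X7, ?X8}" and X="\<lambda>x. x"])
    fix i assume i: "i \<in> {?X1, ?X2, ?X3, ?X4, ?X5, ?X6, ?X7, ?X8}"
    have "\<forall>i\<in>{?X1, ?X2, ?X3, ?X4, ?X5, ?X6, ?X7, ?X8}. conv_to_0 i" by (intro ballI_insert c)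
    then show "conv_to_0 i" using i by (rule bspec)
    fix n
    have "\<forall>i\<in>{?X1, ?X2, ?X3, ?X4, ?X5, ?X6, ?X7, ?X8}. i n \<in> borel_measurable M" by (intro ballI_insert m)
    then show "i n \<in> borel_measurable M" using i by (rule bspec)
  next
    fix n
    show "(\<lambda>\<omega>. (\<Sum>k<n. exp (v (grid t n k) \<omega>) * (Hu (grid t n k) \<omega> + u (grid t n k) \<omega> * Hv (grid t n k) \<omega>) * ?D n k \<omega>) - ?I \<omega>) \<in> borel_measurable M"
      by (intro borel_measurable_diff[OF riemann_sum_measurable[OF cH t] mI])
  next
    show "AE \<omega> in M. \<forall>r. strict_mono r \<longrightarrow> (\<forall>i\<in>{?X1, ?X2, ?X3, ?X4, ?X5, ?X6, ?X7, ?X8}. (\<lambda>n. i (r n) \<omega>) \<longlonglongrightarrow> 0) \<longrightarrow>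
      (\<lambda>n. (\<Sum>k<r n. exp (v (grid t (r n) k) \<omega>) * (Hu (grid t (r n) k) \<omega> + u (grid t (r n) k) \<omega> * Hv (grid t (r n) k) \<omega>) * ?D (r n) k \<omega>) - ?I \<omega>) \<longlonglongrightarrow> 0"
      using equ eqv AE_space
    proof eventually_elim
      case (elim \<omega>)
      show ?case
      proof (intro allI impI)
        fix r assume r: "strict_mono (r :: nat \<Rightarrow> nat)"
          and lim: "\<forall>i\<in>{?X1, ?X2, ?X3, ?X4, ?X5, ?X6, ?X7, ?X8}. (\<lambda>n. i (r n) \<omega>) \<longlonglongrightarrow> 0"
        have lim': "(\<lambda>n. ?X1 (r n) \<omega>) \<longlonglongrightarrow> 0" "(\<lambda>n. ?X2 (r n) \<omega>) \<longlonglongrightarrow> 0" "(\<lambda>n. ?X3 (r n) \<omega>) \<longlonglongrightarrow> 0" "(\<lambda>n. ?X4 (r n) \<omega>) \<longlonglongrightarrow> 0"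
          "(\<lambda>n. ?X5 (r n) \<omega>) \<longlonglongrightarrow> 0" "(\<lambda>n. ?X6 (r n) \<omega>) \<longlonglongrightarrow> 0" "(\<lambda>n. ?X7 (r n) \<omega>) \<longlonglongrightarrow> 0" "(\<lambda>n. ?X8 (r n) \<omega>) \<longlonglongrightarrow> 0"
          by (rule bspec[OF lim]; intro insertI1 insertI2)+
        have c: "continuous_on {0..t} (\<lambda>s. a s \<omega>)" if "cont_adapted a" for a
          by (rule continuous_on_subset[OF cont_adapted_cont[OF that elim(3)]]) (use t in auto)
        have e1: "u s \<omega> = u 0 \<omega> + integral {0..s} (\<lambda>s. au s \<omega>) + Ju s \<omega>" if "s \<in> {0..t}" for s by (rule bspec[OF elim(1)]) (use that t in auto)
        have e2: "v s \<omega> = v 0 \<omega> + integral {0..s} (\<lambda>s. av s \<omega>) + Jv s \<omega>" if "s \<in> {0..t}" for s by (rule bspec[OF elim(2)]) (use that t in auto)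
        show "(\<lambda>n. (\<Sum>k<r n. exp (v (grid t (r n) k) \<omega>) * (Hu (grid t (r n) k) \<omega> + u (grid t (r n) k) \<omega> * Hv (grid t (r n) k) \<omega>) * ?D (r n) k \<omega>) - ?I \<omega>) \<longlonglongrightarrow> 0"
          by (rule ito_exp_path[where u="\<lambda>s. u s \<omega>" and v="\<lambda>s. v s \<omega>" and au="\<lambda>s. au s \<omega>" and av="\<lambda>s. av s \<omega>" and hu="\<lambda>s. Hu s \<omega>" and hv="\<lambda>s. Hv s \<omega>" and w="\<lambda>s. W s \<omega>" and ju="\<lambda>s. Ju s \<omega>" and jv="\<lambda>s. Jv s \<omega>" and t=t and r=r,
              OF t(1) filterlim_subseq[OF r] c[OF cont_adapted(1)] c[OF cont_adapted(2)] c[OF cont_adapted(3)] c[OF cont_adapted(4)] c[OF cont_adapted(5)] c[OF cont_adapted(6)] e1 e2])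
            (assumption | fact lim'[unfolded ito_remainder_def])+
      qed
    qed
  qed simp
  then show "conv_in_prob M (\<lambda>n \<omega>. \<Sum>k<n. exp (v (grid t n k) \<omega>) * (Hu (grid t n k) \<omega> + u (grid t n k) \<omega> * Hv (grid t n k) \<omega>) * ?D n k \<omega>) ?I"
    by (rule conv_in_prob_of_conv_to_0)
qed

end

section \<open>The pathwise equation\<close>

text \<open>Recovers the path S = E y from the unknown y = S / E of the random differential
  equation, with the initial path attached.\<close>

definition glue_path :: "(real \<Rightarrow> real) \<Rightarrow> (real \<Rightarrow> real) \<Rightarrow> (real \<Rightarrow> real) \<Rightarrow> real \<Rightarrow> real" where
  "glue_path \<phi> E y t = (if t \<le> 0 then \<phi> t else E t * y t)"

lemma glue_path_cont:
  assumes "\<phi> \<in> cspace L" "continuous_on {0..\<tau>} E" "continuous_on {0..\<tau>} y" "E 0 = 1" "y 0 = \<phi> 0"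
  shows "continuous_on {-L..\<tau>} (glue_path \<phi> E y)"
proof -
  have "continuous_on {-L..\<tau>} (\<lambda>t. if t \<le> 0 then \<phi> t else E t * y t)"
  proof (rule continuous_on_cases_le)
    have "continuous_on {-L..0} \<phi>" using assms(1) unfolding cspace_def by auto
    then show "continuous_on {t \<in> {-L..\<tau>}. t \<le> 0} \<phi>" by (rule continuous_on_subset) auto
    have "continuous_on {0..\<tau>} (\<lambda>t. E t * y t)" using assms by (intro continuous_intros)
    then show "continuous_on {t \<in> {-L..\<tau>}. 0 \<le> t} (\<lambda>t. E t * y t)" by (rule continuous_on_subset) auto
  qed (use assms in \<open>auto intro: continuous_intros\<close>)
  then show ?thesis unfolding glue_path_def .
qed

lemma seg_cspace:
  assumes x: "continuous_on {-L..\<tau>} x" and s: "0 \<le> s" "s \<le> \<tau>"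
  shows "seg L x s \<in> cspace L"
proof -
  have "continuous_on {-L..0} (\<lambda>u. x (s + u))"
    by (rule continuous_on_compose2[OF x]) (use s in \<open>auto intro!: continuous_intros\<close>)
  then have "continuous_on {-L..0} (seg L x s)" unfolding seg_def by (rule continuous_on_eq) auto
  then show ?thesis unfolding cspace_def seg_def by auto
qed

lemma seg_cong: "(\<And>u. s - L \<le> u \<Longrightarrow> u \<le> s \<Longrightarrow> x u = y u) \<Longrightarrow> seg L x s = seg L y s"
  unfolding seg_def by (auto simp: fun_eq_iff)

lemma cspace_diff: "\<eta> \<in> cspace L \<Longrightarrow> \<eta>' \<in> cspace L \<Longrightarrow> (\<lambda>s. \<eta> s - \<eta>' s) \<in> cspace L"
  unfolding cspace_def by (auto intro: continuous_intros)

lemma cspace_bdd: "\<eta> \<in> cspace L \<Longrightarrow> bdd_above ((\<lambda>s. \<bar>\<eta> s\<bar>) ` {-L..0})"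
  unfolding cspace_def
  by (intro bounded_imp_bdd_above compact_imp_bounded compact_continuous_image) (auto intro!: continuous_intros)

lemma supn_upper: "\<eta> \<in> cspace L \<Longrightarrow> s \<in> {-L..0} \<Longrightarrow> \<bar>\<eta> s\<bar> \<le> supn L \<eta>"
  unfolding supn_def by (rule cSUP_upper[OF _ cspace_bdd])

lemma supn_least: "0 \<le> L \<Longrightarrow> (\<And>s. s \<in> {-L..0} \<Longrightarrow> \<bar>\<eta> s\<bar> \<le> c) \<Longrightarrow> supn L \<eta> \<le> c"
  unfolding supn_def by (rule cSUP_least) auto

lemma summable_power_fact: "summable (\<lambda>n. (x::real) ^ n / fact n)"
  using summable_exp[of x] by (simp add: divide_inverse mult.commute)

section \<open>The drift along a path and its Picard iteration\<close>

locale drift =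
  fixes T L :: real and f :: "real \<Rightarrow> (real \<Rightarrow> real) \<Rightarrow> real" and L' :: real
  assumes T0: "0 < T" and L0: "0 < L" and cont: "cont_drift T L f" and L'0: "0 < L'"
    and growth: "\<And>t \<eta>. t \<in> {0..T} \<Longrightarrow> \<eta> \<in> cspace L \<Longrightarrow> \<bar>f t \<eta>\<bar> \<le> L' * (1 + supn L \<eta>)"
    and lip: "\<And>n::nat. n > 0 \<Longrightarrow> (\<exists>lc>0. \<forall>t\<in>{0..T}. \<forall>\<eta>1\<in>cspace L. \<forall>\<eta>2\<in>cspace L.
            supn L \<eta>1 \<le> real n \<and> supn L \<eta>2 \<le> real n \<longrightarrow> \<bar>f t \<eta>1 - f t \<eta>2\<bar> \<le> lc * supn L (\<lambda>s. \<eta>1 s - \<eta>2 s))"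
begin

text \<open>A path is uniformly continuous on [-L, tau], so its segments move continuously in the
  supremum norm, and f is jointly continuous.\<close>

lemma drift_cont:
  assumes x: "continuous_on {-L..\<tau>} x" and \<tau>: "0 \<le> \<tau>" "\<tau> \<le> T"
  shows "continuous_on {0..\<tau>} (\<lambda>s. f s (seg L x s))"
  unfolding continuous_on_iff
proof (intro ballI allI impI)
  fix s e :: real assume s: "s \<in> {0..\<tau>}" and e: "0 < e"
  have sT: "s \<in> {0..T}" using s \<tau> by auto
  have sc: "seg L x s \<in> cspace L" using seg_cspace[OF x] s by auto
  obtain d where d: "d > 0" "\<And>t' \<eta>'. t' \<in> {0..T} \<Longrightarrow> \<eta>' \<in> cspace L \<Longrightarrow> \<bar>t' - s\<bar> < d \<Longrightarrow> supn L (\<lambda>u. \<eta>' u - seg L x s u) < d \<Longrightarrow> \<bar>f t' \<eta>' - f s (seg L x s)\<bar> < e"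
  proof -
    have "\<exists>d>0. \<forall>t'\<in>{0..T}. \<forall>\<eta>'\<in>cspace L. \<bar>t' - s\<bar> < d \<and> supn L (\<lambda>u. \<eta>' u - seg L x s u) < d \<longrightarrow> \<bar>f t' \<eta>' - f s (seg L x s)\<bar> < e"
      by (rule cont[unfolded cont_drift_def, rule_format, OF sT sc e])
    then show ?thesis using that by blast
  qed
  have "uniformly_continuous_on {-L..\<tau>} x" by (rule compact_uniformly_continuous[OF x compact_Icc])
  then obtain d' where d': "d' > 0" "\<And>a b. a \<in> {-L..\<tau>} \<Longrightarrow> b \<in> {-L..\<tau>} \<Longrightarrow> dist b a < d' \<Longrightarrow> dist (x b) (x a) < d / 2"
    unfolding uniformly_continuous_on_def using d(1) by (meson half_gt_zero)
  show "\<exists>d>0. \<forall>x'\<in>{0..\<tau>}. dist x' s < d \<longrightarrow> dist (f x' (seg L x x')) (f s (seg L x s)) < e"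
  proof (intro exI[of _ "min d d'"] conjI ballI impI)
    fix s' assume s': "s' \<in> {0..\<tau>}" "dist s' s < min d d'"
    have "supn L (\<lambda>u. seg L x s' u - seg L x s u) \<le> d / 2"
    proof (rule supn_least)
      fix u assume u: "u \<in> {-L..0}"
      have "dist (x (s' + u)) (x (s + u)) < d / 2"
        by (rule d'(2)) (use s s' u in \<open>auto simp: dist_real_def\<close>)
      then show "\<bar>seg L x s' u - seg L x s u\<bar> \<le> d / 2" unfolding seg_def using u by (auto simp: dist_real_def)
    qed (use L0 in auto)
    then have "\<bar>f s' (seg L x s') - f s (seg L x s)\<bar> < e"
      using d(1) s' \<tau> seg_cspace[OF x, of s'] by (intro d(2)) (auto simp: dist_real_def)
    then show "dist (f s' (seg L x s')) (f s (seg L x s)) < e" by (simp add: dist_real_def)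
  qed (use d d' in auto)
qed

definition picard :: "(real \<Rightarrow> real) \<Rightarrow> (real \<Rightarrow> real) \<Rightarrow> (real \<Rightarrow> real) \<Rightarrow> real \<Rightarrow> real" where
  "picard \<phi> E y t = \<phi> 0 + integral {0..t} (\<lambda>s. f s (seg L (glue_path \<phi> E y) s) / E s)"

definition picard_iter :: "(real \<Rightarrow> real) \<Rightarrow> (real \<Rightarrow> real) \<Rightarrow> nat \<Rightarrow> real \<Rightarrow> real" where
  "picard_iter \<phi> E n = ((picard \<phi> E) ^^ n) (\<lambda>_. \<phi> 0)"

context
  fixes \<phi> E :: "real \<Rightarrow> real" and \<tau> C P :: real
  assumes \<phi>: "\<phi> \<in> cspace L" and \<tau>: "0 \<le> \<tau>" "\<tau> \<le> T"
    and E: "continuous_on {0..\<tau>} E" "E 0 = 1" "\<And>s. s \<in> {0..\<tau>} \<Longrightarrow> 0 < E s" and C: "1 \<le> C" "\<And>s. s \<in> {0..\<tau>} \<Longrightarrow> E s \<le> C" "\<And>s. s \<in> {0..\<tau>} \<Longrightarrow> 1 / E s \<le> C"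
    and P: "0 \<le> P" "\<And>s. s \<in> {-L..0} \<Longrightarrow> \<bar>\<phi> s\<bar> \<le> P"
begin

lemma integrand_cont:
  assumes y: "continuous_on {0..\<tau>} y" "y 0 = \<phi> 0"
  shows "continuous_on {0..\<tau>} (\<lambda>s. f s (seg L (glue_path \<phi> E y) s) / E s)"
proof -
  have "continuous_on {0..\<tau>} (\<lambda>s. f s (seg L (glue_path \<phi> E y) s))"
    by (rule drift_cont[OF glue_path_cont[OF \<phi> E(1) y(1) E(2) y(2)] \<tau>])
  then show ?thesis using E(1,3) by (intro continuous_on_divide) force+
qed

lemma picard_cont:
  assumes y: "continuous_on {0..\<tau>} y" "y 0 = \<phi> 0"
  shows "continuous_on {0..\<tau>} (picard \<phi> E y)" "picard \<phi> E y 0 = \<phi> 0"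
proof -
  have "(\<lambda>s. f s (seg L (glue_path \<phi> E y) s) / E s) integrable_on {0..\<tau>}"
    by (rule integrable_continuous_interval[OF integrand_cont[OF y]])
  then show "continuous_on {0..\<tau>} (picard \<phi> E y)" unfolding picard_def
    by (intro continuous_intros indefinite_integral_continuous_1)
  show "picard \<phi> E y 0 = \<phi> 0" unfolding picard_def by simp
qed

lemma glue_path_bound:
  assumes y: "\<And>u. u \<in> {0..s} \<Longrightarrow> \<bar>y u\<bar> \<le> m" and s: "s \<in> {0..\<tau>}" and m: "0 \<le> m" and u: "u \<in> {-L..0}"
  shows "\<bar>glue_path \<phi> E y (s + u)\<bar> \<le> P + C * m \<or> s + u < -L"
proof (cases "s + u \<le> 0")
  case True
  have "0 \<le> C * m" using C(1) m by auto
  then show ?thesis unfolding glue_path_def using True P(2)[of "s + u"] by (cases "s + u < -L") auto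
next
  case False
  have "\<bar>E (s + u)\<bar> \<le> C" using C(2)[of "s + u"] E(3)[of "s + u"] False s u by auto
  moreover have "\<bar>y (s + u)\<bar> \<le> m" using y[of "s + u"] False u by auto
  ultimately have "\<bar>E (s + u)\<bar> * \<bar>y (s + u)\<bar> \<le> C * m" using C(1) by (intro mult_mono) auto
  then show ?thesis unfolding glue_path_def using False P(1) by (simp add: abs_mult)
qed

lemma seg_glue_path_bound:
  assumes y: "\<And>u. u \<in> {0..s} \<Longrightarrow> \<bar>y u\<bar> \<le> m" and s: "s \<in> {0..\<tau>}" and m: "0 \<le> m"
  shows "supn L (seg L (glue_path \<phi> E y) s) \<le> P + C * m"
proof (rule supn_least)
  fix u assume u: "u \<in> {-L..0}"
  then show "\<bar>seg L (glue_path \<phi> E y) s u\<bar> \<le> P + C * m" unfolding seg_def using glue_path_bound[OF y s m u] s by auto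
qed (use L0 in auto)

text \<open>Before time 0 both paths equal the initial path; after it they differ by E (y - z), and
  E is at most C.\<close>

lemma seg_glue_path_diff_bound:
  assumes y: "\<And>u. u \<in> {0..s} \<Longrightarrow> \<bar>y u - z u\<bar> \<le> m" and s: "s \<in> {0..\<tau>}" and m: "0 \<le> m"
  shows "supn L (\<lambda>u. seg L (glue_path \<phi> E y) s u - seg L (glue_path \<phi> E z) s u) \<le> C * m"
proof (rule supn_least)
  fix u assume u: "u \<in> {-L..0}"
  show "\<bar>seg L (glue_path \<phi> E y) s u - seg L (glue_path \<phi> E z) s u\<bar> \<le> C * m"
  proof (cases "s + u \<le> 0")
    case True then show ?thesis unfolding seg_def glue_path_def using C(1) m by auto
  next
    case False
    have "\<bar>E (s + u)\<bar> \<le> C" using C(2)[of "s + u"] E(3)[of "s + u"] False s u by auto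
    moreover have "\<bar>y (s + u) - z (s + u)\<bar> \<le> m" using y[of "s + u"] False u by auto
    ultimately have "\<bar>E (s + u)\<bar> * \<bar>y (s + u) - z (s + u)\<bar> \<le> C * m" using C(1) by (intro mult_mono) auto
    then show ?thesis unfolding seg_def glue_path_def using False u by (simp add: abs_mult[symmetric] right_diff_distrib)
  qed
qed (use L0 in auto)

text \<open>The majorant m(t) = (1 + P) exp(K t) with K = 2 C^2 L' reproduces itself. Linear growth
  bounds the integrand by C L' (1 + P + C m), where one C comes from 1 / E and the other from E;
  since 1 + P is at most C m, this is at most K m, which is the derivative of m.\<close>

lemma picard_bound:
  assumes y: "continuous_on {0..\<tau>} y" "y 0 = \<phi> 0" and b: "\<And>u. u \<in> {0..\<tau>} \<Longrightarrow> \<bar>y u\<bar> \<le> (1 + P) * exp (2 * C * C * L' * u)"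
    and t: "t \<in> {0..\<tau>}"
  shows "\<bar>picard \<phi> E y t\<bar> \<le> (1 + P) * exp (2 * C * C * L' * t)"
proof -
  define K where "K = 2 * C * C * L'"
  have K: "0 < K" unfolding K_def using C L'0 by auto
  have e1: "1 \<le> exp (K * u)" if "0 \<le> u" for u using K that by simp
  have hi: "((\<lambda>s. (1 + P) * (K * exp (K * s))) has_integral (1 + P) * (exp (K * t) - exp (K * 0))) {0..t}"
  proof (rule has_integral_mult_right, rule fundamental_theorem_of_calculus)
    fix s assume "s \<in> {0..t}"
    have "((\<lambda>s. exp (K * s)) has_field_derivative K * exp (K * s)) (at s within {0..t})"
      by (auto intro!: derivative_eq_intros)
    then show "((\<lambda>s. exp (K * s)) has_vector_derivative K * exp (K * s)) (at s within {0..t})"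
      by (simp add: has_real_derivative_iff_has_vector_derivative)
  qed (use t in auto)
  have "norm (integral {0..t} (\<lambda>s. f s (seg L (glue_path \<phi> E y) s) / E s)) \<le> integral {0..t} (\<lambda>s. (1 + P) * (K * exp (K * s)))"
  proof (rule integral_norm_bound_integral)
    show "(\<lambda>s. f s (seg L (glue_path \<phi> E y) s) / E s) integrable_on {0..t}"
      using t by (intro integrable_continuous_interval continuous_on_subset[OF integrand_cont[OF y]]) auto
    show "(\<lambda>s. (1 + P) * (K * exp (K * s))) integrable_on {0..t}" using hi by (rule has_integral_integrable)
    fix s assume s: "s \<in> {0..t}"
    then have s\<tau>: "s \<in> {0..\<tau>}" using t by auto
    let ?m = "(1 + P) * exp (K * s)"
    have m0: "0 \<le> ?m" using P by simp
    have "\<bar>y u\<bar> \<le> ?m" if "u \<in> {0..s}" for u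
    proof -
      have "\<bar>y u\<bar> \<le> (1 + P) * exp (K * u)" unfolding K_def using b[of u] that s t by auto
      also have "\<dots> \<le> ?m" using that K P by (intro mult_left_mono) auto
      finally show ?thesis .
    qed
    then have "supn L (seg L (glue_path \<phi> E y) s) \<le> P + C * ?m" by (rule seg_glue_path_bound[OF _ s\<tau> m0])
    moreover have "seg L (glue_path \<phi> E y) s \<in> cspace L"
      using seg_cspace[OF glue_path_cont[OF \<phi> E(1) y(1) E(2) y(2)]] s\<tau> by auto
    then have "\<bar>f s (seg L (glue_path \<phi> E y) s)\<bar> \<le> L' * (1 + supn L (seg L (glue_path \<phi> E y) s))" using growth s\<tau> \<tau> by auto
    ultimately have 1: "\<bar>f s (seg L (glue_path \<phi> E y) s)\<bar> \<le> L' * (1 + P + C * ?m)"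
      using L'0 by (smt (verit) mult_left_mono)
    have "1 + P \<le> ?m" using mult_left_mono[OF e1[of s], of "1 + P"] s P by auto
    also have "\<dots> \<le> C * ?m" using mult_right_mono[OF C(1) m0] by simp
    finally have "L' * (1 + P + C * ?m) \<le> L' * (2 * C * ?m)" using L'0 by simp
    with 1 have 2: "\<bar>f s (seg L (glue_path \<phi> E y) s)\<bar> \<le> L' * (2 * C * ?m)" by linarith
    have "norm (f s (seg L (glue_path \<phi> E y) s) / E s) = \<bar>f s (seg L (glue_path \<phi> E y) s)\<bar> * (1 / E s)" using E(3)[OF s\<tau>] by simp
    also have "\<dots> \<le> (L' * (2 * C * ?m)) * C"
      using 2 C(3)[OF s\<tau>] E(3)[OF s\<tau>] order_trans[OF abs_ge_zero 2] by (intro mult_mono) auto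
    also have "\<dots> = (1 + P) * (K * exp (K * s))" unfolding K_def by simp
    finally show "norm (f s (seg L (glue_path \<phi> E y) s) / E s) \<le> (1 + P) * (K * exp (K * s))" .
  qed
  also have "\<dots> = (1 + P) * (exp (K * t) - 1)" using integral_unique[OF hi] by simp
  finally have 3: "\<bar>integral {0..t} (\<lambda>s. f s (seg L (glue_path \<phi> E y) s) / E s)\<bar> \<le> (1 + P) * exp (K * t) - (1 + P)" by (simp add: algebra_simps)
  have "\<bar>\<phi> 0\<bar> \<le> P" using P(2)[of 0] L0 by auto
  then show ?thesis unfolding picard_def K_def[symmetric] using 3 by linarith
qed

text \<open>Segments look back in time, so the difference is controlled by a majorant D s of |y - z|
  on all of [0, s]. The factor C^2 comes from E in the path and from 1 / E in the integrand.\<close>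

lemma picard_lip:
  assumes R: "0 < R" and lc: "0 < lc" "\<forall>t\<in>{0..T}. \<forall>\<eta>1\<in>cspace L. \<forall>\<eta>2\<in>cspace L.
      supn L \<eta>1 \<le> P + C * R \<and> supn L \<eta>2 \<le> P + C * R \<longrightarrow> \<bar>f t \<eta>1 - f t \<eta>2\<bar> \<le> lc * supn L (\<lambda>s. \<eta>1 s - \<eta>2 s)"
    and y: "continuous_on {0..\<tau>} y" "y 0 = \<phi> 0" "\<And>u. u \<in> {0..\<tau>} \<Longrightarrow> \<bar>y u\<bar> \<le> R"
    and z: "continuous_on {0..\<tau>} z" "z 0 = \<phi> 0" "\<And>u. u \<in> {0..\<tau>} \<Longrightarrow> \<bar>z u\<bar> \<le> R"
    and D: "continuous_on {0..\<tau>} D" "\<And>u s. 0 \<le> u \<Longrightarrow> u \<le> s \<Longrightarrow> s \<le> \<tau> \<Longrightarrow> \<bar>y u - z u\<bar> \<le> D s" and t: "t \<in> {0..\<tau>}"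
  shows "\<bar>picard \<phi> E y t - picard \<phi> E z t\<bar> \<le> integral {0..t} (\<lambda>s. C * C * lc * D s)"
proof -
  let ?h = "\<lambda>y s. f s (seg L (glue_path \<phi> E y) s) / E s"
  have iy: "?h y integrable_on {0..t}" "?h z integrable_on {0..t}"
    using t by (auto intro!: integrable_continuous_interval continuous_on_subset[OF integrand_cont[OF y(1,2)]] continuous_on_subset[OF integrand_cont[OF z(1,2)]])
  have eq: "picard \<phi> E y t - picard \<phi> E z t = integral {0..t} (\<lambda>s. ?h y s - ?h z s)"
    unfolding picard_def using iy by (subst Henstock_Kurzweil_Integration.integral_diff) auto
  have "norm (integral {0..t} (\<lambda>s. ?h y s - ?h z s)) \<le> integral {0..t} (\<lambda>s. C * C * lc * D s)"
  proof (rule integral_norm_bound_integral)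
    show "(\<lambda>s. ?h y s - ?h z s) integrable_on {0..t}" using iy by (rule integrable_diff)
    show "(\<lambda>s. C * C * lc * D s) integrable_on {0..t}"
      using t by (intro integrable_continuous_interval continuous_intros continuous_on_subset[OF D(1)]) auto
    fix s assume s: "s \<in> {0..t}"
    then have s\<tau>: "s \<in> {0..\<tau>}" using t by auto
    have D0: "0 \<le> D s" using D(2)[of 0 s] s\<tau> y(2) z(2) by auto
    have "supn L (seg L (glue_path \<phi> E y) s) \<le> P + C * R" "supn L (seg L (glue_path \<phi> E z) s) \<le> P + C * R"
      using y(3) z(3) s\<tau> R by (auto intro!: seg_glue_path_bound)
    moreover have "seg L (glue_path \<phi> E y) s \<in> cspace L" "seg L (glue_path \<phi> E z) s \<in> cspace L"
      using seg_cspace[OF glue_path_cont[OF \<phi> E(1) y(1) E(2) y(2)]] seg_cspace[OF glue_path_cont[OF \<phi> E(1) z(1) E(2) z(2)]] s\<tau> by auto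
    moreover have "s \<in> {0..T}" using s\<tau> \<tau> by auto
    ultimately have "\<bar>f s (seg L (glue_path \<phi> E y) s) - f s (seg L (glue_path \<phi> E z) s)\<bar> \<le> lc * supn L (\<lambda>u. seg L (glue_path \<phi> E y) s u - seg L (glue_path \<phi> E z) s u)"
      using lc(2) by blast
    also have "\<dots> \<le> lc * (C * D s)" using lc(1) D(2) s\<tau> D0 by (intro mult_left_mono seg_glue_path_diff_bound) auto
    finally have 1: "\<bar>f s (seg L (glue_path \<phi> E y) s) - f s (seg L (glue_path \<phi> E z) s)\<bar> \<le> lc * (C * D s)" .
    have "norm (?h y s - ?h z s) = \<bar>f s (seg L (glue_path \<phi> E y) s) - f s (seg L (glue_path \<phi> E z) s)\<bar> * (1 / E s)"
      using E(3)[OF s\<tau>] by (simp add: diff_divide_distrib[symmetric])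
    also have "\<dots> \<le> (lc * (C * D s)) * C"
      using 1 C(3)[OF s\<tau>] E(3)[OF s\<tau>] order_trans[OF abs_ge_zero 1] by (intro mult_mono) auto
    finally show "norm (?h y s - ?h z s) \<le> C * C * lc * D s" by (simp add: mult_ac)
  qed
  then show ?thesis unfolding eq by simp
qed

text \<open>Integration turns one term of the exponential series of K t into the next. Successive
  applications therefore contract on the whole interval, whatever its length.\<close>

lemma picard_lip_power:
  assumes R: "0 < R" and lc: "0 < lc" "\<forall>t\<in>{0..T}. \<forall>\<eta>1\<in>cspace L. \<forall>\<eta>2\<in>cspace L.
      supn L \<eta>1 \<le> P + C * R \<and> supn L \<eta>2 \<le> P + C * R \<longrightarrow> \<bar>f t \<eta>1 - f t \<eta>2\<bar> \<le> lc * supn L (\<lambda>s. \<eta>1 s - \<eta>2 s)"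
    and y: "continuous_on {0..\<tau>} y" "y 0 = \<phi> 0" "\<And>u. u \<in> {0..\<tau>} \<Longrightarrow> \<bar>y u\<bar> \<le> R"
    and z: "continuous_on {0..\<tau>} z" "z 0 = \<phi> 0" "\<And>u. u \<in> {0..\<tau>} \<Longrightarrow> \<bar>z u\<bar> \<le> R"
    and K: "K = C * C * lc" and B: "0 \<le> B" and D: "\<And>u. u \<in> {0..\<tau>} \<Longrightarrow> \<bar>y u - z u\<bar> \<le> B * ((K * u) ^ n / fact n)" and t: "t \<in> {0..\<tau>}"
  shows "\<bar>picard \<phi> E y t - picard \<phi> E z t\<bar> \<le> B * ((K * t) ^ Suc n / fact (Suc n))"
proof -
  have K0: "0 < K" unfolding K using C lc by auto
  have "\<bar>picard \<phi> E y t - picard \<phi> E z t\<bar> \<le> integral {0..t} (\<lambda>s. C * C * lc * (B * ((K * s) ^ n / fact n)))"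
  proof (rule picard_lip[OF R lc y z _ _ t])
    show "continuous_on {0..\<tau>} (\<lambda>s. B * ((K * s) ^ n / fact n))" by (intro continuous_intros) auto
    fix u s assume us: "0 \<le> u" "u \<le> s" "s \<le> \<tau>"
    then have "\<bar>y u - z u\<bar> \<le> B * ((K * u) ^ n / fact n)" using D by auto
    also have "\<dots> \<le> B * ((K * s) ^ n / fact n)" using us K0 B by (intro mult_left_mono divide_right_mono power_mono) auto
    finally show "\<bar>y u - z u\<bar> \<le> B * ((K * s) ^ n / fact n)" .
  qed
  also have "\<dots> = B * ((K * t) ^ Suc n / fact (Suc n))"
  proof (rule integral_unique)
    have "((\<lambda>s. C * C * lc * (B * ((K * s) ^ n / fact n))) has_integral
      B * ((K * t) ^ Suc n / fact (Suc n)) - B * ((K * 0) ^ Suc n / fact (Suc n))) {0..t}"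
    proof (rule fundamental_theorem_of_calculus)
      fix s assume "s \<in> {0..t}"
      have "((\<lambda>s. B * ((K * s) ^ Suc n / fact (Suc n))) has_field_derivative B * ((real (Suc n) * (K * s) ^ n * K) / fact (Suc n))) (at s within {0..t})"
        by (rule derivative_eq_intros refl | simp)+
      moreover have "B * ((real (Suc n) * (K * s) ^ n * K) / fact (Suc n)) = C * C * lc * (B * ((K * s) ^ n / fact n))"
        unfolding K by (simp add: fact_Suc del: of_nat_Suc)
      ultimately show "((\<lambda>s. B * ((K * s) ^ Suc n / fact (Suc n))) has_vector_derivative C * C * lc * (B * ((K * s) ^ n / fact n))) (at s within {0..t})"
        unfolding has_real_derivative_iff_has_vector_derivative[symmetric] by (simp only:)
    qed (use t in auto)
    then show "((\<lambda>s. C * C * lc * (B * ((K * s) ^ n / fact n))) has_integral B * ((K * t) ^ Suc n / fact (Suc n))) {0..t}" by simp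
  qed
  finally show ?thesis .
qed

lemma lip_exists:
  assumes R: "0 < R"
  shows "\<exists>lc>0. \<forall>t\<in>{0..T}. \<forall>\<eta>1\<in>cspace L. \<forall>\<eta>2\<in>cspace L.
      supn L \<eta>1 \<le> P + C * R \<and> supn L \<eta>2 \<le> P + C * R \<longrightarrow> \<bar>f t \<eta>1 - f t \<eta>2\<bar> \<le> lc * supn L (\<lambda>s. \<eta>1 s - \<eta>2 s)"
proof -
  define n where "n = nat \<lceil>P + C * R\<rceil> + 1"
  have n: "n > 0" "P + C * R \<le> real n" unfolding n_def by linarith+
  obtain lc where lc: "lc > 0" "\<forall>t\<in>{0..T}. \<forall>\<eta>1\<in>cspace L. \<forall>\<eta>2\<in>cspace L.
            supn L \<eta>1 \<le> real n \<and> supn L \<eta>2 \<le> real n \<longrightarrow> \<bar>f t \<eta>1 - f t \<eta>2\<bar> \<le> lc * supn L (\<lambda>s. \<eta>1 s - \<eta>2 s)"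
    using lip[OF n(1)] by blast
  show ?thesis using lc n(2) by (intro exI[of _ lc]) (meson order_trans)
qed

text \<open>Two continuous fixed points are bounded by a common R, which fixes one Lipschitz
  constant. Iterating the estimate bounds their distance by 2 R (K t)^n / n! for every n.\<close>

lemma picard_unique:
  assumes y: "continuous_on {0..\<tau>} y" "\<And>u. u \<in> {0..\<tau>} \<Longrightarrow> y u = picard \<phi> E y u"
    and z: "continuous_on {0..\<tau>} z" "\<And>u. u \<in> {0..\<tau>} \<Longrightarrow> z u = picard \<phi> E z u" and t: "t \<in> {0..\<tau>}"
  shows "y t = z t"
proof -
  have y0: "y 0 = \<phi> 0" "z 0 = \<phi> 0" using y(2)[of 0] z(2)[of 0] \<tau> unfolding picard_def by auto
  obtain R1 where R1: "0 < R1" "\<And>u. u \<in> {0..\<tau>} \<Longrightarrow> \<bar>y u\<bar> \<le> R1"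
    using compact_imp_bounded[OF compact_continuous_image[OF y(1) compact_Icc]] unfolding bounded_pos by auto
  obtain R2 where R2: "0 < R2" "\<And>u. u \<in> {0..\<tau>} \<Longrightarrow> \<bar>z u\<bar> \<le> R2"
    using compact_imp_bounded[OF compact_continuous_image[OF z(1) compact_Icc]] unfolding bounded_pos by auto
  define R where "R = R1 + R2"
  have R: "0 < R" "\<And>u. u \<in> {0..\<tau>} \<Longrightarrow> \<bar>y u\<bar> \<le> R" "\<And>u. u \<in> {0..\<tau>} \<Longrightarrow> \<bar>z u\<bar> \<le> R"
    unfolding R_def using R1(1) R2(1) order_trans[OF R1(2)] order_trans[OF R2(2)] by auto
  obtain lc where lc: "0 < lc" "\<forall>t\<in>{0..T}. \<forall>\<eta>1\<in>cspace L. \<forall>\<eta>2\<in>cspace L.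
      supn L \<eta>1 \<le> P + C * R \<and> supn L \<eta>2 \<le> P + C * R \<longrightarrow> \<bar>f t \<eta>1 - f t \<eta>2\<bar> \<le> lc * supn L (\<lambda>s. \<eta>1 s - \<eta>2 s)"
    using lip_exists[OF R(1)] by blast
  define K where "K = C * C * lc"
  have bound: "\<bar>y u - z u\<bar> \<le> (2 * R) * ((K * u) ^ n / fact n)" if "u \<in> {0..\<tau>}" for n u
    using that
  proof (induction n arbitrary: u)
    case 0 then show ?case using R(2)[of u] R(3)[of u] by simp
  next
    case (Suc n)
    have "\<bar>picard \<phi> E y u - picard \<phi> E z u\<bar> \<le> (2 * R) * ((K * u) ^ Suc n / fact (Suc n))"
      by (rule picard_lip_power[OF R(1) lc y(1) y0(1) R(2) z(1) y0(2) R(3) K_def _ Suc.IH Suc.prems]) (use R(1) in auto)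
    then show ?case using y(2)[OF Suc.prems] z(2)[OF Suc.prems] by simp
  qed
  have "(\<lambda>n. (2 * R) * ((K * t) ^ n / fact n)) \<longlonglongrightarrow> (2 * R) * 0"
    by (intro tendsto_mult tendsto_const summable_LIMSEQ_zero summable_power_fact)
  then have "\<bar>y t - z t\<bar> \<le> 2 * R * 0" using bound[OF t] by (intro LIMSEQ_le_const) auto
  then show ?thesis by simp
qed

text \<open>The constant start lies below the majorant of \<open>picard_bound\<close> because P
  bounds the initial path, and the operator preserves the majorant. A bound uniform in n is what
  makes a local Lipschitz condition sufficient.\<close>

lemma picard_iter_props:
  shows "continuous_on {0..\<tau>} (picard_iter \<phi> E n)" "picard_iter \<phi> E n 0 = \<phi> 0" "\<And>u. u \<in> {0..\<tau>} \<Longrightarrow> \<bar>picard_iter \<phi> E n u\<bar> \<le> (1 + P) * exp (2 * C * C * L' * u)"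
proof (induction n)
  case 0
  { case 1 show ?case unfolding picard_iter_def by simp }
  { case 2 show ?case unfolding picard_iter_def by simp }
  { case (3 u)
    have "\<bar>\<phi> 0\<bar> \<le> 1 + P" using P(2)[of 0] L0 by auto
    also have "\<dots> \<le> (1 + P) * exp (2 * C * C * L' * u)" using 3 P(1) C(1) L'0 by (simp add: mult_le_cancel_left1)
    finally show ?case unfolding picard_iter_def by simp }
next
  case (Suc n)
  have S: "picard_iter \<phi> E (Suc n) = picard \<phi> E (picard_iter \<phi> E n)" unfolding picard_iter_def by simp
  { case 1 show ?case unfolding S by (rule picard_cont[OF Suc(1,2)]) }
  { case 2 show ?case unfolding S by (rule picard_cont[OF Suc(1,2)]) }
  { case (3 u) show ?case unfolding S by (rule picard_bound[OF Suc(1,2) Suc(3) 3]) }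
qed

text \<open>All iterates stay within R, so one Lipschitz constant serves them all and consecutive
  differences have a summable majorant. The same constant allows the passage to the limit inside the
  operator.\<close>

lemma picard_iter_converges:
  "\<exists>y. uniform_limit {0..\<tau>} (picard_iter \<phi> E) y sequentially \<and> continuous_on {0..\<tau>} y \<and> (\<forall>t\<in>{0..\<tau>}. y t = picard \<phi> E y t)"
proof -
  define R where "R = (1 + P) * exp (2 * C * C * L' * \<tau>)"
  have R0: "0 < R" unfolding R_def using P by (simp add: add_pos_nonneg)
  have R: "\<bar>picard_iter \<phi> E n u\<bar> \<le> R" if "u \<in> {0..\<tau>}" for n u
  proof -
    have "(1 + P) * exp (2 * C * C * L' * u) \<le> R" unfolding R_def using that P C(1) L'0 by (intro mult_left_mono) (auto intro!: mult_left_mono)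
    then show ?thesis using picard_iter_props(3)[OF that, of n] by linarith
  qed
  obtain lc where lc: "0 < lc" "\<forall>t\<in>{0..T}. \<forall>\<eta>1\<in>cspace L. \<forall>\<eta>2\<in>cspace L.
      supn L \<eta>1 \<le> P + C * R \<and> supn L \<eta>2 \<le> P + C * R \<longrightarrow> \<bar>f t \<eta>1 - f t \<eta>2\<bar> \<le> lc * supn L (\<lambda>s. \<eta>1 s - \<eta>2 s)"
    using lip_exists[OF R0] by blast
  define K where "K = C * C * lc"
  have K0: "0 < K" unfolding K_def using C lc by auto
  have S: "picard_iter \<phi> E (Suc n) = picard \<phi> E (picard_iter \<phi> E n)" for n unfolding picard_iter_def by simp
  have step: "\<bar>picard_iter \<phi> E (Suc n) u - picard_iter \<phi> E n u\<bar> \<le> (2 * R) * ((K * u) ^ n / fact n)" if "u \<in> {0..\<tau>}" for n u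
    using that
  proof (induction n arbitrary: u)
    case 0 then show ?case using R[of u 1] R[of u 0] by simp
  next
    case (Suc n)
    have "\<bar>picard \<phi> E (picard_iter \<phi> E (Suc n)) u - picard \<phi> E (picard_iter \<phi> E n) u\<bar> \<le> (2 * R) * ((K * u) ^ Suc n / fact (Suc n))"
      by (rule picard_lip_power[OF R0 lc picard_iter_props(1,2) R picard_iter_props(1,2) R K_def _ Suc.IH Suc.prems]) (use R0 in auto)
    then show ?case unfolding S .
  qed
  have "uniform_limit {0..\<tau>} (\<lambda>n t. \<Sum>i<n. picard_iter \<phi> E (Suc i) t - picard_iter \<phi> E i t) (\<lambda>t. suminf (\<lambda>i. picard_iter \<phi> E (Suc i) t - picard_iter \<phi> E i t)) sequentially"
  proof (rule Weierstrass_m_test)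
    show "summable (\<lambda>n. (2 * R) * ((K * \<tau>) ^ n / fact n))"
      by (intro summable_mult summable_power_fact)
    fix n u assume u: "u \<in> {0..\<tau>}"
    have "(2 * R) * ((K * u) ^ n / fact n) \<le> (2 * R) * ((K * \<tau>) ^ n / fact n)"
      using u K0 R0 by (intro mult_left_mono divide_right_mono power_mono) auto
    then show "norm (picard_iter \<phi> E (Suc n) u - picard_iter \<phi> E n u) \<le> (2 * R) * ((K * \<tau>) ^ n / fact n)" using step[OF u, of n] by simp
  qed
  then have "uniform_limit {0..\<tau>} (\<lambda>n t. picard_iter \<phi> E 0 t + (\<Sum>i<n. picard_iter \<phi> E (Suc i) t - picard_iter \<phi> E i t)) (\<lambda>t. picard_iter \<phi> E 0 t + suminf (\<lambda>i. picard_iter \<phi> E (Suc i) t - picard_iter \<phi> E i t)) sequentially"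
    by (intro uniform_limit_intros)
  moreover have "picard_iter \<phi> E 0 t + (\<Sum>i<n. picard_iter \<phi> E (Suc i) t - picard_iter \<phi> E i t) = picard_iter \<phi> E n t" for n t
    by (subst sum_lessThan_telescope) simp
  ultimately obtain y where y: "uniform_limit {0..\<tau>} (picard_iter \<phi> E) y sequentially" by auto
  have yc: "continuous_on {0..\<tau>} y"
    by (rule uniform_limit_theorem[OF always_eventually[OF allI[OF picard_iter_props(1)]] y]) simp
  have lim: "(\<lambda>n. picard_iter \<phi> E n t) \<longlonglongrightarrow> y t" if "t \<in> {0..\<tau>}" for t using tendsto_uniform_limitI[OF y that] .
  have y0: "y 0 = \<phi> 0" using LIMSEQ_unique[OF lim[of 0]] \<tau> by (auto simp: picard_iter_props(2))
  have yR: "\<bar>y u\<bar> \<le> R" if "u \<in> {0..\<tau>}" for u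
    using LIMSEQ_le_const2[OF tendsto_rabs[OF lim[OF that]]] R[OF that] by auto
  have "y t = picard \<phi> E y t" if t: "t \<in> {0..\<tau>}" for t
  proof -
    have "(\<lambda>n. picard \<phi> E (picard_iter \<phi> E n) t) \<longlonglongrightarrow> picard \<phi> E y t"
    proof (rule LIMSEQ_I)
      fix e :: real assume e: "0 < e"
      define \<epsilon> where "\<epsilon> = e / (2 * (C * C * lc * (t + 1)))"
      have c: "0 < C * C * lc * (t + 1)" using C lc t by auto
      have \<epsilon>: "0 < \<epsilon>" unfolding \<epsilon>_def using e c by simp
      obtain N where N: "\<And>n u. n \<ge> N \<Longrightarrow> u \<in> {0..\<tau>} \<Longrightarrow> dist (picard_iter \<phi> E n u) (y u) < \<epsilon>"
        using y \<epsilon> unfolding uniform_limit_iff eventually_sequentially by blast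
      show "\<exists>no. \<forall>n\<ge>no. norm (picard \<phi> E (picard_iter \<phi> E n) t - picard \<phi> E y t) < e"
      proof (intro exI[of _ N] allI impI)
        fix n assume n: "N \<le> n"
        have "\<bar>picard \<phi> E (picard_iter \<phi> E n) t - picard \<phi> E y t\<bar> \<le> integral {0..t} (\<lambda>s. C * C * lc * \<epsilon>)"
        proof (rule picard_lip[OF R0 lc picard_iter_props(1,2) R yc y0 yR _ _ t])
          fix u s assume "0 \<le> u" "u \<le> s" "s \<le> \<tau>"
          then show "\<bar>picard_iter \<phi> E n u - y u\<bar> \<le> \<epsilon>" using N[OF n, of u] by (simp add: dist_real_def)
        qed auto
        also have "\<dots> = C * C * lc * \<epsilon> * t" using t by simp
        also have "\<dots> \<le> C * C * lc * \<epsilon> * (t + 1)" using C lc \<epsilon> by (intro mult_left_mono) auto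
        also have "\<dots> = e / 2" unfolding \<epsilon>_def using c C lc t by (simp add: field_simps)
        also have "\<dots> < e" using e by simp
        finally show "norm (picard \<phi> E (picard_iter \<phi> E n) t - picard \<phi> E y t) < e" by simp
      qed
    qed
    moreover have "(\<lambda>n. picard \<phi> E (picard_iter \<phi> E n) t) \<longlonglongrightarrow> y t" using LIMSEQ_Suc[OF lim[OF t]] unfolding S .
    ultimately show ?thesis using LIMSEQ_unique by blast
  qed
  with y yc show ?thesis by blast
qed

end

text \<open>The quotient y = S / E has the derivative k = f / E, which is positive at any time up to
  which S is nonnegative. Suppose y becomes negative and let tau be the infimum of such times. Up to
  and including tau it is nonnegative, so k is positive at tau and, by continuity, shortly after;
  then y cannot fall below 0 there. Once y is known to be nonnegative, it increases from S 0, which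
  gives the strict statement.\<close>

lemma positive_solution:
  assumes pos: "\<And>t \<eta>. t \<in> {0..T} \<Longrightarrow> \<eta> \<in> cspace L \<Longrightarrow> (\<forall>s\<in>{-L..0}. \<eta> s \<ge> 0) \<Longrightarrow> f t \<eta> > 0"
    and S: "continuous_on {-L..T} S" and E: "continuous_on {0..T} E" "\<And>s. s \<in> {0..T} \<Longrightarrow> 0 < E s"
    and eq: "\<And>t. t \<in> {0..T} \<Longrightarrow> S t / E t = S 0 + integral {0..t} (\<lambda>s. f s (seg L S s) / E s)"
    and S0: "\<And>t. t \<in> {-L..0} \<Longrightarrow> 0 \<le> S t"
  shows "\<And>t. t \<in> {0..T} \<Longrightarrow> 0 \<le> S t" "\<And>t. 0 < S 0 \<Longrightarrow> t \<in> {0..T} \<Longrightarrow> 0 < S t"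
proof -
  define k where "k = (\<lambda>s. f s (seg L S s) / E s)"
  have "continuous_on {0..T} (\<lambda>s. f s (seg L S s))" by (rule drift_cont[OF S]) (use T0 in auto)
  then have kc: "continuous_on {0..T} k" unfolding k_def using E by (intro continuous_on_divide) force+
  define y where "y = (\<lambda>t. S 0 + integral {0..t} k)"
  have yc: "continuous_on {0..T} y" unfolding y_def
    by (intro continuous_intros indefinite_integral_continuous_1 integrable_continuous_interval kc)
  have Sy: "S t = E t * y t" if "t \<in> {0..T}" for t
    using eq[OF that] E(2)[OF that] unfolding y_def k_def by (simp add: field_simps)
  have inc: "y t - y s = integral {s..t} k" if "0 \<le> s" "s \<le> t" "t \<le> T" for s t
  proof -
    have "k integrable_on {0..t}" using that by (intro integrable_continuous_interval continuous_on_subset[OF kc]) auto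
    then show ?thesis unfolding y_def using Henstock_Kurzweil_Integration.integral_combine[of 0 s t k] that by simp
  qed
  have kpos: "0 < k t" if "t \<in> {0..T}" "\<And>s. s \<in> {0..t} \<Longrightarrow> 0 \<le> y s" for t
  proof -
    have "\<forall>s\<in>{-L..0}. 0 \<le> seg L S t s"
    proof
      fix s assume s: "s \<in> {-L..0}"
      show "0 \<le> seg L S t s"
      proof (cases "t + s \<le> 0")
        case True then show ?thesis unfolding seg_def using S0[of "t + s"] s that by auto
      next
        case False
        then have "t + s \<in> {0..T}" "t + s \<in> {0..t}" using s that by auto
        then show ?thesis unfolding seg_def using Sy[of "t + s"] that(2)[of "t + s"] E(2)[of "t + s"] s by auto
      qed
    qed
    then have "0 < f t (seg L S t)" using pos that(1) seg_cspace[OF S, of t] by auto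
    then show ?thesis unfolding k_def using E(2)[OF that(1)] by simp
  qed
  have yn: "0 \<le> y t" if t: "t \<in> {0..T}" for t
  proof (rule ccontr)
    assume "\<not> 0 \<le> y t"
    define B where "B = {s \<in> {0..T}. y s < 0}"
    have tB: "t \<in> B" unfolding B_def using t \<open>\<not> 0 \<le> y t\<close> by auto
    have bdd: "bdd_below B" unfolding B_def by (rule bdd_belowI[of _ 0]) auto
    define \<tau> where "\<tau> = Inf B"
    have \<tau>le: "\<tau> \<le> s" if "s \<in> B" for s unfolding \<tau>_def by (rule cInf_lower[OF that bdd])
    have \<tau>0: "0 \<le> \<tau>" unfolding \<tau>_def by (rule cInf_greatest) (use tB in \<open>auto simp: B_def\<close>)
    have \<tau>T: "\<tau> \<in> {0..T}" using \<tau>0 \<tau>le[OF tB] t by auto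
    have before: "0 \<le> y s" if "0 \<le> s" "s < \<tau>" for s
    proof (rule ccontr)
      assume "\<not> 0 \<le> y s"
      then have "s \<in> B" unfolding B_def using that \<tau>T by auto
      then show False using \<tau>le[of s] that by simp
    qed
    \<comment> \<open>If y were negative at tau, then tau > 0, and continuity would make y negative
      shortly before tau.\<close>
    have y\<tau>: "0 \<le> y \<tau>"
    proof (rule ccontr)
      assume neg: "\<not> 0 \<le> y \<tau>"
      have "\<tau> \<noteq> 0" using neg S0[of 0] L0 unfolding y_def by auto
      then have \<tau>p: "0 < \<tau>" using \<tau>0 by simp
      obtain d where d: "0 < d" "\<And>s. s \<in> {0..T} \<Longrightarrow> dist s \<tau> < d \<Longrightarrow> dist (y s) (y \<tau>) < - y \<tau>"
        using yc \<tau>T neg unfolding continuous_on_iff by (metis neg_0_less_iff_less not_le)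
      define s where "s = max (\<tau> / 2) (\<tau> - d / 2)"
      have s: "0 \<le> s" "s < \<tau>" "dist s \<tau> < d" "s \<in> {0..T}" using \<tau>p d(1) \<tau>T unfolding s_def dist_real_def by auto
      have "dist (y s) (y \<tau>) < - y \<tau>" by (rule d(2)[OF s(4,3)])
      then have "y s < 0" by (simp add: dist_real_def)
      then show False using before[OF s(1,2)] by simp
    qed
    have upto: "0 \<le> y s" if "s \<in> {0..\<tau>}" for s using before[of s] y\<tau> that by (cases "s = \<tau>") auto
    have "0 < k \<tau>" by (rule kpos[OF \<tau>T upto])
    then obtain d where d: "0 < d" "\<And>s. s \<in> {0..T} \<Longrightarrow> dist s \<tau> < d \<Longrightarrow> dist (k s) (k \<tau>) < k \<tau>"
      using kc \<tau>T unfolding continuous_on_iff by blast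
    have after: "0 \<le> y s" if s: "\<tau> \<le> s" "s < \<tau> + d" "s \<le> T" for s
    proof -
      have "0 \<le> integral {\<tau>..s} k"
      proof (rule integral_nonneg)
        show "k integrable_on {\<tau>..s}" using s \<tau>T by (intro integrable_continuous_interval continuous_on_subset[OF kc]) auto
        fix u assume u: "u \<in> {\<tau>..s}"
        then have "dist (k u) (k \<tau>) < k \<tau>" using s \<tau>T by (intro d(2)) (auto simp: dist_real_def)
        then show "0 \<le> k u" by (simp add: dist_real_def)
      qed
      then show ?thesis using inc[of \<tau> s] s \<tau>T y\<tau> by auto
    qed
    \<comment> \<open>No time before tau + d belongs to B, so tau + d is a lower bound of B and
      cannot exceed its infimum.\<close>
    have "\<tau> + d \<le> \<tau>" unfolding \<tau>_def[of]
    proof (rule cInf_greatest)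
      show "B \<noteq> {}" using tB by auto
      fix s assume sB: "s \<in> B"
      show "Inf B + d \<le> s"
      proof (rule ccontr)
        assume "\<not> Inf B + d \<le> s"
        then have "0 \<le> y s" using after[of s] \<tau>le[OF sB] sB unfolding B_def \<tau>_def by auto
        then show False using sB unfolding B_def by auto
      qed
    qed
    then show False using d(1) by simp
  qed
  show "\<And>t. t \<in> {0..T} \<Longrightarrow> 0 \<le> S t" using Sy yn E(2) by (simp add: less_imp_le)
  fix t assume S00: "0 < S 0" and t: "t \<in> {0..T}"
  have "0 \<le> integral {0..t} k"
  proof (rule integral_nonneg)
    show "k integrable_on {0..t}" using t by (intro integrable_continuous_interval continuous_on_subset[OF kc]) auto
    fix u assume u: "u \<in> {0..t}"
    have "0 < k u" by (rule kpos) (use u t yn in auto)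
    then show "0 \<le> k u" by simp
  qed
  then have "0 < y t" unfolding y_def using S00 by simp
  then show "0 < S t" using Sy[OF t] E(2)[OF t] by simp
qed

end

section \<open>The stochastic equation\<close>

text \<open>Integers are countable, so a list can be built head first: for each fixed head only the
  measurability of the tail is needed.\<close>

lemma map_measurable_count_space:
  fixes Z :: "'k \<Rightarrow> 'a \<Rightarrow> int"
  assumes "\<And>k. k \<in> set ks \<Longrightarrow> Z k \<in> measurable N (count_space UNIV)"
  shows "(\<lambda>\<omega>. map (\<lambda>k. Z k \<omega>) ks) \<in> measurable N (count_space UNIV)"
  using assms
proof (induction ks)
  case Nil show ?case by simp
next
  case (Cons k ks)
  have 1: "(\<lambda>\<omega>. map (\<lambda>k. Z k \<omega>) ks) \<in> measurable N (count_space UNIV)" by (rule Cons.IH) (use Cons.prems in auto)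
  have 2: "(\<lambda>\<omega>. z # map (\<lambda>k. Z k \<omega>) ks) \<in> measurable N (count_space UNIV)" for z
    by (rule measurable_compose[OF 1]) simp
  have "(\<lambda>\<omega>. Z k \<omega> # map (\<lambda>k. Z k \<omega>) ks) \<in> measurable N (count_space UNIV)"
    by (rule measurable_compose_countable[where f="\<lambda>z \<omega>. z # map (\<lambda>k. Z k \<omega>) ks", OF 2]) (use Cons.prems in auto)
  then show ?case by simp
qed

text \<open>Bernstein polynomials with rounded coefficients form a countable family, so a drift evaluated along
  them is measurable without an appeal to separability of the path space.\<close>

definition bernstein_rounded :: "real \<Rightarrow> nat \<Rightarrow> int list \<Rightarrow> real \<Rightarrow> real" where
  "bernstein_rounded L n vs u = (if u \<in> {-L..0} then \<Sum>k\<le>n. (real_of_int (vs ! k) / real (Suc n)) * Bernstein n k ((u + L) / L) else 0)"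

lemma bernstein_rounded_cspace: "0 < L \<Longrightarrow> bernstein_rounded L n vs \<in> cspace L"
proof -
  assume "0 < L"
  have "continuous_on {-L..0} (\<lambda>u. \<Sum>k\<le>n. (real_of_int (vs ! k) / real (Suc n)) * Bernstein n k ((u + L) / L))"
    unfolding Bernstein_def using \<open>0 < L\<close> by (intro continuous_intros) auto
  then have "continuous_on {-L..0} (bernstein_rounded L n vs)" by (rule continuous_on_eq) (simp add: bernstein_rounded_def)
  then show ?thesis unfolding cspace_def bernstein_rounded_def by auto
qed

text \<open>Bernstein polynomials are nonnegative and sum to 1, so rounding every coefficient down
  to a multiple of 1 / (n + 1) changes the approximant by at most 1 / (n + 1). The Weierstrass
  approximation accounts for the other e / 2.\<close>

lemma bernstein_rounded_approx:
  assumes x: "continuous_on {-L..0} x" and L: "0 < L" and e: "0 < e"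
  shows "\<exists>N. \<forall>n\<ge>N. \<forall>u\<in>{-L..0}. \<bar>bernstein_rounded L n (map (\<lambda>k. \<lfloor>real (Suc n) * x (L * (real k / real n) - L)\<rfloor>) [0..<Suc n]) u - x u\<bar> < e"
proof -
  define h where "h = (\<lambda>p. x (L * p - L))"
  have "continuous_on {0..1} h" unfolding h_def
    by (rule continuous_on_compose2[OF x]) (use L in \<open>auto intro!: continuous_intros simp: mult_left_le\<close>)
  from Bernstein_Weierstrass[OF this, of "e / 2"] e
  obtain N1 where N1: "\<And>n p. N1 \<le> n \<Longrightarrow> p \<in> {0..1} \<Longrightarrow> \<bar>h p - (\<Sum>k\<le>n. h (real k / real n) * Bernstein n k p)\<bar> < e / 2" by auto
  obtain N2 :: nat where N2: "2 / e < real N2" using reals_Archimedean2 by blast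
  show ?thesis
  proof (intro exI[of _ "max N1 N2"] allI impI ballI)
    fix n u assume n: "max N1 N2 \<le> n" and u: "u \<in> {-L..0}"
    define p where "p = (u + L) / L"
    have p: "p \<in> {0..1}" unfolding p_def using u L by auto
    have hp: "h p = x u" unfolding h_def p_def using L by simp
    define q where "q = (\<lambda>k. real_of_int \<lfloor>real (Suc n) * h (real k / real n)\<rfloor> / real (Suc n))"
    have m: "map (\<lambda>k. \<lfloor>real (Suc n) * x (L * (real k / real n) - L)\<rfloor>) [0..<Suc n] ! k = \<lfloor>real (Suc n) * h (real k / real n)\<rfloor>" if "k \<le> n" for k
      using that unfolding h_def by (subst nth_map) (auto simp del: upt_Suc)
    have b: "bernstein_rounded L n (map (\<lambda>k. \<lfloor>real (Suc n) * x (L * (real k / real n) - L)\<rfloor>) [0..<Suc n]) u = (\<Sum>k\<le>n. q k * Bernstein n k p)"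
      unfolding bernstein_rounded_def q_def p_def if_P[OF u] by (rule sum.cong[OF refl]) (simp only: m atMost_iff)
    have qh: "\<bar>q k - h (real k / real n)\<bar> \<le> 1 / real (Suc n)" for k
    proof -
      let ?a = "real (Suc n) * h (real k / real n)"
      have "\<bar>real_of_int \<lfloor>?a\<rfloor> - ?a\<bar> \<le> 1" by linarith
      moreover have "q k - h (real k / real n) = (real_of_int \<lfloor>?a\<rfloor> - ?a) / real (Suc n)"
        unfolding q_def by (simp add: diff_divide_distrib del: of_nat_Suc)
      ultimately show ?thesis by (simp add: divide_right_mono del: of_nat_Suc)
    qed
    have "\<bar>(\<Sum>k\<le>n. q k * Bernstein n k p) - (\<Sum>k\<le>n. h (real k / real n) * Bernstein n k p)\<bar> = \<bar>\<Sum>k\<le>n. (q k - h (real k / real n)) * Bernstein n k p\<bar>"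
      by (simp add: sum_subtractf left_diff_distrib)
    also have "\<dots> \<le> (\<Sum>k\<le>n. \<bar>(q k - h (real k / real n)) * Bernstein n k p\<bar>)" by (rule sum_abs)
    also have "\<dots> \<le> (\<Sum>k\<le>n. (1 / real (Suc n)) * Bernstein n k p)"
    proof (rule sum_mono)
      fix k
      have B: "0 \<le> Bernstein n k p" using p by (intro Bernstein_nonneg) auto
      show "\<bar>(q k - h (real k / real n)) * Bernstein n k p\<bar> \<le> (1 / real (Suc n)) * Bernstein n k p"
        unfolding abs_mult abs_of_nonneg[OF B] by (rule mult_right_mono[OF qh B])
    qed
    also have "\<dots> = 1 / real (Suc n)" unfolding sum_distrib_left[symmetric] sum_Bernstein by simp
    also have "\<dots> < e / 2"
    proof -
      have "2 / e < real (Suc n)" using N2 n by simp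
      then show ?thesis using e by (simp add: field_simps del: of_nat_Suc)
    qed
    finally have "\<bar>(\<Sum>k\<le>n. q k * Bernstein n k p) - (\<Sum>k\<le>n. h (real k / real n) * Bernstein n k p)\<bar> < e / 2" .
    moreover have "\<bar>h p - (\<Sum>k\<le>n. h (real k / real n) * Bernstein n k p)\<bar> < e / 2" by (rule N1[OF _ p]) (use n in auto)
    ultimately show "\<bar>bernstein_rounded L n (map (\<lambda>k. \<lfloor>real (Suc n) * x (L * (real k / real n) - L)\<rfloor>) [0..<Suc n]) u - x u\<bar> < e"
      unfolding b hp[symmetric] by linarith
  qed
qed

section \<open>Measurability of the drift along a random path\<close>

context drift
begin

text \<open>The rounded coefficients take values in a countable discrete space, on which every
  function is measurable, so f may be evaluated along the approximants. Continuity of f in the path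
  then gives the limit. Only values of X on [s - L, s] are sampled, which yields
  adaptedness.\<close>

lemma drift_measurable:
  assumes s: "s \<in> {0..T}" and X: "\<And>u. u \<in> {s - L..s} \<Longrightarrow> X u \<in> borel_measurable N"
    and c: "\<And>\<omega>. \<omega> \<in> space N \<Longrightarrow> continuous_on {-L..s} (\<lambda>u. X u \<omega>)"
  shows "(\<lambda>\<omega>. f s (seg L (\<lambda>u. X u \<omega>) s)) \<in> borel_measurable N"
proof (rule borel_measurable_LIMSEQ_real)
  define vs where "vs = (\<lambda>n \<omega>. map (\<lambda>k. \<lfloor>real (Suc n) * X (s + (L * (real k / real n) - L)) \<omega>\<rfloor>) [0..<Suc n])"
  show "(\<lambda>\<omega>. f s (bernstein_rounded L n (vs n \<omega>))) \<in> borel_measurable N" for n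
  proof -
    have "vs n \<in> measurable N (count_space UNIV)" unfolding vs_def
    proof (rule map_measurable_count_space)
      fix k assume "k \<in> set [0..<Suc n]"
      then have k: "k \<le> n" by auto
      have "0 \<le> L * (real k / real n)" "L * (real k / real n) \<le> L"
        using k L0 mult_left_mono[of "real k / real n" 1 L] by (auto simp: divide_le_eq_1)
      then have [measurable]: "X (s + (L * (real k / real n) - L)) \<in> borel_measurable N" by (intro X) auto
      show "(\<lambda>\<omega>. \<lfloor>real (Suc n) * X (s + (L * (real k / real n) - L)) \<omega>\<rfloor>) \<in> measurable N (count_space UNIV)" by measurable
    qed
    then show ?thesis by (rule measurable_compose) simp
  qed
  fix \<omega> assume \<omega>: "\<omega> \<in> space N"
  let ?x = "\<lambda>u. X (s + u) \<omega>"
  have xc: "continuous_on {-L..0} ?x"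
    by (rule continuous_on_compose2[OF c[OF \<omega>]]) (use s in \<open>auto intro!: continuous_intros\<close>)
  have sc: "seg L (\<lambda>u. X u \<omega>) s \<in> cspace L" by (rule seg_cspace[OF c[OF \<omega>]]) (use s in auto)
  show "(\<lambda>n. f s (bernstein_rounded L n (vs n \<omega>))) \<longlonglongrightarrow> f s (seg L (\<lambda>u. X u \<omega>) s)"
  proof (rule LIMSEQ_I)
    fix e :: real assume e: "0 < e"
    have "\<exists>d>0. \<forall>t'\<in>{0..T}. \<forall>\<eta>'\<in>cspace L. \<bar>t' - s\<bar> < d \<and> supn L (\<lambda>u. \<eta>' u - seg L (\<lambda>u. X u \<omega>) s u) < d \<longrightarrow> \<bar>f t' \<eta>' - f s (seg L (\<lambda>u. X u \<omega>) s)\<bar> < e"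
      by (rule cont[unfolded cont_drift_def, rule_format, OF s sc e])
    then obtain d where d: "d > 0" "\<And>\<eta>'. \<eta>' \<in> cspace L \<Longrightarrow> supn L (\<lambda>u. \<eta>' u - seg L (\<lambda>u. X u \<omega>) s u) < d \<Longrightarrow> \<bar>f s \<eta>' - f s (seg L (\<lambda>u. X u \<omega>) s)\<bar> < e"
      using s by fastforce
    have d2: "0 < d / 2" using d by simp
    obtain N0 where N0: "\<And>n u. n \<ge> N0 \<Longrightarrow> u \<in> {-L..0} \<Longrightarrow> \<bar>bernstein_rounded L n (vs n \<omega>) u - ?x u\<bar> < d / 2"
      using bernstein_rounded_approx[OF xc L0 d2] unfolding vs_def by blast
    show "\<exists>no. \<forall>n\<ge>no. norm (f s (bernstein_rounded L n (vs n \<omega>)) - f s (seg L (\<lambda>u. X u \<omega>) s)) < e"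
    proof (intro exI[of _ N0] allI impI)
      fix n assume n: "N0 \<le> n"
      have "supn L (\<lambda>u. bernstein_rounded L n (vs n \<omega>) u - seg L (\<lambda>u. X u \<omega>) s u) \<le> d / 2"
      proof (rule supn_least)
        fix u assume u: "u \<in> {-L..0}"
        show "\<bar>bernstein_rounded L n (vs n \<omega>) u - seg L (\<lambda>u. X u \<omega>) s u\<bar> \<le> d / 2"
          unfolding seg_def using N0[OF n u] u by simp
      qed (use L0 in auto)
      then have "supn L (\<lambda>u. bernstein_rounded L n (vs n \<omega>) u - seg L (\<lambda>u. X u \<omega>) s u) < d" using d(1) by linarith
      then show "norm (f s (bernstein_rounded L n (vs n \<omega>)) - f s (seg L (\<lambda>u. X u \<omega>) s)) < e"
        using d(2)[OF bernstein_rounded_cspace[OF L0]] by simp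
    qed
  qed
qed

lemma E_bounds:
  fixes E :: "real \<Rightarrow> real"
  assumes E: "continuous_on {0..\<tau>} E" "\<And>s. s \<in> {0..\<tau>} \<Longrightarrow> 0 < E s"
  shows "\<exists>C\<ge>1. \<forall>s\<in>{0..\<tau>}. E s \<le> C \<and> 1 / E s \<le> C"
proof -
  obtain C1 where C1: "\<And>s. s \<in> {0..\<tau>} \<Longrightarrow> \<bar>E s\<bar> \<le> C1" using continuous_on_Icc_bounded[OF E(1)] by blast
  have "continuous_on {0..\<tau>} (\<lambda>s. 1 / E s)" using E by (intro continuous_on_divide) force+
  from continuous_on_Icc_bounded[OF this] obtain C2 where C2: "\<And>s. s \<in> {0..\<tau>} \<Longrightarrow> \<bar>1 / E s\<bar> \<le> C2" by blast
  show ?thesis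
  proof (intro exI[of _ "max 1 (max C1 C2)"] conjI ballI)
    fix s assume s: "s \<in> {0..\<tau>}"
    show "E s \<le> max 1 (max C1 C2)" "1 / E s \<le> max 1 (max C1 C2)" using C1[OF s] C2[OF s] by linarith+
  qed simp
qed

lemma phi_bound: "\<phi> \<in> cspace L \<Longrightarrow> \<exists>P\<ge>0. \<forall>s\<in>{-L..0}. \<bar>\<phi> s\<bar> \<le> P"
proof -
  assume \<phi>: "\<phi> \<in> cspace L"
  have "0 \<le> supn L \<phi>" using supn_upper[OF \<phi>, of 0] L0 by auto
  then show ?thesis using supn_upper[OF \<phi>] by blast
qed

end

section \<open>Admissible processes and the equation with frozen delay\<close>

locale sfde = brownian_motion M T F W + drift T L f L'
  for M :: "'a measure" and T F W L f L' +
  fixes b :: real and g :: "real \<Rightarrow> real" and \<phi> :: "'a \<Rightarrow> real \<Rightarrow> real"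
  assumes b0: "0 < b" "b \<le> L" and g_cont: "continuous_on UNIV g"
    and phi_cspace: "\<And>\<omega>. \<omega> \<in> space M \<Longrightarrow> \<phi> \<omega> \<in> cspace L"
    and phi_meas: "\<And>A. A \<in> cborel L \<Longrightarrow> {\<omega>\<in>space M. \<phi> \<omega> \<in> A} \<in> F 0"
begin

text \<open>Evaluation at t is continuous for the supremum norm, so the paths whose value at t
  exceeds a form an open set.\<close>

lemma phi_Ft0:
  assumes t: "t \<in> {-L..0}"
  shows "(\<lambda>\<omega>. \<phi> \<omega> t) \<in> borel_measurable (Ft 0)"
proof (rule borel_measurableI_greater)
  fix a :: real
  have "sup_open L {\<eta> \<in> cspace L. a < \<eta> t}"
    unfolding sup_open_def
  proof (intro conjI ballI)
    fix \<eta> assume \<eta>: "\<eta> \<in> {\<eta> \<in> cspace L. a < \<eta> t}"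
    show "\<exists>e>0. \<forall>\<eta>'\<in>cspace L. supn L (\<lambda>s. \<eta>' s - \<eta> s) < e \<longrightarrow> \<eta>' \<in> {\<eta> \<in> cspace L. a < \<eta> t}"
    proof (intro exI[of _ "\<eta> t - a"] conjI ballI impI)
      fix \<eta>' assume \<eta>': "\<eta>' \<in> cspace L" "supn L (\<lambda>s. \<eta>' s - \<eta> s) < \<eta> t - a"
      have "\<bar>\<eta>' t - \<eta> t\<bar> \<le> supn L (\<lambda>s. \<eta>' s - \<eta> s)"
        by (rule supn_upper[OF cspace_diff t]) (use \<eta> \<eta>' in auto)
      then show "\<eta>' \<in> {\<eta> \<in> cspace L. a < \<eta> t}" using \<eta>' by auto
    qed (use \<eta> in auto)
  qed auto
  then have "{\<eta> \<in> cspace L. a < \<eta> t} \<in> cborel L" unfolding cborel_def by (intro sigma_sets.Basic) auto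
  from phi_meas[OF this] have "{\<omega>\<in>space M. \<phi> \<omega> \<in> {\<eta> \<in> cspace L. a < \<eta> t}} \<in> F 0" .
  moreover have "{\<omega>\<in>space M. \<phi> \<omega> \<in> {\<eta> \<in> cspace L. a < \<eta> t}} = {\<omega>\<in>space (Ft 0). a < \<phi> \<omega> t}" using phi_cspace by auto
  ultimately show "{\<omega>\<in>space (Ft 0). a < \<phi> \<omega> t} \<in> sets (Ft 0)" using sets_Ft[of 0] T_pos by simp
qed

text \<open>What \<open>sfde_solution\<close> demands apart from the equation itself, with
  adaptedness expressed through \<open>Ft\<close>.\<close>

definition admissible :: "(real \<Rightarrow> 'a \<Rightarrow> real) \<Rightarrow> bool" where
  "admissible S \<longleftrightarrow> (\<forall>\<omega>\<in>space M. continuous_on {-L..T} (\<lambda>t. S t \<omega>)) \<and> (\<forall>t\<in>{0..T}. S t \<in> borel_measurable (Ft t)) \<and>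
    (\<forall>\<omega>\<in>space M. \<forall>t\<in>{-L..0}. S t \<omega> = \<phi> \<omega> t)"

lemma admissible_cont: "admissible S \<Longrightarrow> \<omega> \<in> space M \<Longrightarrow> continuous_on {-L..T} (\<lambda>t. S t \<omega>)"
  and admissible_phi: "admissible S \<Longrightarrow> \<omega> \<in> space M \<Longrightarrow> t \<in> {-L..0} \<Longrightarrow> S t \<omega> = \<phi> \<omega> t"
  unfolding admissible_def by auto

lemma admissible_cont_adapted: "admissible S \<Longrightarrow> cont_adapted S"
proof (rule cadI)
  assume S: "admissible S"
  show "S t \<in> borel_measurable (Ft t)" if "0 \<le> t" "t \<le> T" for t using S that unfolding admissible_def by auto
  show "continuous_on {0..T} (\<lambda>t. S t \<omega>)" if "\<omega> \<in> space M" for \<omega>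
    by (rule continuous_on_subset[OF admissible_cont[OF S that]]) (use L0 in auto)
qed

lemma admissible_meas:
  assumes S: "admissible S" and u: "-L \<le> u" "u \<le> s" and s: "0 \<le> s" "s \<le> T"
  shows "S u \<in> borel_measurable (Ft s)"
proof (cases "0 \<le> u")
  case True then show ?thesis using cont_adapted_Ft[OF admissible_cont_adapted[OF S]] u s by auto
next
  case False
  then have m: "(\<lambda>\<omega>. \<phi> \<omega> u) \<in> borel_measurable (Ft s)" using Ft_mono[OF phi_Ft0[of u], of s] u s by auto
  have eq: "S u \<omega> = \<phi> \<omega> u" if "\<omega> \<in> space (Ft s)" for \<omega> using admissible_phi[OF S, of \<omega> u] that False u by auto
  show ?thesis by (rule measurable_cong[THEN iffD2, OF eq m])
qed

text \<open>Since 0 < b <= L, the delayed time s - b stays between -L and s, where the process is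
  defined and already known.\<close>

lemma cont_adapted_delay:
  assumes R: "admissible R"
  shows "cont_adapted (\<lambda>s \<omega>. g (R (s - b) \<omega>))"
proof (rule cont_adapted_compose[OF cadI g_cont])
  show "R (t - b) \<in> borel_measurable (Ft t)" if "0 \<le> t" "t \<le> T" for t
    by (rule admissible_meas[OF R]) (use that b0 in auto)
  show "continuous_on {0..T} (\<lambda>t. R (t - b) \<omega>)" if "\<omega> \<in> space M" for \<omega>
    by (rule continuous_on_compose2[OF admissible_cont[OF R that]]) (use b0 in \<open>auto intro!: continuous_intros\<close>)
qed

lemma cont_adapted_drift:
  assumes S: "admissible S"
  shows "cont_adapted (\<lambda>s \<omega>. f s (seg L (\<lambda>u. S u \<omega>) s))"
proof (rule cadI)
  fix s assume s: "0 \<le> s" "s \<le> T"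
  show "(\<lambda>\<omega>. f s (seg L (\<lambda>u. S u \<omega>) s)) \<in> borel_measurable (Ft s)"
  proof (rule drift_measurable)
    show "S u \<in> borel_measurable (Ft s)" if "u \<in> {s - L..s}" for u
      by (rule admissible_meas[OF S _ _ s]) (use that s in auto)
    show "continuous_on {-L..s} (\<lambda>u. S u \<omega>)" if "\<omega> \<in> space (Ft s)" for \<omega>
      by (rule continuous_on_subset[OF admissible_cont[OF S]]) (use that s in auto)
  qed (use s in auto)
next
  fix \<omega> assume "\<omega> \<in> space M"
  from drift_cont[OF admissible_cont[OF S this]] T_pos show "continuous_on {0..T} (\<lambda>s. f s (seg L (\<lambda>u. S u \<omega>) s))" by auto
qed

text \<open>The equation with the delayed argument of \<open>g\<close> taken from a given process \<open>R\<close>. Solutions of the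
  original equation are the fixed points, and the \<open>n\<close>-th iterate is stationary up to time \<open>n b\<close>.\<close>

definition frozen_delay_solution :: "(real \<Rightarrow> 'a \<Rightarrow> real) \<Rightarrow> (real \<Rightarrow> 'a \<Rightarrow> real) \<Rightarrow> bool" where
  "frozen_delay_solution R S \<longleftrightarrow> admissible S \<and> (\<exists>I. is_ito_integral M T W (\<lambda>s \<omega>. g (R (s - b) \<omega>) * S s \<omega>) I \<and>
        (AE \<omega> in M. \<forall>t\<in>{0..T}. S t \<omega> = \<phi> \<omega> 0 + integral {0..t} (\<lambda>s. f s (seg L (\<lambda>u. S u \<omega>) s)) + I t \<omega>))"

lemma frozen_delay_solution_admissible: "frozen_delay_solution R S \<Longrightarrow> admissible S"
  unfolding frozen_delay_solution_def by auto

lemma sfde_solution_iff: "sfde_solution M T F W L b f g \<phi> S \<longleftrightarrow> frozen_delay_solution S S"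
  unfolding sfde_solution_def frozen_delay_solution_def admissible_def by (auto simp: meas_wrt_iff)

text \<open>The integral J of H' equals I almost surely at each time, because the sums of H and H'
  agree almost surely. Convergence in probability to J is therefore convergence to I.\<close>

lemma is_ito_integral_AE_cong:
  assumes "is_ito_integral M T W H I" "cont_adapted H" "cont_adapted H'" "AE \<omega> in M. \<forall>s\<in>{0..T}. H s \<omega> = H' s \<omega>"
  shows "is_ito_integral M T W H' I"
proof -
  obtain J where J: "ito H' J" using ito_exists[OF assms(3)] by auto
  note iJ = ito_is_ito_integral[OF assms(3) J]
  show ?thesis unfolding is_ito_integral_grid
  proof (intro ballI conjI)
    fix t assume "t \<in> {0..T}"
    then have t: "0 \<le> t" "t \<le> T" by auto
    show mI: "I t \<in> borel_measurable M" using assms(1) t unfolding is_ito_integral_grid by auto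
    have mJ: "J t \<in> borel_measurable M" using iJ t unfolding is_ito_integral_grid by auto
    have "AE \<omega> in M. True \<longrightarrow> I t \<omega> = J t \<omega>"
      by (rule is_ito_integral_unique[OF assms(1) iJ assms(2,3) t]) (use assms(4) t in \<open>auto elim!: eventually_mono\<close>)
    then have eq: "AE \<omega> in M. I t \<omega> = J t \<omega>" by simp
    let ?R = "\<lambda>n \<omega>. \<Sum>k<n. H' (grid t n k) \<omega> * (incr t n k \<omega>)"
    have "conv_in_prob M ?R (J t)" using iJ t unfolding is_ito_integral_grid by auto
    moreover have "prob {\<omega>\<in>space M. \<bar>?R n \<omega> - J t \<omega>\<bar> > e} = prob {\<omega>\<in>space M. \<bar>?R n \<omega> - I t \<omega>\<bar> > e}" for n e
    proof (rule finite_measure_eq_AE)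
      show "AE \<omega> in M. (\<omega> \<in> {\<omega>\<in>space M. \<bar>?R n \<omega> - J t \<omega>\<bar> > e}) = (\<omega> \<in> {\<omega>\<in>space M. \<bar>?R n \<omega> - I t \<omega>\<bar> > e})"
        using eq by eventually_elim auto
      note [measurable] = riemann_sum_measurable[OF assms(3) t] mI mJ
      show "{\<omega>\<in>space M. \<bar>?R n \<omega> - J t \<omega>\<bar> > e} \<in> sets M" "{\<omega>\<in>space M. \<bar>?R n \<omega> - I t \<omega>\<bar> > e} \<in> sets M" by measurable
    qed
    ultimately show "conv_in_prob M ?R (I t)" unfolding conv_in_prob_def by simp
  qed
qed

section \<open>The exponential transform in both directions\<close>

lemma ito_zero: "ito (\<lambda>_ _. 0) (\<lambda>_ _. 0)"
  unfolding ito_def by (auto intro!: cont_adapted_const exI[of _ "\<lambda>n. n"] simp: ito_sum_def strict_mono_def)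

text \<open>Used for the exponent -log E, whose stochastic part is -J.\<close>

lemma ito_uminus:
  assumes "ito H J"
  shows "ito (\<lambda>t \<omega>. - H t \<omega>) (\<lambda>t \<omega>. - J t \<omega>)"
proof -
  obtain r where r: "strict_mono r" "AE \<omega> in M. \<forall>t\<in>{0..T}. (\<lambda>i. ito_sum H (r i) t \<omega>) \<longlonglongrightarrow> J t \<omega>"
    using assms unfolding ito_def by auto
  have ito_sum: "ito_sum (\<lambda>t \<omega>. - H t \<omega>) n t \<omega> = - ito_sum H n t \<omega>" for n t \<omega> unfolding ito_sum_def by (simp add: sum_negf)
  have "AE \<omega> in M. \<forall>t\<in>{0..T}. (\<lambda>i. ito_sum (\<lambda>t \<omega>. - H t \<omega>) (r i) t \<omega>) \<longlonglongrightarrow> - J t \<omega>"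
    using r(2) unfolding ito_sum by eventually_elim (auto intro: tendsto_minus)
  then show ?thesis using assms r(1) unfolding ito_def by (auto intro!: cont_adapted_uminus)
qed

text \<open>Logarithm of the Doleans exponential; \<open>J\<close> is the Ito integral of \<open>h\<close>.\<close>

definition log_doleans :: "(real \<Rightarrow> 'a \<Rightarrow> real) \<Rightarrow> (real \<Rightarrow> 'a \<Rightarrow> real) \<Rightarrow> real \<Rightarrow> 'a \<Rightarrow> real" where
  "log_doleans h J t \<omega> = J t \<omega> + integral {0..t} (\<lambda>s. - (h s \<omega>)\<^sup>2 / 2)"

lemma cont_adapted_half: "cont_adapted h \<Longrightarrow> cont_adapted (\<lambda>s \<omega>. - (h s \<omega>)\<^sup>2 / 2)"
  using cont_adapted_mult[OF cont_adapted_power2[of h] cont_adapted_const[of "- 1 / 2"]] by simp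

lemma cont_adapted_log_doleans: "cont_adapted h \<Longrightarrow> ito h J \<Longrightarrow> cont_adapted (log_doleans h J)"
proof -
  assume h: "cont_adapted h" "ito h J"
  have "cont_adapted (\<lambda>t \<omega>. J t \<omega> + integral {0..t} (\<lambda>s. - (h s \<omega>)\<^sup>2 / 2))"
    by (rule cont_adapted_add[OF ito_cont_adapted[OF h(2)] cont_adapted_integral[OF cont_adapted_half[OF h(1)]]])
  moreover have "log_doleans h J = (\<lambda>t \<omega>. J t \<omega> + integral {0..t} (\<lambda>s. - (h s \<omega>)\<^sup>2 / 2))" by (simp add: fun_eq_iff log_doleans_def)
  ultimately show ?thesis by simp
qed

lemma log_doleans_0: "ito h J \<Longrightarrow> \<omega> \<in> space M \<Longrightarrow> log_doleans h J 0 \<omega> = 0"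
  unfolding log_doleans_def ito_def by auto

lemma admissible_glue_path:
  assumes v: "cont_adapted v" "\<And>\<omega>. \<omega> \<in> space M \<Longrightarrow> v 0 \<omega> = 0" and y: "cont_adapted y" "\<And>\<omega>. \<omega> \<in> space M \<Longrightarrow> y 0 \<omega> = \<phi> \<omega> 0"
  shows "admissible (\<lambda>t \<omega>. glue_path (\<phi> \<omega>) (\<lambda>s. exp (v s \<omega>)) (\<lambda>s. y s \<omega>) t)"
  unfolding admissible_def
proof (intro conjI ballI)
  fix \<omega> assume \<omega>: "\<omega> \<in> space M"
  show "continuous_on {-L..T} (glue_path (\<phi> \<omega>) (\<lambda>s. exp (v s \<omega>)) (\<lambda>s. y s \<omega>))"
    by (rule glue_path_cont[OF phi_cspace[OF \<omega>] cont_adapted_cont[OF cont_adapted_exp[OF v(1)] \<omega>] cont_adapted_cont[OF y(1) \<omega>]]) (use v(2) y(2) \<omega> in auto)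
  show "glue_path (\<phi> \<omega>) (\<lambda>s. exp (v s \<omega>)) (\<lambda>s. y s \<omega>) t = \<phi> \<omega> t" if "t \<in> {-L..0}" for t
    using that unfolding glue_path_def by simp
next
  fix t assume t: "t \<in> {0..T}"
  have m: "(\<lambda>\<omega>. exp (v t \<omega>) * y t \<omega>) \<in> borel_measurable (Ft t)"
    using cont_adapted_Ft[OF cont_adapted_mult[OF cont_adapted_exp[OF v(1)] y(1)], of t t] t by auto
  have eq: "glue_path (\<phi> \<omega>) (\<lambda>s. exp (v s \<omega>)) (\<lambda>s. y s \<omega>) t = exp (v t \<omega>) * y t \<omega>" if "\<omega> \<in> space (Ft t)" for \<omega>
    using that v(2)[of \<omega>] y(2)[of \<omega>] t unfolding glue_path_def by auto
  show "(\<lambda>\<omega>. glue_path (\<phi> \<omega>) (\<lambda>s. exp (v s \<omega>)) (\<lambda>s. y s \<omega>) t) \<in> borel_measurable (Ft t)"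
    by (rule measurable_cong[THEN iffD2, OF eq m])
qed

text \<open>A fixed point picked separately for each outcome need not be measurable. So y is defined
  as the limit of the Picard iterates, each of which is adapted because the operator integrates an
  adapted continuous drift.\<close>

lemma random_ode:
  assumes v: "cont_adapted v" "\<And>\<omega>. \<omega> \<in> space M \<Longrightarrow> v 0 \<omega> = 0"
  shows "\<exists>y. cont_adapted y \<and> (\<forall>\<omega>\<in>space M. y 0 \<omega> = \<phi> \<omega> 0 \<and>
    (\<forall>t\<in>{0..T}. y t \<omega> = picard (\<phi> \<omega>) (\<lambda>s. exp (v s \<omega>)) (\<lambda>s. y s \<omega>) t))"
proof -
  define Y where "Y = (\<lambda>n t \<omega>. picard_iter (\<phi> \<omega>) (\<lambda>s. exp (v s \<omega>)) n t)"
  have S: "Y (Suc n) t \<omega> = picard (\<phi> \<omega>) (\<lambda>s. exp (v s \<omega>)) (\<lambda>s. Y n s \<omega>) t" for n t \<omega>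
    unfolding Y_def picard_iter_def by simp
  have T0': "0 \<le> T" using T_pos by simp
  have Ec: "continuous_on {0..T} (\<lambda>s. exp (v s \<omega>))" if "\<omega> \<in> space M" for \<omega> using cont_adapted_cont[OF cont_adapted_exp[OF v(1)] that] .
  have cadphi: "cont_adapted (\<lambda>t \<omega>. \<phi> \<omega> 0)"
    by (rule cadI) (use Ft_mono[OF phi_Ft0[of 0]] L0 in auto)
  have Y: "cont_adapted (Y n) \<and> (\<forall>\<omega>\<in>space M. Y n 0 \<omega> = \<phi> \<omega> 0)" for n
  proof (induction n)
    case 0
    have "Y 0 = (\<lambda>t \<omega>. \<phi> \<omega> 0)" unfolding Y_def picard_iter_def by (simp add: fun_eq_iff)
    then show ?case using cadphi by simp
  next
    case (Suc n)
    let ?S = "\<lambda>t \<omega>. glue_path (\<phi> \<omega>) (\<lambda>s. exp (v s \<omega>)) (\<lambda>s. Y n s \<omega>) t"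
    have "admissible ?S" by (rule admissible_glue_path[OF v]) (use Suc in auto)
    from cont_adapted_mult[OF cont_adapted_drift[OF this] cont_adapted_exp[OF cont_adapted_uminus[OF v(1)]]]
    have "cont_adapted (\<lambda>s \<omega>. f s (seg L (glue_path (\<phi> \<omega>) (\<lambda>s. exp (v s \<omega>)) (\<lambda>s. Y n s \<omega>)) s) / exp (v s \<omega>))"
      by (simp add: exp_minus divide_inverse)
    from cont_adapted_add[OF cadphi cont_adapted_integral[OF this]]
    have "cont_adapted (\<lambda>t \<omega>. picard (\<phi> \<omega>) (\<lambda>s. exp (v s \<omega>)) (\<lambda>s. Y n s \<omega>) t)" unfolding picard_def .
    moreover have "Y (Suc n) = (\<lambda>t \<omega>. picard (\<phi> \<omega>) (\<lambda>s. exp (v s \<omega>)) (\<lambda>s. Y n s \<omega>) t)" by (simp add: fun_eq_iff S)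
    moreover have "picard (\<phi> \<omega>) (\<lambda>s. exp (v s \<omega>)) (\<lambda>s. Y n s \<omega>) 0 = \<phi> \<omega> 0" for \<omega> unfolding picard_def by simp
    ultimately show ?case by simp
  qed
  have conv: "\<exists>y. uniform_limit {0..T} (\<lambda>n t. Y n t \<omega>) y sequentially \<and> continuous_on {0..T} y \<and> (\<forall>t\<in>{0..T}. y t = picard (\<phi> \<omega>) (\<lambda>s. exp (v s \<omega>)) y t)"
    if \<omega>: "\<omega> \<in> space M" for \<omega>
  proof -
    obtain C where C: "1 \<le> C" "\<And>s. s \<in> {0..T} \<Longrightarrow> exp (v s \<omega>) \<le> C" "\<And>s. s \<in> {0..T} \<Longrightarrow> 1 / exp (v s \<omega>) \<le> C"
      using E_bounds[OF Ec[OF \<omega>]] by auto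
    obtain P where P: "0 \<le> P" "\<And>s. s \<in> {-L..0} \<Longrightarrow> \<bar>\<phi> \<omega> s\<bar> \<le> P" using phi_bound[OF phi_cspace[OF \<omega>]] by blast
    have "\<exists>y. uniform_limit {0..T} (picard_iter (\<phi> \<omega>) (\<lambda>s. exp (v s \<omega>))) y sequentially \<and> continuous_on {0..T} y \<and> (\<forall>t\<in>{0..T}. y t = picard (\<phi> \<omega>) (\<lambda>s. exp (v s \<omega>)) y t)"
      by (rule picard_iter_converges[OF phi_cspace[OF \<omega>] T0' order_refl Ec[OF \<omega>] _ _ C P]) (use v(2)[OF \<omega>] in auto)
    then show ?thesis unfolding Y_def by simp
  qed
  define y where "y = (\<lambda>t \<omega>. lim (\<lambda>n. Y n t \<omega>))"
  have ylim: "(\<lambda>n. Y n t \<omega>) \<longlonglongrightarrow> y t \<omega>" and yc: "continuous_on {0..T} (\<lambda>t. y t \<omega>)"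
    and yP: "y t \<omega> = picard (\<phi> \<omega>) (\<lambda>s. exp (v s \<omega>)) (\<lambda>s. y s \<omega>) t"
    if \<omega>: "\<omega> \<in> space M" and t: "t \<in> {0..T}" for \<omega> t
  proof -
    obtain z where z: "uniform_limit {0..T} (\<lambda>n t. Y n t \<omega>) z sequentially" "continuous_on {0..T} z" "\<forall>t\<in>{0..T}. z t = picard (\<phi> \<omega>) (\<lambda>s. exp (v s \<omega>)) z t"
      using conv[OF \<omega>] by auto
    have zl: "(\<lambda>n. Y n t \<omega>) \<longlonglongrightarrow> z t" if "t \<in> {0..T}" for t using tendsto_uniform_limitI[OF z(1) that] .
    have yz: "y t \<omega> = z t" if "t \<in> {0..T}" for t unfolding y_def using limI[OF zl[OF that]] .
    show "(\<lambda>n. Y n t \<omega>) \<longlonglongrightarrow> y t \<omega>" using zl[OF t] yz[OF t] by simp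
    show "continuous_on {0..T} (\<lambda>t. y t \<omega>)" by (rule continuous_on_eq[OF z(2)]) (use yz in auto)
    have "picard (\<phi> \<omega>) (\<lambda>s. exp (v s \<omega>)) z t = picard (\<phi> \<omega>) (\<lambda>s. exp (v s \<omega>)) (\<lambda>s. y s \<omega>) t"
      unfolding picard_def
    \<comment> \<open>The two functions are known to agree on [0, T] only; segments up to time t
      look at nothing beyond.\<close>
    proof (intro arg_cong2[where f="(+)"] refl integral_cong)
      fix s assume s: "s \<in> {0..t}"
      have "seg L (glue_path (\<phi> \<omega>) (\<lambda>s. exp (v s \<omega>)) z) s = seg L (glue_path (\<phi> \<omega>) (\<lambda>s. exp (v s \<omega>)) (\<lambda>s. y s \<omega>)) s"
        by (rule seg_cong) (use s t yz in \<open>auto simp: glue_path_def\<close>)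
      then show "f s (seg L (glue_path (\<phi> \<omega>) (\<lambda>s. exp (v s \<omega>)) z) s) / exp (v s \<omega>) =
        f s (seg L (glue_path (\<phi> \<omega>) (\<lambda>s. exp (v s \<omega>)) (\<lambda>s. y s \<omega>)) s) / exp (v s \<omega>)" by simp
    qed
    then show "y t \<omega> = picard (\<phi> \<omega>) (\<lambda>s. exp (v s \<omega>)) (\<lambda>s. y s \<omega>) t" using z(3) t yz[OF t] by simp
  qed
  have "cont_adapted y"
  proof (rule cadI)
    fix t assume t: "0 \<le> t" "t \<le> T"
    show "y t \<in> borel_measurable (Ft t)"
    proof (rule borel_measurable_LIMSEQ_real)
      show "Y n t \<in> borel_measurable (Ft t)" for n using cont_adapted_Ft[of "Y n" t t] Y[of n] t by auto
      show "(\<lambda>n. Y n t \<omega>) \<longlonglongrightarrow> y t \<omega>" if "\<omega> \<in> space (Ft t)" for \<omega> using ylim[of \<omega> t] that t by auto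
    qed
  next
    fix \<omega> assume "\<omega> \<in> space M"
    then show "continuous_on {0..T} (\<lambda>t. y t \<omega>)" using yc[of \<omega> 0] T0' by auto
  qed
  moreover have "y 0 \<omega> = \<phi> \<omega> 0" if "\<omega> \<in> space M" for \<omega>
    using yP[OF that, of 0] T0' unfolding picard_def by simp
  ultimately show ?thesis using yP by blast
qed

text \<open>Ito's formula with u = y, which has drift a / E and no stochastic part, and v = log E.
  The drift -h^2 / 2 of v cancels the second order term h^2 / 2, leaving drift a and stochastic
  integrand h S for S = E y.\<close>

theorem frozen_delay_solution_exists:
  assumes R: "admissible R"
  shows "\<exists>S. frozen_delay_solution R S"
proof -
  define h where "h = (\<lambda>s \<omega>. g (R (s - b) \<omega>))"
  have h: "cont_adapted h" unfolding h_def by (rule cont_adapted_delay[OF R])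
  obtain J where J: "ito h J" using ito_exists[OF h] by auto
  define v where "v = log_doleans h J"
  have v: "cont_adapted v" "\<And>\<omega>. \<omega> \<in> space M \<Longrightarrow> v 0 \<omega> = 0" unfolding v_def using cont_adapted_log_doleans[OF h J] log_doleans_0[OF J] by auto
  obtain y where y: "cont_adapted y" "\<And>\<omega>. \<omega> \<in> space M \<Longrightarrow> y 0 \<omega> = \<phi> \<omega> 0"
    "\<And>\<omega> t. \<omega> \<in> space M \<Longrightarrow> t \<in> {0..T} \<Longrightarrow> y t \<omega> = picard (\<phi> \<omega>) (\<lambda>s. exp (v s \<omega>)) (\<lambda>s. y s \<omega>) t"
    using random_ode[OF v] by blast
  define S where "S = (\<lambda>t \<omega>. glue_path (\<phi> \<omega>) (\<lambda>s. exp (v s \<omega>)) (\<lambda>s. y s \<omega>) t)"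
  have S: "admissible S" unfolding S_def by (rule admissible_glue_path[OF v y(1,2)])
  have Sy: "S t \<omega> = exp (v t \<omega>) * y t \<omega>" if "\<omega> \<in> space M" "t \<in> {0..T}" for t \<omega>
    using that v(2)[of \<omega>] y(2)[of \<omega>] unfolding S_def glue_path_def by auto
  define a where "a = (\<lambda>s \<omega>. f s (seg L (\<lambda>u. S u \<omega>) s))"
  have a: "cont_adapted a" unfolding a_def by (rule cont_adapted_drift[OF S])
  have au: "cont_adapted (\<lambda>s \<omega>. a s \<omega> / exp (v s \<omega>))"
    using cont_adapted_mult[OF a cont_adapted_exp[OF cont_adapted_uminus[OF v(1)]]] by (simp add: exp_minus divide_inverse)
  have equ: "AE \<omega> in M. \<forall>t\<in>{0..T}. y t \<omega> = y 0 \<omega> + integral {0..t} (\<lambda>s. a s \<omega> / exp (v s \<omega>)) + 0"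
  proof (rule AE_I2, rule ballI)
    fix \<omega> t assume \<omega>: "\<omega> \<in> space M" and t: "t \<in> {0..T}"
    show "y t \<omega> = y 0 \<omega> + integral {0..t} (\<lambda>s. a s \<omega> / exp (v s \<omega>)) + 0"
      using y(3)[OF \<omega> t] y(2)[OF \<omega>] unfolding picard_def a_def S_def by simp
  qed
  have eqv: "AE \<omega> in M. \<forall>t\<in>{0..T}. v t \<omega> = v 0 \<omega> + integral {0..t} (\<lambda>s. - (h s \<omega>)\<^sup>2 / 2) + J t \<omega>"
    using v(2) by (intro AE_I2) (auto simp: v_def log_doleans_def)
  note ito = ito_exp_product[OF y(1) v(1) au cont_adapted_half[OF h] cont_adapted_const h ito_zero J equ eqv]
  let ?I = "\<lambda>t \<omega>. y t \<omega> * exp (v t \<omega>) - y 0 \<omega> * exp (v 0 \<omega>) -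
     integral {0..t} (\<lambda>s. exp (v s \<omega>) * (a s \<omega> / exp (v s \<omega>) + y s \<omega> * (- (h s \<omega>)\<^sup>2 / 2) + 0 * h s \<omega> + y s \<omega> * (h s \<omega>)\<^sup>2 / 2))"
  have "is_ito_integral M T W (\<lambda>s \<omega>. h s \<omega> * S s \<omega>) ?I"
  proof (rule is_ito_integral_AE_cong[OF ito])
    show "cont_adapted (\<lambda>s \<omega>. exp (v s \<omega>) * (0 + y s \<omega> * h s \<omega>))" by (intro cont_adapted_mult cont_adapted_add cont_adapted_const cont_adapted_exp v y h)
    show "cont_adapted (\<lambda>s \<omega>. h s \<omega> * S s \<omega>)" by (rule cont_adapted_mult[OF h admissible_cont_adapted[OF S]])
    show "AE \<omega> in M. \<forall>s\<in>{0..T}. exp (v s \<omega>) * (0 + y s \<omega> * h s \<omega>) = h s \<omega> * S s \<omega>"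
      by (rule AE_I2) (auto simp: Sy)
  qed
  moreover have "AE \<omega> in M. \<forall>t\<in>{0..T}. S t \<omega> = \<phi> \<omega> 0 + integral {0..t} (\<lambda>s. f s (seg L (\<lambda>u. S u \<omega>) s)) + ?I t \<omega>"
  proof (rule AE_I2, rule ballI)
    fix \<omega> t assume \<omega>: "\<omega> \<in> space M" and t: "t \<in> {0..T}"
    have "(\<lambda>s. exp (v s \<omega>) * (a s \<omega> / exp (v s \<omega>) + y s \<omega> * (- (h s \<omega>)\<^sup>2 / 2) + 0 * h s \<omega> + y s \<omega> * (h s \<omega>)\<^sup>2 / 2)) =
      (\<lambda>s. f s (seg L (\<lambda>u. S u \<omega>) s))" by (simp add: fun_eq_iff a_def)
    then show "S t \<omega> = \<phi> \<omega> 0 + integral {0..t} (\<lambda>s. f s (seg L (\<lambda>u. S u \<omega>) s)) + ?I t \<omega>"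
      using Sy[OF \<omega> t] y(2)[OF \<omega>] v(2)[OF \<omega>] by simp
  qed
  ultimately have "frozen_delay_solution R S" unfolding frozen_delay_solution_def h_def using S by blast
  then show ?thesis by blast
qed

text \<open>Ito's formula with u = S and v = -log E. The stochastic integrand is (h S - S h) / E =
  0, and the corrections S h^2 / 2 - h^2 S + S h^2 / 2 cancel as well. So S / E minus its initial
  value minus the integral of a / E is an integral of 0, hence 0 almost surely at each time, and by
  continuity at all times.\<close>

theorem frozen_delay_solution_representation:
  assumes R: "admissible R" and st: "frozen_delay_solution R S" and J: "ito (\<lambda>s \<omega>. g (R (s - b) \<omega>)) J"
  shows "AE \<omega> in M. \<forall>t\<in>{0..T}. S t \<omega> / exp (log_doleans (\<lambda>s \<omega>. g (R (s - b) \<omega>)) J t \<omega>) =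
    \<phi> \<omega> 0 + integral {0..t} (\<lambda>s. f s (seg L (\<lambda>u. S u \<omega>) s) / exp (log_doleans (\<lambda>s \<omega>. g (R (s - b) \<omega>)) J s \<omega>))"
proof -
  define h where "h = (\<lambda>s \<omega>. g (R (s - b) \<omega>))"
  have h: "cont_adapted h" unfolding h_def by (rule cont_adapted_delay[OF R])
  have J: "ito h J" using J unfolding h_def .
  have S: "admissible S" by (rule frozen_delay_solution_admissible[OF st])
  obtain I where I: "is_ito_integral M T W (\<lambda>s \<omega>. h s \<omega> * S s \<omega>) I"
    "AE \<omega> in M. \<forall>t\<in>{0..T}. S t \<omega> = \<phi> \<omega> 0 + integral {0..t} (\<lambda>s. f s (seg L (\<lambda>u. S u \<omega>) s)) + I t \<omega>"
    using st unfolding frozen_delay_solution_def h_def by auto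
  define a where "a = (\<lambda>s \<omega>. f s (seg L (\<lambda>u. S u \<omega>) s))"
  have a: "cont_adapted a" unfolding a_def by (rule cont_adapted_drift[OF S])
  define w where "w = (\<lambda>t \<omega>. - log_doleans h J t \<omega>)"
  have w: "cont_adapted w" unfolding w_def by (rule cont_adapted_uminus[OF cont_adapted_log_doleans[OF h J]])
  have w0: "w 0 \<omega> = 0" if "\<omega> \<in> space M" for \<omega> unfolding w_def using log_doleans_0[OF J that] by simp
  have hS: "cont_adapted (\<lambda>s \<omega>. h s \<omega> * S s \<omega>)" by (rule cont_adapted_mult[OF h admissible_cont_adapted[OF S]])
  obtain J2 where J2: "ito (\<lambda>s \<omega>. h s \<omega> * S s \<omega>) J2" using ito_exists[OF hS] by auto
  have S0: "S 0 \<omega> = \<phi> \<omega> 0" if "\<omega> \<in> space M" for \<omega> using admissible_phi[OF S that, of 0] L0 by auto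
  have cadS0: "cont_adapted (\<lambda>t. S 0)"
    by (rule cadI) (use cont_adapted_Ft[OF admissible_cont_adapted[OF S], of 0] in auto)
  \<comment> \<open>The integral in the definition of a solution is determined only time by time. It
    is replaced by the continuous version J2, so that the equation holds at all times off one null
    set in terms of \<open>ito\<close>.\<close>
  have "AE \<omega> in M. True \<longrightarrow> (\<forall>t\<in>{0..T}. S t \<omega> - S 0 \<omega> - integral {0..t} (\<lambda>s. a s \<omega>) = J2 t \<omega>)"
  proof (rule AE_all_from_dyadics)
    show "AE \<omega> in M. continuous_on {0..T} (\<lambda>t. S t \<omega> - S 0 \<omega> - integral {0..t} (\<lambda>s. a s \<omega>))"
      using cont_adapted_cont[OF cont_adapted_diff[OF cont_adapted_diff[OF admissible_cont_adapted[OF S] cadS0] cont_adapted_integral[OF a]]] by (intro AE_I2)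
    show "AE \<omega> in M. continuous_on {0..T} (\<lambda>t. J2 t \<omega>)" using cont_adapted_cont[OF ito_cont_adapted[OF J2]] by (intro AE_I2)
    fix t assume t: "0 \<le> t" "t \<le> T"
    have "AE \<omega> in M. True \<longrightarrow> I t \<omega> = J2 t \<omega>"
      by (rule is_ito_integral_unique[OF I(1) ito_is_ito_integral[OF hS J2] hS hS t]) auto
    then show "AE \<omega> in M. True \<longrightarrow> S t \<omega> - S 0 \<omega> - integral {0..t} (\<lambda>s. a s \<omega>) = J2 t \<omega>"
      using I(2) AE_space
    proof eventually_elim
      case (elim \<omega>)
      have "S t \<omega> = \<phi> \<omega> 0 + integral {0..t} (\<lambda>s. a s \<omega>) + I t \<omega>" unfolding a_def by (rule bspec[OF elim(2)]) (use t in auto)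
      then show ?case using elim(1) S0[OF elim(3)] by simp
    qed
  qed
  then have equ: "AE \<omega> in M. \<forall>t\<in>{0..T}. S t \<omega> = S 0 \<omega> + integral {0..t} (\<lambda>s. a s \<omega>) + J2 t \<omega>"
  proof eventually_elim
    case (elim \<omega>)
    show ?case
    proof
      fix t assume "t \<in> {0..T}"
      then have "S t \<omega> - S 0 \<omega> - integral {0..t} (\<lambda>s. a s \<omega>) = J2 t \<omega>" using elim by blast
      then show "S t \<omega> = S 0 \<omega> + integral {0..t} (\<lambda>s. a s \<omega>) + J2 t \<omega>" by linarith
    qed
  qed
  have half: "cont_adapted (\<lambda>s \<omega>. (h s \<omega>)\<^sup>2 / 2)" using cont_adapted_uminus[OF cont_adapted_half[OF h]] by simp
  have eqw: "AE \<omega> in M. \<forall>t\<in>{0..T}. w t \<omega> = w 0 \<omega> + integral {0..t} (\<lambda>s. (h s \<omega>)\<^sup>2 / 2) + - J t \<omega>"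
  proof (rule AE_I2, rule ballI)
    fix \<omega> t assume \<omega>: "\<omega> \<in> space M" and t: "t \<in> {0..T}"
    have "integral {0..t} (\<lambda>s. - (h s \<omega>)\<^sup>2 / 2) = - integral {0..t} (\<lambda>s. (h s \<omega>)\<^sup>2 / 2)"
      using integral_neg[of "{0..t}" "\<lambda>s. (h s \<omega>)\<^sup>2 / 2"] by simp
    then show "w t \<omega> = w 0 \<omega> + integral {0..t} (\<lambda>s. (h s \<omega>)\<^sup>2 / 2) + - J t \<omega>"
      using w0[OF \<omega>] unfolding w_def log_doleans_def by simp
  qed
  note ito = ito_exp_product[OF admissible_cont_adapted[OF S] w a half hS cont_adapted_uminus[OF h] J2 ito_uminus[OF J] equ eqw]
  let ?D = "\<lambda>t \<omega>. S t \<omega> * exp (w t \<omega>) - S 0 \<omega> * exp (w 0 \<omega>) - integral {0..t} (\<lambda>s. exp (w s \<omega>) *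
       (a s \<omega> + S s \<omega> * ((h s \<omega>)\<^sup>2 / 2) + h s \<omega> * S s \<omega> * - h s \<omega> + S s \<omega> * (- h s \<omega>)\<^sup>2 / 2))"
  have D: "?D t \<omega> = S t \<omega> * exp (w t \<omega>) - S 0 \<omega> * exp (w 0 \<omega>) - integral {0..t} (\<lambda>s. exp (w s \<omega>) * a s \<omega>)" for t \<omega>
    by (simp add: power2_eq_square algebra_simps)
  have Dc: "cont_adapted (\<lambda>t \<omega>. S t \<omega> * exp (w t \<omega>) - S 0 \<omega> * exp (w 0 \<omega>) - integral {0..t} (\<lambda>s. exp (w s \<omega>) * a s \<omega>))"
  proof (intro cont_adapted_diff cont_adapted_mult cont_adapted_integral cont_adapted_exp w a admissible_cont_adapted[OF S] cadS0)
    show "cont_adapted (\<lambda>t. w 0)" by (rule cadI) (use cont_adapted_Ft[OF w, of 0] in auto)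
  qed
  have "AE \<omega> in M. True \<longrightarrow> (\<forall>t\<in>{0..T}. S t \<omega> * exp (w t \<omega>) - S 0 \<omega> * exp (w 0 \<omega>) - integral {0..t} (\<lambda>s. exp (w s \<omega>) * a s \<omega>) = 0)"
  proof (rule AE_all_from_dyadics)
    fix t assume t: "0 \<le> t" "t \<le> T"
    have "AE \<omega> in M. True \<longrightarrow> ?D t \<omega> = 0"
    proof (rule is_ito_integral_unique[OF ito ito_is_ito_integral[OF cont_adapted_const ito_zero] _ cont_adapted_const t])
      show "cont_adapted (\<lambda>s \<omega>. exp (w s \<omega>) * (h s \<omega> * S s \<omega> + S s \<omega> * - h s \<omega>))"
        by (intro cont_adapted_mult cont_adapted_add cont_adapted_exp cont_adapted_uminus w h admissible_cont_adapted[OF S])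
    qed (simp add: mult.commute)
    then show "AE \<omega> in M. True \<longrightarrow> S t \<omega> * exp (w t \<omega>) - S 0 \<omega> * exp (w 0 \<omega>) - integral {0..t} (\<lambda>s. exp (w s \<omega>) * a s \<omega>) = 0"
      unfolding D .
  qed (use cont_adapted_cont[OF Dc] in auto)
  then show ?thesis using AE_space
  proof eventually_elim
    case (elim \<omega>)
    show ?case
    proof
      fix t assume t: "t \<in> {0..T}"
      have "S t \<omega> * exp (w t \<omega>) - S 0 \<omega> * exp (w 0 \<omega>) - integral {0..t} (\<lambda>s. exp (w s \<omega>) * a s \<omega>) = 0" using elim(1) t by blast
      then have "S t \<omega> * exp (w t \<omega>) = \<phi> \<omega> 0 + integral {0..t} (\<lambda>s. exp (w s \<omega>) * a s \<omega>)" using S0[OF elim(2)] w0[OF elim(2)] by simp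
      then show "S t \<omega> / exp (log_doleans (\<lambda>s \<omega>. g (R (s - b) \<omega>)) J t \<omega>) =
        \<phi> \<omega> 0 + integral {0..t} (\<lambda>s. f s (seg L (\<lambda>u. S u \<omega>) s) / exp (log_doleans (\<lambda>s \<omega>. g (R (s - b) \<omega>)) J s \<omega>))"
        unfolding w_def a_def h_def by (simp add: exp_minus divide_inverse mult.commute)
    qed
  qed
qed

end

section \<open>Induction over intervals of length b, and positivity\<close>

context sfde
begin

text \<open>Up to time tau the coefficient h involves R only up to tau - b. Hence h and h', their
  integrals and their exponentials agree on [0, tau], and S / E and S' / E are fixed points of the
  same Picard operator on almost every path.\<close>

theorem frozen_delay_solution_unique:
  assumes R: "admissible R" "admissible R'" and st: "frozen_delay_solution R S" "frozen_delay_solution R' S'" and \<tau>: "0 \<le> \<tau>" "\<tau> \<le> T"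
    and eq: "AE \<omega> in M. \<forall>t\<in>{-L..\<tau> - b}. R t \<omega> = R' t \<omega>"
  shows "AE \<omega> in M. \<forall>t\<in>{-L..\<tau>}. S t \<omega> = S' t \<omega>"
proof -
  define h where "h = (\<lambda>s \<omega>. g (R (s - b) \<omega>))"
  define h' where "h' = (\<lambda>s \<omega>. g (R' (s - b) \<omega>))"
  have h: "cont_adapted h" "cont_adapted h'" unfolding h_def h'_def using cont_adapted_delay R by auto
  obtain J where J: "ito h J" using ito_exists[OF h(1)] by auto
  obtain J' where J': "ito h' J'" using ito_exists[OF h(2)] by auto
  have S: "admissible S" "admissible S'" using frozen_delay_solution_admissible st by auto
  have eqh: "AE \<omega> in M. \<forall>s\<in>{0..\<tau>}. h s \<omega> = h' s \<omega>"
    using eq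
  proof eventually_elim
    case (elim \<omega>)
    show ?case
    proof
      fix s assume "s \<in> {0..\<tau>}"
      then have "s - b \<in> {-L..\<tau> - b}" using b0 by auto
      then show "h s \<omega> = h' s \<omega>" unfolding h_def h'_def using elim by simp
    qed
  qed
  \<comment> \<open>Stopping both processes at tau makes them comparable on all of [0, T], which
    \<open>AE_all_from_dyadics\<close> expects.\<close>
  have "AE \<omega> in M. True \<longrightarrow> (\<forall>t\<in>{0..T}. J (min t \<tau>) \<omega> = J' (min t \<tau>) \<omega>)"
  proof (rule AE_all_from_dyadics)
    have "continuous_on {0..T} (\<lambda>t. K (min t \<tau>) \<omega>)" if "cont_adapted K" "\<omega> \<in> space M" for K \<omega>
      by (rule continuous_on_compose2[OF cont_adapted_cont[OF that]]) (use \<tau> in \<open>auto intro!: continuous_intros\<close>)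
    then show "AE \<omega> in M. continuous_on {0..T} (\<lambda>t. J (min t \<tau>) \<omega>)" "AE \<omega> in M. continuous_on {0..T} (\<lambda>t. J' (min t \<tau>) \<omega>)"
      using ito_cont_adapted[OF J] ito_cont_adapted[OF J'] by auto
    fix t assume t: "0 \<le> t" "t \<le> T"
    show "AE \<omega> in M. True \<longrightarrow> J (min t \<tau>) \<omega> = J' (min t \<tau>) \<omega>"
    proof (rule is_ito_integral_unique[OF ito_is_ito_integral[OF h(1) J] ito_is_ito_integral[OF h(2) J'] h])
      show "AE \<omega> in M. True \<longrightarrow> (\<forall>s\<in>{0..min t \<tau>}. h s \<omega> = h' s \<omega>)" using eqh by eventually_elim auto
    qed (use t \<tau> in auto)
  qed
  then have eqJ: "AE \<omega> in M. \<forall>t\<in>{0..\<tau>}. J t \<omega> = J' t \<omega>"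
  proof eventually_elim
    case (elim \<omega>)
    show ?case
    proof
      fix t assume "t \<in> {0..\<tau>}"
      then show "J t \<omega> = J' t \<omega>" using bspec[OF mp[OF elim TrueI], of t] \<tau> by (simp add: min_absorb1)
    qed
  qed
  from frozen_delay_solution_representation[OF R(1) st(1) J[unfolded h_def], folded h_def]
    frozen_delay_solution_representation[OF R(2) st(2) J'[unfolded h'_def], folded h'_def] eqh eqJ AE_space
  show ?thesis
  proof eventually_elim
    case (elim \<omega>)
    define E where "E = (\<lambda>s. exp (log_doleans h J s \<omega>))"
    note \<omega> = elim(5)
    have E: "continuous_on {0..\<tau>} E" unfolding E_def
      by (rule continuous_on_subset[OF cont_adapted_cont[OF cont_adapted_exp[OF cont_adapted_log_doleans[OF h(1) J]] \<omega>]]) (use \<tau> in auto)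
    have E0: "E 0 = 1" unfolding E_def using log_doleans_0[OF J \<omega>] by simp
    have Ep: "0 < E s" for s unfolding E_def by simp
    have E': "exp (log_doleans h' J' s \<omega>) = E s" if "s \<in> {0..\<tau>}" for s
    proof -
      have "integral {0..s} (\<lambda>s. - (h s \<omega>)\<^sup>2 / 2) = integral {0..s} (\<lambda>s. - (h' s \<omega>)\<^sup>2 / 2)"
        by (rule integral_cong) (use elim(3) that in auto)
      then show ?thesis unfolding E_def log_doleans_def using elim(4) that by auto
    qed
    obtain C where C: "1 \<le> C" "\<And>s. s \<in> {0..\<tau>} \<Longrightarrow> E s \<le> C" "\<And>s. s \<in> {0..\<tau>} \<Longrightarrow> 1 / E s \<le> C"
      using E_bounds[OF E Ep] by auto
    obtain P where P: "0 \<le> P" "\<And>s. s \<in> {-L..0} \<Longrightarrow> \<bar>\<phi> \<omega> s\<bar> \<le> P" using phi_bound[OF phi_cspace[OF \<omega>]] by blast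
    have cS: "continuous_on {0..\<tau>} (\<lambda>t. V t \<omega> / E t)" if "admissible V" for V
    proof (rule continuous_on_divide[OF _ E])
      show "continuous_on {0..\<tau>} (\<lambda>t. V t \<omega>)"
        by (rule continuous_on_subset[OF admissible_cont[OF that \<omega>]]) (use \<tau> L0 in auto)
      show "\<forall>t\<in>{0..\<tau>}. E t \<noteq> 0" using Ep by (metis less_irrefl)
    qed
    have seg: "seg L (glue_path (\<phi> \<omega>) E (\<lambda>t. V t \<omega> / E t)) s = seg L (\<lambda>u. V u \<omega>) s" if "admissible V" "s \<in> {0..\<tau>}" for V s
    proof (rule seg_cong)
      fix u assume u: "s - L \<le> u" "u \<le> s"
      show "glue_path (\<phi> \<omega>) E (\<lambda>t. V t \<omega> / E t) u = V u \<omega>"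
        unfolding glue_path_def using admissible_phi[OF that(1) \<omega>, of u] u that(2) Ep[of u] by auto
    qed
    have pic: "V u \<omega> / E u = picard (\<phi> \<omega>) E (\<lambda>t. V t \<omega> / E t) u"
      if V: "admissible V" and rep: "V u \<omega> / E u = \<phi> \<omega> 0 + integral {0..u} (\<lambda>s. f s (seg L (\<lambda>u. V u \<omega>) s) / E s)" and u: "u \<in> {0..\<tau>}" for V u
    proof -
      have "integral {0..u} (\<lambda>s. f s (seg L (\<lambda>u. V u \<omega>) s) / E s) = integral {0..u} (\<lambda>s. f s (seg L (glue_path (\<phi> \<omega>) E (\<lambda>t. V t \<omega> / E t)) s) / E s)"
        by (rule integral_cong) (use seg[OF V] u in auto)
      then show ?thesis unfolding picard_def using rep by simp
    qed
    have rep1: "S u \<omega> / E u = \<phi> \<omega> 0 + integral {0..u} (\<lambda>s. f s (seg L (\<lambda>u. S u \<omega>) s) / E s)" if "u \<in> {0..\<tau>}" for u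
      using bspec[OF elim(1), of u] that \<tau> unfolding E_def by simp
    have rep2: "S' u \<omega> / E u = \<phi> \<omega> 0 + integral {0..u} (\<lambda>s. f s (seg L (\<lambda>u. S' u \<omega>) s) / E s)" if u: "u \<in> {0..\<tau>}" for u
    proof -
      have "integral {0..u} (\<lambda>s. f s (seg L (\<lambda>u. S' u \<omega>) s) / exp (log_doleans h' J' s \<omega>)) = integral {0..u} (\<lambda>s. f s (seg L (\<lambda>u. S' u \<omega>) s) / E s)"
        by (rule integral_cong) (use E' u in auto)
      then show ?thesis using bspec[OF elim(2), of u] u \<tau> E'[OF u] by simp
    qed
    have eqE: "S t \<omega> / E t = S' t \<omega> / E t" if t: "t \<in> {0..\<tau>}" for t
      by (rule picard_unique[OF phi_cspace[OF \<omega>] \<tau> E E0 Ep C P cS[OF S(1)] pic[OF S(1) rep1] cS[OF S(2)] pic[OF S(2) rep2] t])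
    have "S t \<omega> = S' t \<omega>" if "t \<in> {0..\<tau>}" for t using eqE[OF that] Ep[of t] by simp
    moreover have "S t \<omega> = S' t \<omega>" if "t \<in> {-L..0}" for t using admissible_phi[OF S(1) \<omega> that] admissible_phi[OF S(2) \<omega> that] by simp
    ultimately show ?case by (metis atLeastAtMost_iff linear)
  qed
qed

lemma frozen_delay_solution_cong:
  assumes "frozen_delay_solution R S" "admissible R" "admissible R'" "AE \<omega> in M. \<forall>t\<in>{-L..T}. R t \<omega> = R' t \<omega>"
  shows "frozen_delay_solution R' S"
proof -
  have S: "admissible S" by (rule frozen_delay_solution_admissible[OF assms(1)])
  obtain I where I: "is_ito_integral M T W (\<lambda>s \<omega>. g (R (s - b) \<omega>) * S s \<omega>) I"
    "AE \<omega> in M. \<forall>t\<in>{0..T}. S t \<omega> = \<phi> \<omega> 0 + integral {0..t} (\<lambda>s. f s (seg L (\<lambda>u. S u \<omega>) s)) + I t \<omega>"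
    using assms(1) unfolding frozen_delay_solution_def by auto
  have "is_ito_integral M T W (\<lambda>s \<omega>. g (R' (s - b) \<omega>) * S s \<omega>) I"
  proof (rule is_ito_integral_AE_cong[OF I(1)])
    show "cont_adapted (\<lambda>s \<omega>. g (R (s - b) \<omega>) * S s \<omega>)" "cont_adapted (\<lambda>s \<omega>. g (R' (s - b) \<omega>) * S s \<omega>)"
      using cont_adapted_mult[OF cont_adapted_delay admissible_cont_adapted[OF S]] assms by auto
    show "AE \<omega> in M. \<forall>s\<in>{0..T}. g (R (s - b) \<omega>) * S s \<omega> = g (R' (s - b) \<omega>) * S s \<omega>"
      using assms(4)
    proof eventually_elim
      case (elim \<omega>)
      show ?case
      proof
        fix s assume "s \<in> {0..T}"
        then have "s - b \<in> {-L..T}" using b0 by auto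
        then show "g (R (s - b) \<omega>) * S s \<omega> = g (R' (s - b) \<omega>) * S s \<omega>" using elim by simp
      qed
    qed
  qed
  then show ?thesis unfolding frozen_delay_solution_def using S I(2) by blast
qed

lemma solution_exists: "\<exists>S. frozen_delay_solution S S"
proof -
  \<comment> \<open>The initial path continued by its value at 0 is continuous, and it is adapted
    because that value is known at time 0.\<close>
  define S0 where "S0 = (\<lambda>t \<omega>. \<phi> \<omega> (min t 0))"
  have S0: "admissible S0" unfolding admissible_def
  proof (intro conjI ballI)
    fix \<omega> assume "\<omega> \<in> space M"
    then have "continuous_on {-L..0} (\<phi> \<omega>)" using phi_cspace unfolding cspace_def by auto
    then show "continuous_on {-L..T} (\<lambda>t. S0 t \<omega>)" unfolding S0_def
      by (rule continuous_on_compose2) (use L0 in \<open>auto intro!: continuous_intros\<close>)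
  next
    fix t assume t: "t \<in> {0..T}"
    have "S0 t = (\<lambda>\<omega>. \<phi> \<omega> 0)" using t unfolding S0_def by (simp add: fun_eq_iff)
    then show "S0 t \<in> borel_measurable (Ft t)" using Ft_mono[OF phi_Ft0[of 0], of t] t L0 by auto
  qed (auto simp: S0_def min_absorb1)
  \<comment> \<open>The choice is harmless for measurability: it selects an entire adapted process,
    not a value for each outcome.\<close>
  define Sq where "Sq = rec_nat S0 (\<lambda>_ R. SOME S. frozen_delay_solution R S)"
  have Suc: "Sq (Suc n) = (SOME S. frozen_delay_solution (Sq n) S)" for n unfolding Sq_def by simp
  have admissible: "admissible (Sq n)" for n
  proof (induction n)
    case 0 show ?case unfolding Sq_def using S0 by simp
  next
    case (Suc n)
    show ?case unfolding \<open>\<And>n. Sq (Suc n) = (SOME S. frozen_delay_solution (Sq n) S)\<close>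
      by (rule frozen_delay_solution_admissible[OF someI_ex[OF frozen_delay_solution_exists[OF Suc]]])
  qed
  have step: "frozen_delay_solution (Sq n) (Sq (Suc n))" for n
    unfolding Suc by (rule someI_ex[OF frozen_delay_solution_exists[OF admissible]])
  \<comment> \<open>All iterates share the initial path, which starts the induction. Agreement up to
    n b settles the delayed coefficient up to (n + 1) b; the minimum with T ends the procedure at
    the horizon.\<close>
  have agree: "AE \<omega> in M. \<forall>t\<in>{-L..min (real n * b) T}. Sq n t \<omega> = Sq (Suc n) t \<omega>" for n
  proof (induction n)
    case 0
    show ?case
    proof (rule AE_I2, rule ballI)
      fix \<omega> t assume \<omega>: "\<omega> \<in> space M" and "t \<in> {-L..min (real 0 * b) T}"
      then have t: "t \<in> {-L..0}" by auto
      show "Sq 0 t \<omega> = Sq (Suc 0) t \<omega>" using admissible_phi[OF admissible \<omega> t] by simp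
    qed
  next
    case (Suc n)
    show ?case
    proof (rule frozen_delay_solution_unique[OF admissible admissible step step])
      show "AE \<omega> in M. \<forall>t\<in>{-L..min (real (Suc n) * b) T - b}. Sq n t \<omega> = Sq (Suc n) t \<omega>"
        using Suc
      proof eventually_elim
        case (elim \<omega>)
        show ?case
        proof
          fix t assume "t \<in> {-L..min (real (Suc n) * b) T - b}"
          then have "t \<in> {-L..min (real n * b) T}" using b0 by (auto simp: algebra_simps)
          then show "Sq n t \<omega> = Sq (Suc n) t \<omega>" using elim by blast
        qed
      qed
    qed (use b0 T_pos in auto)
  qed
  obtain n :: nat where "T / b < real n" using reals_Archimedean2 by blast
  then have "min (real n * b) T = T" using b0 by (simp add: pos_divide_less_eq)
  then have "AE \<omega> in M. \<forall>t\<in>{-L..T}. Sq n t \<omega> = Sq (Suc n) t \<omega>" using agree[of n] by simp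
  \<comment> \<open>Two consecutive iterates now agree on all of [-L, T], so the second one may
    replace the first as the source of the delayed argument.\<close>
  then have "frozen_delay_solution (Sq (Suc n)) (Sq (Suc n))" by (rule frozen_delay_solution_cong[OF step admissible admissible])
  then show ?thesis by blast
qed

text \<open>Each solution is a solution frozen at itself, so agreement spreads from the shared
  initial path in steps of length b.\<close>

lemma solution_unique:
  assumes "frozen_delay_solution S S" "frozen_delay_solution S' S'"
  shows "AE \<omega> in M. \<forall>t\<in>{-L..T}. S t \<omega> = S' t \<omega>"
proof -
  have S: "admissible S" "admissible S'" using assms frozen_delay_solution_admissible by auto
  have agree: "AE \<omega> in M. \<forall>t\<in>{-L..min (real n * b) T}. S t \<omega> = S' t \<omega>" for n
  proof (induction n)
    case 0
    show ?case
    proof (rule AE_I2, rule ballI)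
      fix \<omega> t assume \<omega>: "\<omega> \<in> space M" and "t \<in> {-L..min (real 0 * b) T}"
      then have t: "t \<in> {-L..0}" by auto
      show "S t \<omega> = S' t \<omega>" using admissible_phi[OF S(1) \<omega> t] admissible_phi[OF S(2) \<omega> t] by simp
    qed
  next
    case (Suc n)
    show ?case
    proof (rule frozen_delay_solution_unique[OF S assms])
      show "AE \<omega> in M. \<forall>t\<in>{-L..min (real (Suc n) * b) T - b}. S t \<omega> = S' t \<omega>"
        using Suc
      proof eventually_elim
        case (elim \<omega>)
        show ?case
        proof
          fix t assume "t \<in> {-L..min (real (Suc n) * b) T - b}"
          then have "t \<in> {-L..min (real n * b) T}" using b0 by (auto simp: algebra_simps)
          then show "S t \<omega> = S' t \<omega>" using elim by blast
        qed
      qed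
    qed (use b0 T_pos in auto)
  qed
  obtain n :: nat where "T / b < real n" using reals_Archimedean2 by blast
  then have "min (real n * b) T = T" using b0 by (simp add: pos_divide_less_eq)
  then show ?thesis using agree[of n] by simp
qed

text \<open>The representation with R = S brings almost every path into the form required by
  \<open>positive_solution\<close>. Strict positivity is stated conditionally on the initial value
  of the path, so that both positivity claims follow from one null set.\<close>

lemma solution_positive:
  assumes st: "frozen_delay_solution S S" and pos: "\<forall>t\<in>{0..T}. \<forall>\<eta>\<in>cspace L. (\<forall>s\<in>{-L..0}. \<eta> s \<ge> 0) \<longrightarrow> f t \<eta> > 0"
    and phi: "AE \<omega> in M. \<forall>t\<in>{-L..0}. \<phi> \<omega> t \<ge> 0"
  shows "AE \<omega> in M. \<forall>t\<in>{0..T}. S t \<omega> \<ge> 0 \<and> (\<phi> \<omega> 0 > 0 \<longrightarrow> S t \<omega> > 0)"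
proof -
  have S: "admissible S" by (rule frozen_delay_solution_admissible[OF st])
  define h where "h = (\<lambda>s \<omega>. g (S (s - b) \<omega>))"
  have h: "cont_adapted h" unfolding h_def by (rule cont_adapted_delay[OF S])
  obtain J where J: "ito h J" using ito_exists[OF h] by auto
  from frozen_delay_solution_representation[OF S st J[unfolded h_def], folded h_def] phi AE_space
  show ?thesis
  proof eventually_elim
    case (elim \<omega>)
    note \<omega> = elim(3)
    have S0: "S 0 \<omega> = \<phi> \<omega> 0" using admissible_phi[OF S \<omega>, of 0] L0 by auto
    have Ec: "continuous_on {0..T} (\<lambda>s. exp (log_doleans h J s \<omega>))" by (rule cont_adapted_cont[OF cont_adapted_exp[OF cont_adapted_log_doleans[OF h J]] \<omega>])
    have eq: "S t \<omega> / exp (log_doleans h J t \<omega>) = S 0 \<omega> + integral {0..t} (\<lambda>s. f s (seg L (\<lambda>u. S u \<omega>) s) / exp (log_doleans h J s \<omega>))" if "t \<in> {0..T}" for t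
      unfolding S0 using elim(1) that by blast
    have S00: "0 \<le> S t \<omega>" if "t \<in> {-L..0}" for t using elim(2) admissible_phi[OF S \<omega> that] that by simp
    have Ep: "0 < exp (log_doleans h J s \<omega>)" for s by simp
    have pos': "0 < f t \<eta>" if "t \<in> {0..T}" "\<eta> \<in> cspace L" "\<forall>s\<in>{-L..0}. \<eta> s \<ge> 0" for t \<eta>
      using pos that by blast
    have P1: "0 \<le> S t \<omega>" if "t \<in> {0..T}" for t
      by (rule positive_solution(1)[where S="\<lambda>t. S t \<omega>" and E="\<lambda>s. exp (log_doleans h J s \<omega>)"])
        (rule pos' admissible_cont[OF S \<omega>] Ec Ep eq S00 that | assumption)+
    have P2: "0 < S t \<omega>" if "0 < S 0 \<omega>" "t \<in> {0..T}" for t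
      by (rule positive_solution(2)[where S="\<lambda>t. S t \<omega>" and E="\<lambda>s. exp (log_doleans h J s \<omega>)"])
        (rule pos' admissible_cont[OF S \<omega>] Ec Ep eq S00 that | assumption)+
    show ?case
    proof (intro ballI conjI impI)
      fix t assume t: "t \<in> {0..T}"
      show "0 \<le> S t \<omega>" by (rule P1[OF t])
      assume "0 < \<phi> \<omega> 0"
      then have "0 < S 0 \<omega>" by (simp only: S0)
      then show "0 < S t \<omega>" by (rule P2[OF _ t])
    qed
  qed
qed

end

theorem theorem1:
  fixes M :: "'a measure" and F :: "real \<Rightarrow> 'a set set" and W :: "real \<Rightarrow> 'a \<Rightarrow> real"
    and L b T :: real and f :: "real \<Rightarrow> (real \<Rightarrow> real) \<Rightarrow> real" and g :: "real \<Rightarrow> real"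
    and \<phi> :: "'a \<Rightarrow> real \<Rightarrow> real"
  assumes "prob_space M"
    and "usual_filtration M T F"
    and "std_BM M T F W"
    and "L > 0" "b > 0" "T > 0" "L \<ge> b"
    and "cont_drift T L f"
    and "continuous_on UNIV g"
    and "\<exists>L'>0. \<forall>t\<in>{0..T}. \<forall>\<eta>\<in>cspace L. \<bar>f t \<eta>\<bar> \<le> L' * (1 + supn L \<eta>)"
    and "\<forall>n::nat. n > 0 \<longrightarrow> (\<exists>Ln>0. \<forall>t\<in>{0..T}. \<forall>\<eta>1\<in>cspace L. \<forall>\<eta>2\<in>cspace L.
            supn L \<eta>1 \<le> real n \<and> supn L \<eta>2 \<le> real n \<longrightarrow>
            \<bar>f t \<eta>1 - f t \<eta>2\<bar> \<le> Ln * supn L (\<lambda>s. \<eta>1 s - \<eta>2 s))"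
    and "\<forall>t\<in>{0..T}. \<forall>\<eta>\<in>cspace L. (\<forall>s\<in>{-L..0}. \<eta> s \<ge> 0) \<longrightarrow> f t \<eta> > 0"
    and "\<forall>\<omega>\<in>space M. \<phi> \<omega> \<in> cspace L"
    and "\<forall>A\<in>cborel L. {\<omega>\<in>space M. \<phi> \<omega> \<in> A} \<in> F 0"
  shows "(\<exists>S. sfde_solution M T F W L b f g \<phi> S) \<and>
    (\<forall>S S'. sfde_solution M T F W L b f g \<phi> S \<and> sfde_solution M T F W L b f g \<phi> S' \<longrightarrow>
        (AE \<omega> in M. \<forall>t\<in>{-L..T}. S t \<omega> = S' t \<omega>)) \<and>
    ((AE \<omega> in M. \<forall>t\<in>{-L..0}. \<phi> \<omega> t \<ge> 0) \<longrightarrow>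
       (\<forall>S. sfde_solution M T F W L b f g \<phi> S \<longrightarrow> (AE \<omega> in M. \<forall>t\<in>{0..T}. S t \<omega> \<ge> 0))) \<and>
    ((AE \<omega> in M. \<forall>t\<in>{-L..0}. \<phi> \<omega> t \<ge> 0) \<and> (AE \<omega> in M. \<phi> \<omega> 0 > 0) \<longrightarrow>
       (\<forall>S. sfde_solution M T F W L b f g \<phi> S \<longrightarrow> (AE \<omega> in M. \<forall>t\<in>{0..T}. S t \<omega> > 0)))"
proof -
  obtain L' where L': "L' > 0" "\<forall>t\<in>{0..T}. \<forall>\<eta>\<in>cspace L. \<bar>f t \<eta>\<bar> \<le> L' * (1 + supn L \<eta>)" using assms(10) by blast
  interpret prob_space M by fact
  interpret sfde M T F W L f L' b g \<phi>
  proof unfold_locales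
    show "\<exists>Ln>0. \<forall>t\<in>{0..T}. \<forall>\<eta>1\<in>cspace L. \<forall>\<eta>2\<in>cspace L.
            supn L \<eta>1 \<le> real n \<and> supn L \<eta>2 \<le> real n \<longrightarrow>
            \<bar>f t \<eta>1 - f t \<eta>2\<bar> \<le> Ln * supn L (\<lambda>s. \<eta>1 s - \<eta>2 s)" if "n > 0" for n :: nat
      using assms(11) that by blast
    show "\<bar>f t \<eta>\<bar> \<le> L' * (1 + supn L \<eta>)" if "t \<in> {0..T}" "\<eta> \<in> cspace L" for t \<eta> using L'(2) that by blast
    show "{\<omega>\<in>space M. \<phi> \<omega> \<in> A} \<in> F 0" if "A \<in> cborel L" for A using assms(14) that by blast
    show "\<phi> \<omega> \<in> cspace L" if "\<omega> \<in> space M" for \<omega> using assms(13) that by blast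
  qed fact+
  show ?thesis
    unfolding sfde_solution_iff
  proof (intro conjI allI impI)
    show "\<exists>S. frozen_delay_solution S S" by (rule solution_exists)
    show "AE \<omega> in M. \<forall>t\<in>{-L..T}. S t \<omega> = S' t \<omega>" if "frozen_delay_solution S S \<and> frozen_delay_solution S' S'" for S S'
      using that by (intro solution_unique) auto
    show "AE \<omega> in M. \<forall>t\<in>{0..T}. S t \<omega> \<ge> 0" if "AE \<omega> in M. \<forall>t\<in>{-L..0}. \<phi> \<omega> t \<ge> 0" "frozen_delay_solution S S" for S
      using solution_positive[OF that(2) assms(12) that(1)] by eventually_elim blast
    show "AE \<omega> in M. \<forall>t\<in>{0..T}. S t \<omega> > 0"
      if "(AE \<omega> in M. \<forall>t\<in>{-L..0}. \<phi> \<omega> t \<ge> 0) \<and> (AE \<omega> in M. \<phi> \<omega> 0 > 0)" "frozen_delay_solution S S" for S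
      using solution_positive[OF that(2) assms(12) conjunct1[OF that(1)]] conjunct2[OF that(1)] by eventually_elim blast
  qed
qed

end
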